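(* Let $\mathbf V$ be any model of ZFC and let $\mathbf V[G]$ be its extension by adding one Cohen real. Then in $\mathbf V[G]$ there is a c-algebra $\mathfrak A$ of size $\aleph_1$ such that, in $\mathbf V[G]$, the (UG) Banach space $C(\mathrm{St}(\mathfrak A))$ does not isomorphically embed into any Banach space $X_\ast$ which belongs to $\mathbf V$ and has density $\aleph_1$.
   Context: A subset $C$ of a Boolean algebra $\mathfrak A$ has the nice property if for no finite $F\subseteq C$ is $\bigvee F=1$. A Boolean algebra $\mathfrak A$ is a c-algebra if there is a family $\{B_n:n<\omega\}$ of pairwise disjoint antichains of $\mathfrak A$ whose union has the nice property and generates $\mathfrak A$. A Banach space is UG if it admits a uniformly Gâteaux differentiable renorming; for a c-algebra $\mathfrak A$, $C(\mathrm{St}(\mathfrak A))$ is UG. $\mathrm{St}(\mathfrak A)$ is the Stone space of $\mathfrak A$, and $C(K)$ the Banach space of continuous real functions on $K$ with the sup norm. An isomorphic embedding is a linear map $T$ with $\frac1c\|x\|\le\|Tx\|\le c\|x\|$ for some $c>0$. Adding one Cohen real means forcing with finite partial functions from $\omega$ to $2$ ordered by extension. *)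

theory Defs
  imports "HOL-Algebra.Module" "HOL-Algebra.Lattice"
begin

text \<open>
  Models of set theory are arbitrary membership structures, not necessarily well-founded. The
  first-order formulas below serve to state the two axiom schemes; quantifying over HOL predicates
  instead would give second-order ZFC, whose models have no proper Cohen extensions.
\<close>

datatype fm = Mem nat nat | Equal nat nat | Neg fm | Conj fm fm | Forall nat fm

primrec sat :: "'a set \<Rightarrow> ('a \<Rightarrow> 'a \<Rightarrow> bool) \<Rightarrow> fm \<Rightarrow> (nat \<Rightarrow> 'a) \<Rightarrow> bool" where
  "sat U E (Mem i j) s \<longleftrightarrow> E (s i) (s j)"
| "sat U E (Equal i j) s \<longleftrightarrow> s i = s j"
| "sat U E (Neg \<phi>) s \<longleftrightarrow> \<not> sat U E \<phi> s"
| "sat U E (Conj \<phi> \<psi>) s \<longleftrightarrow> sat U E \<phi> s \<and> sat U E \<psi> s"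
| "sat U E (Forall i \<phi>) s \<longleftrightarrow> (\<forall>x\<in>U. sat U E \<phi> (s(i := x)))"

record 'a ordered_ring = "'a ring" +
  rle :: "'a \<Rightarrow> 'a \<Rightarrow> bool" (infix "\<preceq>\<index>" 50)

record 'a normed_module = "('a, 'a) module" +
  nrm :: "'a \<Rightarrow> 'a"

definition rlt :: "'a ordered_ring \<Rightarrow> 'a \<Rightarrow> 'a \<Rightarrow> bool" (infix "\<prec>\<index>" 50) where
  "x \<prec>\<^bsub>R\<^esub> y \<longleftrightarrow> x \<preceq>\<^bsub>R\<^esub> y \<and> x \<noteq> y"

definition order_of :: "'a ordered_ring \<Rightarrow> 'a gorder" where
  "order_of R = \<lparr>carrier = carrier R, eq = (=), le = rle R\<rparr>"

definition rabs :: "'a ordered_ring \<Rightarrow> 'a \<Rightarrow> 'a" where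
  "rabs R x = (if \<zero>\<^bsub>R\<^esub> \<preceq>\<^bsub>R\<^esub> x then x else \<ominus>\<^bsub>R\<^esub> x)"

definition ordered_field :: "'a ordered_ring \<Rightarrow> bool" where
  "ordered_field R \<longleftrightarrow> field R \<and> total_order (order_of R) \<and>
     (\<forall>x\<in>carrier R. \<forall>y\<in>carrier R. \<forall>z\<in>carrier R. x \<preceq>\<^bsub>R\<^esub> y \<longrightarrow> x \<oplus>\<^bsub>R\<^esub> z \<preceq>\<^bsub>R\<^esub> y \<oplus>\<^bsub>R\<^esub> z) \<and>
     (\<forall>x\<in>carrier R. \<forall>y\<in>carrier R.
        \<zero>\<^bsub>R\<^esub> \<preceq>\<^bsub>R\<^esub> x \<and> \<zero>\<^bsub>R\<^esub> \<preceq>\<^bsub>R\<^esub> y \<longrightarrow> \<zero>\<^bsub>R\<^esub> \<preceq>\<^bsub>R\<^esub> x \<otimes>\<^bsub>R\<^esub> y)"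

definition norm_on :: "'a ordered_ring \<Rightarrow> 'a normed_module \<Rightarrow> bool" where
  "norm_on R X \<longleftrightarrow>
     (\<forall>x\<in>carrier X. nrm X x \<in> carrier R \<and> \<zero>\<^bsub>R\<^esub> \<preceq>\<^bsub>R\<^esub> nrm X x \<and> (nrm X x = \<zero>\<^bsub>R\<^esub> \<longleftrightarrow> x = \<zero>\<^bsub>X\<^esub>)) \<and>
     (\<forall>r\<in>carrier R. \<forall>x\<in>carrier X. nrm X (r \<odot>\<^bsub>X\<^esub> x) = rabs R r \<otimes>\<^bsub>R\<^esub> nrm X x) \<and>
     (\<forall>x\<in>carrier X. \<forall>y\<in>carrier X. nrm X (x \<oplus>\<^bsub>X\<^esub> y) \<preceq>\<^bsub>R\<^esub> nrm X x \<oplus>\<^bsub>R\<^esub> nrm X y)"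

definition dense_in :: "'a ordered_ring \<Rightarrow> 'a normed_module \<Rightarrow> 'a set \<Rightarrow> bool" where
  "dense_in R X D \<longleftrightarrow> D \<subseteq> carrier X \<and>
     (\<forall>x\<in>carrier X. \<forall>e\<in>carrier R. \<zero>\<^bsub>R\<^esub> \<prec>\<^bsub>R\<^esub> e \<longrightarrow> (\<exists>d\<in>D. nrm X (x \<ominus>\<^bsub>X\<^esub> d) \<prec>\<^bsub>R\<^esub> e))"

definition complement_of :: "'a gorder \<Rightarrow> 'a \<Rightarrow> 'a \<Rightarrow> bool" where
  "complement_of L x y \<longleftrightarrow> y \<in> carrier L \<and> x \<squnion>\<^bsub>L\<^esub> y = \<top>\<^bsub>L\<^esub> \<and> x \<sqinter>\<^bsub>L\<^esub> y = \<bottom>\<^bsub>L\<^esub>"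

definition boolean_lattice :: "'a gorder \<Rightarrow> bool" where
  "boolean_lattice L \<longleftrightarrow> bounded_lattice L \<and>
     (\<forall>x\<in>carrier L. \<forall>y\<in>carrier L. \<forall>z\<in>carrier L.
        x \<sqinter>\<^bsub>L\<^esub> (y \<squnion>\<^bsub>L\<^esub> z) = (x \<sqinter>\<^bsub>L\<^esub> y) \<squnion>\<^bsub>L\<^esub> (x \<sqinter>\<^bsub>L\<^esub> z)) \<and>
     (\<forall>x\<in>carrier L. \<exists>y. complement_of L x y)"

definition subalgebra_of :: "'a gorder \<Rightarrow> 'a set \<Rightarrow> bool" where
  "subalgebra_of L S \<longleftrightarrow> S \<subseteq> carrier L \<and> \<top>\<^bsub>L\<^esub> \<in> S \<and> \<bottom>\<^bsub>L\<^esub> \<in> S \<and>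
     (\<forall>x\<in>S. \<forall>y\<in>S. x \<squnion>\<^bsub>L\<^esub> y \<in> S \<and> x \<sqinter>\<^bsub>L\<^esub> y \<in> S) \<and>
     (\<forall>x\<in>S. \<forall>y. complement_of L x y \<longrightarrow> y \<in> S)"

definition antichain_of :: "'a gorder \<Rightarrow> 'a set \<Rightarrow> bool" where
  "antichain_of L S \<longleftrightarrow> S \<subseteq> carrier L - {\<bottom>\<^bsub>L\<^esub>} \<and>
     (\<forall>x\<in>S. \<forall>y\<in>S. x \<noteq> y \<longrightarrow> x \<sqinter>\<^bsub>L\<^esub> y = \<bottom>\<^bsub>L\<^esub>)"

definition ultrafilter_of :: "'a gorder \<Rightarrow> 'a set \<Rightarrow> bool" where
  "ultrafilter_of L S \<longleftrightarrow> S \<subseteq> carrier L \<and> \<top>\<^bsub>L\<^esub> \<in> S \<and> \<bottom>\<^bsub>L\<^esub> \<notin> S \<and>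
     (\<forall>x\<in>S. \<forall>y\<in>carrier L. x \<sqsubseteq>\<^bsub>L\<^esub> y \<longrightarrow> y \<in> S) \<and>
     (\<forall>x\<in>S. \<forall>y\<in>S. x \<sqinter>\<^bsub>L\<^esub> y \<in> S) \<and>
     (\<forall>x\<in>carrier L. \<forall>y. complement_of L x y \<longrightarrow> x \<in> S \<or> y \<in> S)"

text \<open>
  In the locale below, mathematical objects of the structure \<open>(U, E)\<close> are represented by HOL
  objects over the type of its elements: a set of the structure by its extension, a function of
  the structure by a HOL function whose graph is the extension of an element of \<open>U\<close>, and so on
  for algebraic structures. First-order properties of such objects are then expressed directly in
  HOL, whereas every quantifier over subsets, sequences or maps is restricted to objects of the
  structure. This gives exactly the meaning of the corresponding statement inside \<open>(U, E)\<close>.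
\<close>

locale set_structure =
  fixes U :: "'a set" and E :: "'a \<Rightarrow> 'a \<Rightarrow> bool"
begin

definition ext :: "'a \<Rightarrow> 'a set" where
  "ext x = {y \<in> U. E y x}"

definition Sets :: "'a set set" where
  "Sets = ext ` U"

definition ZFC :: bool where
  "ZFC \<longleftrightarrow>
    \<comment> \<open>extensionality\<close>
    (\<forall>x\<in>U. \<forall>y\<in>U. ext x = ext y \<longrightarrow> x = y) \<and>
    \<comment> \<open>foundation\<close>
    (\<forall>x\<in>U. ext x \<noteq> {} \<longrightarrow> (\<exists>y\<in>ext x. ext y \<inter> ext x = {})) \<and>
    \<comment> \<open>pairing, union, power set\<close>
    (\<forall>x\<in>U. \<forall>y\<in>U. {x, y} \<in> Sets) \<and>
    (\<forall>x\<in>U. (\<Union>y\<in>ext x. ext y) \<in> Sets) \<and>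
    (\<forall>x\<in>U. {y \<in> U. ext y \<subseteq> ext x} \<in> Sets) \<and>
    \<comment> \<open>infinity\<close>
    (\<exists>w\<in>U. (\<exists>z\<in>ext w. ext z = {}) \<and> (\<forall>x\<in>ext w. \<exists>y\<in>ext w. ext y = insert x (ext x))) \<and>
    \<comment> \<open>separation and replacement; the values of \<open>s\<close> are the parameters\<close>
    (\<forall>\<phi> s. range s \<subseteq> U \<longrightarrow> (\<forall>a\<in>U. {x \<in> ext a. sat U E \<phi> (s(0 := x))} \<in> Sets)) \<and>
    (\<forall>\<phi> s. range s \<subseteq> U \<longrightarrow>
       (\<forall>a\<in>U. (\<forall>x\<in>ext a. \<exists>!y. y \<in> U \<and> sat U E \<phi> (s(0 := x, 1 := y))) \<longrightarrow>
          {y \<in> U. \<exists>x\<in>ext a. sat U E \<phi> (s(0 := x, 1 := y))} \<in> Sets)) \<and>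
    \<comment> \<open>choice\<close>
    (\<forall>a\<in>U. (\<forall>x\<in>ext a. ext x \<noteq> {}) \<and>
       (\<forall>x\<in>ext a. \<forall>y\<in>ext a. x \<noteq> y \<longrightarrow> ext x \<inter> ext y = {}) \<longrightarrow>
       (\<exists>c\<in>U. \<forall>x\<in>ext a. \<exists>!z. z \<in> ext c \<inter> ext x))"

definition pr :: "'a \<Rightarrow> 'a \<Rightarrow> 'a" where
  "pr x y = (THE z. z \<in> U \<and> (\<exists>s\<in>U. \<exists>t\<in>U. ext s = {x} \<and> ext t = {x, y} \<and> ext z = {s, t}))"

definition fun_in :: "'a set \<Rightarrow> ('a \<Rightarrow> 'a) \<Rightarrow> bool" where
  "fun_in S f \<longleftrightarrow> f ` S \<subseteq> U \<and> {pr x (f x) | x. x \<in> S} \<in> Sets"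

definition fun2_in :: "'a set \<Rightarrow> 'a set \<Rightarrow> ('a \<Rightarrow> 'a \<Rightarrow> 'a) \<Rightarrow> bool" where
  "fun2_in S T f \<longleftrightarrow> (\<forall>x\<in>S. \<forall>y\<in>T. f x y \<in> U) \<and>
     {pr (pr x y) (f x y) | x y. x \<in> S \<and> y \<in> T} \<in> Sets"

definition rel_in :: "'a set \<Rightarrow> ('a \<Rightarrow> 'a \<Rightarrow> bool) \<Rightarrow> bool" where
  "rel_in S r \<longleftrightarrow> {pr x y | x y. x \<in> S \<and> y \<in> S \<and> r x y} \<in> Sets"

definition code :: "'a set \<Rightarrow> ('a \<Rightarrow> 'a) \<Rightarrow> 'a" where
  "code S f = (THE c. c \<in> U \<and> ext c = {pr x (f x) | x. x \<in> S})"

definition app :: "'a \<Rightarrow> 'a \<Rightarrow> 'a" where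
  "app c x = (THE y. y \<in> U \<and> pr x y \<in> ext c)"

definition omega :: "'a set" where
  "omega = {n \<in> U. \<forall>w\<in>U. (\<exists>z\<in>ext w. ext z = {}) \<and>
     (\<forall>x\<in>ext w. \<exists>y\<in>ext w. ext y = insert x (ext x)) \<longrightarrow> n \<in> ext w}"

definition finite_in :: "'a set \<Rightarrow> bool" where
  "finite_in S \<longleftrightarrow> (\<exists>n\<in>omega. \<exists>f. fun_in (ext n) f \<and> bij_betw f (ext n) S)"

definition countable_in :: "'a set \<Rightarrow> bool" where
  "countable_in S \<longleftrightarrow> (\<exists>f. fun_in S f \<and> inj_on f S \<and> f ` S \<subseteq> omega)"

definition ordinal :: "'a \<Rightarrow> bool" where
  "ordinal k \<longleftrightarrow> k \<in> U \<and> (\<forall>x\<in>ext k. ext x \<subseteq> ext k \<and> (\<forall>y\<in>ext x. ext y \<subseteq> ext x))"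

definition is_aleph1 :: "'a \<Rightarrow> bool" where
  "is_aleph1 k \<longleftrightarrow> ordinal k \<and> \<not> countable_in (ext k) \<and> (\<forall>a\<in>ext k. countable_in (ext a))"

definition size_aleph1 :: "'a set \<Rightarrow> bool" where
  "size_aleph1 S \<longleftrightarrow> (\<exists>k f. is_aleph1 k \<and> fun_in S f \<and> bij_betw f S (ext k))"

definition size_ge_aleph1 :: "'a set \<Rightarrow> bool" where
  "size_ge_aleph1 S \<longleftrightarrow> (\<exists>k f. is_aleph1 k \<and> fun_in (ext k) f \<and> inj_on f (ext k) \<and> f ` ext k \<subseteq> S)"

definition boolean_algebra_in :: "'a gorder \<Rightarrow> bool" where
  "boolean_algebra_in L \<longleftrightarrow> carrier L \<in> Sets \<and> rel_in (carrier L) (le L) \<and> boolean_lattice L"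

definition nice :: "'a gorder \<Rightarrow> 'a set \<Rightarrow> bool" where
  "nice L C \<longleftrightarrow> C \<subseteq> carrier L \<and> (\<forall>F\<in>Sets. F \<subseteq> C \<and> finite_in F \<longrightarrow> \<Squnion>\<^bsub>L\<^esub>F \<noteq> \<top>\<^bsub>L\<^esub>)"

definition generates :: "'a gorder \<Rightarrow> 'a set \<Rightarrow> bool" where
  "generates L C \<longleftrightarrow> (\<forall>S\<in>Sets. subalgebra_of L S \<and> C \<subseteq> S \<longrightarrow> S = carrier L)"

definition c_algebra :: "'a gorder \<Rightarrow> bool" where
  "c_algebra L \<longleftrightarrow> boolean_algebra_in L \<and>
     (\<exists>B. fun_in omega B \<and>
        (\<forall>n\<in>omega. antichain_of L (ext (B n))) \<and>
        (\<forall>m\<in>omega. \<forall>n\<in>omega. m \<noteq> n \<longrightarrow> ext (B m) \<inter> ext (B n) = {}) \<and>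
        nice L (\<Union>n\<in>omega. ext (B n)) \<and> generates L (\<Union>n\<in>omega. ext (B n)))"

text \<open>The field of real numbers, as a Dedekind complete ordered field in the sense of the
  structure; it is unique up to isomorphism.\<close>

definition real_field :: "'a ordered_ring \<Rightarrow> bool" where
  "real_field R \<longleftrightarrow> ordered_field R \<and>
     carrier R \<in> Sets \<and> fun2_in (carrier R) (carrier R) (add R) \<and>
     fun2_in (carrier R) (carrier R) (mult R) \<and> rel_in (carrier R) (rle R) \<and>
     (\<forall>S\<in>Sets. S \<subseteq> carrier R \<and> S \<noteq> {} \<and> Upper (order_of R) S \<noteq> {} \<longrightarrow>
        (\<exists>s. least (order_of R) s (Upper (order_of R) S)))"

definition normed_space_in :: "'a ordered_ring \<Rightarrow> 'a normed_module \<Rightarrow> bool" where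
  "normed_space_in R X \<longleftrightarrow> real_field R \<and> module R X \<and> norm_on R X \<and>
     carrier X \<in> Sets \<and> fun2_in (carrier X) (carrier X) (add X) \<and>
     fun2_in (carrier R) (carrier X) (smult X) \<and> fun_in (carrier X) (nrm X)"

definition banach_space_in :: "'a ordered_ring \<Rightarrow> 'a normed_module \<Rightarrow> bool" where
  "banach_space_in R X \<longleftrightarrow> normed_space_in R X \<and>
     (\<forall>s. fun_in omega s \<and> s ` omega \<subseteq> carrier X \<and>
        (\<forall>e\<in>carrier R. \<zero>\<^bsub>R\<^esub> \<prec>\<^bsub>R\<^esub> e \<longrightarrow>
           (\<exists>k\<in>omega. \<forall>m\<in>omega. \<forall>n\<in>omega. E k m \<and> E k n \<longrightarrow> nrm X (s m \<ominus>\<^bsub>X\<^esub> s n) \<prec>\<^bsub>R\<^esub> e)) \<longrightarrow>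
        (\<exists>x\<in>carrier X. \<forall>e\<in>carrier R. \<zero>\<^bsub>R\<^esub> \<prec>\<^bsub>R\<^esub> e \<longrightarrow>
           (\<exists>k\<in>omega. \<forall>n\<in>omega. E k n \<longrightarrow> nrm X (s n \<ominus>\<^bsub>X\<^esub> x) \<prec>\<^bsub>R\<^esub> e)))"

definition density_aleph1 :: "'a ordered_ring \<Rightarrow> 'a normed_module \<Rightarrow> bool" where
  "density_aleph1 R X \<longleftrightarrow> (\<exists>D\<in>Sets. dense_in R X D \<and> size_aleph1 D) \<and>
     (\<forall>D\<in>Sets. dense_in R X D \<longrightarrow> size_ge_aleph1 D)"

definition equivalent_norms :: "'a ordered_ring \<Rightarrow> 'a normed_module \<Rightarrow> ('a \<Rightarrow> 'a) \<Rightarrow> bool" where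
  "equivalent_norms R X \<nu> \<longleftrightarrow> (\<exists>c\<in>carrier R. \<zero>\<^bsub>R\<^esub> \<prec>\<^bsub>R\<^esub> c \<and>
     (\<forall>x\<in>carrier X. inv\<^bsub>R\<^esub> c \<otimes>\<^bsub>R\<^esub> nrm X x \<preceq>\<^bsub>R\<^esub> \<nu> x \<and> \<nu> x \<preceq>\<^bsub>R\<^esub> c \<otimes>\<^bsub>R\<^esub> nrm X x))"

text \<open>For every direction \<open>h\<close>, the limit of \<open>(\<parallel>x + th\<parallel> - \<parallel>x\<parallel>)/t\<close> for \<open>t \<rightarrow> 0\<close> exists uniformly
  in \<open>x\<close> from the unit sphere.\<close>

definition unif_gateaux_norm :: "'a ordered_ring \<Rightarrow> 'a normed_module \<Rightarrow> bool" where
  "unif_gateaux_norm R X \<longleftrightarrow>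
     (let S = {x \<in> carrier X. nrm X x = \<one>\<^bsub>R\<^esub>} in
      \<forall>h\<in>carrier X. \<exists>D. fun_in S D \<and> D ` S \<subseteq> carrier R \<and>
        (\<forall>e\<in>carrier R. \<zero>\<^bsub>R\<^esub> \<prec>\<^bsub>R\<^esub> e \<longrightarrow>
          (\<exists>d\<in>carrier R. \<zero>\<^bsub>R\<^esub> \<prec>\<^bsub>R\<^esub> d \<and>
            (\<forall>x\<in>S. \<forall>t\<in>carrier R. t \<noteq> \<zero>\<^bsub>R\<^esub> \<and> rabs R t \<prec>\<^bsub>R\<^esub> d \<longrightarrow>
               rabs R (inv\<^bsub>R\<^esub> t \<otimes>\<^bsub>R\<^esub> (nrm X (x \<oplus>\<^bsub>X\<^esub> (t \<odot>\<^bsub>X\<^esub> h)) \<ominus>\<^bsub>R\<^esub> nrm X x) \<ominus>\<^bsub>R\<^esub> D x) \<prec>\<^bsub>R\<^esub> e))))"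

definition UG :: "'a ordered_ring \<Rightarrow> 'a normed_module \<Rightarrow> bool" where
  "UG R X \<longleftrightarrow> banach_space_in R X \<and>
     (\<exists>\<nu>. normed_space_in R (X\<lparr>nrm := \<nu>\<rparr>) \<and> equivalent_norms R X \<nu> \<and>
          unif_gateaux_norm R (X\<lparr>nrm := \<nu>\<rparr>))"

definition iso_embeds :: "'a ordered_ring \<Rightarrow> 'a normed_module \<Rightarrow> 'a normed_module \<Rightarrow> bool" where
  "iso_embeds R X Y \<longleftrightarrow> (\<exists>T. fun_in (carrier X) T \<and> T ` carrier X \<subseteq> carrier Y \<and>
     (\<forall>x\<in>carrier X. \<forall>y\<in>carrier X. T (x \<oplus>\<^bsub>X\<^esub> y) = T x \<oplus>\<^bsub>Y\<^esub> T y) \<and>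
     (\<forall>r\<in>carrier R. \<forall>x\<in>carrier X. T (r \<odot>\<^bsub>X\<^esub> x) = r \<odot>\<^bsub>Y\<^esub> T x) \<and>
     (\<exists>c\<in>carrier R. \<zero>\<^bsub>R\<^esub> \<prec>\<^bsub>R\<^esub> c \<and>
        (\<forall>x\<in>carrier X. inv\<^bsub>R\<^esub> c \<otimes>\<^bsub>R\<^esub> nrm X x \<preceq>\<^bsub>R\<^esub> nrm Y (T x) \<and>
                       nrm Y (T x) \<preceq>\<^bsub>R\<^esub> c \<otimes>\<^bsub>R\<^esub> nrm X x)))"

definition Stone :: "'a gorder \<Rightarrow> 'a set" where
  "Stone L = {u \<in> U. ultrafilter_of L (ext u)}"

text \<open>Continuity is with respect to the topology with base \<open>{u. a \<in> u}\<close> for \<open>a\<close> in the algebra.\<close>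

definition continuous_Stone :: "'a ordered_ring \<Rightarrow> 'a gorder \<Rightarrow> ('a \<Rightarrow> 'a) \<Rightarrow> bool" where
  "continuous_Stone R L f \<longleftrightarrow> f ` Stone L \<subseteq> carrier R \<and>
     (\<forall>u\<in>Stone L. \<forall>e\<in>carrier R. \<zero>\<^bsub>R\<^esub> \<prec>\<^bsub>R\<^esub> e \<longrightarrow>
        (\<exists>a\<in>ext u. \<forall>v\<in>Stone L. a \<in> ext v \<longrightarrow> rabs R (f v \<ominus>\<^bsub>R\<^esub> f u) \<prec>\<^bsub>R\<^esub> e))"

definition C_Stone :: "'a ordered_ring \<Rightarrow> 'a gorder \<Rightarrow> 'a normed_module" where
  "C_Stone R L = \<lparr>
     carrier = {code (Stone L) f | f. fun_in (Stone L) f \<and> continuous_Stone R L f},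
     mult = (\<lambda>f g. code (Stone L) (\<lambda>u. app f u \<otimes>\<^bsub>R\<^esub> app g u)),
     one = code (Stone L) (\<lambda>u. \<one>\<^bsub>R\<^esub>),
     zero = code (Stone L) (\<lambda>u. \<zero>\<^bsub>R\<^esub>),
     add = (\<lambda>f g. code (Stone L) (\<lambda>u. app f u \<oplus>\<^bsub>R\<^esub> app g u)),
     smult = (\<lambda>r f. code (Stone L) (\<lambda>u. r \<otimes>\<^bsub>R\<^esub> app f u)),
     nrm = (\<lambda>f. \<Squnion>\<^bsub>order_of R\<^esub> {rabs R (app f u) | u. u \<in> Stone L})\<rparr>"

text \<open>\<open>X\<close> is a normed space over \<open>K\<close> coming from a smaller structure; \<open>Y\<close> is its completion, over
  the real field \<open>R\<close> of the present structure. The map \<open>j\<close> identifies the old reals with their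
  copies among the new ones, and \<open>i\<close> is the canonical embedding of \<open>X\<close> into its completion.\<close>

definition completion_of ::
    "'a ordered_ring \<Rightarrow> 'a normed_module \<Rightarrow> 'a ordered_ring \<Rightarrow> 'a normed_module \<Rightarrow> bool" where
  "completion_of K X R Y \<longleftrightarrow> banach_space_in R Y \<and>
     (\<exists>j i. fun_in (carrier K) j \<and> j \<in> ring_hom K R \<and>
        (\<forall>r\<in>carrier K. \<forall>s\<in>carrier K. r \<preceq>\<^bsub>K\<^esub> s \<longleftrightarrow> j r \<preceq>\<^bsub>R\<^esub> j s) \<and>
        fun_in (carrier X) i \<and> i ` carrier X \<subseteq> carrier Y \<and>
        (\<forall>x\<in>carrier X. \<forall>y\<in>carrier X. i (x \<oplus>\<^bsub>X\<^esub> y) = i x \<oplus>\<^bsub>Y\<^esub> i y) \<and>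
        (\<forall>r\<in>carrier K. \<forall>x\<in>carrier X. i (r \<odot>\<^bsub>X\<^esub> x) = j r \<odot>\<^bsub>Y\<^esub> i x) \<and>
        (\<forall>x\<in>carrier X. nrm Y (i x) = j (nrm X x)) \<and>
        dense_in R Y (i ` carrier X))"

text \<open>Finite partial functions from \<open>\<omega>\<close> to \<open>2\<close>; \<open>q\<close> is stronger than \<open>p\<close> iff \<open>ext p \<subseteq> ext q\<close>.\<close>

definition cohen_conditions :: "'a set" where
  "cohen_conditions = {p \<in> U. finite_in (ext p) \<and>
     (\<forall>z\<in>ext p. \<exists>n\<in>omega. \<exists>i\<in>U. (ext i = {} \<or> (\<exists>o'\<in>U. ext o' = {} \<and> ext i = {o'})) \<and> z = pr n i) \<and>
     (\<forall>n\<in>omega. \<forall>i\<in>U. \<forall>j\<in>U. pr n i \<in> ext p \<and> pr n j \<in> ext p \<longrightarrow> i = j)}"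

definition cohen_generic :: "'a set \<Rightarrow> bool" where
  "cohen_generic G \<longleftrightarrow> G \<subseteq> cohen_conditions \<and> G \<noteq> {} \<and>
     (\<forall>p\<in>G. \<forall>q\<in>cohen_conditions. ext q \<subseteq> ext p \<longrightarrow> q \<in> G) \<and>
     (\<forall>p\<in>G. \<forall>q\<in>G. \<exists>r\<in>G. ext p \<subseteq> ext r \<and> ext q \<subseteq> ext r) \<and>
     (\<forall>D\<in>Sets. D \<subseteq> cohen_conditions \<and> (\<forall>p\<in>cohen_conditions. \<exists>q\<in>D. ext p \<subseteq> ext q) \<longrightarrow>
        D \<inter> G \<noteq> {})"

text \<open>
  \<open>x\<close> is the evaluation of \<open>\<tau>\<close> by \<open>G\<close>, that is, \<open>x = F \<tau>\<close> for the function
  \<open>F \<sigma> = {F \<pi> | \<exists>p \<in> G. (\<pi>, p) \<in> \<sigma>}\<close> defined by \<open>\<in>\<close>-recursion in the structure. Every set may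
  serve as a name, since members that are not pairs \<open>(\<pi>, p)\<close> with \<open>p \<in> G\<close> play no role.
\<close>

definition evaluates_to :: "'a set \<Rightarrow> 'a \<Rightarrow> 'a \<Rightarrow> bool" where
  "evaluates_to G \<tau> x \<longleftrightarrow> (\<exists>T\<in>Sets. \<exists>F. fun_in T F \<and> \<tau> \<in> T \<and>
     (\<forall>\<sigma>\<in>T. \<forall>\<pi>\<in>U. \<forall>p\<in>U. pr \<pi> p \<in> ext \<sigma> \<longrightarrow> \<pi> \<in> T) \<and>
     (\<forall>\<sigma>\<in>T. ext (F \<sigma>) = {F \<pi> | \<pi>. \<pi> \<in> U \<and> (\<exists>p\<in>G. pr \<pi> p \<in> ext \<sigma>)}) \<and>
     x = F \<tau>)"

end

text \<open>\<open>W\<close> is the generic extension of \<open>V\<close> by the Cohen generic filter \<open>G\<close>.\<close>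

definition cohen_extension :: "'a set \<Rightarrow> 'a set \<Rightarrow> ('a \<Rightarrow> 'a \<Rightarrow> bool) \<Rightarrow> 'a \<Rightarrow> bool" where
  "cohen_extension V W E G \<longleftrightarrow>
     set_structure.ZFC W E \<and> V \<subseteq> W \<and> (\<forall>x\<in>V. \<forall>y\<in>W. E y x \<longrightarrow> y \<in> V) \<and>
     G \<in> W \<and> set_structure.cohen_generic V E (set_structure.ext W E G) \<and>
     (\<forall>x\<in>W. \<exists>\<tau>\<in>V. set_structure.evaluates_to W E (set_structure.ext W E G) \<tau> x)"

end

theory Submission
 imports Defs "HOL.Rat"
begin

text \<open>
 Call two ground model reals compatible if the first place where they differ belongs to the Cohen
 real. For a set \<open>I\<close> of \<open>\<aleph>\<^sub>1\<close> ground model reals, take the finite partial functions from \<open>\<omega>\<close> to \<open>I\<close>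
 with pairwise compatible values, and the algebra generated by the sets
 \<open>g\<^sub>n\<^sub>\<alpha> = {f. f(n) = \<alpha>}\<close>; for fixed \<open>n\<close> these form an antichain.

 Let \<open>\<chi>\<^sub>\<alpha>\<close> be the characteristic function of \<open>g\<^sub>0\<^sub>\<alpha> \<union> \<dots> \<union> g\<^sub>m\<^sub>\<alpha>\<close> with \<open>m = N - 1\<close>. A sum of \<open>N\<close> functions
 \<open>\<chi>\<^sub>\<alpha>\<close> has norm \<open>N\<close> if the \<open>\<alpha>\<close> are pairwise compatible and norm at most 1 if they are pairwise
 incompatible. If \<open>T\<close> embeds \<open>C(St)\<close> into the completion of a ground model space, approximate each
 \<open>T \<chi>\<^sub>\<alpha>\<close> by a vector \<open>d\<^sub>\<alpha>\<close> of that space. Since the forcing is countable, \<open>\<alpha> \<mapsto> d\<^sub>\<alpha>\<close> agrees with a ground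
 model function on an uncountable ground model set. A condition \<open>p\<close> leaves the compatibility of \<open>N\<close>
 reals undecided if they agree on the domain of \<open>p\<close>, whereas the norm of the sum of their vectors is
 already determined in the ground model; so \<open>p\<close> extends to a condition that forces the wrong norm.

 For the smooth norm, the elements of the multiplicative family generated by the \<open>g\<^sub>n\<^sub>\<alpha>\<close> split into
 countably many antichains; giving the \<open>k\<close>-th antichain weight \<open>2\<^sup>-\<^sup>k\<close> makes a weighted
 Hilbert space \<open>l\<^sub>2\<close> map densely into \<open>C(St)\<close>, and the infimal convolution of its norm with the
 supremum norm is uniformly smooth in the directions from its range.
\<close>

subsection \<open>Definability\<close>

text \<open>The models are arbitrary first-order structures, possibly ill-founded and with
  nonstandard natural numbers. No induction, recursion, finite sum or evaluation of names can be
  taken over from the logic: each is carried out for objects of the structure, and each use of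
  separation or replacement needs a formula. Hence definability is a predicate with closure rules.
  Of forcing, one case of the truth lemma suffices: a subset of a ground model set has a name made
  of pairs of a ground model element and a condition. The constants come from two estimates, with
  \<open>c\<close> bounding the embedding in both directions. If the ground vectors have a sum of
  norm at most \<open>k\<close>, compatible reals are forced and \<open>N \<le> c * (k + 1)\<close>
  follows; otherwise incompatible reals are forced and \<open>k < c + 1\<close> follows. So
  \<open>k\<close> is taken above \<open>c + 1\<close>, then \<open>N\<close> above
  \<open>c * (k + 1)\<close>. The summand 1 is the total error when each of the \<open>N\<close>
  images is approximated within \<open>1 / N\<close>. Joining \<open>N\<close> sets for each real
  lets one finite function take \<open>N\<close> compatible reals as values at different
  arguments.\<close>

named_theorems df

text \<open>Valuations are read in de Bruijn style: index 0 is the variable bound last, and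
  \<open>sh e\<close> is the valuation of the surrounding scope. All closure rules below use this
  convention.\<close>

abbreviation sh :: "(nat \<Rightarrow> 'a) \<Rightarrow> nat \<Rightarrow> 'a" where
 "sh e \<equiv> \<lambda>n. e (Suc n)"

locale zfc = set_structure +
 assumes ZFC: ZFC
begin

abbreviation coinf :: "(nat \<Rightarrow> nat) \<Rightarrow> (nat \<Rightarrow> nat) \<Rightarrow> bool" where
 "coinf \<rho> \<kappa> \<equiv> infinite (- (range \<rho> \<union> range \<kappa>))"

abbreviation expr :: "fm \<Rightarrow> (nat \<Rightarrow> 'a) \<Rightarrow> (nat \<Rightarrow> nat) \<Rightarrow> ((nat \<Rightarrow> 'a) \<Rightarrow> bool) \<Rightarrow> bool" where
 "expr \<phi> c \<kappa> Q \<equiv> \<forall>s. range s \<subseteq> U \<longrightarrow> (\<forall>n. s (\<kappa> n) = c n) \<longrightarrow> (sat U E \<phi> s \<longleftrightarrow> Q s)"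

text \<open>\<open>Df P\<close>: the property \<open>P\<close> of valuations is expressible by a formula with parameters \<open>c\<close>. The
 maps \<open>\<rho>\<close> and \<open>\<kappa>\<close> say which variables of the formula hold the arguments and the parameters; that they
 are arbitrary lets formulas be combined without renaming, and the infinitely many variables outside
 their ranges are available for quantifiers.\<close>

definition Df :: "((nat \<Rightarrow> 'a) \<Rightarrow> bool) \<Rightarrow> bool" where
 "Df P \<longleftrightarrow> (\<exists>c. range c \<subseteq> U \<and> (\<forall>\<rho> \<kappa>. coinf \<rho> \<kappa> \<longrightarrow>
   (\<exists>\<phi>. expr \<phi> c \<kappa> (\<lambda>s. P (\<lambda>n. s (\<rho> n))))))"

text \<open>Values in \<open>U\<close> make \<open>t e\<close> a legitimate witness for a quantifier
  over \<open>U\<close>; this is how terms are eliminated in \<open>Df_subst\<close>.\<close>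

definition DT :: "((nat \<Rightarrow> 'a) \<Rightarrow> 'a) \<Rightarrow> bool" where
 "DT t \<longleftrightarrow> (\<forall>e. range e \<subseteq> U \<longrightarrow> t e \<in> U) \<and> Df (\<lambda>e. e 0 = t (sh e))"

text \<open>These are classes rather than sets: \<open>S e\<close> may be too large to be an
  element, as for \<open>U\<close> itself. Whether it is a set is again expressible, by
  \<open>Df_Sets\<close>.\<close>

definition DS :: "((nat \<Rightarrow> 'a) \<Rightarrow> 'a set) \<Rightarrow> bool" where
 "DS S \<longleftrightarrow> (\<forall>e. range e \<subseteq> U \<longrightarrow> S e \<subseteq> U) \<and> Df (\<lambda>e. e 0 \<in> S (sh e))"

lemmas ax1 = ZFC[unfolded ZFC_def]
lemmas ax2 = ax1[THEN conjunct2] and ax_ext = ax1[THEN conjunct1]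
lemmas ax3 = ax2[THEN conjunct2] and ax_found = ax2[THEN conjunct1]
lemmas ax4 = ax3[THEN conjunct2] and ax_pair = ax3[THEN conjunct1]
lemmas ax5 = ax4[THEN conjunct2] and ax_union = ax4[THEN conjunct1]
lemmas ax6 = ax5[THEN conjunct2] and ax_power = ax5[THEN conjunct1]
lemmas ax7 = ax6[THEN conjunct2] and ax_inf = ax6[THEN conjunct1]
lemmas ax8 = ax7[THEN conjunct2] and ax_sep = ax7[THEN conjunct1]
lemmas ax_choice = ax8[THEN conjunct2] and ax_repl = ax8[THEN conjunct1]

lemma U_nonempty: "\<exists>u. u \<in> U"
 using ax_inf by blast

text \<open>Agreement is required only on valuations in \<open>U\<close>, so equations that hold for
  elements of the structure may be used to rewrite a property.\<close>

lemma Df_cong: assumes "Df Q" and eq: "\<And>e. range e \<subseteq> U \<Longrightarrow> P e = Q e" shows "Df P"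
proof -
 from assms(1) obtain c where c: "range c \<subseteq> U" and H: "\<forall>\<rho> \<kappa>. coinf \<rho> \<kappa> \<longrightarrow>
   (\<exists>\<phi>. expr \<phi> c \<kappa> (\<lambda>s. Q (\<lambda>n. s (\<rho> n))))"
  unfolding Df_def by blast
 show ?thesis unfolding Df_def
 proof (rule exI[of _ c], intro conjI c allI impI)
  fix \<rho> \<kappa> :: "nat \<Rightarrow> nat"
  assume "coinf \<rho> \<kappa>"
  with H obtain \<phi> where "expr \<phi> c \<kappa> (\<lambda>s. Q (\<lambda>n. s (\<rho> n)))"
   by blast
  moreover have "P (\<lambda>n. s (\<rho> n)) = Q (\<lambda>n. s (\<rho> n))" if "range s \<subseteq> U" for s
   by (rule eq) (use that in blast)
  ultimately show "\<exists>\<phi>. expr \<phi> c \<kappa> (\<lambda>s. P (\<lambda>n. s (\<rho> n)))"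
   by auto
 qed
qed

text \<open>As \<open>\<rho>\<close> is arbitrary, in particular not injective, its composition with
  \<open>f\<close> is again an admissible placement of the arguments; its range only
  shrinks.\<close>

lemma Df_rename:
 assumes "Df P"
 shows "Df (\<lambda>e. P (\<lambda>n. e (f n)))"
proof -
 from assms obtain c where c: "range c \<subseteq> U" and H: "\<forall>\<rho> \<kappa>. coinf \<rho> \<kappa> \<longrightarrow>
   (\<exists>\<phi>. expr \<phi> c \<kappa> (\<lambda>s. P (\<lambda>n. s (\<rho> n))))"
  unfolding Df_def by blast
 show ?thesis unfolding Df_def
 proof (rule exI[of _ c], intro conjI c allI impI)
  fix \<rho> \<kappa> :: "nat \<Rightarrow> nat"
  assume "coinf \<rho> \<kappa>"
  moreover have "- (range \<rho> \<union> range \<kappa>) \<subseteq> - (range (\<lambda>n. \<rho> (f n)) \<union> range \<kappa>)" by auto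
  ultimately have "infinite (- (range (\<lambda>n. \<rho> (f n)) \<union> range \<kappa>))"
   by (meson finite_subset)
  with H show "\<exists>\<phi>. expr \<phi> c \<kappa> (\<lambda>s. P (\<lambda>n. s (\<rho> (f n))))"
   by blast
 qed
qed

lemma Df_not[df]: assumes "Df P" shows "Df (\<lambda>e. \<not> P e)"
proof -
 from assms obtain c where c: "range c \<subseteq> U" and H: "\<forall>\<rho> \<kappa>. coinf \<rho> \<kappa> \<longrightarrow>
   (\<exists>\<phi>. expr \<phi> c \<kappa> (\<lambda>s. P (\<lambda>n. s (\<rho> n))))"
  unfolding Df_def by blast
 show ?thesis unfolding Df_def
 proof (rule exI[of _ c], intro conjI c allI impI)
  fix \<rho> \<kappa> :: "nat \<Rightarrow> nat"
  assume "coinf \<rho> \<kappa>"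
  with H obtain \<phi> where "expr \<phi> c \<kappa> (\<lambda>s. P (\<lambda>n. s (\<rho> n)))"
   by blast
  then show "\<exists>\<phi>. expr \<phi> c \<kappa> (\<lambda>s. \<not> P (\<lambda>n. s (\<rho> n)))"
   by (intro exI[of _ "Neg \<phi>"]) auto
 qed
qed

text \<open>The parameters of both formulas are interleaved, even positions for \<open>P\<close> and
  odd ones for \<open>Q\<close>; the placement \<open>\<kappa>\<close> is split in the same
  way.\<close>

lemma Df_conj[df]: assumes "Df P" "Df Q" shows "Df (\<lambda>e. P e \<and> Q e)"
proof -
 from assms(1) obtain c where c: "range c \<subseteq> U" and H: "\<forall>\<rho> \<kappa>. coinf \<rho> \<kappa> \<longrightarrow>
   (\<exists>\<phi>. expr \<phi> c \<kappa> (\<lambda>s. P (\<lambda>n. s (\<rho> n))))"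
  unfolding Df_def by blast
 from assms(2) obtain d where d: "range d \<subseteq> U" and K: "\<forall>\<rho> \<kappa>. coinf \<rho> \<kappa> \<longrightarrow>
   (\<exists>\<phi>. expr \<phi> d \<kappa> (\<lambda>s. Q (\<lambda>n. s (\<rho> n))))"
  unfolding Df_def by blast
 define b where "b n = (if even n then c (n div 2) else d (n div 2))" for n
 show ?thesis unfolding Df_def
 proof (rule exI[of _ b], intro conjI allI impI)
  show "range b \<subseteq> U" using c d by (auto simp: b_def)
  fix \<rho> \<kappa> :: "nat \<Rightarrow> nat"
  assume inf: "coinf \<rho> \<kappa>"
  have "- (range \<rho> \<union> range \<kappa>) \<subseteq> - (range \<rho> \<union> range (\<lambda>n. \<kappa> (2 * n)))" by auto
  with inf have "infinite (- (range \<rho> \<union> range (\<lambda>n. \<kappa> (2 * n))))" by (meson finite_subset)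
  with H obtain \<phi> where \<phi>: "expr \<phi> c (\<lambda>n. \<kappa> (2 * n)) (\<lambda>s. P (\<lambda>n. s (\<rho> n)))"
   by blast
  have "- (range \<rho> \<union> range \<kappa>) \<subseteq> - (range \<rho> \<union> range (\<lambda>n. \<kappa> (2 * n + 1)))" by auto
  with inf have "infinite (- (range \<rho> \<union> range (\<lambda>n. \<kappa> (2 * n + 1))))" by (meson finite_subset)
  with K obtain \<psi> where \<psi>: "expr \<psi> d (\<lambda>n. \<kappa> (2 * n + 1)) (\<lambda>s. Q (\<lambda>n. s (\<rho> n)))"
   by blast
  show "\<exists>\<phi>. expr \<phi> b \<kappa> (\<lambda>s. P (\<lambda>n. s (\<rho> n)) \<and> Q (\<lambda>n. s (\<rho> n)))"
  proof (intro exI[of _ "Conj \<phi> \<psi>"] allI impI)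
   fix s :: "nat \<Rightarrow> 'a" assume s: "range s \<subseteq> U" and e: "\<forall>n. s (\<kappa> n) = b n"
   have "\<forall>n. s (\<kappa> (2 * n)) = c n" "\<forall>n. s (\<kappa> (2 * n + 1)) = d n" using e by (simp_all add: b_def)
   then show "sat U E (Conj \<phi> \<psi>) s \<longleftrightarrow> P (\<lambda>n. s (\<rho> n)) \<and> Q (\<lambda>n. s (\<rho> n))"
    using \<phi> \<psi> s by auto
  qed
 qed
qed

text \<open>The bound variable is taken outside the ranges of \<open>\<rho>\<close> and
  \<open>\<kappa>\<close>; using up one index leaves infinitely many.\<close>

lemma Df_allU[df]:
 assumes "Df (\<lambda>e. Q (sh e) (e 0))"
 shows "Df (\<lambda>e. \<forall>x\<in>U. Q e x)"
proof -
 from assms obtain c where c: "range c \<subseteq> U" and H: "\<And>\<rho> \<kappa>. coinf \<rho> \<kappa> \<Longrightarrow>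
   (\<exists>\<phi>. expr \<phi> c \<kappa> (\<lambda>s. Q (\<lambda>n. s (\<rho> (Suc n))) (s (\<rho> 0))))"
  unfolding Df_def by blast
 show ?thesis unfolding Df_def
 proof (rule exI[of _ c], intro conjI c allI impI)
  fix \<rho> \<kappa> :: "nat \<Rightarrow> nat"
  assume inf: "coinf \<rho> \<kappa>"
  then obtain k where k: "k \<notin> range \<rho> \<union> range \<kappa>" by (metis ComplD finite.emptyI ex_in_conv)
  define r where "r = case_nat k \<rho>"
  have "range r \<subseteq> insert k (range \<rho>)" unfolding r_def by (auto split: nat.splits)
  then have "- (range \<rho> \<union> range \<kappa>) - {k} \<subseteq> - (range r \<union> range \<kappa>)" by blast
  then have "coinf r \<kappa>" using inf by (metis finite_Diff2 finite_subset finite.emptyI finite_insert)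
  then obtain \<phi> where \<phi>: "expr \<phi> c \<kappa> (\<lambda>s. Q (\<lambda>n. s (r (Suc n))) (s (r 0)))"
   using H by blast
  show "\<exists>\<phi>. expr \<phi> c \<kappa> (\<lambda>s. (\<forall>x\<in>U. Q (\<lambda>n. s (\<rho> n)) x))"
  proof (intro exI[of _ "Forall k \<phi>"] allI impI)
   fix s :: "nat \<Rightarrow> 'a" assume s: "range s \<subseteq> U" and e: "\<forall>n. s (\<kappa> n) = c n"
   have "sat U E \<phi> (s(k := x)) \<longleftrightarrow> Q (\<lambda>n. s (\<rho> n)) x" if "x \<in> U" for x
   proof -
    have 1: "range (s(k := x)) \<subseteq> U" using s that by auto
    have 2: "\<forall>n. (s(k := x)) (\<kappa> n) = c n" using e k by auto
    have 3: "(\<lambda>n. (s(k := x)) (r (Suc n))) = (\<lambda>n. s (\<rho> n))" using k unfolding r_def by (auto simp: fun_eq_iff)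
    have 4: "(s(k := x)) (r 0) = x" by (simp add: r_def)
    show ?thesis using \<phi>[rule_format, OF 1 2[rule_format]] unfolding 3 4 .
   qed
   then show "sat U E (Forall k \<phi>) s \<longleftrightarrow> (\<forall>x\<in>U. Q (\<lambda>n. s (\<rho> n)) x)" by auto
  qed
 qed
qed

lemma Df_mem_var: "Df (\<lambda>e. E (e i) (e j))"
 unfolding Df_def using U_nonempty
proof (elim exE, intro exI conjI allI impI)
 fix u show "u \<in> U \<Longrightarrow> range (\<lambda>n::nat. u) \<subseteq> U" by auto
 fix \<rho> :: "nat \<Rightarrow> nat" and s show "sat U E (Mem (\<rho> i) (\<rho> j)) s \<longleftrightarrow> E (s (\<rho> i)) (s (\<rho> j))" by simp
qed

lemma Df_eq_var: "Df (\<lambda>e. e i = e j)"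
 unfolding Df_def using U_nonempty
proof (elim exE, intro exI conjI allI impI)
 fix u show "u \<in> U \<Longrightarrow> range (\<lambda>n::nat. u) \<subseteq> U" by auto
 fix \<rho> :: "nat \<Rightarrow> nat" and s show "sat U E (Equal (\<rho> i) (\<rho> j)) s \<longleftrightarrow> s (\<rho> i) = s (\<rho> j)" by simp
qed

lemma Df_eq_const: "a \<in> U \<Longrightarrow> Df (\<lambda>e. e i = a)"
 unfolding Df_def
proof (intro exI conjI allI impI)
 show "a \<in> U \<Longrightarrow> range (\<lambda>n::nat. a) \<subseteq> U" by auto
 fix \<rho> \<kappa> :: "nat \<Rightarrow> nat" and s assume "\<forall>n. s (\<kappa> n) = a"
 then show "sat U E (Equal (\<rho> i) (\<kappa> 0)) s \<longleftrightarrow> s (\<rho> i) = a" by simp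
qed

lemma Df_disj[df]: "Df P \<Longrightarrow> Df Q \<Longrightarrow> Df (\<lambda>e. P e \<or> Q e)"
 by (rule Df_cong[OF Df_not[OF Df_conj[OF Df_not Df_not]]]) auto

lemma Df_imp[df]: "Df P \<Longrightarrow> Df Q \<Longrightarrow> Df (\<lambda>e. P e \<longrightarrow> Q e)"
 by (rule Df_cong[OF Df_disj[OF Df_not]]) auto

lemma Df_iff[df]: assumes "Df P" "Df Q" shows "Df (\<lambda>e. P e \<longleftrightarrow> Q e)"
proof (rule Df_cong)
 show "Df (\<lambda>e. (P e \<longrightarrow> Q e) \<and> (Q e \<longrightarrow> P e))" by (intro df assms)
qed auto

lemma Df_const[df]: "Df (\<lambda>e. b)"
proof (cases b)
 case True
 show ?thesis by (rule Df_cong[OF Df_eq_var[of 0 0]]) (simp add: True)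
next
 case False
 show ?thesis by (rule Df_cong[OF Df_not[OF Df_eq_var[of 0 0]]]) (simp add: False)
qed

lemma Df_exU[df]:
 assumes "Df (\<lambda>e. Q (sh e) (e 0))"
 shows "Df (\<lambda>e. \<exists>x\<in>U. Q e x)"
 by (rule Df_cong[OF Df_not[OF Df_allU[of "\<lambda>e x. \<not> Q e x", OF Df_not[OF assms]]]]) auto

lemma DT_var[df]: "DT (\<lambda>e. e k)"
 unfolding DT_def using Df_eq_var by auto

lemma DT_const[df]: "a \<in> U \<Longrightarrow> DT (\<lambda>e. a)"
 unfolding DT_def using Df_eq_const by auto

lemma DT_U: "DT t \<Longrightarrow> range e \<subseteq> U \<Longrightarrow> t e \<in> U"
 unfolding DT_def by blast

lemma DS_U: "DS t \<Longrightarrow> range e \<subseteq> U \<Longrightarrow> t e \<subseteq> U"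
 unfolding DS_def by blast

text \<open>The term is introduced by a quantifier, as in
  \<open>\<exists>x\<in>U. x = t e \<and> Q e x\<close>, so formulas need no language of
  terms.\<close>

lemma Df_subst:
 assumes "DT t" and "Df (\<lambda>e. Q (sh e) (e 0))"
 shows "Df (\<lambda>e. Q e (t e))"
proof (rule Df_cong)
 show "Df (\<lambda>e. \<exists>x\<in>U. x = t e \<and> Q e x)"
  using assms unfolding DT_def by (intro df) auto
qed (use assms in \<open>auto simp: DT_def\<close>)

lemma DT_weaken: "DT t \<Longrightarrow> DT (\<lambda>e. t (\<lambda>n. e (f n)))"
proof -
 assume t: "DT t"
 then have "Df (\<lambda>e. e 0 = t (sh e))" by (simp add: DT_def)
 from Df_rename[OF this, of "case_nat 0 (\<lambda>n. Suc (f n))"]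
 have "Df (\<lambda>e. e 0 = t (\<lambda>n. e (Suc (f n))))" by simp
 moreover have "t (\<lambda>n. e (f n)) \<in> U" if "range e \<subseteq> U" for e
  by (rule DT_U[OF t]) (use that in auto)
 ultimately show ?thesis unfolding DT_def by auto
qed

lemma DS_weaken: "DS t \<Longrightarrow> DS (\<lambda>e. t (\<lambda>n. e (f n)))"
proof -
 assume t: "DS t"
 then have "Df (\<lambda>e. e 0 \<in> t (sh e))" by (simp add: DS_def)
 from Df_rename[OF this, of "case_nat 0 (\<lambda>n. Suc (f n))"]
 have "Df (\<lambda>e. e 0 \<in> t (\<lambda>n. e (Suc (f n))))" by simp
 moreover have "t (\<lambda>n. e (f n)) \<subseteq> U" if "range e \<subseteq> U" for e
  by (rule DS_U[OF t]) (use that in auto)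
 ultimately show ?thesis unfolding DS_def by auto
qed

lemma Df_1:
 assumes "Df (\<lambda>e. p (e 0))" "DT t"
 shows "Df (\<lambda>e. p (t e))"
 by (rule Df_subst[OF assms(2), of "\<lambda>e x. p x"]) (use assms(1) in simp)

lemma Df_2:
 assumes "Df (\<lambda>e. p (e 0) (e (Suc 0)))" "DT t" "DT u"
 shows "Df (\<lambda>e. p (t e) (u e))"
proof (rule Df_subst[OF assms(2), of "\<lambda>e x. p x (u e)"])
 show "Df (\<lambda>e. p (e 0) (u (sh e)))"
 proof (rule Df_subst[OF DT_weaken[OF assms(3)], of "\<lambda>e y. p (e 0) y" Suc])
  show "Df (\<lambda>e. p (e (Suc 0)) (e 0))"
   using Df_rename[OF assms(1), of "\<lambda>n. if n = 0 then Suc 0 else 0"] by simp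
 qed
qed

lemma Df_3:
 assumes "Df (\<lambda>e. p (e 0) (e (Suc 0)) (e (Suc (Suc 0))))" "DT t" "DT u" "DT v"
 shows "Df (\<lambda>e. p (t e) (u e) (v e))"
proof (rule Df_subst[OF assms(2), of "\<lambda>e x. p x (u e) (v e)"])
 show "Df (\<lambda>e. p (e 0) (u (sh e)) (v (sh e)))"
 proof (rule Df_subst[OF DT_weaken[OF assms(3)], of "\<lambda>e y. p (e 0) y (v (sh e))" Suc])
  show "Df (\<lambda>e. p (e (Suc 0)) (e 0) (v (\<lambda>n. e (Suc (Suc n)))))"
  proof (rule Df_subst[OF DT_weaken[OF assms(4)], of "\<lambda>e y. p (e (Suc 0)) (e 0) y" "\<lambda>n. Suc (Suc n)"])
   show "Df (\<lambda>e. p (e (Suc (Suc 0))) (e (Suc 0)) (e 0))"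
    using Df_rename[OF assms(1), of "\<lambda>n. if n = 0 then Suc (Suc 0) else if n = Suc 0 then Suc 0 else 0"] by simp
  qed
 qed
qed

lemma DT_1:
 assumes "Df (\<lambda>e. e 0 = g (e (Suc 0)))" "\<And>x. x \<in> U \<Longrightarrow> g x \<in> U" "DT t"
 shows "DT (\<lambda>e. g (t e))"
 unfolding DT_def using assms(2) DT_U[OF assms(3)] Df_2[OF assms(1) DT_var DT_weaken[OF assms(3)]] by auto

lemma DT_2:
 assumes "Df (\<lambda>e. e 0 = g (e (Suc 0)) (e (Suc (Suc 0))))" "\<And>x y. x \<in> U \<Longrightarrow> y \<in> U \<Longrightarrow> g x y \<in> U" "DT t" "DT u"
 shows "DT (\<lambda>e. g (t e) (u e))"
 unfolding DT_def using assms(2) DT_U[OF assms(3)] DT_U[OF assms(4)]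
  Df_3[OF assms(1) DT_var DT_weaken[OF assms(3)] DT_weaken[OF assms(4)]] by auto

lemma Df_eq[df]: "DT t \<Longrightarrow> DT u \<Longrightarrow> Df (\<lambda>e. t e = u e)"
 by (rule Df_2[of "(=)", OF Df_eq_var])

lemma Df_E[df]: "DT t \<Longrightarrow> DT u \<Longrightarrow> Df (\<lambda>e. E (t e) (u e))"
 by (rule Df_2[of E, OF Df_mem_var])

lemma Df_in[df]:
 assumes "DT t" "DS S" shows "Df (\<lambda>e. t e \<in> S e)"
 by (rule Df_subst[OF assms(1), of "\<lambda>e x. x \<in> S e"]) (use assms(2) in \<open>simp add: DS_def\<close>)

lemma DS_I: "(\<And>e. range e \<subseteq> U \<Longrightarrow> S e \<subseteq> U) \<Longrightarrow> Df (\<lambda>e. e 0 \<in> S (sh e)) \<Longrightarrow> DS S"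
 unfolding DS_def by blast

lemma range_Suc: "range e \<subseteq> U \<Longrightarrow> range (\<lambda>n. e (f n)) \<subseteq> U"
 by auto

lemma DS_ext[df]: assumes "DT t" shows "DS (\<lambda>e. ext (t e))"
proof (rule DS_I)
 show "Df (\<lambda>e. e 0 \<in> ext (t (sh e)))"
 proof (rule Df_cong)
  show "Df (\<lambda>e. E (e 0) (t (sh e)))" by (intro df assms[THEN DT_weaken])
 qed (auto simp: ext_def)
qed (auto simp: ext_def)

lemma DS_U'[df]: "DS (\<lambda>e. U)"
proof (rule DS_I)
 show "Df (\<lambda>e. e 0 \<in> U)" by (rule Df_cong[OF Df_const[of True]]) auto
qed auto

section \<open>Sets, pairs and functions as elements of the structure\<close>

lemma in_ext_U[dest]: "x \<in> ext y \<Longrightarrow> x \<in> U" by (auto simp: ext_def)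

lemma Sets_subset: "S \<in> Sets \<Longrightarrow> S \<subseteq> U" by (auto simp: Sets_def ext_def)

lemma Sets_U: "S \<in> Sets \<Longrightarrow> x \<in> S \<Longrightarrow> x \<in> U" by (auto simp: Sets_def ext_def)

lemma ext_Sets[simp, intro]: "x \<in> U \<Longrightarrow> ext x \<in> Sets" by (auto simp: Sets_def)

lemma DS_Sets[df]: assumes "S \<in> Sets" shows "DS (\<lambda>e. S)"
proof -
 from assms obtain a where "a \<in> U" "S = ext a" by (auto simp: Sets_def)
 then show ?thesis by (simp, intro df)
qed

lemma ext_inj: "x \<in> U \<Longrightarrow> y \<in> U \<Longrightarrow> ext x = ext y \<Longrightarrow> x = y"
 using ax_ext by blast

lemma emp_Sets[simp, intro]: "{} \<in> Sets"
proof -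
 from ax_inf have "\<exists>w\<in>U. \<exists>z\<in>ext w. ext z = {}" by blast
 then show ?thesis by (metis Sets_def image_eqI in_ext_U)
qed

text \<open>The inverse of \<open>ext\<close> on sets. On other classes it takes the empty set as
  default, which keeps it total and, since being a set is expressible, definable.\<close>

definition cd :: "'a set \<Rightarrow> 'a" where
 "cd S = (if S \<in> Sets then (THE x. x \<in> U \<and> ext x = S) else (THE x. x \<in> U \<and> ext x = {}))"

lemma cd: assumes "S \<in> Sets" shows "cd S \<in> U" "ext (cd S) = S"
proof -
 from assms obtain x where "x \<in> U" "ext x = S" by (auto simp: Sets_def)
 then have "\<exists>!x. x \<in> U \<and> ext x = S" using ext_inj by blast
 from theI'[OF this] show "cd S \<in> U" "ext (cd S) = S" using assms by (auto simp: cd_def)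
qed

lemma ext_cd[simp]: "S \<in> Sets \<Longrightarrow> ext (cd S) = S" by (rule cd)

lemma cd_ext[simp]: "x \<in> U \<Longrightarrow> cd (ext x) = x" using cd[of "ext x"] ext_inj by auto

lemma cd_junk: "S \<notin> Sets \<Longrightarrow> cd S = cd {}" by (simp add: cd_def)

lemma cd_U[simp, intro]: "cd S \<in> U" by (cases "S \<in> Sets") (auto simp: cd cd_junk)

lemma cd_inj: "S \<in> Sets \<Longrightarrow> T \<in> Sets \<Longrightarrow> cd S = cd T \<longleftrightarrow> S = T" by (metis ext_cd)

lemma Df_ball[df]:
 assumes "DS S" "Df (\<lambda>e. Q (sh e) (e 0))"
 shows "Df (\<lambda>e. \<forall>x\<in>S e. Q e x)"
proof (rule Df_cong)
 show "Df (\<lambda>e. \<forall>x\<in>U. x \<in> S e \<longrightarrow> Q e x)" by (intro df assms(1)[THEN DS_weaken] assms(2))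
qed (use DS_U[OF assms(1)] in blast)

lemma Df_bex[df]:
 assumes "DS S" "Df (\<lambda>e. Q (sh e) (e 0))"
 shows "Df (\<lambda>e. \<exists>x\<in>S e. Q e x)"
proof (rule Df_cong)
 show "Df (\<lambda>e. \<exists>x\<in>U. x \<in> S e \<and> Q e x)" by (intro df assms(1)[THEN DS_weaken] assms(2))
qed (use DS_U[OF assms(1)] in blast)

lemma Df_subset[df]: assumes "DS S" "DS T" shows "Df (\<lambda>e. S e \<subseteq> T e)"
proof (rule Df_cong)
 show "Df (\<lambda>e. \<forall>x\<in>S e. x \<in> T e)" by (intro df assms assms[THEN DS_weaken])
qed auto

lemma Df_seteq[df]: assumes "DS S" "DS T" shows "Df (\<lambda>e. S e = T e)"
proof (rule Df_cong)
 show "Df (\<lambda>e. S e \<subseteq> T e \<and> T e \<subseteq> S e)" by (intro df assms)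
qed auto

lemma Df_Sets[df]: assumes "DS S" shows "Df (\<lambda>e. S e \<in> Sets)"
proof (rule Df_cong)
 show "Df (\<lambda>e. \<exists>x\<in>U. ext x = S e)" by (intro df assms assms[THEN DS_weaken])
qed (auto simp: Sets_def)

lemma DT_cd[df]: assumes "DS S" shows "DT (\<lambda>e. cd (S e))"
 unfolding DT_def
proof (intro conjI allI impI)
 show "Df (\<lambda>e. e 0 = cd (S (sh e)))"
 proof (rule Df_cong)
  show "Df (\<lambda>e. (S (sh e) \<in> Sets \<and> ext (e 0) = S (sh e)) \<or>
    (S (sh e) \<notin> Sets \<and> e 0 = cd {}))"
   by (intro df assms assms[THEN DS_weaken]) auto
  fix e :: "nat \<Rightarrow> 'a" assume "range e \<subseteq> U"
  then have "e 0 \<in> U" by auto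
  then show "(e 0 = cd (S (sh e))) = ((S (sh e) \<in> Sets \<and> ext (e 0) = S (sh e)) \<or>
    (S (sh e) \<notin> Sets \<and> e 0 = cd {}))"
   by (metis cd_ext cd_junk ext_cd)
 qed
qed auto

lemma DS_empty[df]: "DS (\<lambda>e. {})" by (rule DS_Sets) auto

lemma DS_insert[df]: assumes "DT t" "DS S" shows "DS (\<lambda>e. insert (t e) (S e))"
proof (rule DS_I)
 show "Df (\<lambda>e. e 0 \<in> insert (t (sh e)) (S (sh e)))"
  unfolding insert_iff by (intro df assms(1)[THEN DT_weaken] assms(2)[THEN DS_weaken])
qed (use assms DT_U DS_U in auto)

lemma DS_Un[df]: assumes "DS T" "DS S" shows "DS (\<lambda>e. T e \<union> S e)"
proof (rule DS_I)
 show "Df (\<lambda>e. e 0 \<in> T (sh e) \<union> S (sh e))"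
  unfolding Un_iff by (intro df assms[THEN DS_weaken])
qed (use assms DS_U in auto)

lemma DS_Int[df]: assumes "DS T" "DS S" shows "DS (\<lambda>e. T e \<inter> S e)"
proof (rule DS_I)
 show "Df (\<lambda>e. e 0 \<in> T (sh e) \<inter> S (sh e))"
  unfolding Int_iff by (intro df assms[THEN DS_weaken])
 show "T e \<inter> S e \<subseteq> U" if "range e \<subseteq> U" for e using DS_U[OF assms(1) that] by blast
qed

lemma DS_Diff[df]: assumes "DS T" "DS S" shows "DS (\<lambda>e. T e - S e)"
proof (rule DS_I)
 show "Df (\<lambda>e. e 0 \<in> T (sh e) - S (sh e))"
  unfolding Diff_iff by (intro df assms[THEN DS_weaken])
 show "T e - S e \<subseteq> U" if "range e \<subseteq> U" for e using DS_U[OF assms(1) that] by blast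
qed

lemma DS_sep[df]: assumes "DS S" "Df (\<lambda>e. Q (sh e) (e 0))"
 shows "DS (\<lambda>e. {x \<in> S e. Q e x})"
proof (rule DS_I)
 show "Df (\<lambda>e. e 0 \<in> {x \<in> S (sh e). Q (sh e) x})"
  unfolding mem_Collect_eq by (intro df assms(1)[THEN DS_weaken] assms(2))
 show "{x \<in> S e. Q e x} \<subseteq> U" if "range e \<subseteq> U" for e using DS_U[OF assms(1) that] by blast
qed

lemma DS_UN[df]: assumes "DS S" "DS (\<lambda>e. T (sh e) (e 0))"
 shows "DS (\<lambda>e. \<Union>x\<in>S e. T e x)"
proof (rule DS_I)
 have *: "Df (\<lambda>e. e (Suc 0) \<in> T (\<lambda>n. e (Suc (Suc n))) (e 0))"
  using Df_in[OF DT_var[of "Suc 0"] DS_weaken[OF assms(2), of "case_nat 0 (\<lambda>n. Suc (Suc n))"]] by simp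
 show "Df (\<lambda>e. e 0 \<in> (\<Union>x\<in>S (sh e). T (sh e) x))"
  unfolding UN_iff by (intro df assms(1)[THEN DS_weaken] *)
 show "(\<Union>x\<in>S e. T e x) \<subseteq> U" if r: "range e \<subseteq> U" for e
 proof (intro UN_least)
  fix x assume "x \<in> S e"
  then have "x \<in> U" using DS_U[OF assms(1) r] by blast
  then have "range (case_nat x e) \<subseteq> U" using r by (auto simp: image_subset_iff split: nat.splits)
  from DS_U[OF assms(2) this] show "T e x \<subseteq> U" by simp
 qed
qed

lemma DS_image[df]: assumes "DS S" "DT (\<lambda>e. t (sh e) (e 0))"
 shows "DS (\<lambda>e. (\<lambda>x. t e x) ` S e)"
proof -
 have "DS (\<lambda>e. \<Union>x\<in>S e. {t e x})"
  by (rule DS_UN[OF assms(1)]) (intro df assms(2))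
 moreover have "(\<lambda>x. t e x) ` S e = (\<Union>x\<in>S e. {t e x})" for e by auto
 ultimately show ?thesis by simp
qed

lemma DS_if[df]: assumes "Df P" "DS T" "DS S" shows "DS (\<lambda>e. if P e then T e else S e)"
proof (rule DS_I)
 show "Df (\<lambda>e. e 0 \<in> (if P (sh e) then T (sh e) else S (sh e)))"
 proof (rule Df_cong)
  show "Df (\<lambda>e. (P (sh e) \<and> e 0 \<in> T (sh e)) \<or> (\<not> P (sh e) \<and> e 0 \<in> S (sh e)))"
   by (intro df assms(2,3)[THEN DS_weaken] assms(1)[THEN Df_rename])
 qed auto
qed (use assms DS_U in auto)

lemma DT_if[df]: assumes "Df P" "DT t" "DT u" shows "DT (\<lambda>e. if P e then t e else u e)"
 unfolding DT_def
proof (intro conjI allI impI)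
 show "Df (\<lambda>e. e 0 = (if P (sh e) then t (sh e) else u (sh e)))"
 proof (rule Df_cong)
  show "Df (\<lambda>e. (P (sh e) \<and> e 0 = t (sh e)) \<or> (\<not> P (sh e) \<and> e 0 = u (sh e)))"
   by (intro df assms(2,3)[THEN DT_weaken] assms(1)[THEN Df_rename])
 qed auto
qed (use assms DT_U in auto)

text \<open>The axiom scheme reserves variable 0 for the element. The parameters go to the odd
  indices, so the positive even ones stay free for quantifiers; accordingly \<open>s\<close> returns
  \<open>c n\<close> at index \<open>2 * n + 1\<close>.\<close>

lemma separation:
 assumes A: "A \<in> Sets" and P: "Df (\<lambda>e. P (e 0))"
 shows "{x \<in> A. P x} \<in> Sets"
proof -
 from A obtain a where a: "a \<in> U" "A = ext a" by (auto simp: Sets_def)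
 from P obtain c where c: "range c \<subseteq> U" and H: "\<And>\<rho> \<kappa>. coinf \<rho> \<kappa> \<Longrightarrow>
   (\<exists>\<phi>. expr \<phi> c \<kappa> (\<lambda>s. P (s (\<rho> 0))))"
  unfolding Df_def by blast
 have "infinite (- (range (\<lambda>n::nat. 0::nat) \<union> range (\<lambda>n::nat. 2 * n + 1)))"
 proof
  assume "finite (- (range (\<lambda>n::nat. 0::nat) \<union> range (\<lambda>n::nat. 2 * n + 1)))"
  moreover have "range (\<lambda>n::nat. 2 * n + 2) \<subseteq> - (range (\<lambda>n::nat. 0::nat) \<union> range (\<lambda>n::nat. 2 * n + 1))"
   by (auto) presburger
  ultimately have "finite (range (\<lambda>n::nat. 2 * n + 2))" by (meson finite_subset)
  moreover have "inj (\<lambda>n::nat. 2 * n + 2)" by (auto simp: inj_def)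
  ultimately show False using finite_imageD infinite_UNIV_nat by blast
 qed
 from H[OF this] obtain \<phi> where \<phi>: "expr \<phi> c (\<lambda>n. 2 * n + 1) (\<lambda>s. P (s 0))"
  by blast
 define s where "s = (\<lambda>n. c (n div 2))"
 have s: "range s \<subseteq> U" using c by (auto simp: s_def)
 have "{x \<in> ext a. sat U E \<phi> (s(0 := x))} \<in> Sets" using ax_sep a(1) s by blast
 moreover have "sat U E \<phi> (s(0 := x)) \<longleftrightarrow> P x" if "x \<in> ext a" for x
  using \<phi>[rule_format, of "s(0 := x)"] s that by (auto simp: s_def ext_def)
 ultimately show ?thesis using a by (metis (mono_tags, lifting) Collect_cong)
qed

text \<open>As for separation, but indices 0 and 1 are both reserved, so the parameters start at 3
  and \<open>s\<close> returns \<open>c n\<close> at index \<open>2 * n + 3\<close>.\<close>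

lemma replacement:
 assumes A: "A \<in> Sets" and P: "Df (\<lambda>e. P (e 0) (e (Suc 0)))"
  and ex: "\<And>x. x \<in> A \<Longrightarrow> \<exists>!y. y \<in> U \<and> P x y"
 shows "{y \<in> U. \<exists>x\<in>A. P x y} \<in> Sets"
proof -
 from A obtain a where a: "a \<in> U" "A = ext a" by (auto simp: Sets_def)
 from P obtain c where c: "range c \<subseteq> U" and H: "\<And>\<rho> \<kappa>. coinf \<rho> \<kappa> \<Longrightarrow>
   (\<exists>\<phi>. expr \<phi> c \<kappa> (\<lambda>s. P (s (\<rho> 0)) (s (\<rho> (Suc 0)))))"
  unfolding Df_def by blast
 define r where "r n = (if n = 0 then 0 else 1::nat)" for n :: nat
 have "infinite (- (range r \<union> range (\<lambda>n::nat. 2 * n + 3)))"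
 proof
  assume "finite (- (range r \<union> range (\<lambda>n::nat. 2 * n + 3)))"
  moreover have "range (\<lambda>n::nat. 2 * n + 2) \<subseteq> - (range r \<union> range (\<lambda>n::nat. 2 * n + 3))"
   by (auto simp: r_def) presburger
  ultimately have "finite (range (\<lambda>n::nat. 2 * n + 2))" by (meson finite_subset)
  moreover have "inj (\<lambda>n::nat. 2 * n + 2)" by (auto simp: inj_def)
  ultimately show False using finite_imageD infinite_UNIV_nat by blast
 qed
 from H[OF this] obtain \<phi> where \<phi>: "expr \<phi> c (\<lambda>n. 2 * n + 3) (\<lambda>s. P (s 0) (s 1))"
  by (auto simp: r_def)
 define s where "s = (\<lambda>n. c ((n - 3) div 2))"
 have s: "range s \<subseteq> U" using c by (auto simp: s_def)
 have eq: "sat U E \<phi> (s(0 := x, 1 := y)) \<longleftrightarrow> P x y" if "x \<in> ext a" "y \<in> U" for x y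
  using \<phi>[rule_format, of "s(0 := x, 1 := y)"] s that by (auto simp: s_def ext_def)
 have "\<forall>x\<in>ext a. \<exists>!y. y \<in> U \<and> sat U E \<phi> (s(0 := x, 1 := y))"
 proof
  fix x assume x: "x \<in> ext a"
  from ex[of x] x a obtain y where "y \<in> U" "P x y" "\<And>z. z \<in> U \<Longrightarrow> P x z \<Longrightarrow> z = y" by blast
  then show "\<exists>!y. y \<in> U \<and> sat U E \<phi> (s(0 := x, 1 := y))" using eq[OF x] by blast
 qed
 then have "{y \<in> U. \<exists>x\<in>ext a. sat U E \<phi> (s(0 := x, 1 := y))} \<in> Sets" using ax_repl a(1) s by blast
 moreover have "{y \<in> U. \<exists>x\<in>ext a. sat U E \<phi> (s(0 := x, 1 := y))} = {y \<in> U. \<exists>x\<in>A. P x y}"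
  using eq a by blast
 ultimately show ?thesis by simp
qed

lemma Sets_subsetI: "A \<in> Sets \<Longrightarrow> DS (\<lambda>e. S) \<Longrightarrow> S \<subseteq> A \<Longrightarrow> S \<in> Sets"
 using separation[of A "\<lambda>x. x \<in> S", OF _ Df_in[OF DT_var]]
 by (metis (mono_tags) Collect_mem_eq inf.absorb_iff2 Collect_conj_eq)

lemma Sets_image: assumes "A \<in> Sets" "Df (\<lambda>e. e 0 \<in> A \<and> e (Suc 0) = f (e 0))" "\<And>x. x \<in> A \<Longrightarrow> f x \<in> U"
 shows "f ` A \<in> Sets"
proof -
 have "{y \<in> U. \<exists>x\<in>A. x \<in> A \<and> y = f x} \<in> Sets"
  by (rule replacement[OF assms(1,2)]) (use assms in auto)
 moreover have "{y \<in> U. \<exists>x\<in>A. x \<in> A \<and> y = f x} = f ` A" using assms(3) by auto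
 ultimately show ?thesis by simp
qed

lemma Sets_imageT: assumes "A \<in> Sets" "DT (\<lambda>e. f (e 0))" shows "f ` A \<in> Sets"
proof (rule Sets_image[OF assms(1)])
 show "Df (\<lambda>e. e 0 \<in> A \<and> e (Suc 0) = f (e 0))" by (intro df assms)
 show "f x \<in> U" if "x \<in> A" for x using DT_U[OF assms(2), of "\<lambda>_. x"] Sets_U[OF assms(1) that] by auto
qed

lemma Sets_pair: "x \<in> U \<Longrightarrow> y \<in> U \<Longrightarrow> {x, y} \<in> Sets" using ax_pair by blast

lemma Sets_Union: assumes "A \<in> Sets" shows "(\<Union>x\<in>A. ext x) \<in> Sets"
proof -
 from assms obtain a where "a \<in> U" "A = ext a" by (auto simp: Sets_def)
 then show ?thesis using ax_union by blast
qed

lemma Sets_Un[simp, intro]: assumes "A \<in> Sets" "B \<in> Sets" shows "A \<union> B \<in> Sets"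
 using Sets_Union[OF Sets_pair[of "cd A" "cd B"]] assms by simp

lemma Sets_insert[simp, intro]: "x \<in> U \<Longrightarrow> A \<in> Sets \<Longrightarrow> insert x A \<in> Sets"
 using Sets_Un[of "{x}" A] Sets_pair[of x x] by auto

definition pset :: "'a set \<Rightarrow> 'a set" where
 "pset A = {x \<in> U. ext x \<subseteq> A}"

lemma Sets_pset[simp, intro]: assumes "A \<in> Sets" shows "pset A \<in> Sets"
proof -
 from assms obtain a where "a \<in> U" "A = ext a" by (auto simp: Sets_def)
 then show ?thesis using ax_power unfolding pset_def by blast
qed

lemma DS_pset[df]: assumes "DS S" shows "DS (\<lambda>e. pset (S e))"
 unfolding pset_def by (intro df assms[THEN DS_weaken])

lemma pset_iff: "x \<in> pset A \<longleftrightarrow> x \<in> U \<and> ext x \<subseteq> A" by (simp add: pset_def)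

lemma Sets_UN: assumes "A \<in> Sets" "DS (\<lambda>e. F (e 0))" "\<And>x. x \<in> A \<Longrightarrow> F x \<in> Sets"
 shows "(\<Union>x\<in>A. F x) \<in> Sets"
proof -
 have "(\<lambda>x. cd (F x)) ` A \<in> Sets" by (intro Sets_imageT assms df)
 from Sets_Union[OF this] assms(3) show ?thesis by auto
qed

lemma Sets_Int[simp, intro]: assumes "A \<in> Sets" "B \<in> Sets" shows "A \<inter> B \<in> Sets"
 by (rule Sets_subsetI[OF assms(1)]) (intro df assms, auto)

lemma Sets_Diff[simp, intro]: assumes "A \<in> Sets" "B \<in> Sets" shows "A - B \<in> Sets"
 by (rule Sets_subsetI[OF assms(1)]) (intro df assms, auto)

lemma pr_ex1: assumes "x \<in> U" "y \<in> U"
 shows "\<exists>!z. z \<in> U \<and> (\<exists>s\<in>U. \<exists>t\<in>U. ext s = {x} \<and> ext t = {x, y} \<and> ext z = {s, t})"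
proof (rule ex1I[of _ "cd {cd {x}, cd {x, y}}"])
 have s: "{x} \<in> Sets" "{x, y} \<in> Sets" "{cd {x}, cd {x, y}} \<in> Sets" using assms by (auto simp: Sets_pair)
 then show "cd {cd {x}, cd {x, y}} \<in> U \<and> (\<exists>s\<in>U. \<exists>t\<in>U. ext s = {x} \<and> ext t = {x, y} \<and> ext (cd {cd {x}, cd {x, y}}) = {s, t})"
  by (intro conjI bexI[of _ "cd {x}"] bexI[of _ "cd {x, y}"]) auto
 fix z assume "z \<in> U \<and> (\<exists>s\<in>U. \<exists>t\<in>U. ext s = {x} \<and> ext t = {x, y} \<and> ext z = {s, t})"
 then show "z = cd {cd {x}, cd {x, y}}" by (metis cd_ext)
qed

lemma pr_eq: "x \<in> U \<Longrightarrow> y \<in> U \<Longrightarrow> pr x y = cd {cd {x}, cd {x, y}}"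
 using theI'[OF pr_ex1, of x y] unfolding pr_def[symmetric] by (metis cd_ext)

lemma pr_U[simp, intro]: "x \<in> U \<Longrightarrow> y \<in> U \<Longrightarrow> pr x y \<in> U" by (simp add: pr_eq)

lemma pr_inj[simp]: assumes "x \<in> U" "y \<in> U" "x' \<in> U" "y' \<in> U"
 shows "pr x y = pr x' y' \<longleftrightarrow> x = x' \<and> y = y'"
proof
 assume h: "pr x y = pr x' y'"
 have s: "{x} \<in> Sets" "{x, y} \<in> Sets" "{x'} \<in> Sets" "{x', y'} \<in> Sets" "{cd {x}, cd {x, y}} \<in> Sets" "{cd {x'}, cd {x', y'}} \<in> Sets"
  using assms by (auto simp: Sets_pair)
 have "{cd {x}, cd {x, y}} = {cd {x'}, cd {x', y'}}"
  using h assms s by (simp add: pr_eq cd_inj)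
 then have "ext ` {cd {x}, cd {x, y}} = ext ` {cd {x'}, cd {x', y'}}" by (rule arg_cong)
 then have "{{x}, {x, y}} = {{x'}, {x', y'}}" using s by simp
 then show "x = x' \<and> y = y'" by (auto simp: doubleton_eq_iff)
qed simp

lemma DT_pr[df]: assumes "DT t" "DT u" shows "DT (\<lambda>e. pr (t e) (u e))"
proof (rule DT_2[OF _ _ assms])
 show "Df (\<lambda>e. e 0 = pr (e (Suc 0)) (e (Suc (Suc 0))))"
 proof (rule Df_cong)
  show "Df (\<lambda>e. e 0 = cd {cd {e (Suc 0)}, cd {e (Suc 0), e (Suc (Suc 0))}})" by (intro df)
 qed (auto simp: pr_eq image_subset_iff)
qed auto

definition prd :: "'a set \<Rightarrow> 'a set \<Rightarrow> 'a set" where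
 "prd A B = (\<Union>x\<in>A. (\<lambda>y. pr x y) ` B)"

lemma prd_iff: "z \<in> prd A B \<longleftrightarrow> (\<exists>x\<in>A. \<exists>y\<in>B. z = pr x y)" by (auto simp: prd_def)

lemma DS_prd[df]: assumes "DS A" "DS B" shows "DS (\<lambda>e. prd (A e) (B e))"
 unfolding prd_def by (intro df assms assms[THEN DS_weaken])

lemma Sets_prd[simp, intro]: "A \<in> Sets \<Longrightarrow> B \<in> Sets \<Longrightarrow> prd A B \<in> Sets"
 unfolding prd_def
proof (rule Sets_UN)
 assume a: "A \<in> Sets" "B \<in> Sets"
 show "DS (\<lambda>e. pr (e 0) ` B)" by (intro df a)
 fix x assume "x \<in> A"
 then have "x \<in> U" using a Sets_U by auto
 then show "pr x ` B \<in> Sets" by (intro Sets_imageT a df) auto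
qed

text \<open>A total version of \<open>app\<close> with the empty set as default, so that application
  is a definable term. Quantifying over functions then means quantifying over codes
  \<open>c \<in> U\<close>.\<close>

definition ap :: "'a \<Rightarrow> 'a \<Rightarrow> 'a" where
 "ap c x = (if \<exists>!y. y \<in> U \<and> pr x y \<in> ext c then (THE y. y \<in> U \<and> pr x y \<in> ext c) else cd {})"

lemma ap_unique: "y \<in> U \<Longrightarrow> pr x y \<in> ext c \<Longrightarrow> (\<And>z. z \<in> U \<Longrightarrow> pr x z \<in> ext c \<Longrightarrow> z = y) \<Longrightarrow> ap c x = y"
proof -
 assume a: "y \<in> U" "pr x y \<in> ext c" "\<And>z. z \<in> U \<Longrightarrow> pr x z \<in> ext c \<Longrightarrow> z = y"
 then have *: "\<exists>!y. y \<in> U \<and> pr x y \<in> ext c" by blast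
 show ?thesis unfolding ap_def using the1_equality[OF *, of y] * a(1,2) by simp
qed

lemma ap_U[simp, intro]: "ap c x \<in> U"
 unfolding ap_def using theI'[of "\<lambda>y. y \<in> U \<and> pr x y \<in> ext c"] by auto

lemma DT_ap[df]: assumes "DT t" "DT u" shows "DT (\<lambda>e. ap (t e) (u e))"
proof (rule DT_2[OF _ _ assms])
 show "Df (\<lambda>e. e 0 = ap (e (Suc 0)) (e (Suc (Suc 0))))"
 proof (rule Df_cong)
  show "Df (\<lambda>e. (\<exists>y\<in>U. pr (e (Suc (Suc 0))) y \<in> ext (e (Suc 0)) \<and>
    (\<forall>z\<in>U. pr (e (Suc (Suc 0))) z \<in> ext (e (Suc 0)) \<longrightarrow> z = y) \<and> e 0 = y) \<or>
    (\<not> (\<exists>y\<in>U. pr (e (Suc (Suc 0))) y \<in> ext (e (Suc 0)) \<and>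
    (\<forall>z\<in>U. pr (e (Suc (Suc 0))) z \<in> ext (e (Suc 0)) \<longrightarrow> z = y)) \<and> e 0 = cd {}))"
   by (intro df) auto
  fix e :: "nat \<Rightarrow> 'a" assume "range e \<subseteq> U"
  show "(e 0 = ap (e (Suc 0)) (e (Suc (Suc 0)))) = ((\<exists>y\<in>U. pr (e (Suc (Suc 0))) y \<in> ext (e (Suc 0)) \<and>
    (\<forall>z\<in>U. pr (e (Suc (Suc 0))) z \<in> ext (e (Suc 0)) \<longrightarrow> z = y) \<and> e 0 = y) \<or>
    (\<not> (\<exists>y\<in>U. pr (e (Suc (Suc 0))) y \<in> ext (e (Suc 0)) \<and>
    (\<forall>z\<in>U. pr (e (Suc (Suc 0))) z \<in> ext (e (Suc 0)) \<longrightarrow> z = y)) \<and> e 0 = cd {}))"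
  proof (cases "\<exists>!y. y \<in> U \<and> pr (e (Suc (Suc 0))) y \<in> ext (e (Suc 0))")
   case True
   then obtain y where y: "y \<in> U" "pr (e (Suc (Suc 0))) y \<in> ext (e (Suc 0))"
    "\<And>z. z \<in> U \<Longrightarrow> pr (e (Suc (Suc 0))) z \<in> ext (e (Suc 0)) \<Longrightarrow> z = y" by auto
   have "ap (e (Suc 0)) (e (Suc (Suc 0))) = y" using y by (rule ap_unique)
   with y show ?thesis by metis
  next
   case False
   then have "ap (e (Suc 0)) (e (Suc (Suc 0))) = cd {}" unfolding ap_def by auto
   then show ?thesis using False by auto
  qed
 qed
qed auto

lemma graph_eq: "{pr x (f x) | x. x \<in> S} = (\<lambda>x. pr x (f x)) ` S" by auto

lemma code_eq: "{pr x (f x) | x. x \<in> S} \<in> Sets \<Longrightarrow> code S f = cd {pr x (f x) | x. x \<in> S}"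
 unfolding code_def by (rule the_equality) (auto simp: cd, metis cd_ext)

lemma fun_inD: assumes "fun_in S f" "S \<subseteq> U"
 shows "code S f \<in> U" "ext (code S f) = {pr x (f x) | x. x \<in> S}" "\<And>x. x \<in> S \<Longrightarrow> ap (code S f) x = f x"
proof -
 have f: "f ` S \<subseteq> U" "{pr x (f x) | x. x \<in> S} \<in> Sets" using assms by (auto simp: fun_in_def)
 then show 1: "code S f \<in> U" "ext (code S f) = {pr x (f x) | x. x \<in> S}" by (simp_all add: code_eq)
 fix x assume x: "x \<in> S"
 show "ap (code S f) x = f x"
 proof (rule ap_unique)
  show "f x \<in> U" "pr x (f x) \<in> ext (code S f)" using x f(1) 1 by auto
  fix z assume "z \<in> U" "pr x z \<in> ext (code S f)"
  then obtain x' where "pr x z = pr x' (f x')" "x' \<in> S" using 1 by auto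
  then show "z = f x" using pr_inj[of x z x' "f x'"] x \<open>z \<in> U\<close> f(1) assms(2) by auto
 qed
qed

lemma fun_in_mem: "fun_in S f \<Longrightarrow> x \<in> S \<Longrightarrow> f x \<in> U"
 by (auto simp: fun_in_def)

text \<open>Only the graph over \<open>S\<close> has to be definable, so \<open>f\<close> may be
  given by a choice made outside the structure, as long as its values on \<open>S\<close> are
  determined.\<close>

lemma fun_inI: assumes "S \<in> Sets" "Df (\<lambda>e. e 0 \<in> S \<and> e (Suc 0) = f (e 0))" "\<And>x. x \<in> S \<Longrightarrow> f x \<in> U"
 shows "fun_in S f"
 unfolding fun_in_def graph_eq
proof
 show "f ` S \<subseteq> U" using assms by auto
 show "(\<lambda>x. pr x (f x)) ` S \<in> Sets"
 proof (rule Sets_image[OF assms(1)])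
  have "Df (\<lambda>e. e 0 \<in> S \<and> (\<exists>y\<in>U. (e 0 \<in> S \<and> y = f (e 0)) \<and> e (Suc 0) = pr (e 0) y))"
   by (intro df assms Df_rename[OF assms(2), of "case_nat (Suc 0) (\<lambda>_. 0)", simplified])
  then show "Df (\<lambda>e. e 0 \<in> S \<and> e (Suc 0) = pr (e 0) (f (e 0)))"
   by (rule Df_cong) (use assms(3) in auto)
  show "pr x (f x) \<in> U" if "x \<in> S" for x using that assms Sets_U by auto
 qed
qed

lemma fun_inT: assumes "S \<in> Sets" "DT (\<lambda>e. f (e 0))" shows "fun_in S f"
proof (rule fun_inI[OF assms(1)])
 show "Df (\<lambda>e. e 0 \<in> S \<and> e (Suc 0) = f (e 0))" by (intro df assms)
 show "f x \<in> U" if "x \<in> S" for x using DT_U[OF assms(2), of "\<lambda>_. x"] Sets_U[OF assms(1) that] by auto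
qed

lemma fun_in_cong: "fun_in S f \<Longrightarrow> (\<And>x. x \<in> S \<Longrightarrow> f x = g x) \<Longrightarrow> fun_in S g"
proof -
 assume a: "fun_in S f" "\<And>x. x \<in> S \<Longrightarrow> f x = g x"
 then have "{pr x (f x) | x. x \<in> S} = {pr x (g x) | x. x \<in> S}" "f ` S = g ` S" by force+
 then show ?thesis using a(1) unfolding fun_in_def by simp
qed

text \<open>Turns an internal function into a parameter \<open>c\<close>, the form in which it can
  occur in a formula.\<close>

lemma fn_of_fun_in: assumes "fun_in S f" "S \<in> Sets" shows "\<exists>c\<in>U. \<forall>x\<in>S. f x = ap c x"
 using fun_inD[OF assms(1) Sets_subset[OF assms(2)]] by metis

lemma fun_in_ap[simp, intro]: "c \<in> U \<Longrightarrow> S \<in> Sets \<Longrightarrow> fun_in S (ap c)"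
 by (intro fun_inT df)

end

section \<open>Natural numbers, recursion, choice and finite sets inside the structure\<close>

context zfc
begin

lemma Df_inj_on[df]: assumes "DS S" "DT (\<lambda>e. t (sh e) (e 0))"
 shows "Df (\<lambda>e. inj_on (\<lambda>x. t e x) (S e))"
proof -
 have 1: "DT (\<lambda>e. t (\<lambda>n. e (Suc (Suc n))) (e 0))"
  using DT_weaken[OF assms(2), of "case_nat 0 (\<lambda>n. Suc (Suc n))"] by simp
 have 2: "DT (\<lambda>e. t (\<lambda>n. e (Suc (Suc n))) (e (Suc 0)))"
  using DT_weaken[OF assms(2), of "case_nat (Suc 0) (\<lambda>n. Suc (Suc n))"] by simp
 show ?thesis unfolding inj_on_def by (intro df assms(1) assms(1)[THEN DS_weaken] 1 2)
qed

lemma Df_bij_betw[df]: assumes "DS S" "DS T" "DT (\<lambda>e. t (sh e) (e 0))"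
 shows "Df (\<lambda>e. bij_betw (\<lambda>x. t e x) (S e) (T e))"
 unfolding bij_betw_def by (intro df assms)

lemma foundation: "S \<in> Sets \<Longrightarrow> S \<noteq> {} \<Longrightarrow> \<exists>y\<in>S. ext y \<inter> S = {}"
 using ax_found unfolding Sets_def by blast

lemma no_self: "x \<in> U \<Longrightarrow> x \<notin> ext x"
 using foundation[of "{x}"] Sets_pair[of x x] by auto

definition sc :: "'a \<Rightarrow> 'a" where "sc n = cd (insert n (ext n))"

lemma ext_sc[simp]: "n \<in> U \<Longrightarrow> ext (sc n) = insert n (ext n)" by (simp add: sc_def)
lemma sc_U[simp, intro]: "sc n \<in> U" by (simp add: sc_def)
lemma DT_sc[df]: "DT t \<Longrightarrow> DT (\<lambda>e. sc (t e))" unfolding sc_def by (intro df)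

lemma sc_iff: "n \<in> U \<Longrightarrow> y \<in> U \<Longrightarrow> ext y = insert n (ext n) \<longleftrightarrow> y = sc n"
 by (metis cd_ext ext_sc sc_def)

lemma emp_iff: "y \<in> U \<Longrightarrow> ext y = {} \<longleftrightarrow> y = cd {}"
 by (metis cd_ext emp_Sets ext_cd)

text \<open>The defining formula restated with the terms \<open>cd {}\<close> and \<open>sc\<close>,
  the form on which the definability rules work.\<close>

lemma omega_eq: "omega = {n \<in> U. \<forall>w\<in>U. cd {} \<in> ext w \<and> (\<forall>x\<in>ext w. sc x \<in> ext w) \<longrightarrow> n \<in> ext w}"
proof -
 have 1: "(\<exists>z\<in>ext w. ext z = {}) \<longleftrightarrow> cd {} \<in> ext w" for w
  by (metis emp_Sets emp_iff ext_cd in_ext_U)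
 have 2: "(\<exists>y\<in>ext w. ext y = insert x (ext x)) \<longleftrightarrow> sc x \<in> ext w" if "x \<in> ext w" for w x
  using that sc_iff in_ext_U by (metis ext_sc)
 show ?thesis unfolding omega_def 1 using 2 by auto
qed

lemma omega_Sets[simp, intro]: "omega \<in> Sets"
proof -
 from ax_inf obtain w where w: "w \<in> U" "\<exists>z\<in>ext w. ext z = {}" "\<forall>x\<in>ext w. \<exists>y\<in>ext w. ext y = insert x (ext x)" by blast
 then have "omega \<subseteq> ext w" unfolding omega_def by blast
 moreover have "DS (\<lambda>e. omega)" unfolding omega_eq by (intro df) auto
 ultimately show ?thesis using Sets_subsetI[of "ext w"] w by auto
qed

lemma omega_U[dest]: "n \<in> omega \<Longrightarrow> n \<in> U" using Sets_U[OF omega_Sets] by auto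

lemma omega_0[simp, intro]: "cd {} \<in> omega" unfolding omega_eq by auto

lemma omega_sc[simp, intro]: "n \<in> omega \<Longrightarrow> sc n \<in> omega" unfolding omega_eq by auto

text \<open>By separation the numbers with property \<open>P\<close> form an inductive set. Seen
  from outside the numbers may be nonstandard, so induction is restricted to definable
  \<open>P\<close>; the same premise recurs in the later induction principles.\<close>

lemma omega_induct [consumes 1, case_names Df 0 sc]:
 assumes "n \<in> omega" "Df (\<lambda>e. P (e 0))" "P (cd {})" "\<And>n. n \<in> omega \<Longrightarrow> P n \<Longrightarrow> P (sc n)"
 shows "P n"
proof -
 let ?w = "{n \<in> omega. P n}"
 have w: "?w \<in> Sets" by (intro separation omega_Sets assms)
 have "cd {} \<in> ext (cd ?w)" "\<forall>x\<in>ext (cd ?w). sc x \<in> ext (cd ?w)" using assms by (simp_all add: w)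
 then have "n \<in> ext (cd ?w)" using assms(1) unfolding omega_eq by blast
 then show ?thesis using w by simp
qed

lemma omega_trans: assumes "n \<in> omega" shows "ext n \<subseteq> omega"
 using assms
proof (induction rule: omega_induct)
 case Df show ?case by (intro df) auto
qed (auto simp: omega_U)

lemma nat_trans: assumes "n \<in> omega" shows "\<forall>m\<in>ext n. ext m \<subseteq> ext n"
 using assms
proof (induction rule: omega_induct)
 case Df show ?case by (intro df)
qed (auto simp: omega_U)

lemma nat_zero: assumes "n \<in> omega" shows "n = cd {} \<or> cd {} \<in> ext n"
 using assms
proof (induction rule: omega_induct)
 case Df show ?case by (intro df) auto
qed (auto simp: omega_U)

lemma nat_sc_mono: assumes "n \<in> omega" shows "\<forall>m\<in>ext n. sc m = n \<or> sc m \<in> ext n"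
 using assms
proof (induction rule: omega_induct)
 case Df show ?case by (intro df)
qed (auto simp: omega_U)

lemma nat_linear: assumes "n \<in> omega" shows "\<forall>m\<in>omega. m \<in> ext n \<or> m = n \<or> n \<in> ext m"
 using assms
proof (induction rule: omega_induct)
 case Df show ?case by (intro df) auto
next
 case 0 show ?case using nat_zero by auto
next
 case (sc n)
 then show ?case using nat_sc_mono omega_U by (metis ext_sc insert_iff)
qed

lemma nat_cases: assumes "n \<in> omega" shows "n = cd {} \<or> (\<exists>m\<in>omega. n = sc m)"
 using assms
proof (induction rule: omega_induct)
 case Df show ?case by (intro df) auto
qed auto

lemma sc_ne_0[simp]: "n \<in> omega \<Longrightarrow> sc n \<noteq> cd {}" "n \<in> omega \<Longrightarrow> cd {} \<noteq> sc n"
 by (metis emp_Sets empty_iff ext_cd ext_sc insertI1 omega_U)+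

lemma omega_least: assumes "n \<in> omega" "P n" "Df (\<lambda>e. P (e 0))"
 shows "\<exists>m\<in>omega. P m \<and> (\<forall>k\<in>ext m. \<not> P k)"
proof -
 have "{n \<in> omega. P n} \<in> Sets" by (intro separation assms omega_Sets)
 from foundation[OF this] assms obtain m where m: "m \<in> omega" "P m" "ext m \<inter> {n \<in> omega. P n} = {}" by auto
 with omega_trans[of m] show ?thesis by blast
qed

lemma ap_exists: assumes "S \<in> Sets" "Df (\<lambda>e. e 0 \<in> S \<and> e (Suc 0) = f (e 0))" "\<And>x. x \<in> S \<Longrightarrow> f x \<in> U"
 shows "\<exists>c\<in>U. \<forall>x\<in>S. ap c x = f x"
 using fn_of_fun_in[OF fun_inI[OF assms] assms(1)] by metis

lemma ap_existsT: assumes "S \<in> Sets" "DT (\<lambda>e. f (e 0))" shows "\<exists>c\<in>U. \<forall>x\<in>S. ap c x = f x"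
 using fn_of_fun_in[OF fun_inT[OF assms] assms(1)] by metis

lemma ap_upd: assumes "S \<in> Sets" "c \<in> U" "x \<in> U" "y \<in> U"
 shows "\<exists>d\<in>U. ap d x = y \<and> (\<forall>z\<in>S. z \<noteq> x \<longrightarrow> ap d z = ap c z)"
proof -
 have "\<exists>d\<in>U. \<forall>z\<in>insert x S. ap d z = (if z = x then y else ap c z)"
  by (rule ap_existsT) (use assms in \<open>auto intro!: df\<close>)
 then show ?thesis by auto
qed

definition restr :: "'a \<Rightarrow> 'a set \<Rightarrow> 'a" where
 "restr c S = cd ((\<lambda>y. pr y (ap c y)) ` S)"

lemma restr_U[simp, intro]: "restr c S \<in> U" by (simp add: restr_def)

lemma DT_restr[df]: assumes "DT t" "DS S" shows "DT (\<lambda>e. restr (t e) (S e))"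
 unfolding restr_def by (intro df assms assms(1)[THEN DT_weaken])

lemma restr_cong: "(\<And>y. y \<in> S \<Longrightarrow> ap c y = ap d y) \<Longrightarrow> restr c S = restr d S"
 unfolding restr_def by (metis (no_types, lifting) image_cong)

lemma ap_restr: assumes "S \<in> Sets" "c \<in> U" "x \<in> S" shows "ap (restr c S) x = ap c x"
proof -
 have s: "(\<lambda>y. pr y (ap c y)) ` S \<in> Sets" by (intro Sets_imageT df assms)
 show ?thesis
 proof (rule ap_unique)
  show "pr x (ap c x) \<in> ext (restr c S)" using s assms by (simp add: restr_def)
  fix z assume "z \<in> U" "pr x z \<in> ext (restr c S)"
  then obtain x' where "pr x z = pr x' (ap c x')" "x' \<in> S" using s by (auto simp: restr_def)
  then show "z = ap c x" using pr_inj[of x z x' "ap c x'"] Sets_U[OF assms(1)] assms \<open>z \<in> U\<close> by auto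
 qed auto
qed

text \<open>Proof by attempts: \<open>att x c\<close> says that \<open>c\<close> obeys the recursion
  at \<open>x\<close> and below. Attempts agree where they overlap, replacement glues them, and a
  minimal point without an attempt would get one by extending the glued function. Minimal elements
  exist only for sets \<open>B\<close> of the structure, which suffices because the classes to which
  this is applied are definable.\<close>

theorem recursion:
 assumes A: "A \<in> Sets" and r: "Df (\<lambda>e. r (e 0) (e (Suc 0)))"
  and trans: "\<And>x y z. x \<in> A \<Longrightarrow> y \<in> A \<Longrightarrow> z \<in> A \<Longrightarrow> r x y \<Longrightarrow> r y z \<Longrightarrow> r x z"
  and wf: "\<And>B. B \<in> Sets \<Longrightarrow> B \<subseteq> A \<Longrightarrow> B \<noteq> {} \<Longrightarrow> \<exists>m\<in>B. \<forall>y\<in>B. \<not> r y m"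
  and H: "DT (\<lambda>e. H (e 0) (e (Suc 0)))"
 shows "\<exists>c\<in>U. \<forall>x\<in>A. ap c x = H x (restr c {y \<in> A. r y x})"
proof -
 have HU: "H x y \<in> U" if "x \<in> U" "y \<in> U" for x y
  using DT_U[OF H, of "case_nat x (\<lambda>_. y)"] that by (auto split: nat.splits simp: image_subset_iff)
 have DH: "DT (\<lambda>e. H (t e) (u e))" if "DT t" "DT u" for t u
 proof (rule DT_2[OF _ HU that])
  show "Df (\<lambda>e. e 0 = H (e (Suc 0)) (e (Suc (Suc 0))))"
   using H unfolding DT_def by auto
 qed
 note Dr = Df_2[OF r]
 define below where "below x = {y \<in> A. r y x}" for x
 have DSb: "DS (\<lambda>e. below (t e))" if "DT t" for t
  unfolding below_def by (intro df A Dr that that[THEN DT_weaken])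
 have bS: "below x \<in> Sets" if "x \<in> A" for x unfolding below_def
  by (intro separation A Dr df) (use that A Sets_U in auto)
 define att where "att x c \<longleftrightarrow> (\<forall>y\<in>A. (r y x \<or> y = x) \<longrightarrow> ap c y = H y (restr c (below y)))" for x c
 have Da: "Df (\<lambda>e. att (t e) (u e))" if "DT t" "DT u" for t u
  unfolding att_def by (intro df A Dr DH DSb that that[THEN DT_weaken])
 have uniq: "ap c y = ap d y" if c: "att x c" and d: "att x d" and cU: "c \<in> U" "d \<in> U" and x: "x \<in> A" and y: "y \<in> A" "r y x \<or> y = x" for x c d y
 proof (rule ccontr)
  assume ne: "ap c y \<noteq> ap d y"
  let ?B = "{y \<in> A. (r y x \<or> y = x) \<and> ap c y \<noteq> ap d y}"
  have "?B \<in> Sets" by (intro separation A df Dr cU) (use x A Sets_U in auto)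
  from wf[OF this] ne y obtain m where m: "m \<in> ?B" "\<forall>z\<in>?B. \<not> r z m" by blast
  have "ap c z = ap d z" if "z \<in> below m" for z
   using m that trans[of z m x] x unfolding below_def by blast
  then have "restr c (below m) = restr d (below m)" by (rule restr_cong)
  then show False using m(1) c d unfolding att_def by auto
 qed
 have sub: "att y c" if "att x c" "x \<in> A" "y \<in> A" "r y x" for x y c
  using that trans unfolding att_def by blast
 have glue: "\<exists>c\<in>U. (\<forall>y\<in>B. \<forall>d\<in>U. att y d \<longrightarrow> ap c y = ap d y) \<and> (\<forall>y\<in>B. ap c y = H y (restr c (below y)))"
  if B: "B \<in> Sets" "B \<subseteq> A" "\<And>x y. x \<in> A \<Longrightarrow> y \<in> B \<Longrightarrow> r x y \<Longrightarrow> x \<in> B" and ex: "\<And>y. y \<in> B \<Longrightarrow> \<exists>d\<in>U. att y d" for B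
 proof -
  \<comment> \<open>The attempt is picked outside the structure, but by uniqueness its value at
    \<open>y\<close> does not depend on the choice; this gives the definable graph that
    \<open>ap_exists\<close> asks for.\<close>
  define f where "f y = ap (SOME d. d \<in> U \<and> att y d) y" for y
  have f: "f y = ap d y" if "y \<in> B" "d \<in> U" "att y d" for y d
  proof -
   have "\<exists>d. d \<in> U \<and> att y d" using ex[OF that(1)] by blast
   from someI_ex[OF this] show ?thesis unfolding f_def using uniq[of y _ d y] that B by auto
  qed
  have "\<exists>c\<in>U. \<forall>y\<in>B. ap c y = f y"
  proof (rule ap_exists[OF B(1)])
   show "Df (\<lambda>e. e 0 \<in> B \<and> e (Suc 0) = f (e 0))"
   proof (rule Df_cong)
    show "Df (\<lambda>e. e 0 \<in> B \<and> (\<exists>d\<in>U. att (e 0) d \<and> e (Suc 0) = ap d (e 0)))" by (intro df Da B)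
   qed (use f ex in metis)
  qed (simp add: f_def)
  then obtain c where c: "c \<in> U" "\<forall>y\<in>B. ap c y = f y" by blast
  show ?thesis
  proof (intro bexI[OF _ c(1)] conjI ballI impI)
   fix y d assume "y \<in> B" "d \<in> U" "att y d" then show "ap c y = ap d y" using c f by metis
  next
   fix y assume y: "y \<in> B"
   then obtain d where d: "d \<in> U" "att y d" using ex by blast
   have "ap c z = ap d z" if "z \<in> below y" for z
    using that y d c f sub[OF d(2)] B unfolding below_def by (metis (lifting) mem_Collect_eq subsetD)
   then have e: "restr c (below y) = restr d (below y)" by (rule restr_cong)
   have "ap c y = ap d y" using y d c f by metis
   also have "\<dots> = H y (restr d (below y))" using d(2) y B unfolding att_def by blast
   finally show "ap c y = H y (restr c (below y))" by (simp add: e)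
  qed
 qed
 have irr: "\<not> r x x" if "x \<in> A" for x
  using wf[of "{x}"] that A Sets_U Sets_pair[of x x] by auto
 have exA: "\<exists>d\<in>U. att x d" if "x \<in> A" for x
 proof (rule ccontr)
  assume ne: "\<not> (\<exists>d\<in>U. att x d)"
  let ?B = "{x \<in> A. \<not> (\<exists>d\<in>U. att x d)}"
  have "?B \<in> Sets" by (intro separation A df Da)
  from wf[OF this] ne that obtain m where m: "m \<in> ?B" "\<forall>z\<in>?B. \<not> r z m" by blast
  have mA: "m \<in> A" using m by blast
  obtain c where c: "c \<in> U" "\<forall>y\<in>below m. ap c y = H y (restr c (below y))"
   using glue[of "below m"] bS[OF mA] m trans[OF _ _ mA] unfolding below_def by blast
  \<comment> \<open>Changing the glued function at \<open>m\<close> alone gives an attempt there: by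
    irreflexivity the values below \<open>m\<close> stay untouched.\<close>
  obtain d where d: "d \<in> U" "ap d m = H m (restr c (below m))" "\<forall>z\<in>A. z \<noteq> m \<longrightarrow> ap d z = ap c z"
   using ap_upd[OF A c(1), of m "H m (restr c (below m))"] HU mA Sets_U[OF A] by auto
  have e: "restr d (below y) = restr c (below y)" if "y \<in> A" "r y m \<or> y = m" for y
  proof (rule restr_cong)
   fix z assume z: "z \<in> below y"
   then have "z \<noteq> m" using that irr mA trans[of m y m] unfolding below_def by auto
   then show "ap d z = ap c z" using d z unfolding below_def by auto
  qed
  have "att m d" unfolding att_def
  proof (intro ballI impI)
   fix y assume y: "y \<in> A" "r y m \<or> y = m"
   show "ap d y = H y (restr d (below y))"
   proof (cases "y = m")
    case True then show ?thesis using d e[OF y] by simp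
   next
    case False
    then have "y \<in> below m" using y by (auto simp: below_def)
    then show ?thesis using False d c e[OF y] y by simp
   qed
  qed
  then show False using m d by blast
 qed
 from glue[OF A order_refl _ exA] show ?thesis unfolding below_def by blast
qed

text \<open>The axiom selects from a disjoint family. Pairing the candidates for \<open>x\<close>
  with \<open>x\<close> itself makes the family disjoint, and the bounding set \<open>B\<close>
  makes each collection of candidates a set.\<close>

theorem choice:
 assumes A: "A \<in> Sets" and B: "B \<in> Sets" and P: "Df (\<lambda>e. P (e 0) (e (Suc 0)))"
  and ex: "\<And>x. x \<in> A \<Longrightarrow> \<exists>y\<in>B. P x y"
 shows "\<exists>c\<in>U. \<forall>x\<in>A. ap c x \<in> B \<and> P x (ap c x)"
proof -
 note DP = Df_2[OF P]
 define F where "F x = pr x ` {y \<in> B. P x y}" for x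
 have DF: "DS (\<lambda>e. F (e 0))" unfolding F_def by (intro df B DP)
 have AU: "x \<in> U" if "x \<in> A" for x using that A Sets_U by auto
 have BU: "x \<in> U" if "x \<in> B" for x using that B Sets_U by auto
 have FS: "F x \<in> Sets" if "x \<in> A" for x unfolding F_def
  by (intro Sets_imageT separation B DP df) (use AU that in auto)
 define a where "a = cd ((\<lambda>x. cd (F x)) ` A)"
 have im: "(\<lambda>x. cd (F x)) ` A \<in> Sets" by (intro Sets_imageT A df DF)
 have ea: "ext a = (\<lambda>x. cd (F x)) ` A" unfolding a_def using im by simp
 have "\<forall>x\<in>ext a. ext x \<noteq> {}" unfolding ea using FS ex by (auto simp: F_def)
 moreover have "\<forall>x\<in>ext a. \<forall>y\<in>ext a. x \<noteq> y \<longrightarrow> ext x \<inter> ext y = {}"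
 proof (intro ballI impI)
  fix x y assume "x \<in> ext a" "y \<in> ext a" "x \<noteq> y"
  then obtain x' y' where *: "x = cd (F x')" "y = cd (F y')" "x' \<in> A" "y' \<in> A" "x' \<noteq> y'" unfolding ea by auto
  have "pr x' z \<noteq> pr y' w" if "z \<in> B" "w \<in> B" for z w using * that AU BU by auto
  then show "ext x \<inter> ext y = {}" using * FS by (auto simp: F_def)
 qed
 ultimately obtain C where C: "C \<in> U" "\<forall>x\<in>ext a. \<exists>!z. z \<in> ext C \<inter> ext x"
  using ax_choice[rule_format, of a] a_def by auto
 \<comment> \<open>The selector may contain extraneous elements; after the intersection only tagged
   candidates remain, so \<open>c\<close> is the graph of a function.\<close>
 define c where "c = cd (ext C \<inter> (\<Union>x\<in>A. F x))"
 have "(\<Union>x\<in>A. F x) \<in> Sets" by (intro Sets_UN A DF FS)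
 then have ec: "ext c = ext C \<inter> (\<Union>x\<in>A. F x)" unfolding c_def using C by simp
 have "ap c x \<in> B \<and> P x (ap c x)" if x: "x \<in> A" for x
 proof -
  have u: "\<exists>!z. z \<in> ext C \<inter> F x" using C(2)[rule_format, of "cd (F x)"] x FS[OF x] unfolding ea by simp
  then obtain y where y: "y \<in> B" "P x y" "pr x y \<in> ext C" by (auto simp: F_def)
  have "ap c x = y"
  proof (rule ap_unique)
   show "y \<in> U" using y BU by auto
   show "pr x y \<in> ext c" using y x unfolding ec by (auto simp: F_def)
   fix z assume z: "z \<in> U" "pr x z \<in> ext c"
   then obtain x' y' where "x' \<in> A" "y' \<in> B" "P x' y'" "pr x z = pr x' y'" unfolding ec F_def by auto
   then have "z \<in> B" "P x z" using pr_inj[of x z x' y'] AU BU x z by auto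
   then have "pr x z \<in> ext C \<inter> F x" "pr x y \<in> ext C \<inter> F x" using z y unfolding ec F_def by auto
   then have "pr x z = pr x y" using u by blast
   then show "z = y" using AU BU x y z by auto
  qed
  then show ?thesis using y by simp
 qed
 then show ?thesis unfolding c_def by (intro bexI[of _ "cd (ext C \<inter> (\<Union>x\<in>A. F x))"]) auto
qed

lemma finite_in_iff: "finite_in S \<longleftrightarrow> (\<exists>n\<in>omega. \<exists>c\<in>U. bij_betw (ap c) (ext n) S)"
proof
 assume "finite_in S"
 then obtain n f where "n \<in> omega" "fun_in (ext n) f" "bij_betw f (ext n) S" unfolding finite_in_def by blast
 moreover from this obtain c where "c \<in> U" "\<forall>x\<in>ext n. f x = ap c x" using fn_of_fun_in[of "ext n" f] by auto
 ultimately show "\<exists>n\<in>omega. \<exists>c\<in>U. bij_betw (ap c) (ext n) S" using bij_betw_cong[of "ext n" f "ap c" S] by blast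
next
 show "\<exists>n\<in>omega. \<exists>c\<in>U. bij_betw (ap c) (ext n) S \<Longrightarrow> finite_in S" unfolding finite_in_def
  by (meson ext_Sets fun_in_ap omega_U)
qed

lemma Df_finite_in[df]: assumes "DS S" shows "Df (\<lambda>e. finite_in (S e))"
 unfolding finite_in_iff by (intro df assms assms[THEN DS_weaken]) auto

lemma finite_in_Sets: assumes "finite_in S" shows "S \<in> Sets"
proof -
 from assms obtain n c where "n \<in> omega" "c \<in> U" "bij_betw (ap c) (ext n) S" unfolding finite_in_iff by blast
 then have "S = ap c ` ext n" "ext n \<in> Sets" by (auto simp: bij_betw_def)
 then show ?thesis using \<open>c \<in> U\<close> by (auto intro!: Sets_imageT df)
qed

lemma finite_in_empty[simp, intro]: "finite_in {}"
 unfolding finite_in_iff by (intro bexI[of _ "cd {}"]) (auto simp: bij_betw_def)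

lemma finite_in_insert[simp, intro]: assumes "finite_in S" "x \<in> U" shows "finite_in (insert x S)"
proof (cases "x \<in> S")
 case False
 from assms obtain n c where n: "n \<in> omega" "c \<in> U" "bij_betw (ap c) (ext n) S" unfolding finite_in_iff by blast
 then obtain d where d: "d \<in> U" "ap d n = x" "\<forall>z\<in>ext n. z \<noteq> n \<longrightarrow> ap d z = ap c z"
  using ap_upd[of "ext n" c n x] assms by auto
 have nn: "n \<notin> ext n" using no_self n by auto
 have "bij_betw (ap d) (ext n) S"
  using n(3) by (rule bij_betw_cong[THEN iffD1, rotated]) (use d nn in auto)
 then have "bij_betw (ap d) (insert n (ext n)) (insert x S)"
  using d False nn by (auto simp: bij_betw_def)
 then have "bij_betw (ap d) (ext (sc n)) (insert x S)" using n by (simp add: omega_U)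
 then show ?thesis unfolding finite_in_iff using n d by blast
qed (use assms in \<open>simp add: insert_absorb\<close>)

text \<open>Internal finiteness is not finiteness of the extension. The proof is an internal
  induction over the number of elements, for all subsets \<open>T\<close> of \<open>S\<close> of
  that size at once.\<close>

lemma finite_in_induct [consumes 1, case_names Df empty insert]:
 assumes "finite_in S" "Df (\<lambda>e. P (ext (e 0)))" "P {}"
  and "\<And>x F. finite_in F \<Longrightarrow> F \<in> Sets \<Longrightarrow> x \<in> S \<Longrightarrow> F \<subseteq> S \<Longrightarrow> x \<notin> F \<Longrightarrow> P F \<Longrightarrow> P (insert x F)"
 shows "P S"
proof -
 from assms(1) obtain n c where n: "n \<in> omega" "c \<in> U" "bij_betw (ap c) (ext n) S" unfolding finite_in_iff by blast
 have S: "S \<in> Sets" using assms(1) by (rule finite_in_Sets)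
 have "\<forall>T\<in>U. ext T \<subseteq> S \<longrightarrow> (\<exists>d\<in>U. bij_betw (ap d) (ext n) (ext T)) \<longrightarrow> P (ext T)"
  using n(1)
 proof (induction rule: omega_induct)
  case Df
  show ?case by (intro df S Df_1[OF assms(2)])
 next
  case 0 then show ?case using assms(3) by (auto simp: bij_betw_def)
 next
  case (sc n)
  show ?case
  proof (intro ballI impI, elim bexE)
   fix T d assume T: "T \<in> U" "ext T \<subseteq> S" "d \<in> U" "bij_betw (ap d) (ext (sc n)) (ext T)"
   define F where "F = ap d ` ext n"
   have nn: "n \<notin> ext n" using no_self sc by auto
   have FT: "ext T = insert (ap d n) F" "ap d n \<notin> F" and bF: "bij_betw (ap d) (ext n) F"
    using T(4) nn sc by (auto simp: bij_betw_def F_def omega_U)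
   have fF: "finite_in F" using bF sc T unfolding finite_in_iff by blast
   then have FS: "F \<in> Sets" by (rule finite_in_Sets)
   have "P F" using sc(2)[rule_format, of "cd F"] FT T bF FS by auto
   then show "P (ext T)" unfolding FT using fF FS FT T by (intro assms(4)) auto
  qed
 qed
 then show ?thesis using n S by (metis cd_U ext_cd order_refl)
qed

lemma finite_in_subset: assumes "finite_in S" "T \<subseteq> S" "T \<in> Sets" shows "finite_in T"
proof -
 have "\<forall>T\<in>U. ext T \<subseteq> S \<longrightarrow> finite_in (ext T)" using assms(1)
 proof (induction rule: finite_in_induct)
  case Df show ?case by (intro df)
 next
  case empty then show ?case by auto
 next
  case (insert x F)
  show ?case
  proof (intro ballI impI)
   fix T assume T: "T \<in> U" "ext T \<subseteq> insert x F"
   have xU: "x \<in> U" using insert assms finite_in_Sets Sets_U by blast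
   have s: "ext T - {x} \<in> Sets" using T xU Sets_pair[of x x] by auto
   have "finite_in (ext (cd (ext T - {x})))" using insert(6) T s by (metis cd_U Diff_subset_conv ext_cd insert_is_Un)
   then have "finite_in (ext T - {x})" using s by simp
   then have "finite_in (insert x (ext T - {x}))" using xU by (rule finite_in_insert)
   then show "finite_in (ext T)" using \<open>finite_in (ext T - {x})\<close>
    by (cases "x \<in> ext T") (auto simp: insert_absorb)
  qed
 qed
 then show ?thesis using assms by (metis cd_U ext_cd)
qed

lemma finite_in_Un[simp, intro]: assumes "finite_in S" "finite_in T" shows "finite_in (S \<union> T)"
 using assms(1)
proof (induction rule: finite_in_induct)
 case Df show ?case by (intro df finite_in_Sets assms)
next
 case empty then show ?case using assms by simp
next
 case (insert x F)
 then show ?case using assms finite_in_Sets Sets_U by (metis Un_insert_left finite_in_insert)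
qed

lemma finite_in_image: assumes "finite_in S" "DT (\<lambda>e. f (e 0))" shows "finite_in (f ` S)"
 using assms(1)
proof (induction rule: finite_in_induct)
 case Df show ?case by (intro df assms)
next
 case empty then show ?case by simp
next
 case (insert x F)
 have "x \<in> U" using insert assms finite_in_Sets Sets_U by blast
 then have "f x \<in> U" using DT_U[OF assms(2), of "\<lambda>_. x"] by auto
 then show ?case using insert by simp
qed

lemma finite_in_UN: assumes "finite_in S" "DS (\<lambda>e. F (e 0))" "\<And>x. x \<in> S \<Longrightarrow> finite_in (F x)" shows "finite_in (\<Union>x\<in>S. F x)"
 using assms(1)
proof (induction rule: finite_in_induct)
 case Df
 show ?case by (intro df assms(2))
next
 case empty then show ?case by simp
next
 case (insert x F)
 then show ?case using assms(3) by simp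
qed

lemma finite_in_prd: assumes "finite_in S" "finite_in T" shows "finite_in (prd S T)"
 unfolding prd_def
proof (rule finite_in_UN[OF assms(1)])
 show "DS (\<lambda>e. pr (e 0) ` T)" by (intro df finite_in_Sets assms)
 fix x assume "x \<in> S"
 then have "x \<in> U" using assms finite_in_Sets Sets_U by blast
 then show "finite_in (pr x ` T)" by (intro finite_in_image assms df)
qed

lemma finite_in_pset: assumes "finite_in S" shows "finite_in (pset S)"
 using assms(1)
proof (induction rule: finite_in_induct)
 case Df show ?case by (intro df)
next
 case empty
 have "pset {} = {cd {}}" using emp_iff by (auto simp: pset_def)
 then show ?case by (auto intro!: finite_in_insert)
next
 case (insert x F)
 have xU: "x \<in> U" using insert assms finite_in_Sets Sets_U by blast
 have "pset (insert x F) \<subseteq> pset F \<union> (\<lambda>y. cd (insert x (ext y))) ` pset F"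
 proof
  fix y assume y: "y \<in> pset (insert x F)"
  then have yU: "y \<in> U" "ext y \<subseteq> insert x F" by (auto simp: pset_def)
  show "y \<in> pset F \<union> (\<lambda>y. cd (insert x (ext y))) ` pset F"
  proof (cases "x \<in> ext y")
   case True
   have s: "ext y - {x} \<in> Sets" using yU xU Sets_pair[of x x] by auto
   have "y = cd (insert x (ext (cd (ext y - {x}))))" using s True yU by (simp add: insert_absorb)
   moreover have "cd (ext y - {x}) \<in> pset F" using s yU by (auto simp: pset_def)
   ultimately show ?thesis by blast
  qed (use yU in \<open>auto simp: pset_def\<close>)
 qed
 moreover have "finite_in ((\<lambda>y. cd (insert x (ext y))) ` pset F)"
  by (intro finite_in_image insert df xU)
 ultimately show ?case using insert xU by (meson Sets_insert Sets_pset finite_in_Un finite_in_subset)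
qed

lemma finite_in_nat: "n \<in> omega \<Longrightarrow> finite_in (ext n)"
proof (induction rule: omega_induct)
 case Df show ?case by (intro df)
qed (auto simp: omega_U)

definition Fin :: "'a set \<Rightarrow> 'a set" where
 "Fin A = {s \<in> pset A. finite_in (ext s)}"

lemma Fin_iff: "s \<in> Fin A \<longleftrightarrow> s \<in> U \<and> ext s \<subseteq> A \<and> finite_in (ext s)" by (auto simp: Fin_def pset_def)

lemma Sets_Fin[simp, intro]: "A \<in> Sets \<Longrightarrow> Fin A \<in> Sets"
 unfolding Fin_def by (intro separation df) auto

lemma DS_Fin[df]: "DS A \<Longrightarrow> DS (\<lambda>e. Fin (A e))" unfolding Fin_def by (intro df)

lemma finite_max: assumes "finite_in S" "S \<subseteq> omega" "S \<noteq> {}" shows "\<exists>m\<in>S. \<forall>n\<in>S. n = m \<or> n \<in> ext m"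
proof -
 have "S = {} \<or> (\<exists>m\<in>S. \<forall>n\<in>S. n = m \<or> n \<in> ext m)" using assms(1)
 proof (induction rule: finite_in_induct)
  case Df show ?case by (intro df)
 next
  case (insert x F)
  show ?case
  proof (cases "F = {}")
   case False
   then obtain m where m: "m \<in> F" "\<forall>n\<in>F. n = m \<or> n \<in> ext m" using insert by auto
   have o: "m \<in> omega" "x \<in> omega" using m insert assms by auto
   from nat_linear[OF o(1)] o consider "x \<in> ext m" | "x = m" | "m \<in> ext x" by blast
   then show ?thesis
   proof cases
    case 3
    then have "\<forall>n\<in>F. n \<in> ext x" using m nat_trans[OF o(2)] by (metis subsetD)
    then show ?thesis by auto
   qed (use m in auto)
  qed auto
 qed auto
 then show ?thesis using assms by auto
qed

end

context zfc
begin

text \<open>A von Neumann number is the set of its predecessors, so the set of all \<open>m\<close>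
  such that \<open>P\<close> fails up to and including \<open>m\<close> is itself the least number
  with \<open>P\<close>. The formula avoids a definite description and is a definable term.\<close>

definition lst :: "('a \<Rightarrow> bool) \<Rightarrow> 'a" where
 "lst P = cd {m \<in> omega. \<forall>k\<in>insert m (ext m). \<not> P k}"

lemma lst: assumes "n \<in> omega" "P n" "Df (\<lambda>e. P (e 0))"
 shows "lst P \<in> omega" "P (lst P)" "\<And>k. k \<in> ext (lst P) \<Longrightarrow> \<not> P k"
proof -
 from omega_least[OF assms] obtain m where m: "m \<in> omega" "P m" "\<forall>k\<in>ext m. \<not> P k" by blast
 have "{m \<in> omega. \<forall>k\<in>insert m (ext m). \<not> P k} = ext m"
 proof (intro equalityI subsetI)
  fix x assume "x \<in> {m \<in> omega. \<forall>k\<in>insert m (ext m). \<not> P k}"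
  then show "x \<in> ext m" using nat_linear[OF m(1)] m by blast
 next
  fix x assume x: "x \<in> ext m"
  then show "x \<in> {m \<in> omega. \<forall>k\<in>insert m (ext m). \<not> P k}"
   using m omega_trans[OF m(1)] nat_trans[OF m(1)] by blast
 qed
 then have "lst P = m" unfolding lst_def using m by auto
 then show "lst P \<in> omega" "P (lst P)" "\<And>k. k \<in> ext (lst P) \<Longrightarrow> \<not> P k" using m by auto
qed

lemma lst_U[simp, intro]: "lst P \<in> U" by (simp add: lst_def)

lemma DT_lst[df]: assumes "Df (\<lambda>e. Q (sh e) (e 0))" shows "DT (\<lambda>e. lst (\<lambda>x. Q e x))"
proof -
 have *: "Df (\<lambda>e. Q (\<lambda>n. e (Suc (Suc n))) (e 0))"
  using Df_rename[OF assms, of "case_nat 0 (\<lambda>n. Suc (Suc n))"] by simp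
 show ?thesis unfolding lst_def by (intro df * omega_Sets)
qed

text \<open>The union over the class of possible first components: for a pair it is the extension of
  the component, otherwise it is empty, so no description operator is involved.\<close>

definition p1 :: "'a \<Rightarrow> 'a" where "p1 z = cd (\<Union>x\<in>{x \<in> U. \<exists>y\<in>U. z = pr x y}. ext x)"
definition p2 :: "'a \<Rightarrow> 'a" where "p2 z = cd (\<Union>y\<in>{y \<in> U. \<exists>x\<in>U. z = pr x y}. ext y)"

lemma p1[simp]: assumes "x \<in> U" "y \<in> U" shows "p1 (pr x y) = x"
proof -
 have "{x' \<in> U. \<exists>y'\<in>U. pr x y = pr x' y'} = {x}" using assms by auto
 then show ?thesis unfolding p1_def using assms by simp
qed
lemma p2[simp]: assumes "x \<in> U" "y \<in> U" shows "p2 (pr x y) = y"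
proof -
 have "{y' \<in> U. \<exists>x'\<in>U. pr x y = pr x' y'} = {y}" using assms by auto
 then show ?thesis unfolding p2_def using assms by simp
qed
lemma p12_U[simp, intro]: "p1 z \<in> U" "p2 z \<in> U" by (simp_all add: p1_def p2_def)
lemma DT_p1[df]: assumes "DT t" shows "DT (\<lambda>e. p1 (t e))"
 unfolding p1_def by (intro df assms assms[THEN DT_weaken])
lemma DT_p2[df]: assumes "DT t" shows "DT (\<lambda>e. p2 (t e))"
 unfolding p2_def by (intro df assms assms[THEN DT_weaken])

lemma prdE: assumes "z \<in> prd A B" "A \<subseteq> U" "B \<subseteq> U"
 shows "p1 z \<in> A" "p2 z \<in> B" "z = pr (p1 z) (p2 z)"
 using assms by (auto simp: prd_iff dest!: subsetD)

subsection \<open>Well-orders\<close>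

text \<open>Minimal elements are demanded for sets of the structure only; irreflexivity is the case
  of singletons.\<close>

definition wo :: "'a set \<Rightarrow> ('a \<Rightarrow> 'a \<Rightarrow> bool) \<Rightarrow> bool" where
 "wo A r \<longleftrightarrow> A \<in> Sets \<and> Df (\<lambda>e. r (e 0) (e (Suc 0))) \<and>
   (\<forall>x\<in>A. \<forall>y\<in>A. \<forall>z\<in>A. r x y \<longrightarrow> r y z \<longrightarrow> r x z) \<and>
   (\<forall>x\<in>A. \<forall>y\<in>A. r x y \<or> x = y \<or> r y x) \<and>
   (\<forall>B\<in>Sets. B \<subseteq> A \<longrightarrow> B \<noteq> {} \<longrightarrow> (\<exists>m\<in>B. \<forall>y\<in>B. \<not> r y m))"

lemma woD: assumes "wo A r"
 shows "A \<in> Sets" "Df (\<lambda>e. r (e 0) (e (Suc 0)))"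
  "\<And>x y z. x \<in> A \<Longrightarrow> y \<in> A \<Longrightarrow> z \<in> A \<Longrightarrow> r x y \<Longrightarrow> r y z \<Longrightarrow> r x z"
  "\<And>x y. x \<in> A \<Longrightarrow> y \<in> A \<Longrightarrow> r x y \<or> x = y \<or> r y x"
  "\<And>B. B \<in> Sets \<Longrightarrow> B \<subseteq> A \<Longrightarrow> B \<noteq> {} \<Longrightarrow> \<exists>m\<in>B. \<forall>y\<in>B. \<not> r y m"
proof -
 note a = assms[unfolded wo_def]
 show "A \<in> Sets" using a by (rule conjunct1)
 note a = a[THEN conjunct2]
 show "Df (\<lambda>e. r (e 0) (e (Suc 0)))" using a by (rule conjunct1)
 note a = a[THEN conjunct2]
 show "\<And>x y z. x \<in> A \<Longrightarrow> y \<in> A \<Longrightarrow> z \<in> A \<Longrightarrow> r x y \<Longrightarrow> r y z \<Longrightarrow> r x z" using a[THEN conjunct1] by blast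
 note a = a[THEN conjunct2]
 show "\<And>x y. x \<in> A \<Longrightarrow> y \<in> A \<Longrightarrow> r x y \<or> x = y \<or> r y x" using a[THEN conjunct1] by blast
 show "\<And>B. B \<in> Sets \<Longrightarrow> B \<subseteq> A \<Longrightarrow> B \<noteq> {} \<Longrightarrow> \<exists>m\<in>B. \<forall>y\<in>B. \<not> r y m" using a[THEN conjunct2] by blast
qed

lemma wo_induct: assumes "wo A r" "Df (\<lambda>e. P (e 0))" "x \<in> A"
  "\<And>x. x \<in> A \<Longrightarrow> (\<And>y. y \<in> A \<Longrightarrow> r y x \<Longrightarrow> P y) \<Longrightarrow> P x"
 shows "P x"
proof (rule ccontr)
 assume "\<not> P x"
 have "{x \<in> A. \<not> P x} \<in> Sets" by (intro separation woD(1)[OF assms(1)] df assms(2))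
 from woD(5)[OF assms(1) this] \<open>\<not> P x\<close> assms(3) obtain m where m: "m \<in> A" "\<not> P m" "\<And>y. y \<in> A \<Longrightarrow> \<not> P y \<Longrightarrow> \<not> r y m" by blast
 then show False using assms(4)[of m] by blast
qed

lemma wo_below: assumes "wo A r" "x \<in> A" shows "{y \<in> A. r y x} \<in> Sets"
 using assms woD Sets_U by (intro separation Df_2[OF woD(2)] df) blast+

text \<open>Recursion sends \<open>x\<close> to the set of the values below it. Two different points
  are comparable, so equal values would put a value into itself.\<close>

theorem mostowski: assumes "wo A r"
 shows "\<exists>c\<in>U. (\<forall>x\<in>A. ext (ap c x) = ap c ` {y \<in> A. r y x}) \<and> inj_on (ap c) A"
proof -
 note A = woD(1)[OF assms] and Dr = Df_2[OF woD(2)[OF assms]]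
 have "\<exists>c\<in>U. \<forall>x\<in>A. ap c x = cd (ap (restr c {y \<in> A. r y x}) ` {y \<in> A. r y x})"
 proof (rule recursion[OF A woD(2,3,5)[OF assms]])
  show "DT (\<lambda>e. cd (ap (e (Suc 0)) ` {y \<in> A. r y (e 0)}))" by (intro df A Dr)
 qed
 then obtain c where c: "c \<in> U" "\<And>x. x \<in> A \<Longrightarrow> ap c x = cd (ap (restr c {y \<in> A. r y x}) ` {y \<in> A. r y x})" by blast
 have e: "ext (ap c x) = ap c ` {y \<in> A. r y x}" if x: "x \<in> A" for x
 proof -
  have b: "{y \<in> A. r y x} \<in> Sets" using wo_below[OF assms x] .
  then have i: "ap c ` {y \<in> A. r y x} \<in> Sets" by (intro Sets_imageT df c)
  have "ap (restr c {y \<in> A. r y x}) ` {y \<in> A. r y x} = ap c ` {y \<in> A. r y x}"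
   using ap_restr[OF b c(1)] by (intro image_cong) auto
  with c(2)[OF x] i show ?thesis by simp
 qed
 have "inj_on (ap c) A"
 proof (rule inj_onI, rule ccontr)
  fix x y assume *: "x \<in> A" "y \<in> A" "ap c x = ap c y" "x \<noteq> y"
  then consider "r x y" | "r y x" using woD(4)[OF assms] by blast
  then show False
  proof cases
   case 1 then have "ap c x \<in> ext (ap c y)" unfolding e[OF *(2)] using * by blast
   then show False using * no_self[of "ap c y"] by auto
  next
   case 2 then have "ap c y \<in> ext (ap c x)" unfolding e[OF *(1)] using * by blast
   then show False using * no_self[of "ap c y"] by auto
  qed
 qed
 with e c(1) show ?thesis by blast
qed

subsection \<open>Countable sets\<close>

lemma countable_in_iff: assumes "S \<in> Sets"
 shows "countable_in S \<longleftrightarrow> (\<exists>c\<in>U. inj_on (ap c) S \<and> ap c ` S \<subseteq> omega)"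
proof
 assume "countable_in S"
 then obtain f where f: "fun_in S f" "inj_on f S" "f ` S \<subseteq> omega" unfolding countable_in_def by blast
 from fn_of_fun_in[OF f(1) assms] obtain c where c: "c \<in> U" "\<forall>x\<in>S. f x = ap c x" by blast
 have "inj_on (ap c) S" using f(2) c by (simp cong: inj_on_cong)
 moreover have "ap c ` S \<subseteq> omega" using f(3) c by auto
 ultimately show "\<exists>c\<in>U. inj_on (ap c) S \<and> ap c ` S \<subseteq> omega" using c by blast
qed (use assms in \<open>auto simp: countable_in_def\<close>)

lemma Df_countable_in: assumes "DS S" "\<And>e. range e \<subseteq> U \<Longrightarrow> S e \<in> Sets" shows "Df (\<lambda>e. countable_in (S e))"
proof (rule Df_cong)
 show "Df (\<lambda>e. \<exists>c\<in>U. inj_on (ap c) (S e) \<and> ap c ` S e \<subseteq> omega)"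
  by (intro df assms(1)[THEN DS_weaken]) auto
qed (simp add: countable_in_iff assms)

lemma countable_inI: assumes "S \<in> Sets" "Df (\<lambda>e. e 0 \<in> S \<and> e (Suc 0) = f (e 0))" "countable_in T" "T \<in> Sets" "inj_on f S" "f ` S \<subseteq> T"
 shows "countable_in S"
proof -
 from assms(3,4) obtain c where c: "c \<in> U" "inj_on (ap c) T" "ap c ` T \<subseteq> omega" by (auto simp: countable_in_iff)
 have fU: "f x \<in> U" if "x \<in> S" for x using assms that Sets_U by blast
 from ap_exists[OF assms(1,2) fU] obtain d where d: "d \<in> U" "\<forall>x\<in>S. ap d x = f x" by blast
 have "DT (\<lambda>e. ap c (ap d (e 0)))" by (intro df c d)
 from ap_existsT[OF assms(1) this] obtain b where b: "b \<in> U" "\<forall>x\<in>S. ap b x = ap c (ap d x)" by blast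
 have "inj_on (ap b) S" using b d assms(5,6) c(2) by (simp add: inj_on_def) (metis image_subset_iff)
 moreover have "ap b ` S \<subseteq> omega" using b d assms(6) c(3) by (auto simp: image_subset_iff)
 ultimately show ?thesis using b assms(1) by (auto simp: countable_in_iff)
qed

lemma countable_inT: assumes "S \<in> Sets" "DT (\<lambda>e. f (e 0))" "countable_in T" "T \<in> Sets" "inj_on f S" "f ` S \<subseteq> T"
 shows "countable_in S"
 by (rule countable_inI[OF assms(1) _ assms(3-)]) (intro df assms)

lemma countable_in_subset: assumes "countable_in T" "T \<in> Sets" "S \<in> Sets" "S \<subseteq> T" shows "countable_in S"
 by (rule countable_inT[OF assms(3) _ assms(1,2), of "\<lambda>x. x"]) (use assms in \<open>auto intro: df\<close>)

lemma countable_in_omega[simp]: "countable_in omega"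
proof -
 from ap_existsT[OF omega_Sets DT_var[of 0]] obtain c where "c \<in> U" "\<forall>x\<in>omega. ap c x = x" by blast
 then show ?thesis using countable_in_iff[OF omega_Sets] by (metis image_subset_iff inj_onI)
qed

lemma countable_in_bij: assumes "S \<in> Sets" "countable_in S" "c \<in> U" "inj_on (ap c) S" shows "countable_in (ap c ` S)"
proof -
 have T: "ap c ` S \<in> Sets" by (intro Sets_imageT df assms)
 show ?thesis
 proof (rule countable_inI[OF T _ assms(2,1), of "inv_into S (ap c)"])
  show "Df (\<lambda>e. e 0 \<in> ap c ` S \<and> e (Suc 0) = inv_into S (ap c) (e 0))"
  proof (rule Df_cong)
   show "Df (\<lambda>e. \<exists>x\<in>S. e 0 = ap c x \<and> e (Suc 0) = x)" by (intro df assms)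
  qed (use assms(4) in auto)
 qed (use assms(4) in \<open>auto intro: inj_on_inv_into\<close>)
qed

lemma finite_countable: assumes "finite_in S" shows "countable_in S"
proof -
 from assms obtain n c where n: "n \<in> omega" "c \<in> U" "bij_betw (ap c) (ext n) S" unfolding finite_in_iff by blast
 have "countable_in (ap c ` ext n)"
  by (rule countable_in_bij) (use n omega_trans countable_in_subset[of omega "ext n"] in \<open>auto simp: bij_betw_def\<close>)
 then show ?thesis using n by (simp add: bij_betw_def)
qed

text \<open>The Mostowski collapse lands in \<open>omega\<close>: by induction its value at
  \<open>x\<close> is a finite transitive set of numbers, hence empty or the successor of its
  maximum.\<close>

lemma countable_of_finite_below:
 assumes "wo A r" "\<And>x. x \<in> A \<Longrightarrow> finite_in {y \<in> A. r y x}"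
 shows "countable_in A"
proof -
 note A = woD(1)[OF assms(1)]
 from mostowski[OF assms(1)] obtain c where c: "c \<in> U" "\<And>x. x \<in> A \<Longrightarrow> ext (ap c x) = ap c ` {y \<in> A. r y x}" "inj_on (ap c) A" by blast
 have "ap c x \<in> omega" if "x \<in> A" for x
  using assms(1) _ that
 proof (rule wo_induct)
  show "Df (\<lambda>e. ap c (e 0) \<in> omega)" by (intro df c omega_Sets)
  fix x assume x: "x \<in> A" and IH: "\<And>y. y \<in> A \<Longrightarrow> r y x \<Longrightarrow> ap c y \<in> omega"
  have sub: "ext (ap c x) \<subseteq> omega" using IH c(2)[OF x] by auto
  have fin: "finite_in (ext (ap c x))" unfolding c(2)[OF x] by (intro finite_in_image assms(2) x df c)
  have tr: "ext n \<subseteq> ext (ap c x)" if "n \<in> ext (ap c x)" for n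
  proof -
   from that obtain y where y: "y \<in> A" "r y x" "n = ap c y" using c(2)[OF x] by auto
   then show ?thesis using c(2)[OF x] c(2)[OF y(1)] woD(3)[OF assms(1) _ y(1) x] by auto
  qed
  show "ap c x \<in> omega"
  proof (cases "ext (ap c x) = {}")
   case True then show ?thesis using emp_iff[of "ap c x"] by simp
  next
   case False
   from finite_max[OF fin sub False] obtain m where m: "m \<in> ext (ap c x)" "\<forall>n\<in>ext (ap c x). n = m \<or> n \<in> ext m" by blast
   then have "ext (ap c x) = insert m (ext m)" using tr by blast
   then have "ap c x = sc m" using sc_iff[of m "ap c x"] m by auto
   then show ?thesis using m sub by auto
  qed
 qed
 then show ?thesis using c A by (auto simp: countable_in_iff)
qed

text \<open>Order by a level \<open>l\<close>, then by a number \<open>e\<close> within the level.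
  This serves twice: for countable unions of finite sets and for the well-order that measures the
  size of the algebra.\<close>

lemma wo_lex:
 assumes I: "wo I r" and A: "A \<in> Sets" and l: "l \<in> U" "\<And>x. x \<in> A \<Longrightarrow> ap l x \<in> I"
  and e: "e \<in> U" "\<And>x. x \<in> A \<Longrightarrow> ap e x \<in> omega"
  and inj: "\<And>x y. x \<in> A \<Longrightarrow> y \<in> A \<Longrightarrow> ap l x = ap l y \<Longrightarrow> ap e x = ap e y \<Longrightarrow> x = y"
 shows "wo A (\<lambda>x y. r (ap l x) (ap l y) \<or> (ap l x = ap l y \<and> ap e x \<in> ext (ap e y)))"
 unfolding wo_def
proof (intro conjI A ballI impI)
 note Dr = Df_2[OF woD(2)[OF I]]
 show "Df (\<lambda>ee. r (ap l (ee 0)) (ap l (ee (Suc 0))) \<or> ap l (ee 0) = ap l (ee (Suc 0)) \<and> ap e (ee 0) \<in> ext (ap e (ee (Suc 0))))"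
  by (intro df Dr l e)
next
 fix x y z assume xyz: "x \<in> A" "y \<in> A" "z \<in> A"
 assume "r (ap l x) (ap l y) \<or> ap l x = ap l y \<and> ap e x \<in> ext (ap e y)"
  "r (ap l y) (ap l z) \<or> ap l y = ap l z \<and> ap e y \<in> ext (ap e z)"
 then show "r (ap l x) (ap l z) \<or> ap l x = ap l z \<and> ap e x \<in> ext (ap e z)"
  using woD(3)[OF I, of "ap l x" "ap l y" "ap l z"] l(2) xyz nat_trans[OF e(2)[OF xyz(3)]] by auto
next
 fix x y assume xy: "x \<in> A" "y \<in> A"
 show "(r (ap l x) (ap l y) \<or> ap l x = ap l y \<and> ap e x \<in> ext (ap e y)) \<or> x = y \<or>
    (r (ap l y) (ap l x) \<or> ap l y = ap l x \<and> ap e y \<in> ext (ap e x))"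
  using woD(4)[OF I, of "ap l x" "ap l y"] l(2) xy nat_linear[of "ap e x"] e(2)[of x] e(2)[of y] inj[of x y] by metis
next
 fix B assume B: "B \<in> Sets" "B \<subseteq> A" "B \<noteq> {}"
 have "ap l ` B \<in> Sets" by (intro Sets_imageT B df l)
 \<comment> \<open>The minimum is found in two stages: the least level that occurs in
   \<open>B\<close>, then the least number in that level.\<close>
 from woD(5)[OF I this] B l(2) obtain b where b: "b \<in> B" "\<And>y. y \<in> B \<Longrightarrow> \<not> r (ap l y) (ap l b)" by blast
 let ?C = "ap e ` {y \<in> B. ap l y = ap l b}"
 have "?C \<in> Sets" by (intro Sets_imageT separation B df l e) auto
 moreover have "?C \<noteq> {}" using b by auto
 ultimately obtain n where "n \<in> ?C" "ext n \<inter> ?C = {}" using foundation by blast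
 then obtain m where m: "m \<in> B" "ap l m = ap l b" "\<And>y. y \<in> B \<Longrightarrow> ap l y = ap l b \<Longrightarrow> ap e y \<notin> ext (ap e m)" by blast
 then show "\<exists>m\<in>B. \<forall>y\<in>B. \<not> (r (ap l y) (ap l m) \<or> ap l y = ap l m \<and> ap e y \<in> ext (ap e m))"
  using b by (intro bexI[OF _ m(1)]) auto
qed

lemma wo_omega: "wo omega (\<lambda>x y. x \<in> ext y)"
 unfolding wo_def
proof (intro conjI ballI impI omega_Sets)
 show "Df (\<lambda>e. e 0 \<in> ext (e (Suc 0)))" by (intro df)
next
 fix x y z assume "x \<in> omega" "y \<in> omega" "z \<in> omega" "x \<in> ext y" "y \<in> ext z"
 then show "x \<in> ext z" using nat_trans[of z] by (metis subsetD)
next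
 fix x y assume "x \<in> omega" "y \<in> omega"
 then show "x \<in> ext y \<or> x = y \<or> y \<in> ext x" using nat_linear[of y] by blast
next
 fix B assume "B \<in> Sets" "B \<subseteq> omega" "B \<noteq> {}"
 then show "\<exists>m\<in>B. \<forall>y\<in>B. y \<notin> ext m" using foundation[of B] by (metis disjoint_iff)
qed

text \<open>Enumerations of all \<open>F n\<close> are chosen simultaneously. Restricting each one
  to its \<open>F n\<close> puts all candidates into a single set, as \<open>choice\<close>
  demands.\<close>

lemma choose_enum:
 assumes I: "I \<in> Sets" and F: "DS (\<lambda>e. F (e 0))" "\<And>n. n \<in> I \<Longrightarrow> F n \<in> Sets" "\<And>n. n \<in> I \<Longrightarrow> countable_in (F n)"
 shows "\<exists>c\<in>U. \<forall>n\<in>I. inj_on (ap (ap c n)) (F n) \<and> ap (ap c n) ` F n \<subseteq> omega"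
proof -
 have IU: "n \<in> U" if "n \<in> I" for n using that I Sets_U by blast
 have B: "pset (prd (\<Union>n\<in>I. F n) omega) \<in> Sets" by (intro Sets_pset Sets_prd Sets_UN I F omega_Sets)
 have DF: "DS (\<lambda>e. F (e k))" for k using DS_weaken[OF F(1), of "\<lambda>_. k"] .
 have "\<exists>c\<in>U. \<forall>n\<in>I. ap c n \<in> pset (prd (\<Union>n\<in>I. F n) omega) \<and> (inj_on (ap (ap c n)) (F n) \<and> ap (ap c n) ` F n \<subseteq> omega)"
 proof (rule choice[OF I B])
  show "Df (\<lambda>e. inj_on (ap (e (Suc 0))) (F (e 0)) \<and> ap (e (Suc 0)) ` F (e 0) \<subseteq> omega)"
   by (intro df DF omega_Sets)
  fix n assume n: "n \<in> I"
  from F(2,3)[OF n] obtain c where c: "c \<in> U" "inj_on (ap c) (F n)" "ap c ` F n \<subseteq> omega" by (auto simp: countable_in_iff)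
  have eq: "ap (restr c (F n)) x = ap c x" if "x \<in> F n" for x using ap_restr[OF F(2)[OF n] c(1) that] .
  have "(\<lambda>y. pr y (ap c y)) ` F n \<in> Sets" by (intro Sets_imageT F n df c)
  then have "ext (restr c (F n)) \<subseteq> prd (\<Union>n\<in>I. F n) omega"
   unfolding restr_def prd_iff subset_iff using c(3) n by (simp add: image_subset_iff prd_iff) blast
  then have "restr c (F n) \<in> pset (prd (\<Union>n\<in>I. F n) omega)" by (simp add: pset_iff)
  moreover have "inj_on (ap (restr c (F n))) (F n)" using c(2) eq by (simp cong: inj_on_cong)
  moreover have "ap (restr c (F n)) ` F n \<subseteq> omega" using c(3) eq by auto
  ultimately show "\<exists>y\<in>pset (prd (\<Union>n\<in>I. F n) omega). inj_on (ap y) (F n) \<and> ap y ` F n \<subseteq> omega" by blast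
 qed
 then show ?thesis by blast
qed

text \<open>Elements are ordered by the first \<open>n\<close> with \<open>a \<in> F n\<close>, then
  by an enumeration of \<open>F n\<close>. Initial segments lie in finite unions and are finite.
  This replaces an explicit pairing function, because the square of \<open>omega\<close> is a union
  of finite squares.\<close>

lemma countable_UN_finite:
 assumes A: "A \<in> Sets" and F: "DS (\<lambda>e. F (e 0))" "\<And>n. n \<in> omega \<Longrightarrow> finite_in (F n)" and sub: "A \<subseteq> (\<Union>n\<in>omega. F n)"
 shows "countable_in A"
proof -
 have DF: "DS (\<lambda>e. F (e k))" for k using DS_weaken[OF F(1), of "\<lambda>_. k"] .
 have Dl: "Df (\<lambda>e. a \<in> F (e 0))" if "a \<in> U" for a by (intro df F that)
 from choose_enum[OF omega_Sets F(1) finite_in_Sets[OF F(2)] finite_countable[OF F(2)]]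
 obtain c where c: "c \<in> U" "\<forall>n\<in>omega. inj_on (ap (ap c n)) (F n) \<and> ap (ap c n) ` F n \<subseteq> omega" by blast
 define lv where "lv a = lst (\<lambda>n. a \<in> F n)" for a
 have Dlv: "DT (\<lambda>e. lv (e 0))" unfolding lv_def by (intro df DF)
 from ap_existsT[OF A Dlv] obtain l where l: "l \<in> U" "\<forall>a\<in>A. ap l a = lv a" by blast
 have DT': "DT (\<lambda>e. ap (ap c (lv (e 0))) (e 0))" by (intro df Dlv c)
 from ap_existsT[OF A DT'] obtain en where en: "en \<in> U" "\<forall>a\<in>A. ap en a = ap (ap c (lv a)) a" by blast
 have lv: "lv a \<in> omega" "a \<in> F (lv a)" if a: "a \<in> A" for a
 proof -
  from sub a obtain n where n: "n \<in> omega" "a \<in> F n" by blast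
  have "a \<in> U" using a A Sets_U by blast
  from lst[OF n(1), of "\<lambda>n. a \<in> F n", OF n(2) Dl[OF this]]
  show "lv a \<in> omega" "a \<in> F (lv a)" unfolding lv_def by auto
 qed
 let ?r = "\<lambda>x y. ap l x \<in> ext (ap l y) \<or> (ap l x = ap l y \<and> ap en x \<in> ext (ap en y))"
 have w: "wo A ?r"
 proof (rule wo_lex[OF wo_omega A l(1) _ en(1)])
  fix x assume x: "x \<in> A"
  then show "ap l x \<in> omega" using l lv by auto
  show "ap en x \<in> omega" using x en lv[OF x] c by auto
  fix y assume y: "y \<in> A" and *: "ap l x = ap l y" "ap en x = ap en y"
  then have "lv x = lv y" using l x by auto
  then show "x = y" using * en x y lv[OF x] lv[OF y] c unfolding inj_on_def by metis
 qed
 show ?thesis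
 proof (rule countable_of_finite_below[OF w])
  fix x assume x: "x \<in> A"
  have lx: "lv x \<in> omega" using lv x by auto
  have "finite_in (\<Union>n\<in>ext (sc (lv x)). F n)"
   by (intro finite_in_UN finite_in_nat omega_sc lx F) (use lx omega_trans omega_sc in blast)
  then show "finite_in {y \<in> A. ?r y x}"
  proof (rule finite_in_subset)
   show "{y \<in> A. ?r y x} \<subseteq> (\<Union>n\<in>ext (sc (lv x)). F n)"
    using l x lv lx by (auto simp: omega_U) metis
   show "{y \<in> A. ?r y x} \<in> Sets" by (rule wo_below[OF w x])
  qed
 qed
qed

lemma countable_omega_prd: "countable_in (prd omega omega)"
proof (rule countable_UN_finite)
 show "DS (\<lambda>e. prd (ext (e 0)) (ext (e 0)))" by (intro df)
 show "prd omega omega \<subseteq> (\<Union>n\<in>omega. prd (ext n) (ext n))"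
 proof
  fix z assume "z \<in> prd omega omega"
  then obtain m n where mn: "m \<in> omega" "n \<in> omega" "z = pr m n" by (auto simp: prd_iff)
  have "\<exists>k\<in>omega. m \<in> ext k \<and> n \<in> ext k"
  proof -
   consider "m \<in> ext n" | "m = n" | "n \<in> ext m" using nat_linear mn by blast
   then show ?thesis
   proof cases
    case 1 then show ?thesis using mn by (intro bexI[of _ "sc n"]) (auto simp: omega_U)
   next
    case 2 then show ?thesis using mn by (intro bexI[of _ "sc n"]) (auto simp: omega_U)
   next
    case 3 then show ?thesis using mn by (intro bexI[of _ "sc m"]) (auto simp: omega_U)
   qed
  qed
  then show "z \<in> (\<Union>n\<in>omega. prd (ext n) (ext n))" using mn by (auto simp: prd_iff)
 qed
qed (auto intro: finite_in_prd finite_in_nat)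

lemma countable_omega_Fin: "countable_in (Fin omega)"
proof (rule countable_UN_finite)
 show "DS (\<lambda>e. pset (ext (e 0)))" by (intro df)
 show "Fin omega \<subseteq> (\<Union>n\<in>omega. pset (ext n))"
 proof
  fix s assume s: "s \<in> Fin omega"
  show "s \<in> (\<Union>n\<in>omega. pset (ext n))"
  proof (cases "ext s = {}")
   case True then show ?thesis using s by (auto simp: pset_iff Fin_iff intro: bexI[of _ "cd {}"])
  next
   case False
   then obtain m where m: "m \<in> ext s" "\<forall>n\<in>ext s. n = m \<or> n \<in> ext m" using finite_max[of "ext s"] s by (auto simp: Fin_iff)
   then have "ext s \<subseteq> ext (sc m)" by auto
   then show ?thesis using m s by (auto simp: pset_iff Fin_iff intro!: bexI[of _ "sc m"])
  qed
 qed
qed (auto intro: finite_in_pset finite_in_nat)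

lemma countable_in_prd: assumes "countable_in S" "countable_in T" "S \<in> Sets" "T \<in> Sets" shows "countable_in (prd S T)"
proof -
 from assms obtain c d where c: "c \<in> U" "inj_on (ap c) S" "ap c ` S \<subseteq> omega" and d: "d \<in> U" "inj_on (ap d) T" "ap d ` T \<subseteq> omega"
  by (auto simp: countable_in_iff)
 have e: "p1 z \<in> S" "p2 z \<in> T" "z = pr (p1 z) (p2 z)" if "z \<in> prd S T" for z
  using prdE[OF that] assms Sets_subset by auto
 show ?thesis
 proof (rule countable_inT[OF _ _ countable_omega_prd, of _ "\<lambda>z. pr (ap c (p1 z)) (ap d (p2 z))"])
  show "DT (\<lambda>e. pr (ap c (p1 (e 0))) (ap d (p2 (e 0))))" by (intro df c d)
  show "inj_on (\<lambda>z. pr (ap c (p1 z)) (ap d (p2 z))) (prd S T)"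
  proof (rule inj_onI)
   fix z w assume z: "z \<in> prd S T" and w: "w \<in> prd S T" and "pr (ap c (p1 z)) (ap d (p2 z)) = pr (ap c (p1 w)) (ap d (p2 w))"
   then have "p1 z = p1 w" "p2 z = p2 w" using c d e[OF z] e[OF w] by (auto simp: inj_on_def)
   then show "z = w" using e[OF z] e[OF w] by metis
  qed
  show "(\<lambda>z. pr (ap c (p1 z)) (ap d (p2 z))) ` prd S T \<subseteq> prd omega omega"
   using e c d by (force simp: prd_iff)
 qed (use assms in auto)
qed

lemma countable_in_Fin: assumes "countable_in S" "S \<in> Sets" shows "countable_in (Fin S)"
proof -
 from assms obtain c where c: "c \<in> U" "inj_on (ap c) S" "ap c ` S \<subseteq> omega" by (auto simp: countable_in_iff)
 have im: "ap c ` ext s \<in> Sets" "finite_in (ap c ` ext s)" if "s \<in> Fin S" for s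
  using that by (auto simp: Fin_iff intro!: Sets_imageT finite_in_image df c)
 show ?thesis
 proof (rule countable_inT[OF _ _ countable_omega_Fin, of _ "\<lambda>s. cd (ap c ` ext s)"])
  show "DT (\<lambda>e. cd (ap c ` ext (e 0)))" by (intro df c)
  show "inj_on (\<lambda>s. cd (ap c ` ext s)) (Fin S)"
  proof (rule inj_onI)
   fix s t assume s: "s \<in> Fin S" and t: "t \<in> Fin S" and "cd (ap c ` ext s) = cd (ap c ` ext t)"
   then have "ap c ` ext s = ap c ` ext t" using im cd_inj by blast
   then have "ext s = ext t" using inj_on_image_eq_iff[OF c(2)] s t by (auto simp: Fin_iff)
   then show "s = t" using s t ext_inj by (auto simp: Fin_iff)
  qed
  show "(\<lambda>s. cd (ap c ` ext s)) ` Fin S \<subseteq> Fin omega"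
  proof (rule image_subsetI)
   fix s assume s: "s \<in> Fin S"
   then have "ap c ` ext s \<subseteq> omega" using c(3) by (auto simp: Fin_iff)
   then show "cd (ap c ` ext s) \<in> Fin omega" using im[OF s] by (simp add: Fin_iff)
  qed
 qed (use assms in auto)
qed

text \<open>An element is coded by the number of a chosen index \<open>p\<close> together with its
  own number in \<open>F p\<close>.\<close>

lemma countable_in_UN:
 assumes P: "P \<in> Sets" "countable_in P" and A: "A \<in> Sets" and F: "DS (\<lambda>e. F (e 0))" "\<And>p. p \<in> P \<Longrightarrow> F p \<in> Sets" "\<And>p. p \<in> P \<Longrightarrow> countable_in (F p)"
  and sub: "A \<subseteq> (\<Union>p\<in>P. F p)"
 shows "countable_in A"
proof -
 have DF: "DS (\<lambda>e. F (e k))" for k using DS_weaken[OF F(1), of "\<lambda>_. k"] .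
 from choose_enum[OF P(1) F] obtain c where c: "c \<in> U" "\<forall>n\<in>P. inj_on (ap (ap c n)) (F n) \<and> ap (ap c n) ` F n \<subseteq> omega" by blast
 from P obtain k where k: "k \<in> U" "inj_on (ap k) P" "ap k ` P \<subseteq> omega" by (auto simp: countable_in_iff)
 have "\<exists>q\<in>U. \<forall>a\<in>A. ap q a \<in> P \<and> a \<in> F (ap q a)"
  by (rule choice[OF A P(1)]) (intro df DF, use sub in blast)
 then obtain q where q: "q \<in> U" "\<forall>a\<in>A. ap q a \<in> P \<and> a \<in> F (ap q a)" by blast
 show ?thesis
 proof (rule countable_inT[OF A _ countable_omega_prd, of "\<lambda>a. pr (ap k (ap q a)) (ap (ap c (ap q a)) a)"])
  show "DT (\<lambda>e. pr (ap k (ap q (e 0))) (ap (ap c (ap q (e 0))) (e 0)))" by (intro df k q c)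
  show "inj_on (\<lambda>a. pr (ap k (ap q a)) (ap (ap c (ap q a)) a)) A"
  proof (rule inj_onI)
   fix a b assume ab: "a \<in> A" "b \<in> A" "pr (ap k (ap q a)) (ap (ap c (ap q a)) a) = pr (ap k (ap q b)) (ap (ap c (ap q b)) b)"
   then have "ap q a = ap q b" "ap (ap c (ap q a)) a = ap (ap c (ap q b)) b" using q k by (auto simp: inj_on_def)
   then show "a = b" using ab q c unfolding inj_on_def by metis
  qed
  show "(\<lambda>a. pr (ap k (ap q a)) (ap (ap c (ap q a)) a)) ` A \<subseteq> prd omega omega"
   using q k c by (force simp: prd_iff)
 qed auto
qed

text \<open>The range of the Mostowski collapse is an ordinal of the structure. It is uncountable
  with countable elements, which is the definition of the first uncountable ordinal.\<close>

lemma size_aleph1I: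
 assumes w: "wo A r" and unc: "\<not> countable_in A" and c: "\<And>x. x \<in> A \<Longrightarrow> countable_in {y \<in> A. r y x}"
 shows "size_aleph1 A"
proof -
 note A = woD(1)[OF w]
 from mostowski[OF w] obtain F where F: "F \<in> U" "\<And>x. x \<in> A \<Longrightarrow> ext (ap F x) = ap F ` {y \<in> A. r y x}" "inj_on (ap F) A" by blast
 have im: "ap F ` A \<in> Sets" by (intro Sets_imageT df A F)
 let ?k = "cd (ap F ` A)"
 have k: "ext ?k = ap F ` A" using im by simp
 have "ordinal ?k" unfolding ordinal_def k
 proof (intro conjI ballI cd_U)
  fix x assume "x \<in> ap F ` A"
  then obtain a where a: "a \<in> A" "x = ap F a" by blast
  then show "ext x \<subseteq> ap F ` A" using F by auto
  fix y assume "y \<in> ext x"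
  then obtain b where b: "b \<in> A" "r b a" "y = ap F b" using F(2)[OF a(1)] a by auto
  then show "ext y \<subseteq> ext x" using F(2)[OF a(1)] F(2)[OF b(1)] a woD(3)[OF w _ b(1) a(1)] by auto
 qed
 moreover have "\<not> countable_in (ext ?k)"
 proof
  assume "countable_in (ext ?k)"
  then have *: "countable_in (ap F ` A)" unfolding k .
  have "countable_in A"
   by (rule countable_inT[OF A _ * im F(3)]) (use F in \<open>auto intro: df\<close>)
  then show False using unc by simp
 qed
 moreover have "\<forall>a\<in>ext ?k. countable_in (ext a)"
 proof
  fix x assume "x \<in> ext ?k"
  then obtain a where a: "a \<in> A" "x = ap F a" unfolding k by blast
  have "countable_in (ap F ` {y \<in> A. r y a})"
   by (rule countable_in_bij[OF wo_below[OF w a(1)] c[OF a(1)] F(1)]) (rule inj_on_subset[OF F(3)], auto)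
  then show "countable_in (ext x)" using F(2) a by simp
 qed
 ultimately have "is_aleph1 ?k" unfolding is_aleph1_def by blast
 moreover have "fun_in A (ap F)" using F A by auto
 moreover have "bij_betw (ap F) A (ext ?k)" unfolding k using F(3) by (auto simp: bij_betw_def)
 ultimately show ?thesis unfolding size_aleph1_def by blast
qed

end

section \<open>Zermelo's theorem, uncountable sets of reals and transitive closures\<close>

context zfc
begin

definition chain :: "'a set \<Rightarrow> bool" where
 "chain Y \<longleftrightarrow> (\<forall>x\<in>Y. \<forall>y\<in>Y. ext x \<subseteq> ext y \<or> ext y \<subseteq> ext x)"

lemma Df_chain[df]: assumes "DS Y" shows "Df (\<lambda>e. chain (Y e))"
 unfolding chain_def by (intro df assms assms[THEN DS_weaken])

definition union :: "'a set \<Rightarrow> 'a" where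
 "union Y = cd (\<Union>x\<in>Y. ext x)"

lemma union_U[simp, intro]: "union Y \<in> U" by (simp add: union_def)
lemma ext_union[simp]: "Y \<in> Sets \<Longrightarrow> ext (union Y) = (\<Union>x\<in>Y. ext x)" unfolding union_def by (simp add: Sets_Union)
lemma DT_union[df]: "DS Y \<Longrightarrow> DT (\<lambda>e. union (Y e))" unfolding union_def by (intro df)

definition tclosed :: "'a set \<Rightarrow> 'a \<Rightarrow> ('a \<Rightarrow> 'a) \<Rightarrow> 'a set \<Rightarrow> bool" where
 "tclosed A b s M \<longleftrightarrow> b \<in> M \<and> (\<forall>x\<in>M. s x \<in> M) \<and>
   (\<forall>Y\<in>U. ext Y \<subseteq> M \<and> ext Y \<noteq> {} \<and> chain (ext Y) \<longrightarrow> union (ext Y) \<in> M)"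

definition tower :: "'a set \<Rightarrow> 'a \<Rightarrow> ('a \<Rightarrow> 'a) \<Rightarrow> 'a set" where
 "tower A b s = {x \<in> pset A. \<forall>M\<in>U. ext M \<subseteq> pset A \<and> tclosed A b s (ext M) \<longrightarrow> x \<in> ext M}"

text \<open>The chain generated from \<open>b\<close> by the inflationary step \<open>s\<close> and unions, as in Zermelo's
 second proof of the well-ordering theorem.\<close>

lemma tower:
 assumes A: "A \<in> Sets" and b: "b \<in> pset A" and s: "DT (\<lambda>e. s (e 0))"
  and step: "\<forall>x\<in>pset A. s x \<in> pset A \<and> ext x \<subseteq> ext (s x)"
 shows "tower A b s \<in> Sets" "tclosed A b s (tower A b s)" "chain (tower A b s)"
  "\<And>P x. Df (\<lambda>e. P (e 0)) \<Longrightarrow> P b \<Longrightarrow> (\<And>x. x \<in> tower A b s \<Longrightarrow> P x \<Longrightarrow> P (s x)) \<Longrightarrow>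
   (\<And>Y. Y \<in> Sets \<Longrightarrow> Y \<subseteq> tower A b s \<Longrightarrow> Y \<noteq> {} \<Longrightarrow> (\<And>y. y \<in> Y \<Longrightarrow> P y) \<Longrightarrow> P (union Y)) \<Longrightarrow> x \<in> tower A b s \<Longrightarrow> P x"
  "\<And>x y. x \<in> tower A b s \<Longrightarrow> y \<in> tower A b s \<Longrightarrow> ext y \<subseteq> ext x \<or> ext (s x) \<subseteq> ext y"
  "\<And>x. x \<in> tower A b s \<Longrightarrow> ext b \<subseteq> ext x"
proof -
 let ?T = "tower A b s"
 have Ds: "DT (\<lambda>e. s (t e))" if "DT t" for t
 proof (rule DT_1[OF _ _ that])
  show "Df (\<lambda>e. e 0 = s (e (Suc 0)))" using s unfolding DT_def by auto
  show "s x \<in> U" if "x \<in> U" for x using DT_U[OF s, of "\<lambda>_. x"] that by auto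
 qed
 have bU: "b \<in> U" using b by (simp add: pset_iff)
 have Dc: "Df (\<lambda>e. tclosed A b s (S e))" if "DS S" for S
  unfolding tclosed_def by (intro df Ds bU that that[THEN DS_weaken])
 show TS: "?T \<in> Sets" unfolding tower_def by (intro separation Sets_pset A df Dc)
 have TA: "?T \<subseteq> pset A" unfolding tower_def by auto
 show clo: "tclosed A b s ?T"
  unfolding tclosed_def
 proof (intro conjI ballI impI)
  show "b \<in> ?T" unfolding tower_def tclosed_def using b by auto
  fix x assume "x \<in> ?T" then show "s x \<in> ?T" unfolding tower_def tclosed_def using step by blast
 next
  fix Y assume Y: "Y \<in> U" "ext Y \<subseteq> ?T \<and> ext Y \<noteq> {} \<and> chain (ext Y)"
  then have "ext y \<subseteq> A" if "y \<in> ext Y" for y using TA that by (meson pset_iff subsetD)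
  then have "ext (union (ext Y)) \<subseteq> A" using Y by auto
  then show "union (ext Y) \<in> ?T" unfolding tower_def
  proof (intro CollectI conjI ballI impI)
   fix M assume M: "M \<in> U" "ext M \<subseteq> pset A \<and> tclosed A b s (ext M)"
   then have "ext Y \<subseteq> ext M" using Y(2) unfolding tower_def by blast
   then show "union (ext Y) \<in> ext M" using M Y unfolding tclosed_def by blast
  qed (simp add: pset_iff)
 qed
 have minimal: "?T \<subseteq> M" if M: "M \<in> Sets" "M \<subseteq> ?T" "tclosed A b s M" for M
 proof
  fix x assume "x \<in> ?T"
  moreover have "cd M \<in> U" "ext (cd M) \<subseteq> pset A" "tclosed A b s (ext (cd M))" using M TA by auto
  ultimately have "x \<in> ext (cd M)" unfolding tower_def by blast
  then show "x \<in> M" using M by simp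
 qed
 show ind: "P x" if D: "Df (\<lambda>e. P (e 0))" and Pb: "P b" and Ps: "\<And>x. x \<in> ?T \<Longrightarrow> P x \<Longrightarrow> P (s x)"
  and PY: "\<And>Y. Y \<in> Sets \<Longrightarrow> Y \<subseteq> ?T \<Longrightarrow> Y \<noteq> {} \<Longrightarrow> (\<And>y. y \<in> Y \<Longrightarrow> P y) \<Longrightarrow> P (union Y)"
  and x: "x \<in> ?T" for P x
 proof -
  have M: "{x \<in> ?T. P x} \<in> Sets" by (rule separation[OF TS D])
  have "tclosed A b s {x \<in> ?T. P x}"
   unfolding tclosed_def
  proof (intro conjI ballI impI)
   show "b \<in> {x \<in> ?T. P x}" using clo Pb unfolding tclosed_def by blast
   fix x assume "x \<in> {x \<in> ?T. P x}" then show "s x \<in> {x \<in> ?T. P x}" using clo Ps unfolding tclosed_def by blast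
  next
   fix Y assume Y: "Y \<in> U" "ext Y \<subseteq> {x \<in> ?T. P x} \<and> ext Y \<noteq> {} \<and> chain (ext Y)"
   then have "P (union (ext Y))" by (intro PY) auto
   then show "union (ext Y) \<in> {x \<in> ?T. P x}" using Y clo unfolding tclosed_def by blast
  qed
  from minimal[OF M _ this] x show ?thesis by blast
 qed
 have TU: "x \<in> U" if "x \<in> ?T" for x using TS that Sets_U by blast
 have step': "ext x \<subseteq> ext (s x)" if "x \<in> ?T" for x using step TA that by blast
 show base: "ext b \<subseteq> ext x" if "x \<in> ?T" for x
 proof (rule ind[of "\<lambda>x. ext b \<subseteq> ext x", OF _ _ _ _ that])
  show "Df (\<lambda>e. ext b \<subseteq> ext (e 0))" by (intro df bU)
  fix x assume "x \<in> ?T" "ext b \<subseteq> ext x" then show "ext b \<subseteq> ext (s x)" using step' by blast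
 next
  fix Y assume "Y \<in> Sets" "Y \<subseteq> ?T" "Y \<noteq> {}" "\<And>y. y \<in> Y \<Longrightarrow> ext b \<subseteq> ext y"
  then show "ext b \<subseteq> ext (union Y)" by auto
 qed auto
 \<comment> \<open>\<open>x\<close> is a bottleneck: the successor of a member properly below
   \<open>x\<close> stays within \<open>x\<close>. \<open>L1\<close> compares such an
   \<open>x\<close> with every member, and \<open>L2\<close> shows by induction that all members are
   of this kind.\<close>
 let ?g = "\<lambda>x. \<forall>y\<in>?T. ext y \<subseteq> ext x \<and> ext y \<noteq> ext x \<longrightarrow> ext (s y) \<subseteq> ext x"
 have L1: "ext y \<subseteq> ext x \<or> ext (s x) \<subseteq> ext y"
  if x: "x \<in> ?T" and y: "y \<in> ?T" and g: "?g x" for x y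
 proof (rule ind[of "\<lambda>y. ext y \<subseteq> ext x \<or> ext (s x) \<subseteq> ext y", OF _ _ _ _ y])
  show "Df (\<lambda>e. ext (e 0) \<subseteq> ext x \<or> ext (s x) \<subseteq> ext (e 0))" by (intro df Ds TU x)
  show "ext b \<subseteq> ext x \<or> ext (s x) \<subseteq> ext b" using base x by blast
  fix y assume y: "y \<in> ?T" and h: "ext y \<subseteq> ext x \<or> ext (s x) \<subseteq> ext y"
  then show "ext (s y) \<subseteq> ext x \<or> ext (s x) \<subseteq> ext (s y)"
   using g step'[OF y] ext_inj[OF TU[OF x] TU[OF y]] by blast
 next
  fix Y assume Y: "Y \<in> Sets" "Y \<subseteq> ?T" "Y \<noteq> {}" "\<And>y. y \<in> Y \<Longrightarrow> ext y \<subseteq> ext x \<or> ext (s x) \<subseteq> ext y"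
  then show "ext (union Y) \<subseteq> ext x \<or> ext (s x) \<subseteq> ext (union Y)" by (simp add: UN_subset_iff) blast
 qed
 have L2: "?g x" if "x \<in> ?T" for x
 proof -
  have "x \<in> ?T \<and> ?g x"
  proof (rule ind[of "\<lambda>x. x \<in> ?T \<and> ?g x", OF _ _ _ _ that])
   show "Df (\<lambda>e. e 0 \<in> ?T \<and> ?g (e 0))"
    by (intro df TS Ds)
   show "b \<in> ?T \<and> ?g b"
    using base clo unfolding tclosed_def by blast
   fix x assume x: "x \<in> ?T" and h: "x \<in> ?T \<and> ?g x"
   show "s x \<in> ?T \<and> ?g (s x)"
   proof (intro conjI ballI impI)
    show "s x \<in> ?T" using clo x unfolding tclosed_def by blast
    fix y assume y: "y \<in> ?T" "ext y \<subseteq> ext (s x) \<and> ext y \<noteq> ext (s x)"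
    then have "ext y \<subseteq> ext x" using L1[OF x y(1)] h by blast
    then show "ext (s y) \<subseteq> ext (s x)" using h y step'[OF x] ext_inj[OF TU[OF y(1)] TU[OF x]] by blast
   qed
  next
   fix Y assume Y: "Y \<in> Sets" "Y \<subseteq> ?T" "Y \<noteq> {}" "\<And>x. x \<in> Y \<Longrightarrow> x \<in> ?T \<and> ?g x"
   have c: "chain Y" unfolding chain_def
   proof (intro ballI)
    fix x y assume "x \<in> Y" "y \<in> Y"
    then show "ext x \<subseteq> ext y \<or> ext y \<subseteq> ext x" using L1[of x y] Y(4)[of x] Y(2) step'[of x] by blast
   qed
   show "union Y \<in> ?T \<and> ?g (union Y)"
   proof (intro conjI ballI impI)
    have "union (ext (cd Y)) \<in> ?T" using clo c Y(1-3) unfolding tclosed_def by (metis cd_U ext_cd)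
    then show "union Y \<in> ?T" using Y by simp
    fix y assume y: "y \<in> ?T" "ext y \<subseteq> ext (union Y) \<and> ext y \<noteq> ext (union Y)"
    have "\<exists>x\<in>Y. \<not> ext x \<subseteq> ext y" using y Y(1) by auto
    then obtain x where x: "x \<in> Y" "\<not> ext x \<subseteq> ext y" by blast
    have xT: "x \<in> ?T" using x Y by blast
    have "ext y \<subseteq> ext x" using L1[OF xT y(1)] Y(4)[OF x(1)] step'[OF xT] x(2) by blast
    then have "ext (s y) \<subseteq> ext x" using Y(4)[OF x(1)] x(2) y(1) by blast
    then show "ext (s y) \<subseteq> ext (union Y)" using x Y(1) by auto
   qed
  qed
  then show ?thesis by blast
 qed
 show cmp: "ext y \<subseteq> ext x \<or> ext (s x) \<subseteq> ext y" if "x \<in> ?T" "y \<in> ?T" for x y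
  using L1[OF that L2[OF that(1)]] .
 show "chain ?T" unfolding chain_def
  using cmp step' by blast
qed

text \<open>The tower is a nonempty chain closed under unions, so its union is its largest member,
  which the step cannot enlarge.\<close>

lemma tower_top:
 assumes A: "A \<in> Sets" and b: "b \<in> pset A" and s: "DT (\<lambda>e. s (e 0))"
  and step: "\<forall>x\<in>pset A. s x \<in> pset A \<and> ext x \<subseteq> ext (s x)"
 shows "\<exists>m\<in>tower A b s. s m = m"
proof -
 note T = tower[OF assms]
 let ?T = "tower A b s"
 have "?T \<noteq> {}" using T(2) unfolding tclosed_def by blast
 then have m: "union ?T \<in> ?T" using T(1-3) unfolding tclosed_def by (metis cd_U ext_cd order_refl)
 then have sm: "s (union ?T) \<in> ?T" using T(2) unfolding tclosed_def by blast
 have "ext (s (union ?T)) \<subseteq> ext (union ?T)" using sm T(1) by auto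
 moreover have "union ?T \<in> pset A" "s (union ?T) \<in> pset A" using m sm unfolding tower_def by blast+
 ultimately have "s (union ?T) = union ?T" using step[rule_format, of "union ?T"] by (intro ext_inj equalityI) (auto simp: pset_iff)
 then show ?thesis using m by blast
qed

text \<open>The step adjoins a chosen point of the complement. For \<open>x \<in> A\<close> let
  \<open>P x\<close> be the largest tower member that misses \<open>x\<close>. Then \<open>x\<close>
  is the point chosen at \<open>P x\<close>, and \<open>P x\<close> serves as the set of
  predecessors of \<open>x\<close>.\<close>

theorem zermelo: assumes A: "A \<in> Sets"
 shows "\<exists>c\<in>U. wo A (\<lambda>x y. x \<in> ext (ap c y)) \<and> (\<forall>x\<in>A. ext (ap c x) \<subseteq> A)"
proof -
 let ?D = "{x \<in> pset A. ext x \<noteq> A}"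
 have D: "?D \<in> Sets" by (intro separation Sets_pset A df)
 have "\<exists>ch\<in>U. \<forall>x\<in>?D. ap ch x \<in> A \<and> ap ch x \<notin> ext x"
  by (rule choice[OF D A]) (intro df, auto simp: pset_iff)
 then obtain ch where ch: "ch \<in> U" "\<And>x. x \<in> pset A \<Longrightarrow> ext x \<noteq> A \<Longrightarrow> ap ch x \<in> A \<and> ap ch x \<notin> ext x" by blast
 define s where "s x = (if ext x = A then x else cd (insert (ap ch x) (ext x)))" for x
 have s: "DT (\<lambda>e. s (e 0))" unfolding s_def by (intro df A ch)
 have es: "ext (s x) = insert (ap ch x) (ext x)" if "x \<in> pset A" "ext x \<noteq> A" for x
  using that ch by (simp add: s_def pset_iff)
 have step: "\<forall>x\<in>pset A. s x \<in> pset A \<and> ext x \<subseteq> ext (s x)"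
 proof
  fix x assume that: "x \<in> pset A"
  show "s x \<in> pset A \<and> ext x \<subseteq> ext (s x)"
 proof (cases "ext x = A")
  case False then show ?thesis using es[OF that False] ch(2)[OF that False] that by (simp add: pset_iff s_def) blast
 qed (use that in \<open>simp add: s_def\<close>)
 qed
 have b: "cd {} \<in> pset A" by (simp add: pset_iff)
 note T = tower[OF A b s step]
 let ?T = "tower A (cd {}) s"
 have TA: "?T \<subseteq> pset A" unfolding tower_def by auto
 have TU: "x \<in> U" if "x \<in> ?T" for x using TA that by (auto simp: pset_iff)
 from tower_top[OF A b s step] obtain m where m: "m \<in> ?T" "s m = m" by blast
 have mA: "ext m = A"
 proof (rule ccontr)
  assume ne: "ext m \<noteq> A"
  have mp: "m \<in> pset A" using m TA by blast
  show False using es[OF mp ne] ch(2)[OF mp ne] m(2) by auto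
 qed
 define Y where "Y x = {z \<in> ?T. x \<notin> ext z}" for x
 have YS: "Y x \<in> Sets" if "x \<in> A" for x unfolding Y_def by (intro separation T(1) df Sets_U[OF A that])
 define P where "P x = union (Y x)" for x
 have AU: "x \<in> U" if "x \<in> A" for x using that A Sets_U by blast
 have uT: "union B \<in> ?T" if "B \<in> Sets" "B \<subseteq> ?T" for B
 proof (cases "B = {}")
  case True
  then have "union B = cd {}" using emp_iff[of "union B"] by simp
  then show ?thesis using T(2) unfolding tclosed_def by simp
 next
  case False
  have "chain B" using T(3) that unfolding chain_def by blast
  then show ?thesis using T(2) that False unfolding tclosed_def by (metis cd_U ext_cd)
 qed
 have PT: "P x \<in> ?T" if "x \<in> A" for x unfolding P_def using uT[OF YS[OF that]] by (auto simp: Y_def)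
 have Pn: "x \<notin> ext (P x)" if "x \<in> A" for x unfolding P_def using YS[OF that] by (auto simp: Y_def)
 have PneA: "ext (P x) \<noteq> A" if "x \<in> A" for x using Pn that by blast
 have Pp: "P x \<in> pset A" if "x \<in> A" for x using PT[OF that] TA by blast
 have large: "ext z \<subseteq> ext (P x)" if "x \<in> A" "z \<in> ?T" "x \<notin> ext z" for x z
  unfolding P_def using YS[OF that(1)] that by (auto simp: Y_def)
 have chP: "ap ch (P x) = x" if x: "x \<in> A" for x
 proof (rule ccontr)
  assume ne: "ap ch (P x) \<noteq> x"
  have sT: "s (P x) \<in> ?T" using PT[OF x] T(2) unfolding tclosed_def by blast
  have "x \<notin> ext (s (P x))" using es[OF Pp[OF x] PneA[OF x]] ne Pn[OF x] by auto
  then have "ext (s (P x)) \<subseteq> ext (P x)" using large[OF x sT] by blast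
  then show False using es[OF Pp[OF x] PneA[OF x]] ch(2)[OF Pp[OF x] PneA[OF x]] by auto
 qed
 have sP: "ext (s (P x)) = insert x (ext (P x))" if "x \<in> A" for x
  using es[OF Pp PneA, OF that that] chP[OF that] by simp
 have mem: "x \<in> ext (P y) \<Longrightarrow> ext (P x) \<subseteq> ext (P y)" if "x \<in> A" "y \<in> A" for x y
  using T(5)[OF PT[OF that(1)] PT[OF that(2)]] Pn[OF that(1)] sP[OF that(1)] by blast
 have "DT (\<lambda>e. P (e 0))" unfolding P_def Y_def by (intro df T(1))
 from ap_existsT[OF A this] obtain c where c: "c \<in> U" "\<And>x. x \<in> A \<Longrightarrow> ap c x = P x" by blast
 have "wo A (\<lambda>x y. x \<in> ext (ap c y))" unfolding wo_def
 proof (intro conjI A ballI impI)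
  show "Df (\<lambda>e. e 0 \<in> ext (ap c (e (Suc 0))))" by (intro df c)
  fix x y z assume xyz: "x \<in> A" "y \<in> A" "z \<in> A" "x \<in> ext (ap c y)" "y \<in> ext (ap c z)"
  then show "x \<in> ext (ap c z)" using c mem[OF xyz(2,3)] by auto
 next
  fix x y assume xy: "x \<in> A" "y \<in> A"
  show "x \<in> ext (ap c y) \<or> x = y \<or> y \<in> ext (ap c x)"
  proof (rule ccontr)
   assume "\<not> ?thesis"
   then have n: "x \<notin> ext (P y)" "x \<noteq> y" "y \<notin> ext (P x)" using c xy by auto
   then have "ext (P y) \<subseteq> ext (P x)" "ext (P x) \<subseteq> ext (P y)" using large PT xy by auto
   then have "P x = P y" using ext_inj TU PT xy by blast
   then show False using chP[OF xy(1)] chP[OF xy(2)] n by simp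
  qed
 next
  fix B assume B: "B \<in> Sets" "B \<subseteq> A" "B \<noteq> {}"
  let ?Z = "{z \<in> ?T. ext z \<inter> B = {}}"
  have Z: "?Z \<in> Sets" by (intro separation T(1) df B)
  \<comment> \<open>The largest tower member disjoint from \<open>B\<close>; the point adjoined to
    it next is the least element of \<open>B\<close>.\<close>
  define z where "z = union ?Z"
  have zT: "z \<in> ?T" unfolding z_def using uT[OF Z] by auto
  have zB: "ext z \<inter> B = {}" unfolding z_def using Z by auto
  have zp: "z \<in> pset A" and zA: "ext z \<noteq> A" using zT TA zB B by blast+
  have "ext (s z) \<inter> B \<noteq> {}"
  proof
   assume "ext (s z) \<inter> B = {}"
   moreover have "s z \<in> ?T" using zT T(2) unfolding tclosed_def by blast
   ultimately have "ext (s z) \<subseteq> ext z" unfolding z_def using Z by auto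
   then show False using es[OF zp zA] ch(2)[OF zp zA] by auto
  qed
  then have bB: "ap ch z \<in> B" using es[OF zp zA] zB by auto
  let ?b = "ap ch z"
  have bA: "?b \<in> A" using bB B by blast
  have "ext (P ?b) \<subseteq> ext z" using T(5)[OF zT PT[OF bA]] es[OF zp zA] Pn[OF bA] by auto
  then show "\<exists>m\<in>B. \<forall>y\<in>B. y \<notin> ext (ap c m)" using bB zB c(2)[OF bA] by (intro bexI[OF _ bB]) auto
 qed
 moreover have "\<forall>x\<in>A. ext (ap c x) \<subseteq> A" using c Pp by (auto simp: pset_iff)
 ultimately show ?thesis using c(1) by blast
qed

text \<open>Cantor's diagonal set for a supposed injection \<open>c\<close>: a number is put in
  exactly if no subset with that number contains it.\<close>

lemma pset_omega_uncountable: "\<not> countable_in (pset omega)"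
proof
 assume "countable_in (pset omega)"
 then obtain c where c: "c \<in> U" "inj_on (ap c) (pset omega)" "ap c ` pset omega \<subseteq> omega" by (auto simp: countable_in_iff)
 have "{n \<in> omega. \<forall>x\<in>pset omega. ap c x = n \<longrightarrow> n \<notin> ext x} \<in> Sets" by (intro separation df c) auto
 then obtain d where d: "d \<in> U" "ext d = {n \<in> omega. \<forall>x\<in>pset omega. ap c x = n \<longrightarrow> n \<notin> ext x}"
  by (auto simp: Sets_def)
 have dp: "d \<in> pset omega" using d by (auto simp: pset_iff)
 have do: "ap c d \<in> omega" using c dp by auto
 show False
 proof (cases "ap c d \<in> ext d")
  case True then show False using dp d(2) by auto
 next
  case False
  then obtain x where "x \<in> pset omega" "ap c x = ap c d" "ap c d \<in> ext x" using do d(2) by auto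
  then show False using inj_onD[OF c(2), of x d] dp False by auto
 qed
qed

text \<open>A well-order of the power set of \<open>omega\<close> is cut at the first point with
  uncountably many predecessors; if there is none, all reals are taken. Either way every initial
  segment is countable.\<close>

theorem aleph1_reals:
 "\<exists>I\<in>Sets. \<exists>c\<in>U. I \<subseteq> pset omega \<and> \<not> countable_in I \<and> wo I (\<lambda>x y. x \<in> ext (ap c y)) \<and>
   (\<forall>x\<in>I. ext (ap c x) \<subseteq> I \<and> countable_in (ext (ap c x)))"
proof -
 let ?A = "pset omega"
 have A: "?A \<in> Sets" by auto
 from zermelo[OF A] obtain c where c: "c \<in> U" "wo ?A (\<lambda>x y. x \<in> ext (ap c y))" "\<forall>x\<in>?A. ext (ap c x) \<subseteq> ?A" by blast
 have Dc: "Df (\<lambda>e. countable_in (ext (ap c (e 0))))" by (intro Df_countable_in df c ext_Sets) auto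
 show ?thesis
 proof (cases "\<forall>x\<in>?A. countable_in (ext (ap c x))")
  case True
  then show ?thesis using c pset_omega_uncountable A by blast
 next
  case False
  have B: "{x \<in> ?A. \<not> countable_in (ext (ap c x))} \<in> Sets" by (intro separation A df Dc)
  from woD(5)[OF c(2) B] False obtain m where m: "m \<in> ?A" "\<not> countable_in (ext (ap c m))"
   "\<And>y. y \<in> ?A \<Longrightarrow> \<not> countable_in (ext (ap c y)) \<Longrightarrow> y \<notin> ext (ap c m)" by blast
  let ?I = "ext (ap c m)"
  have IA: "?I \<subseteq> ?A" using c m by blast
  have w: "wo ?I (\<lambda>x y. x \<in> ext (ap c y))" unfolding wo_def
  proof (intro conjI ballI impI)
   show "Df (\<lambda>e. e 0 \<in> ext (ap c (e (Suc 0))))" by (intro df c)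
   show "?I \<in> Sets" by simp
   fix x y z assume "x \<in> ?I" "y \<in> ?I" "z \<in> ?I" "x \<in> ext (ap c y)" "y \<in> ext (ap c z)"
   then show "x \<in> ext (ap c z)" using woD(3)[OF c(2), of x y z] IA by blast
  next
   fix x y assume "x \<in> ?I" "y \<in> ?I"
   then show "x \<in> ext (ap c y) \<or> x = y \<or> y \<in> ext (ap c x)" using woD(4)[OF c(2), of x y] IA by blast
  next
   fix B assume "B \<in> Sets" "B \<subseteq> ?I" "B \<noteq> {}"
   then show "\<exists>m\<in>B. \<forall>y\<in>B. y \<notin> ext (ap c m)" using woD(5)[OF c(2), of B] IA by blast
  qed
  have "ext (ap c x) \<subseteq> ?I \<and> countable_in (ext (ap c x))" if "x \<in> ?I" for x
  proof
   show "countable_in (ext (ap c x))" using m that IA by blast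
   show "ext (ap c x) \<subseteq> ?I" using woD(3)[OF c(2), of _ x m] m(1) that IA c(3) by blast
  qed
  then show ?thesis using w m IA c(1) by (intro bexI[of _ ?I] bexI[of _ c]) auto
 qed
qed

text \<open>Stage \<open>n\<close> of a recursion over \<open>omega\<close> consists of
  \<open>x\<close> and the elements of all members of earlier stages. Transitive sets are needed in
  \<open>nice_name\<close>, to bound the names and values for which forcing has to be a set.\<close>

theorem transitive_closure: assumes x: "x \<in> U"
 shows "\<exists>T\<in>Sets. x \<in> T \<and> (\<forall>y\<in>T. ext y \<subseteq> T)"
proof -
 have "\<exists>c\<in>U. \<forall>n\<in>omega. ap c n = cd (insert x (\<Union>m\<in>ext n. (\<Union>y\<in>ext (ap (restr c {y \<in> omega. y \<in> ext n}) m). ext y)))"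
 proof (rule recursion[OF omega_Sets woD(2,3,5)[OF wo_omega]])
  show "DT (\<lambda>e. cd (insert x (\<Union>m\<in>ext (e 0). (\<Union>y\<in>ext (ap (e (Suc 0)) m). ext y))))" by (intro df x)
 qed
 then obtain c where c: "c \<in> U" "\<And>n. n \<in> omega \<Longrightarrow> ap c n = cd (insert x (\<Union>m\<in>ext n. (\<Union>y\<in>ext (ap (restr c {y \<in> omega. y \<in> ext n}) m). ext y)))" by blast
 have e: "ext (ap c n) = insert x (\<Union>m\<in>ext n. (\<Union>y\<in>ext (ap c m). ext y))" if n: "n \<in> omega" for n
 proof -
  have s: "{y \<in> omega. y \<in> ext n} = ext n" using omega_trans[OF n] by auto
  have nS: "ext n \<in> Sets" using n by auto
  have S: "(\<Union>m\<in>ext n. (\<Union>y\<in>ext (ap c m). ext y)) \<in> Sets"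
   by (intro Sets_UN[OF nS] Sets_Union df c) auto
  have "(\<Union>m\<in>ext n. (\<Union>y\<in>ext (ap (restr c (ext n)) m). ext y)) = (\<Union>m\<in>ext n. (\<Union>y\<in>ext (ap c m). ext y))"
   using ap_restr[OF nS c(1)] by simp
  then show ?thesis using c(2)[OF n] S x unfolding s by simp
 qed
 let ?T = "\<Union>n\<in>omega. ext (ap c n)"
 have T: "?T \<in> Sets" by (intro Sets_UN df c) auto
 show ?thesis
 proof (intro bexI[OF _ T] conjI ballI)
  show "x \<in> ?T" using e[OF omega_0] by (intro UN_I[OF omega_0]) auto
  fix y assume "y \<in> ?T"
  then obtain n where n: "n \<in> omega" "y \<in> ext (ap c n)" by blast
  then have "ext y \<subseteq> ext (ap c (sc n))" using e[of "sc n"] by (auto simp: omega_U)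
  then show "ext y \<subseteq> ?T" using n by blast
 qed
qed

end

section \<open>Names and Cohen conditions\<close>

context zfc
begin

text \<open>A subname \<open>\<pi>\<close> lies three membership steps below
  \<open>\<sigma>\<close>, behind the pair \<open>pr \<pi> p\<close> and the singleton of
  \<open>\<pi>\<close>. Foundation is therefore applied to \<open>N\<close> enlarged by the
  intermediate sets that lead back into \<open>N\<close>.\<close>

lemma name_induct: assumes N: "N \<in> Sets" "N \<noteq> {}"
 shows "\<exists>\<sigma>\<in>N. \<forall>\<pi>\<in>U. \<forall>p\<in>U. pr \<pi> p \<in> ext \<sigma> \<longrightarrow> \<pi> \<notin> N"
proof (rule ccontr)
 assume c: "\<not> ?thesis"
 let ?N1 = "\<Union>x\<in>N. ext x" and ?N2 = "\<Union>x\<in>(\<Union>x\<in>N. ext x). ext x"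
 have S: "?N1 \<in> Sets" "?N2 \<in> Sets" by (intro Sets_Union N)+
 let ?H = "N \<union> {w \<in> ?N1. \<exists>v\<in>ext w. \<exists>\<rho>\<in>N. \<rho> \<in> ext v} \<union> {w \<in> ?N2. \<exists>\<rho>\<in>N. \<rho> \<in> ext w}"
 have "?H \<in> Sets" by (intro Sets_Un separation N S df)
 from foundation[OF this] N obtain w where w: "w \<in> ?H" "ext w \<inter> ?H = {}" by blast
 from w(1) consider "w \<in> N" | v \<rho> where "w \<in> ?N1" "v \<in> ext w" "\<rho> \<in> N" "\<rho> \<in> ext v" | \<rho> where "\<rho> \<in> N" "\<rho> \<in> ext w" by blast
 then show False
 proof cases
  case 1
  then obtain \<pi> p where p: "\<pi> \<in> U" "p \<in> U" "pr \<pi> p \<in> ext w" "\<pi> \<in> N" using c by blast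
  have "cd {\<pi>} \<in> ext (pr \<pi> p)" "\<pi> \<in> ext (cd {\<pi>})" using p Sets_pair[of \<pi> \<pi>] Sets_pair[of \<pi> p] by (auto simp: pr_eq)
  then have "pr \<pi> p \<in> ?H" using 1 p by blast
  then show False using w p by blast
 next
  case 2 then have "v \<in> ?H" by blast
  then show False using w 2 by blast
 next
  case 3 then show False using w by blast
 qed
qed

definition two :: "'a set" where "two = {cd {}, sc (cd {})}"

lemma two_Sets[simp, intro]: "two \<in> Sets" unfolding two_def by (intro Sets_pair) auto

lemma two_iff: "i \<in> U \<Longrightarrow> (ext i = {} \<or> (\<exists>z\<in>U. ext z = {} \<and> ext i = {z})) \<longleftrightarrow> i \<in> two"
 unfolding two_def using emp_iff by (auto simp: sc_iff[symmetric])

lemma cohen_conditions_eq: "cohen_conditions = {p \<in> Fin (prd omega two).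
  \<forall>n\<in>omega. \<forall>i\<in>U. \<forall>j\<in>U. pr n i \<in> ext p \<and> pr n j \<in> ext p \<longrightarrow> i = j}"
proof -
 have "(\<forall>z\<in>ext p. \<exists>n\<in>omega. \<exists>i\<in>U. (ext i = {} \<or> (\<exists>o'\<in>U. ext o' = {} \<and> ext i = {o'})) \<and> z = pr n i) \<longleftrightarrow> ext p \<subseteq> prd omega two" for p
  using two_iff Sets_U[OF two_Sets] unfolding subset_iff prd_iff by (metis (no_types, lifting))
 then show ?thesis unfolding cohen_conditions_def by (auto simp: Fin_iff)
qed

lemma cohen_Sets[simp, intro]: "cohen_conditions \<in> Sets"
 unfolding cohen_conditions_eq by (intro separation Sets_Fin Sets_prd df) auto

lemma cohen_countable: "countable_in cohen_conditions"
proof (rule countable_in_subset)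
 have "two \<subseteq> omega" unfolding two_def by auto
 then have "countable_in two" by (intro countable_in_subset[OF countable_in_omega]) auto
 then show "countable_in (Fin (prd omega two))" by (intro countable_in_Fin countable_in_prd) auto
qed (auto simp: cohen_conditions_eq[symmetric], auto simp: cohen_conditions_eq)

end

subsection \<open>Cohen extensions\<close>

locale cohen =
 fixes V W :: "'a set" and E :: "'a \<Rightarrow> 'a \<Rightarrow> bool" and G :: 'a
 assumes V_ZFC: "set_structure.ZFC V E" and ext: "cohen_extension V W E G"
begin

sublocale V: zfc V E using V_ZFC by unfold_locales
sublocale W: zfc W E using ext by unfold_locales (auto simp: cohen_extension_def)

lemmas cohen_ext = ext[unfolded cohen_extension_def]

lemma VW: "V \<subseteq> W" by (rule cohen_ext[THEN conjunct2, THEN conjunct1])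

lemma V_trans: "x \<in> V \<Longrightarrow> y \<in> W \<Longrightarrow> E y x \<Longrightarrow> y \<in> V"
 using cohen_ext[THEN conjunct2, THEN conjunct2, THEN conjunct1] by blast

lemma GW: "G \<in> W" by (rule cohen_ext[THEN conjunct2, THEN conjunct2, THEN conjunct2, THEN conjunct1])

lemma generic: "V.cohen_generic (W.ext G)"
 by (rule cohen_ext[THEN conjunct2, THEN conjunct2, THEN conjunct2, THEN conjunct2, THEN conjunct1])

lemma names: "x \<in> W \<Longrightarrow> \<exists>\<tau>\<in>V. W.evaluates_to (W.ext G) \<tau> x"
 by (rule cohen_ext[THEN conjunct2, THEN conjunct2, THEN conjunct2, THEN conjunct2, THEN conjunct2, THEN bspec])

lemma VW'[simp, intro]: "x \<in> V \<Longrightarrow> x \<in> W" using VW by blast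

text \<open>Ground sets gain no elements because \<open>V\<close> is transitive in \<open>W\<close>.
  The lemmas that follow are the resulting absoluteness of pairs, application and natural
  numbers.\<close>

lemma ext_V[simp]: "x \<in> V \<Longrightarrow> V.ext x = W.ext x"
 unfolding V.ext_def W.ext_def using VW V_trans[of x] by blast

lemma Sets_V[simp, intro]: assumes "S \<in> V.Sets" shows "S \<in> W.Sets"
proof -
 from assms obtain x where "x \<in> V" "S = V.ext x" by (auto simp: V.Sets_def)
 then show ?thesis by auto
qed

lemma cd_V: assumes "S \<in> V.Sets" shows "V.cd S = W.cd S"
 using V.cd[OF assms] W.cd_ext[of "V.cd S"] ext_V[of "V.cd S"] by auto

lemma in_ext_V: "x \<in> V \<Longrightarrow> y \<in> W.ext x \<Longrightarrow> y \<in> V"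
 using ext_V V.in_ext_U by metis

lemma pr_V[simp]: assumes "x \<in> V" "y \<in> V" shows "V.pr x y = W.pr x y"
proof -
 have s: "{x} \<in> V.Sets" "{x, y} \<in> V.Sets" using assms V.Sets_pair[of x x] V.Sets_pair[of x y] by auto
 then have "{V.cd {x}, V.cd {x, y}} \<in> V.Sets" by (intro V.Sets_pair) auto
 then show ?thesis using assms s by (simp add: V.pr_eq W.pr_eq cd_V)
qed

lemma pr_in_V: assumes "x \<in> W" "y \<in> W" shows "W.pr x y \<in> V \<longleftrightarrow> x \<in> V \<and> y \<in> V"
proof
 assume p: "W.pr x y \<in> V"
 have s: "{x, y} \<in> W.Sets" "{W.cd {x}, W.cd {x, y}} \<in> W.Sets" using assms by (auto intro!: W.Sets_pair)
 then have "W.cd {x, y} \<in> W.ext (W.pr x y)" using assms by (simp add: W.pr_eq)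
 then have "W.cd {x, y} \<in> V" using in_ext_V[OF p] by blast
 then show "x \<in> V \<and> y \<in> V" using in_ext_V[of "W.cd {x, y}"] s by simp
next
 assume "x \<in> V \<and> y \<in> V" then show "W.pr x y \<in> V" using V.pr_U pr_V by metis
qed

lemma ap_V[simp]: assumes "c \<in> V" "x \<in> V" shows "V.ap c x = W.ap c x"
proof -
 have "(y \<in> V \<and> V.pr x y \<in> V.ext c) \<longleftrightarrow> (y \<in> W \<and> W.pr x y \<in> W.ext c)" for y
  using assms pr_V[of x y] pr_in_V[of x y] in_ext_V[of c] ext_V[of c] by auto
 then show ?thesis unfolding V.ap_def W.ap_def using cd_V[OF V.emp_Sets] by simp
qed

lemma emp_V[simp]: "V.cd {} = W.cd {}" using cd_V[OF V.emp_Sets] .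

lemma emp_in_V[simp, intro]: "W.cd {} \<in> V" using V.cd_U[of "{}"] by simp

lemma sc_V[simp]: assumes "x \<in> V" shows "V.sc x = W.sc x"
 unfolding V.sc_def W.sc_def using assms V.Sets_insert[of x "V.ext x"] V.ext_Sets[of x] cd_V by auto

lemma sc_in_V[simp, intro]: "x \<in> V \<Longrightarrow> W.sc x \<in> V" using V.sc_U[of x] by simp

text \<open>The \<open>omega\<close> of the ground model is inductive in \<open>W\<close>, which
  gives one inclusion. For the other, foundation in \<open>W\<close> yields a minimal ground number
  outside \<open>W.omega\<close>, and this could be neither zero nor a successor.\<close>

lemma omega_V[simp]: "V.omega = W.omega"
proof
 have w: "W.cd V.omega \<in> W" "W.ext (W.cd V.omega) = V.omega" using Sets_V[OF V.omega_Sets] by auto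
 have "W.sc x \<in> V.omega" if "x \<in> V.omega" for x using V.omega_sc[OF that] V.omega_U[OF that] by simp
 moreover have "W.cd {} \<in> V.omega" using V.omega_0 by simp
 ultimately have cl: "W.cd {} \<in> W.ext (W.cd V.omega) \<and> (\<forall>x\<in>W.ext (W.cd V.omega). W.sc x \<in> W.ext (W.cd V.omega))"
  unfolding w(2) by blast
 show "W.omega \<subseteq> V.omega"
 proof
  fix n assume "n \<in> W.omega"
  then have "\<forall>w\<in>W. W.cd {} \<in> W.ext w \<and> (\<forall>x\<in>W.ext w. W.sc x \<in> W.ext w) \<longrightarrow> n \<in> W.ext w" unfolding W.omega_eq by blast
  from this[rule_format, OF w(1) cl] show "n \<in> V.omega" unfolding w(2) .
 qed
 show "V.omega \<subseteq> W.omega"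
 proof (rule ccontr)
  assume "\<not> ?thesis"
  then have "V.omega - W.omega \<noteq> {}" by blast
  moreover have "V.omega - W.omega \<in> W.Sets" by auto
  ultimately obtain n where n: "n \<in> V.omega" "n \<notin> W.omega" "W.ext n \<inter> (V.omega - W.omega) = {}" using W.foundation by blast
  from V.nat_cases[OF n(1)] show False
  proof
   assume "n = V.cd {}" then show False using n by auto
  next
   assume "\<exists>m\<in>V.omega. n = V.sc m"
   then obtain m where m: "m \<in> V.omega" "n = W.sc m" "m \<in> V" by (auto simp: V.omega_U)
   then have "m \<in> W.omega" using n(3) by auto
   then show False using m n by auto
  qed
 qed
qed

lemma countable_V: assumes "V.countable_in S" "S \<in> V.Sets" shows "W.countable_in S"
proof -
 from assms obtain c where c: "c \<in> V" "inj_on (V.ap c) S" "V.ap c ` S \<subseteq> V.omega" by (auto simp: V.countable_in_iff)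
 have e: "V.ap c x = W.ap c x" if "x \<in> S" for x using c that V.Sets_U[OF assms(2)] by auto
 have "inj_on (W.ap c) S" using c(2) e by (simp cong: inj_on_cong)
 moreover have "W.ap c ` S \<subseteq> W.omega" using c(3) e by auto
 ultimately show ?thesis using c assms(2) by (auto simp: W.countable_in_iff)
qed

abbreviation "PP \<equiv> V.cohen_conditions"
abbreviation "GG \<equiv> W.ext G"

abbreviation weaker (infix "\<ll>" 50) where "p \<ll> q \<equiv> V.ext p \<subseteq> V.ext q"

lemma PV: "p \<in> PP \<Longrightarrow> p \<in> V" using V.Sets_U[OF V.cohen_Sets] by blast

lemma GG_sub: "p \<in> GG \<Longrightarrow> p \<in> PP" using generic unfolding V.cohen_generic_def by blast

lemma GG_up: "p \<in> GG \<Longrightarrow> q \<in> PP \<Longrightarrow> q \<ll> p \<Longrightarrow> q \<in> GG"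
 using generic unfolding V.cohen_generic_def by blast

lemma GG_dir: "p \<in> GG \<Longrightarrow> q \<in> GG \<Longrightarrow> \<exists>r\<in>GG. p \<ll> r \<and> q \<ll> r"
 using generic unfolding V.cohen_generic_def by blast

lemma GG_dense: assumes "D \<in> V.Sets" "D \<subseteq> PP" "\<And>p. p \<in> PP \<Longrightarrow> \<exists>q\<in>D. p \<ll> q" shows "\<exists>q\<in>D. q \<in> GG"
proof -
 have "\<forall>D\<in>V.Sets. D \<subseteq> PP \<and> (\<forall>p\<in>PP. \<exists>q\<in>D. p \<ll> q) \<longrightarrow> D \<inter> GG \<noteq> {}"
  using generic unfolding V.cohen_generic_def by (elim conjE)
 from this[rule_format, of D] assms show ?thesis by blast
qed

text \<open>A set dense below \<open>r\<close> becomes dense after adding the conditions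
  incompatible with \<open>r\<close>, and none of those is in the filter.\<close>

lemma GG_below: assumes r: "r \<in> GG" and D: "D \<in> V.Sets" "D \<subseteq> PP"
  and ex: "\<And>r'. r' \<in> PP \<Longrightarrow> r \<ll> r' \<Longrightarrow> \<exists>s\<in>D. r' \<ll> s"
 shows "\<exists>s\<in>D. s \<in> GG"
proof -
 let ?I = "{p \<in> PP. \<not> (\<exists>q\<in>PP. p \<ll> q \<and> r \<ll> q)}"
 have I: "?I \<in> V.Sets" by (intro V.separation df) (use r GG_sub PV in auto)
 have "\<exists>q\<in>D \<union> ?I. q \<in> GG"
 proof (rule GG_dense)
  show "D \<union> ?I \<in> V.Sets" using D I by blast
  show "D \<union> ?I \<subseteq> PP" using D by blast
  fix p assume p: "p \<in> PP"
  show "\<exists>q\<in>D \<union> ?I. p \<ll> q"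
  proof (cases "\<exists>q\<in>PP. p \<ll> q \<and> r \<ll> q")
   case True
   then obtain q where q: "q \<in> PP" "p \<ll> q" "r \<ll> q" by blast
   from ex[OF q(1,3)] q(2) show ?thesis by blast
  qed (use p in blast)
 qed
 then show ?thesis using GG_dir[OF r] GG_sub by blast
qed

text \<open>A case of the truth lemma: a name takes a ground model value iff some condition in the
  filter forces it, where forcing \<open>\<pi> = a\<close> is a relation \<open>RR\<close> of the
  ground model. Pairing \<open>a\<close> with the conditions that put it into the set named by
  \<open>\<tau>\<close> then gives the required name.\<close>

lemma nice_name:
 assumes Z: "Z \<in> W.Sets" "Z \<subseteq> A" and A: "A \<in> V.Sets"
 shows "\<exists>\<Sigma>\<in>V.Sets. \<forall>a\<in>A. a \<in> Z \<longleftrightarrow> (\<exists>p\<in>GG. V.pr a p \<in> \<Sigma>)"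
proof -
 from names[of "W.cd Z"] obtain \<tau> where \<tau>: "\<tau> \<in> V" "W.evaluates_to GG \<tau> (W.cd Z)" by auto
 from \<tau>(2)[unfolded W.evaluates_to_def] obtain T0 F where T0_1: "T0 \<in> W.Sets" "W.fun_in T0 F" "\<tau> \<in> T0"
  and T0_2: "\<forall>\<sigma>\<in>T0. \<forall>\<pi>\<in>W. \<forall>p\<in>W. W.pr \<pi> p \<in> W.ext \<sigma> \<longrightarrow> \<pi> \<in> T0"
  and T0_3: "\<forall>\<sigma>\<in>T0. W.ext (F \<sigma>) = {F \<pi> | \<pi>. \<pi> \<in> W \<and> (\<exists>p\<in>GG. W.pr \<pi> p \<in> W.ext \<sigma>)}"
  and T0_4: "W.cd Z = F \<tau>" by (elim bexE exE conjE)
 note T0 = T0_1 T0_2[rule_format] T0_3[rule_format] T0_4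
 from W.fn_of_fun_in[OF T0(2,1)] obtain f where f: "f \<in> W" "\<forall>x\<in>T0. F x = W.ap f x" by blast
 from V.transitive_closure[OF \<tau>(1)] obtain T where T: "T \<in> V.Sets" "\<tau> \<in> T" "\<And>y. y \<in> T \<Longrightarrow> V.ext y \<subseteq> T" by blast
 \<comment> \<open>Values of subnames are compared with members of \<open>a\<close>; so names range
   over the transitive set \<open>T\<close> and values over the transitive set \<open>B\<close>,
   both in the ground model.\<close>
 from V.transitive_closure[OF V.cd_U[of A]] obtain B where B: "B \<in> V.Sets" "V.cd A \<in> B" "\<And>y. y \<in> B \<Longrightarrow> V.ext y \<subseteq> B" by blast
 have AB: "A \<subseteq> B" using B(3)[OF B(2)] V.ext_cd[OF A] by simp
 have TV: "x \<in> V" if "x \<in> T" for x using V.Sets_U[OF T(1) that] .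
 have BV: "x \<in> V" if "x \<in> B" for x using V.Sets_U[OF B(1) that] .
 have Tp: "\<rho> \<in> T" if "\<sigma> \<in> T" "\<rho> \<in> V" "q \<in> V" "V.pr \<rho> q \<in> V.ext \<sigma>" for \<sigma> \<rho> q
 proof -
  have s: "{\<rho>} \<in> V.Sets" "{\<rho>, q} \<in> V.Sets" using that V.Sets_pair[of \<rho> \<rho>] V.Sets_pair[of \<rho> q] by auto
  then have "{V.cd {\<rho>}, V.cd {\<rho>, q}} \<in> V.Sets" by (intro V.Sets_pair) auto
  then have 1: "V.cd {\<rho>} \<in> V.ext (V.pr \<rho> q)" using that by (simp add: V.pr_eq del: pr_V ext_V)
  have "V.pr \<rho> q \<in> T" using T(3)[OF that(1)] that(4) by blast
  then have "V.cd {\<rho>} \<in> T" using T(3) 1 by blast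
  then show ?thesis using T(3)[of "V.cd {\<rho>}"] V.ext_cd[OF s(1)] by auto
 qed
 let ?M = "V.prd PP (V.prd T B)"
 have M: "?M \<in> V.Sets" using T B by auto
 txt \<open>\<open>RR\<close> is the relation that \<open>p\<close> forces the name \<open>\<pi>\<close> to denote the ground model set \<open>a\<close>. The
  recursion that defines it is replaced by its largest post-fixed point.\<close>
 define cl where "cl R p \<pi> a \<longleftrightarrow>
  (\<forall>\<rho>\<in>V. \<forall>q\<in>PP. \<forall>r\<in>PP. V.pr \<rho> q \<in> V.ext \<pi> \<and> p \<ll> r \<and> q \<ll> r \<longrightarrow>
    (\<exists>s\<in>PP. r \<ll> s \<and> (\<exists>b\<in>V.ext a. V.pr s (V.pr \<rho> b) \<in> R))) \<and>
  (\<forall>b\<in>V.ext a. \<forall>r\<in>PP. p \<ll> r \<longrightarrow>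
    (\<exists>s\<in>PP. r \<ll> s \<and> (\<exists>\<rho>\<in>V. \<exists>q\<in>PP. V.pr \<rho> q \<in> V.ext \<pi> \<and> q \<ll> s \<and> V.pr s (V.pr \<rho> b) \<in> R)))"
  for R p \<pi> a
 have mono: "cl R' p \<pi> a" if "cl R p \<pi> a" "R \<subseteq> R'" for R R' p \<pi> a
  using that unfolding cl_def by (meson subsetD)
 have weak: "cl R p' \<pi> a" if "cl R p \<pi> a" "p \<ll> p'" for R p p' \<pi> a
  using that unfolding cl_def by (meson order_trans)
 define post where "post R \<longleftrightarrow> (\<forall>p\<in>PP. \<forall>\<pi>\<in>T. \<forall>a\<in>B. V.pr p (V.pr \<pi> a) \<in> R \<longrightarrow> cl R p \<pi> a)" for R
 define RR where "RR = {z \<in> ?M. \<exists>r\<in>V. z \<in> V.ext r \<and> V.ext r \<subseteq> ?M \<and> post (V.ext r)}"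
 have Dcl: "V.Df (\<lambda>e. cl (R e) (t e) (u e) (v e))" if "V.DS R" "V.DT t" "V.DT u" "V.DT v" for R t u v
  unfolding cl_def by (intro df that that(1)[THEN V.DS_weaken] that(2-)[THEN V.DT_weaken] V.cohen_Sets)
 have RRS: "RR \<in> V.Sets" unfolding RR_def post_def by (intro V.separation M df Dcl T B V.cohen_Sets)
 have RR_cl: "cl RR p \<pi> a" if "p \<in> PP" "\<pi> \<in> T" "a \<in> B" "V.pr p (V.pr \<pi> a) \<in> RR" for p \<pi> a
 proof -
  from that(4) obtain r where r: "r \<in> V" "V.pr p (V.pr \<pi> a) \<in> V.ext r" "V.ext r \<subseteq> ?M" "post (V.ext r)" unfolding RR_def by blast
  have "V.ext r \<subseteq> RR" using r unfolding RR_def by blast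
  moreover have "cl (V.ext r) p \<pi> a" using r(2,4) that unfolding post_def by blast
  ultimately show ?thesis using mono by blast
 qed
 \<comment> \<open>The largest post-fixed point is a fixed point: a triple that satisfies the clause
   for \<open>RR\<close> can be added to \<open>RR\<close> without losing post-fixedness.\<close>
 have RR_I: "V.pr p (V.pr \<pi> a) \<in> RR" if *: "p \<in> PP" "\<pi> \<in> T" "a \<in> B" "cl RR p \<pi> a" for p \<pi> a
 proof -
  let ?z = "V.pr p (V.pr \<pi> a)"
  have U: "p \<in> V" "\<pi> \<in> V" "a \<in> V" using * PV TV BV by auto
  have "V.pr \<pi> a \<in> V.prd T B" unfolding V.prd_iff using * by blast
  then have zM: "?z \<in> ?M" unfolding V.prd_iff[of ?z] using * by blast
  have S: "insert ?z RR \<in> V.Sets" by (intro V.Sets_insert V.pr_U RRS U)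
  have po: "post (insert ?z RR)" unfolding post_def
  proof (intro ballI impI)
   fix p' \<pi>' a' assume h: "p' \<in> PP" "\<pi>' \<in> T" "a' \<in> B" "V.pr p' (V.pr \<pi>' a') \<in> insert ?z RR"
   have U': "p' \<in> V" "\<pi>' \<in> V" "a' \<in> V" using h PV TV BV by auto
   show "cl (insert ?z RR) p' \<pi>' a'"
   proof (cases "V.pr p' (V.pr \<pi>' a') = ?z")
    case True
    then have "p' = p" "V.pr \<pi>' a' = V.pr \<pi> a"
     using V.pr_inj[of p' "V.pr \<pi>' a'" p "V.pr \<pi> a"] V.pr_U U U' by auto
    then have "p' = p" "\<pi>' = \<pi>" "a' = a" using V.pr_inj[of \<pi>' a' \<pi> a] U U' by auto
    then show ?thesis using mono[OF *(4)] by blast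
   next
    case False then show ?thesis using h RR_cl mono[of RR] by blast
   qed
  qed
  have e: "V.ext (V.cd (insert ?z RR)) = insert ?z RR" using S by (rule V.ext_cd)
  have "insert ?z RR \<subseteq> ?M" using zM unfolding RR_def by blast
  then have "\<exists>r\<in>V. ?z \<in> V.ext r \<and> V.ext r \<subseteq> ?M \<and> post (V.ext r)"
   using po by (intro bexI[of _ "V.cd (insert ?z RR)"], unfold e) blast+
  with zM show ?thesis unfolding RR_def by blast
 qed
 have RR_weak: "V.pr p' (V.pr \<pi> a) \<in> RR" if "p \<in> PP" "p' \<in> PP" "\<pi> \<in> T" "a \<in> B" "V.pr p (V.pr \<pi> a) \<in> RR" "p \<ll> p'" for p p' \<pi> a
  using RR_I[OF that(2-4)] weak[OF RR_cl[OF that(1,3-5)] that(6)] by blast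
 have eqs: "V.pr x y = W.pr x y" if "x \<in> V" "y \<in> V" for x y using that by simp
 let ?good = "\<lambda>\<sigma>. \<forall>a\<in>B. W.ap f \<sigma> = a \<longleftrightarrow> (\<exists>p\<in>GG. W.pr p (W.pr \<sigma> a) \<in> RR)"
 \<comment> \<open>The truth lemma, by induction over names in \<open>W\<close>. The relation
   \<open>RR\<close> concerns names in \<open>T\<close>, while the evaluation is known on
   \<open>T0\<close>; hence the intersection.\<close>
 have main: "?good \<sigma>" if "\<sigma> \<in> T0 \<inter> T" for \<sigma>
 proof (rule ccontr)
  assume ng: "\<not> ?good \<sigma>"
  let ?N = "{\<sigma> \<in> T0 \<inter> T. \<not> ?good \<sigma>}"
  have "?N \<in> W.Sets" by (intro W.separation df) (use T0 T B RRS f GW in auto)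
  from W.name_induct[OF this] ng that obtain \<sigma> where \<sigma>: "\<sigma> \<in> ?N" and IH0: "\<And>\<pi> p. \<pi> \<in> W \<Longrightarrow> p \<in> W \<Longrightarrow> W.pr \<pi> p \<in> W.ext \<sigma> \<Longrightarrow> \<pi> \<notin> ?N" by blast
  have sT: "\<sigma> \<in> T0" "\<sigma> \<in> T" "\<sigma> \<in> V" using \<sigma> TV by auto
  have IH: "\<rho> \<in> T \<and> \<rho> \<in> V \<and> (\<forall>a\<in>B. F \<rho> = a \<longleftrightarrow> (\<exists>p\<in>GG. V.pr p (V.pr \<rho> a) \<in> RR))"
   if h: "\<rho> \<in> W" "q \<in> W" "W.pr \<rho> q \<in> W.ext \<sigma>" for \<rho> q
  proof -
   have "W.pr \<rho> q \<in> V" using in_ext_V[OF sT(3) h(3)] .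
   then have v: "\<rho> \<in> V" "q \<in> V" using pr_in_V h by auto
   then have rT: "\<rho> \<in> T" using Tp[OF sT(2)] h sT by auto
   have r0: "\<rho> \<in> T0" using T0(4)[OF sT(1) h] .
   then have "?good \<rho>" using IH0[OF h] rT by blast
   moreover have "V.pr p (V.pr \<rho> a) = W.pr p (W.pr \<rho> a)" if "p \<in> GG" "a \<in> B" for p a
    using that v GG_sub PV BV pr_in_V by (metis VW' pr_V)
   ultimately show ?thesis using f r0 rT v by (metis (no_types, lifting))
  qed
  have evS: "W.ext (F \<sigma>) = {F \<pi> | \<pi>. \<pi> \<in> W \<and> (\<exists>p\<in>GG. W.pr \<pi> p \<in> W.ext \<sigma>)}" using T0(5)[OF sT(1)] .
  have FW: "F \<sigma> \<in> W" using W.fun_in_mem[OF T0(2) sT(1)] .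
  have "?good \<sigma>"
  proof
   fix a assume a: "a \<in> B"
   have aV: "a \<in> V" using BV a .
   have eb: "b \<in> B" if "b \<in> W.ext a" for b using B(3)[OF a] that aV by auto
   have eqs': "V.pr p (V.pr \<sigma> a) = W.pr p (W.pr \<sigma> a)" if "p \<in> GG" for p
    using that sT GG_sub PV aV pr_in_V by (metis VW' pr_V)
   show "W.ap f \<sigma> = a \<longleftrightarrow> (\<exists>p\<in>GG. W.pr p (W.pr \<sigma> a) \<in> RR)"
   proof
    assume "W.ap f \<sigma> = a"
    then have Fa: "F \<sigma> = a" using f sT by auto
    \<comment> \<open>The two ways in which the clause is refuted: some subname put in by
      \<open>p\<close> cannot be identified with a member of \<open>a\<close> by any stronger
      condition, or some member of \<open>a\<close> is omitted by all stronger conditions. Together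
      with the clause itself these alternatives are dense.\<close>
    let ?R1 = "\<lambda>p. \<exists>\<rho>\<in>V. \<exists>q\<in>PP. V.pr \<rho> q \<in> V.ext \<sigma> \<and> q \<ll> p \<and> (\<forall>s\<in>PP. p \<ll> s \<longrightarrow> (\<forall>b\<in>V.ext a. V.pr s (V.pr \<rho> b) \<notin> RR))"
    let ?R2 = "\<lambda>p. \<exists>b\<in>V.ext a. \<forall>s\<in>PP. p \<ll> s \<longrightarrow> (\<forall>\<rho>\<in>V. \<forall>q\<in>PP. V.pr \<rho> q \<in> V.ext \<sigma> \<and> q \<ll> s \<longrightarrow> V.pr s (V.pr \<rho> b) \<notin> RR)"
    let ?D = "{p \<in> PP. cl RR p \<sigma> a \<or> ?R1 p \<or> ?R2 p}"
    have D: "?D \<in> V.Sets" by (intro V.separation df Dcl RRS sT aV V.cohen_Sets)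
    have "\<exists>p\<in>?D. p \<in> GG"
    proof (rule GG_dense[OF D])
     fix p assume p: "p \<in> PP"
     show "\<exists>q\<in>?D. p \<ll> q"
     proof (cases "cl RR p \<sigma> a")
      case True then show ?thesis using p by blast
     next
      case False
      let ?P = "\<forall>\<rho>\<in>V. \<forall>q\<in>PP. \<forall>r\<in>PP. V.pr \<rho> q \<in> V.ext \<sigma> \<and> p \<ll> r \<and> q \<ll> r \<longrightarrow>
         (\<exists>s\<in>PP. r \<ll> s \<and> (\<exists>b\<in>V.ext a. V.pr s (V.pr \<rho> b) \<in> RR))"
      let ?Q = "\<forall>b\<in>V.ext a. \<forall>r\<in>PP. p \<ll> r \<longrightarrow>
         (\<exists>s\<in>PP. r \<ll> s \<and> (\<exists>\<rho>\<in>V. \<exists>q\<in>PP. V.pr \<rho> q \<in> V.ext \<sigma> \<and> q \<ll> s \<and> V.pr s (V.pr \<rho> b) \<in> RR))"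
      from False have "\<not> ?P \<or> \<not> ?Q" unfolding cl_def by (rule de_Morgan_conj[THEN iffD1])
      then show ?thesis
      proof
       assume "\<not> ?P"
       then obtain \<rho> q r where 1: "\<rho> \<in> V" "q \<in> PP" "r \<in> PP" "V.pr \<rho> q \<in> V.ext \<sigma>" "p \<ll> r" "q \<ll> r"
        "\<not> (\<exists>s\<in>PP. r \<ll> s \<and> (\<exists>b\<in>V.ext a. V.pr s (V.pr \<rho> b) \<in> RR))" by blast
       then have "?R1 r" by blast
       then have "r \<in> ?D" using 1(3) by simp
       then show ?thesis using 1(5) by blast
      next
       assume "\<not> ?Q"
       then obtain b r where 2: "b \<in> V.ext a" "r \<in> PP" "p \<ll> r"
        "\<not> (\<exists>s\<in>PP. r \<ll> s \<and> (\<exists>\<rho>\<in>V. \<exists>q\<in>PP. V.pr \<rho> q \<in> V.ext \<sigma> \<and> q \<ll> s \<and> V.pr s (V.pr \<rho> b) \<in> RR))" by blast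
       then have "?R2 r" by blast
       then have "r \<in> ?D" using 2(2) by simp
       then show ?thesis using 2(3) by blast
      qed
     qed
    qed auto
    then obtain p where p: "p \<in> GG" "p \<in> PP" "cl RR p \<sigma> a \<or> ?R1 p \<or> ?R2 p" by blast
    from p(3) consider "cl RR p \<sigma> a" | "?R1 p" | "?R2 p" by blast
    then show "\<exists>p\<in>GG. W.pr p (W.pr \<sigma> a) \<in> RR"
    proof cases
     case 1
     then have "V.pr p (V.pr \<sigma> a) \<in> RR" using RR_I p sT a by blast
     then show ?thesis using p eqs' by auto
    next
     case 2
     then obtain \<rho> q where *: "\<rho> \<in> V" "q \<in> PP" "V.pr \<rho> q \<in> V.ext \<sigma>" "q \<ll> p"
      and no: "\<And>s b. s \<in> PP \<Longrightarrow> p \<ll> s \<Longrightarrow> b \<in> V.ext a \<Longrightarrow> V.pr s (V.pr \<rho> b) \<notin> RR" by blast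
     have qG: "q \<in> GG" using GG_up[OF p(1) *(2,4)] .
     have h: "\<rho> \<in> W" "q \<in> W" "W.pr \<rho> q \<in> W.ext \<sigma>" using * PV sT by auto
     have "F \<rho> \<in> W.ext (F \<sigma>)" unfolding evS using h qG by blast
     then have Fb: "F \<rho> \<in> V.ext a" using Fa aV by simp
     then have FB: "F \<rho> \<in> B" using eb aV by simp
     from IH[OF h] FB obtain s where s: "s \<in> GG" "V.pr s (V.pr \<rho> (F \<rho>)) \<in> RR" "\<rho> \<in> T" by blast
     from GG_dir[OF p(1) s(1)] obtain r where r: "r \<in> GG" "p \<ll> r" "s \<ll> r" by blast
     have "V.pr r (V.pr \<rho> (F \<rho>)) \<in> RR" using RR_weak[OF GG_sub[OF s(1)] GG_sub[OF r(1)] s(3) FB s(2) r(3)] .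
     then show ?thesis using no[OF GG_sub[OF r(1)] r(2) Fb] by blast
    next
     case 3
     then obtain b where b: "b \<in> V.ext a"
      and no: "\<And>s \<rho> q. s \<in> PP \<Longrightarrow> p \<ll> s \<Longrightarrow> \<rho> \<in> V \<Longrightarrow> q \<in> PP \<Longrightarrow> V.pr \<rho> q \<in> V.ext \<sigma> \<Longrightarrow> q \<ll> s \<Longrightarrow> V.pr s (V.pr \<rho> b) \<notin> RR" by blast
     have bW: "b \<in> W.ext a" using b aV by simp
     then obtain \<rho> q where h: "\<rho> \<in> W" "q \<in> GG" "W.pr \<rho> q \<in> W.ext \<sigma>" "b = F \<rho>" using Fa evS by auto
     have qW: "q \<in> W" using h by auto
     have bB: "b \<in> B" using eb bW by simp
     from IH[OF h(1) qW h(3)] bB h(4) obtain s where s: "s \<in> GG" "V.pr s (V.pr \<rho> b) \<in> RR" "\<rho> \<in> T" "\<rho> \<in> V" by blast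
     from GG_dir[OF p(1) s(1)] obtain r0 where r0: "r0 \<in> GG" "p \<ll> r0" "s \<ll> r0" by blast
     from GG_dir[OF r0(1) h(2)] obtain r where r: "r \<in> GG" "r0 \<ll> r" "q \<ll> r" by blast
     have "V.pr r (V.pr \<rho> b) \<in> RR" using RR_weak[OF GG_sub[OF s(1)] GG_sub[OF r(1)] s(3) bB s(2)] r0 r by blast
     moreover have "V.pr \<rho> q \<in> V.ext \<sigma>" using h s(4) sT GG_sub PV by simp
     ultimately show ?thesis using no[OF GG_sub[OF r(1)] _ s(4) GG_sub[OF h(2)] _ r(3)] r0 r by blast
    qed
   next
    assume "\<exists>p\<in>GG. W.pr p (W.pr \<sigma> a) \<in> RR"
    then obtain p where p: "p \<in> GG" "V.pr p (V.pr \<sigma> a) \<in> RR" using eqs' by auto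
    have c: "cl RR p \<sigma> a" using RR_cl[OF GG_sub[OF p(1)] sT(2) a p(2)] .
    have "W.ext (F \<sigma>) = W.ext a"
    proof (intro equalityI subsetI)
     fix y assume "y \<in> W.ext (F \<sigma>)"
     then obtain \<rho> q where h: "\<rho> \<in> W" "q \<in> GG" "W.pr \<rho> q \<in> W.ext \<sigma>" "y = F \<rho>" unfolding evS by blast
     have qW: "q \<in> W" using h by auto
     note I = IH[OF h(1) qW h(3)]
     have qP: "q \<in> PP" using GG_sub[OF h(2)] .
     have pq: "V.pr \<rho> q \<in> V.ext \<sigma>" using h I sT PV[OF qP] by simp
     from GG_dir[OF p(1) h(2)] obtain r where r: "r \<in> GG" "p \<ll> r" "q \<ll> r" by blast
     \<comment> \<open>The clause states that the conditions which identify \<open>\<rho>\<close>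
       with a member of \<open>a\<close> are dense below \<open>r\<close>; genericity picks one of
       them in the filter.\<close>
     let ?D = "{s \<in> PP. \<exists>b\<in>V.ext a. V.pr s (V.pr \<rho> b) \<in> RR}"
     have D: "?D \<in> V.Sets" by (intro V.separation df RRS V.cohen_Sets) (use I aV in auto)
     have "\<exists>s\<in>?D. s \<in> GG"
     proof (rule GG_below[OF r(1) D])
      fix r' assume r': "r' \<in> PP" "r \<ll> r'"
      then have "p \<ll> r'" "q \<ll> r'" using r by blast+
      then have "\<exists>s\<in>PP. r' \<ll> s \<and> (\<exists>b\<in>V.ext a. V.pr s (V.pr \<rho> b) \<in> RR)"
       using c[unfolded cl_def, THEN conjunct1] I qP r'(1) pq by blast
      then show "\<exists>s\<in>?D. r' \<ll> s" by blast
     qed auto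
     then obtain s b where s: "s \<in> GG" "b \<in> V.ext a" "V.pr s (V.pr \<rho> b) \<in> RR" by blast
     have "b \<in> W.ext a" using s aV by simp
     moreover from this have "F \<rho> = b" using I s eb by blast
     ultimately show "y \<in> W.ext a" using h by simp
    next
     fix b assume b: "b \<in> W.ext a"
     then have bV: "b \<in> V.ext a" using aV by simp
     let ?D = "{s \<in> PP. \<exists>\<rho>\<in>V. \<exists>q\<in>PP. V.pr \<rho> q \<in> V.ext \<sigma> \<and> q \<ll> s \<and> V.pr s (V.pr \<rho> b) \<in> RR}"
     have D: "?D \<in> V.Sets" by (intro V.separation df RRS V.cohen_Sets sT) (use bV in blast)
     have "\<exists>s\<in>?D. s \<in> GG"
     proof (rule GG_below[OF p(1) D])
      fix r' assume r': "r' \<in> PP" "p \<ll> r'"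
      then have "\<exists>s\<in>PP. r' \<ll> s \<and> (\<exists>\<rho>\<in>V. \<exists>q\<in>PP. V.pr \<rho> q \<in> V.ext \<sigma> \<and> q \<ll> s \<and> V.pr s (V.pr \<rho> b) \<in> RR)"
       using c[unfolded cl_def, THEN conjunct2] bV by blast
      then show "\<exists>s\<in>?D. r' \<ll> s" by blast
     qed auto
     then obtain s \<rho> q where s: "s \<in> GG" "\<rho> \<in> V" "q \<in> PP" "V.pr \<rho> q \<in> V.ext \<sigma>" "q \<ll> s" "V.pr s (V.pr \<rho> b) \<in> RR" by blast
     have qG: "q \<in> GG" using GG_up[OF s(1,3,5)] .
     have h: "\<rho> \<in> W" "q \<in> W" "W.pr \<rho> q \<in> W.ext \<sigma>" using s PV sT by auto
     have "F \<rho> = b" using IH[OF h] s eb[OF b] by blast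
     then show "b \<in> W.ext (F \<sigma>)" unfolding evS using h qG by blast
    qed
    then have "F \<sigma> = a" using W.ext_inj FW aV by blast
    then show "W.ap f \<sigma> = a" using f sT by auto
   qed
  qed
  then show False using \<sigma> by blast
 qed
 \<comment> \<open>The condition \<open>p\<close> has to do two things: extend \<open>q\<close>,
   which puts the value of \<open>\<rho>\<close> into the set named by \<open>\<tau>\<close>, and
   force that this value is \<open>a\<close>.\<close>
 let ?S = "{z \<in> V.prd A PP. \<exists>a\<in>A. \<exists>p\<in>PP. z = V.pr a p \<and> (\<exists>\<rho>\<in>V. \<exists>q\<in>PP. V.pr \<rho> q \<in> V.ext \<tau> \<and> q \<ll> p \<and> V.pr p (V.pr \<rho> a) \<in> RR)}"
 have S: "?S \<in> V.Sets" by (intro V.separation df V.Sets_prd A RRS \<tau> V.cohen_Sets)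
 have eZ: "Z = {F \<pi> | \<pi>. \<pi> \<in> W \<and> (\<exists>p\<in>GG. W.pr \<pi> p \<in> W.ext \<tau>)}"
  using T0(5)[OF T0(3)] T0(6)[symmetric] Z(1) by simp
 have fin: "a \<in> Z \<longleftrightarrow> (\<exists>p\<in>GG. V.pr a p \<in> ?S)" if a: "a \<in> A" for a
 proof
  have aB: "a \<in> B" and aV: "a \<in> V" using a AB BV by auto
  {
   assume "a \<in> Z"
   then obtain \<rho> q where h: "\<rho> \<in> W" "q \<in> GG" "W.pr \<rho> q \<in> W.ext \<tau>" "a = F \<rho>" unfolding eZ by blast
   have qV: "q \<in> V" "q \<in> PP" "q \<in> W" using GG_sub[OF h(2)] PV by auto
   have "W.pr \<rho> q \<in> V" using in_ext_V[OF \<tau>(1) h(3)] .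
   then have rV: "\<rho> \<in> V" using pr_in_V h qV by blast
   have pq: "V.pr \<rho> q \<in> V.ext \<tau>" using rV qV h \<tau> by simp
   then have rT: "\<rho> \<in> T" using Tp[OF T(2) rV qV(1)] by blast
   have r0: "\<rho> \<in> T0" using T0(4)[OF T0(3) h(1) qV(3) h(3)] .
   have "W.ap f \<rho> = a" using h f r0 by auto
   then obtain s where s: "s \<in> GG" "W.pr s (W.pr \<rho> a) \<in> RR" using main[of \<rho>] r0 rT aB by blast
   have sV: "s \<in> V" using GG_sub[OF s(1)] PV by blast
   have s': "V.pr s (V.pr \<rho> a) \<in> RR" using s sV rV aV pr_in_V[of \<rho> a] by simp
   from GG_dir[OF s(1) h(2)] obtain r where r: "r \<in> GG" "s \<ll> r" "q \<ll> r" by blast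
   have "V.pr r (V.pr \<rho> a) \<in> RR" using RR_weak[OF GG_sub[OF s(1)] GG_sub[OF r(1)] rT aB s' r(2)] .
   then have "V.pr a r \<in> ?S" using a GG_sub[OF r(1)] rV qV pq r by (auto simp: V.prd_iff simp del: ext_V pr_V)
   then show "\<exists>p\<in>GG. V.pr a p \<in> ?S" using r by blast
  }
  {
   assume "\<exists>p\<in>GG. V.pr a p \<in> ?S"
   then obtain p a' p' \<rho> q where h: "p \<in> GG" "a' \<in> A" "p' \<in> PP" "V.pr a p = V.pr a' p'" "\<rho> \<in> V" "q \<in> PP" "V.pr \<rho> q \<in> V.ext \<tau>" "q \<ll> p'" "V.pr p' (V.pr \<rho> a') \<in> RR" by blast
   have pV: "p \<in> V" using GG_sub[OF h(1)] PV by blast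
   have "a = a'" "p = p'" using V.pr_inj[of a p a' p'] h aV pV PV AB BV by blast+
   then have h': "q \<ll> p" "V.pr p (V.pr \<rho> a) \<in> RR" using h by auto
   have qG: "q \<in> GG" using GG_up[OF h(1,6) h'(1)] .
   have qV: "q \<in> V" using PV h by blast
   have pq: "W.pr \<rho> q \<in> W.ext \<tau>" using h qV \<tau> by simp
   have rT: "\<rho> \<in> T" using Tp[OF T(2) h(5) qV h(7)] .
   have r0: "\<rho> \<in> T0" using T0(4)[OF T0(3) _ _ pq] h(5) qV by auto
   have "W.pr p (W.pr \<rho> a) \<in> RR" using h' pV h(5) aV pr_in_V[of \<rho> a] by simp
   then have "W.ap f \<rho> = a" using main[of \<rho>] r0 rT aB h(1) by blast
   then have "F \<rho> = a" using f r0 by auto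
   then show "a \<in> Z" unfolding eZ using pq qG h(5) by blast
  }
 qed
 show ?thesis by (intro bexI[OF _ S] ballI) (rule fin)
qed

text \<open>The set \<open>S p\<close> of points at which \<open>p\<close> decides a value belongs
  to the ground model. For \<open>p\<close> in the filter these sets cover \<open>I\<close>, and
  there are only countably many conditions, so some \<open>p\<close> in the filter decides
  uncountably many values. What it decides is true, which makes \<open>?g\<close> a function that
  agrees with \<open>f\<close>.\<close>

theorem uncountable_ground_restriction:
 assumes I: "I \<in> V.Sets" "\<not> V.countable_in I" and A: "A \<in> V.Sets" and f: "W.fun_in I f" "f ` I \<subseteq> A"
 shows "\<exists>S\<in>V.Sets. \<exists>g\<in>V. S \<subseteq> I \<and> \<not> V.countable_in S \<and> (\<forall>x\<in>S. V.ap g x = f x)"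
proof -
 have IV: "x \<in> V" if "x \<in> I" for x using V.Sets_U[OF I(1) that] .
 have AV: "x \<in> V" if "x \<in> A" for x using V.Sets_U[OF A that] .
 let ?Z = "{W.pr x (f x) | x. x \<in> I}"
 have Z: "?Z \<in> W.Sets" using f unfolding W.fun_in_def by blast
 have ZA: "?Z \<subseteq> V.prd I A"
 proof
  fix z assume "z \<in> ?Z"
  then obtain x where x: "x \<in> I" "z = W.pr x (f x)" by blast
  have fx: "f x \<in> A" using f x by blast
  have "z = V.pr x (f x)" using pr_V[OF IV[OF x(1)] AV[OF fx]] x by simp
  then show "z \<in> V.prd I A" unfolding V.prd_iff using x fx by blast
 qed
 have "V.prd I A \<in> V.Sets" using I A by blast
 from nice_name[OF Z ZA this] obtain N where N1: "N \<in> V.Sets" and N2: "\<forall>a\<in>V.prd I A. a \<in> ?Z \<longleftrightarrow> (\<exists>p\<in>GG. V.pr a p \<in> N)" by (elim bexE)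
 note N = N1 N2[rule_format]
 define S where "S p = {x \<in> I. \<exists>y\<in>A. V.pr (V.pr x y) p \<in> N}" for p
 have DS: "V.DS (\<lambda>e. S (t e))" if "V.DT t" for t unfolding S_def by (intro df I A N that that[THEN V.DT_weaken])
 have SS: "S p \<in> V.Sets" if "p \<in> V" for p unfolding S_def by (intro V.separation df I A N that)
 have "\<exists>p\<in>GG. \<not> V.countable_in (S p)"
 proof (rule ccontr)
  assume c: "\<not> ?thesis"
  let ?Q = "{p \<in> PP. V.countable_in (S p)}"
  have Q: "?Q \<in> V.Sets" by (intro V.separation V.cohen_Sets V.Df_countable_in DS df SS) auto
  have "V.countable_in I"
  proof (rule V.countable_in_UN[OF Q _ I(1)])
   show "V.countable_in ?Q" by (rule V.countable_in_subset[OF V.cohen_countable _ Q]) auto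
   show "V.DS (\<lambda>e. S (e 0))" by (intro DS df)
   show "I \<subseteq> (\<Union>p\<in>?Q. S p)"
   proof
    fix x assume x: "x \<in> I"
    then have m: "V.pr x (f x) \<in> V.prd I A" using f by (auto simp: V.prd_iff simp del: pr_V)
    have "V.pr x (f x) = W.pr x (f x)" using x IV AV f by auto
    then have "V.pr x (f x) \<in> ?Z" using x by auto
    then obtain p where p: "p \<in> GG" "V.pr (V.pr x (f x)) p \<in> N" using N(2)[OF m] by blast
    then have "x \<in> S p" using x f unfolding S_def by blast
    then show "x \<in> (\<Union>p\<in>?Q. S p)" using c p GG_sub by blast
   qed
  qed (use SS PV in auto)
  then show False using I by blast
 qed
 then obtain p where p: "p \<in> GG" "\<not> V.countable_in (S p)" by blast
 have pV: "p \<in> V" using p GG_sub PV by blast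
 let ?g = "{z \<in> V.prd I A. V.pr z p \<in> N}"
 have g: "?g \<in> V.Sets" by (intro V.separation V.Sets_prd df I A N pV)
 have "V.ap (V.cd ?g) x = f x" if x: "x \<in> S p" for x
 proof (rule V.ap_unique)
  have uniq: "z = f x" if z: "z \<in> V" "V.pr x z \<in> ?g" for z
  proof -
   have xI: "x \<in> I" using x unfolding S_def by blast
   have "V.pr x z \<in> ?Z" using N(2)[of "V.pr x z"] z p by blast
   then obtain x' where x': "x' \<in> I" "V.pr x z = W.pr x' (f x')" by blast
   have fx: "f x' \<in> A" using f x' by blast
   have eq: "V.pr x z = V.pr x' (f x')" using x'(2) pr_V[OF IV[OF x'(1)] AV[OF fx]] by simp
   have "x = x' \<and> z = f x'"
    using eq V.pr_inj[OF IV[OF xI] z(1) IV[OF x'(1)] AV[OF fx]] by (simp del: pr_V)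
   then show ?thesis by simp
  qed
  from x obtain y where y: "y \<in> A" "V.pr (V.pr x y) p \<in> N" "x \<in> I" unfolding S_def by blast
  then have yg: "V.pr x y \<in> ?g" by (auto simp: V.prd_iff simp del: pr_V)
  have "y = f x" using uniq[of y] y yg AV by blast
  then show "f x \<in> V" "V.pr x (f x) \<in> V.ext (V.cd ?g)" using AV[OF y(1)] yg unfolding V.ext_cd[OF g] by simp_all
  fix z assume "z \<in> V" "V.pr x z \<in> V.ext (V.cd ?g)"
  then show "z = f x" unfolding V.ext_cd[OF g] by (rule uniq)
 qed
 moreover have "S p \<subseteq> I" unfolding S_def by blast
 ultimately show ?thesis using SS[OF pV] p by blast
qed

text \<open>An injection into \<open>omega\<close> would agree with a ground model function on an
  uncountable ground model set, and that function would be injective there.\<close>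

corollary uncountable_preserved:
 assumes I: "I \<in> V.Sets" "\<not> V.countable_in I"
 shows "\<not> W.countable_in I"
proof
 assume "W.countable_in I"
 then obtain f where f: "W.fun_in I f" "inj_on f I" "f ` I \<subseteq> V.omega" unfolding W.countable_in_def by auto
 from uncountable_ground_restriction[OF I V.omega_Sets f(1,3)]
 obtain S g where S: "S \<in> V.Sets" "g \<in> V" "S \<subseteq> I" "\<not> V.countable_in S" "\<And>x. x \<in> S \<Longrightarrow> V.ap g x = f x" by blast
 have "inj_on (V.ap g) S" using f(2) S(3,5) by (metis inj_on_cong inj_on_subset)
 moreover have "V.ap g ` S \<subseteq> V.omega" using f(3) S by auto
 ultimately show False using S V.countable_in_iff by blast
qed

end

subsection \<open>Internal fields of sets and their Stone spaces\<close>

text \<open>Boolean algebras are handled as fields of subsets of \<open>Om\<close>: the order is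
  inclusion, and equations between elements reduce to equations between extensions. Joins and the
  bottom come from meets and complements.\<close>

locale set_algebra = zfc +
 fixes Om Lc :: "'a set"
 assumes Om: "Om \<in> Sets" and Lc: "Lc \<in> Sets" and Lc_sub: "Lc \<subseteq> pset Om"
  and top_Lc: "cd Om \<in> Lc" and cm_Lc': "\<And>a. a \<in> Lc \<Longrightarrow> cd (Om - ext a) \<in> Lc"
  and mt_Lc': "\<And>a b. a \<in> Lc \<Longrightarrow> b \<in> Lc \<Longrightarrow> cd (ext a \<inter> ext b) \<in> Lc"
  and Om_ne: "Om \<noteq> {}"
begin

definition L :: "'a gorder" where "L = \<lparr>carrier = Lc, eq = (=), le = (\<lambda>a b. ext a \<subseteq> ext b)\<rparr>"

definition mt :: "'a \<Rightarrow> 'a \<Rightarrow> 'a" where "mt a b = cd (ext a \<inter> ext b)"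
definition jn :: "'a \<Rightarrow> 'a \<Rightarrow> 'a" where "jn a b = cd (ext a \<union> ext b)"
definition cm :: "'a \<Rightarrow> 'a" where "cm a = cd (Om - ext a)"
definition tp :: 'a where "tp = cd Om"
definition bt :: 'a where "bt = cd {}"

lemma LU: "a \<in> Lc \<Longrightarrow> a \<in> U" using Sets_U[OF Lc] .
lemma L_sub: "a \<in> Lc \<Longrightarrow> ext a \<subseteq> Om" using subsetD[OF Lc_sub] by (simp add: pset_iff)
lemma L_in: "a \<in> Lc \<Longrightarrow> x \<in> ext a \<Longrightarrow> x \<in> Om" using L_sub by blast
lemma mt_ext[simp]: "a \<in> Lc \<Longrightarrow> b \<in> Lc \<Longrightarrow> ext (mt a b) = ext a \<inter> ext b" by (simp add: mt_def LU)
lemma jn_ext[simp]: "a \<in> Lc \<Longrightarrow> b \<in> Lc \<Longrightarrow> ext (jn a b) = ext a \<union> ext b" by (simp add: jn_def LU)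
lemma cm_ext[simp]: "a \<in> Lc \<Longrightarrow> ext (cm a) = Om - ext a" using Om by (simp add: cm_def LU)
lemma tp_ext[simp]: "ext tp = Om" using Om by (simp add: tp_def)
lemma bt_ext[simp]: "ext bt = {}" by (simp add: bt_def)
lemma DT_mt[df]: "DT t \<Longrightarrow> DT u \<Longrightarrow> DT (\<lambda>e. mt (t e) (u e))" unfolding mt_def by (intro df)
lemma DT_jn[df]: "DT t \<Longrightarrow> DT u \<Longrightarrow> DT (\<lambda>e. jn (t e) (u e))" unfolding jn_def by (intro df)
lemma DT_cm[df]: "DT t \<Longrightarrow> DT (\<lambda>e. cm (t e))" unfolding cm_def by (intro df Om)
lemma op_U[simp, intro]: "mt a b \<in> U" "jn a b \<in> U" "cm a \<in> U" "tp \<in> U" "bt \<in> U" by (simp_all add: mt_def jn_def cm_def tp_def bt_def)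
lemma L_eq: "a \<in> Lc \<Longrightarrow> b \<in> Lc \<Longrightarrow> ext a = ext b \<Longrightarrow> a = b" using ext_inj LU by blast
lemma tp_L[simp, intro]: "tp \<in> Lc" using top_Lc by (simp add: tp_def)
lemma cm_L[simp, intro]: "a \<in> Lc \<Longrightarrow> cm a \<in> Lc" using cm_Lc' by (simp add: cm_def)
lemma mt_L[simp, intro]: "a \<in> Lc \<Longrightarrow> b \<in> Lc \<Longrightarrow> mt a b \<in> Lc" using mt_Lc' by (simp add: mt_def)
lemma bt_L[simp, intro]: "bt \<in> Lc"
proof -
 have "bt = cm tp" by (rule ext_inj) auto
 then show ?thesis by auto
qed
lemma jn_L[simp, intro]: assumes "a \<in> Lc" "b \<in> Lc" shows "jn a b \<in> Lc"
proof -
 have "jn a b = cm (mt (cm a) (cm b))" by (rule ext_inj) (use assms L_sub in auto)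
 then show ?thesis using assms by auto
qed

lemma L_simps[simp]: "carrier L = Lc" "le L = (\<lambda>a b. ext a \<subseteq> ext b)" "eq L = (=)" by (simp_all add: L_def)

sublocale PO: partial_order L
 by unfold_locales (auto intro: L_eq)

lemma lub_L: assumes "b \<in> Lc" "F \<subseteq> Lc" "ext b = (\<Union>a\<in>F. ext a)" shows "\<Squnion>\<^bsub>L\<^esub> F = b"
proof -
 have "least L b (Upper L F)" using assms by (auto simp: least_def Upper_def)
 then show ?thesis unfolding Lattice.sup_def using PO.least_unique by blast
qed

lemma glb_L: assumes "b \<in> Lc" "F \<subseteq> Lc" "F \<noteq> {}" "ext b = (\<Inter>a\<in>F. ext a)" shows "\<Sqinter>\<^bsub>L\<^esub> F = b"
proof -
 have "greatest L b (Lower L F)" using assms by (auto simp: greatest_def Lower_def)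
 then show ?thesis unfolding Lattice.inf_def using PO.greatest_unique by blast
qed

lemma join_L[simp]: "a \<in> Lc \<Longrightarrow> b \<in> Lc \<Longrightarrow> a \<squnion>\<^bsub>L\<^esub> b = jn a b"
 unfolding join_def by (rule lub_L) auto

lemma meet_L[simp]: "a \<in> Lc \<Longrightarrow> b \<in> Lc \<Longrightarrow> a \<sqinter>\<^bsub>L\<^esub> b = mt a b"
 unfolding meet_def by (rule glb_L) auto

lemma top_greatest: "greatest L tp (carrier L)" using L_sub by (auto simp: greatest_def)
lemma bot_least: "least L bt (carrier L)" by (auto simp: least_def)

lemma top_L[simp]: "\<top>\<^bsub>L\<^esub> = tp"
 unfolding Order.top_def using PO.greatest_unique top_greatest by blast

lemma bot_L[simp]: "\<bottom>\<^bsub>L\<^esub> = bt"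
 unfolding Order.bottom_def using PO.least_unique bot_least by blast

lemma complement_L: assumes "x \<in> Lc" shows "complement_of L x y \<longleftrightarrow> y = cm x"
proof
 assume c: "complement_of L x y"
 then have y: "y \<in> Lc" by (simp add: complement_of_def)
 with c assms have "jn x y = tp" "mt x y = bt" by (simp_all add: complement_of_def)
 then have "ext (jn x y) = Om" "ext (mt x y) = {}" by simp_all
 then have "ext x \<union> ext y = Om" "ext x \<inter> ext y = {}" using assms y by simp_all
 then show "y = cm x" using assms y by (intro L_eq) auto
next
 assume y: "y = cm x"
 have "jn x (cm x) = tp" "mt x (cm x) = bt" using assms L_in by (auto intro!: L_eq)
 then show "complement_of L x y" using assms y by (simp add: complement_of_def)
qed

lemma boolean_L: "boolean_algebra_in L"
proof -
 have "bounded_lattice L"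
 proof unfold_locales
  fix x y assume xy: "x \<in> carrier L" "y \<in> carrier L"
  show "\<exists>s. least L s (Upper L {x, y})"
   by (rule exI[of _ "jn x y"]) (use xy in \<open>auto simp: least_def Upper_def\<close>)
  show "\<exists>s. greatest L s (Lower L {x, y})"
   by (rule exI[of _ "mt x y"]) (use xy in \<open>auto simp: greatest_def Lower_def\<close>)
 qed (use top_greatest bot_least in blast)+
 moreover have "\<forall>x\<in>Lc. \<forall>y\<in>Lc. \<forall>z\<in>Lc. x \<sqinter>\<^bsub>L\<^esub> (y \<squnion>\<^bsub>L\<^esub> z) = (x \<sqinter>\<^bsub>L\<^esub> y) \<squnion>\<^bsub>L\<^esub> (x \<sqinter>\<^bsub>L\<^esub> z)"
  by (auto intro!: L_eq)
 ultimately have b: "boolean_lattice L" unfolding boolean_lattice_def using complement_L by auto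
 have "{pr x y | x y. x \<in> Lc \<and> y \<in> Lc \<and> ext x \<subseteq> ext y} = {z \<in> prd Lc Lc. ext (p1 z) \<subseteq> ext (p2 z)}"
 proof (intro equalityI subsetI)
  fix z assume "z \<in> {pr x y | x y. x \<in> Lc \<and> y \<in> Lc \<and> ext x \<subseteq> ext y}"
  then obtain x y where "x \<in> Lc" "y \<in> Lc" "ext x \<subseteq> ext y" "z = pr x y" by blast
  then show "z \<in> {z \<in> prd Lc Lc. ext (p1 z) \<subseteq> ext (p2 z)}" using LU by (auto simp: prd_iff)
 next
  fix z assume "z \<in> {z \<in> prd Lc Lc. ext (p1 z) \<subseteq> ext (p2 z)}"
  then have z: "z \<in> prd Lc Lc" "ext (p1 z) \<subseteq> ext (p2 z)" by blast+
  note e = prdE[OF z(1) Sets_subset[OF Lc] Sets_subset[OF Lc]]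
  show "z \<in> {pr x y | x y. x \<in> Lc \<and> y \<in> Lc \<and> ext x \<subseteq> ext y}"
   by (intro CollectI exI conjI, rule e(3), rule e(1), rule e(2), rule z(2))
 qed
 moreover have "{z \<in> prd Lc Lc. ext (p1 z) \<subseteq> ext (p2 z)} \<in> Sets" by (intro separation Sets_prd Lc df)
 ultimately have "rel_in Lc (\<lambda>x y. ext x \<subseteq> ext y)" unfolding rel_in_def by simp
 then show ?thesis unfolding boolean_algebra_in_def using b Lc by simp
qed

definition St :: "'a set" where "St = Stone L"

lemma St_eq: "St = {u \<in> pset Lc. tp \<in> ext u \<and> bt \<notin> ext u \<and> (\<forall>x\<in>ext u. \<forall>y\<in>Lc. ext x \<subseteq> ext y \<longrightarrow> y \<in> ext u) \<and>
  (\<forall>x\<in>ext u. \<forall>y\<in>ext u. mt x y \<in> ext u) \<and> (\<forall>x\<in>Lc. x \<in> ext u \<or> cm x \<in> ext u)}"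
proof -
 have "ultrafilter_of L (ext u) \<longleftrightarrow> ext u \<subseteq> Lc \<and> tp \<in> ext u \<and> bt \<notin> ext u \<and> (\<forall>x\<in>ext u. \<forall>y\<in>Lc. ext x \<subseteq> ext y \<longrightarrow> y \<in> ext u) \<and>
  (\<forall>x\<in>ext u. \<forall>y\<in>ext u. mt x y \<in> ext u) \<and> (\<forall>x\<in>Lc. x \<in> ext u \<or> cm x \<in> ext u)" for u
 proof (cases "ext u \<subseteq> Lc")
  case True
  have 1: "(\<forall>x\<in>Lc. \<forall>y. complement_of L x y \<longrightarrow> x \<in> ext u \<or> y \<in> ext u) \<longleftrightarrow> (\<forall>x\<in>Lc. x \<in> ext u \<or> cm x \<in> ext u)"
   by (intro ball_cong refl) (simp add: complement_L)
  have 2: "(\<forall>x\<in>ext u. \<forall>y\<in>ext u. x \<sqinter>\<^bsub>L\<^esub> y \<in> ext u) \<longleftrightarrow> (\<forall>x\<in>ext u. \<forall>y\<in>ext u. mt x y \<in> ext u)"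
   by (intro ball_cong refl) (simp add: subsetD[OF True])
  show ?thesis unfolding ultrafilter_of_def L_simps top_L bot_L 1 2 by (rule refl)
 qed (simp add: ultrafilter_of_def)
 then show ?thesis unfolding St_def Stone_def pset_iff by (intro Collect_cong) (simp add: pset_iff)
qed

lemma St_Sets[simp, intro]: "St \<in> Sets"
 unfolding St_eq by (intro separation Sets_pset Lc df) auto

lemma StU: "u \<in> St \<Longrightarrow> u \<in> U" using Sets_U[OF St_Sets] .
lemma St_sub: "u \<in> St \<Longrightarrow> a \<in> ext u \<Longrightarrow> a \<in> Lc" unfolding St_eq pset_iff by blast
lemma St_tp[simp]: "u \<in> St \<Longrightarrow> tp \<in> ext u" unfolding St_eq by blast
lemma St_bt[simp]: "u \<in> St \<Longrightarrow> bt \<notin> ext u" unfolding St_eq by blast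
lemma St_up: "u \<in> St \<Longrightarrow> a \<in> ext u \<Longrightarrow> b \<in> Lc \<Longrightarrow> ext a \<subseteq> ext b \<Longrightarrow> b \<in> ext u" unfolding St_eq by blast
lemma St_mt: assumes "u \<in> St" "a \<in> Lc" "b \<in> Lc" shows "mt a b \<in> ext u \<longleftrightarrow> a \<in> ext u \<and> b \<in> ext u"
proof
 assume "mt a b \<in> ext u"
 then show "a \<in> ext u \<and> b \<in> ext u" using St_up[OF assms(1), of "mt a b"] assms by auto
next
 assume "a \<in> ext u \<and> b \<in> ext u" then show "mt a b \<in> ext u" using assms(1) unfolding St_eq by blast
qed
lemma St_cm: assumes "u \<in> St" "a \<in> Lc" shows "cm a \<in> ext u \<longleftrightarrow> a \<notin> ext u"
proof
 assume c: "cm a \<in> ext u"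
 show "a \<notin> ext u"
 proof
  assume "a \<in> ext u"
  then have "mt a (cm a) \<in> ext u" using c assms by (simp add: St_mt)
  moreover have "mt a (cm a) = bt" using assms by (auto intro!: L_eq)
  ultimately show False using assms by simp
 qed
next
 assume "a \<notin> ext u" then show "cm a \<in> ext u" using assms unfolding St_eq by blast
qed
lemma St_jn: assumes "u \<in> St" "a \<in> Lc" "b \<in> Lc" shows "jn a b \<in> ext u \<longleftrightarrow> a \<in> ext u \<or> b \<in> ext u"
proof -
 have "jn a b = cm (mt (cm a) (cm b))" using assms L_in by (auto intro!: L_eq)
 then show ?thesis using assms by (simp add: St_mt St_cm)
qed

text \<open>The Boolean prime ideal theorem. The tower construction adjoins chosen elements to
  \<open>J\<close> as long as the ideal stays proper; the complement of the final ideal is the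
  ultrafilter.\<close>

theorem ultrafilter_exists:
 assumes J: "J \<in> Sets" "J \<subseteq> Lc" "bt \<in> J" "tp \<notin> J"
  and dn: "\<And>a b. a \<in> J \<Longrightarrow> b \<in> Lc \<Longrightarrow> ext b \<subseteq> ext a \<Longrightarrow> b \<in> J"
  and jn: "\<And>a b. a \<in> J \<Longrightarrow> b \<in> J \<Longrightarrow> jn a b \<in> J"
 shows "\<exists>u\<in>St. ext u \<inter> J = {}"
proof -
 define idl where "idl x \<longleftrightarrow> bt \<in> ext x \<and> tp \<notin> ext x \<and> (\<forall>a\<in>ext x. \<forall>b\<in>Lc. ext b \<subseteq> ext a \<longrightarrow> b \<in> ext x) \<and>
  (\<forall>a\<in>ext x. \<forall>b\<in>ext x. jn a b \<in> ext x)" for x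
 have Didl: "Df (\<lambda>e. idl (t e))" if "DT t" for t unfolding idl_def by (intro df Lc that that[THEN DT_weaken]) auto
 \<comment> \<open>\<open>a\<close> can be adjoined properly: it is new, and no member of the ideal
   covers the complement of \<open>a\<close>.\<close>
 let ?ok = "\<lambda>x a. a \<notin> ext x \<and> (\<forall>j\<in>ext x. ext j \<union> ext a \<noteq> Om)"
 define D where "D = {x \<in> pset Lc. idl x \<and> (\<exists>a\<in>Lc. ?ok x a)}"
 have DS: "D \<in> Sets" unfolding D_def by (intro separation Sets_pset Lc Om df Didl)
 have "\<exists>ch\<in>U. \<forall>x\<in>D. ap ch x \<in> Lc \<and> ?ok x (ap ch x)"
  by (rule choice[OF DS Lc]) (intro df Om, auto simp: D_def)
 then obtain ch where ch: "ch \<in> U" "\<And>x. x \<in> D \<Longrightarrow> ap ch x \<in> Lc" "\<And>x. x \<in> D \<Longrightarrow> ?ok x (ap ch x)" by blast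
 let ?e = "\<lambda>x. {c \<in> Lc. \<exists>j\<in>ext x. ext c \<subseteq> ext j \<union> ext (ap ch x)}"
 define s where "s x = (if x \<in> D then cd (?e x) else x)" for x
 have Ds: "DT (\<lambda>e. s (e 0))" unfolding s_def by (intro df DS Lc ch)
 have DU: "x \<in> U" if "x \<in> D" for x using DS that Sets_U by blast
 have es: "ext (s x) = ?e x" if x: "x \<in> D" for x
 proof -
  have "?e x \<in> Sets" by (intro separation Lc df ch DU x)
  then show ?thesis using x by (simp add: s_def)
 qed
 have step: "\<forall>x\<in>pset Lc. s x \<in> pset Lc \<and> ext x \<subseteq> ext (s x)"
 proof
  fix x assume x: "x \<in> pset Lc"
  show "s x \<in> pset Lc \<and> ext x \<subseteq> ext (s x)"
  proof (cases "x \<in> D")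
   case True
   have "s x \<in> U" using True by (simp add: s_def)
   then show ?thesis using es[OF True] x by (auto simp: pset_iff)
  qed (use x in \<open>simp add: s_def\<close>)
 qed
 have b: "cd J \<in> pset Lc" using J by (simp add: pset_iff)
 note T = tower[OF Lc b Ds step]
 let ?T = "tower Lc (cd J) s"
 have TU: "x \<in> U" if "x \<in> ?T" for x using T(1) that Sets_U by blast
 have Tidl: "idl x" if "x \<in> ?T" for x
 proof (rule T(4)[OF _ _ _ _ that])
  show "Df (\<lambda>e. idl (e 0))" by (intro Didl df)
  show "idl (cd J)" unfolding idl_def using J dn jn by simp
  fix x assume x: "x \<in> ?T" "idl x"
  show "idl (s x)"
  proof (cases "x \<in> D")
   case True
   note c = ch(2,3)[OF True]
   have xL: "ext x \<subseteq> Lc" using True unfolding D_def by (simp add: pset_iff)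
   show ?thesis unfolding idl_def es[OF True]
   proof (intro conjI ballI impI)
    show "bt \<in> ?e x" using x unfolding idl_def by auto
    show "tp \<notin> ?e x"
    proof
     assume "tp \<in> ?e x"
     then obtain j where j: "j \<in> ext x" "Om \<subseteq> ext j \<union> ext (ap ch x)" by auto
     have "j \<in> Lc" using j xL by blast
     then have "ext j \<subseteq> Om" "ext (ap ch x) \<subseteq> Om" using c L_sub by blast+
     then show False using j c by blast
    qed
   next
    fix a b assume "a \<in> ?e x" "b \<in> Lc" "ext b \<subseteq> ext a"
    then show "b \<in> ?e x" by blast
   next
    fix a b assume "a \<in> ?e x" "b \<in> ?e x"
    then obtain j k where jk: "a \<in> Lc" "b \<in> Lc" "j \<in> ext x" "k \<in> ext x" "ext a \<subseteq> ext j \<union> ext (ap ch x)" "ext b \<subseteq> ext k \<union> ext (ap ch x)" by blast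
    then have 1: "jn j k \<in> ext x" using x unfolding idl_def by blast
    have "j \<in> Lc" "k \<in> Lc" using jk xL by blast+
    then have "ext (jn a b) \<subseteq> ext (jn j k) \<union> ext (ap ch x)" using jk by auto
    then show "jn a b \<in> ?e x" using 1 jk by blast
   qed
  qed (use x in \<open>simp add: s_def\<close>)
 next
  fix Y assume Y: "Y \<in> Sets" "Y \<subseteq> ?T" "Y \<noteq> {}" "\<And>y. y \<in> Y \<Longrightarrow> idl y"
  let ?U = "\<Union>x\<in>Y. ext x"
  show "idl (union Y)" unfolding idl_def ext_union[OF Y(1)]
  proof (intro conjI ballI impI)
   show "bt \<in> ?U" "tp \<notin> ?U" using Y(3,4) unfolding idl_def by blast+
  next
   fix a b assume "a \<in> ?U" "b \<in> Lc" "ext b \<subseteq> ext a"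
   then show "b \<in> ?U" using Y(4) unfolding idl_def by blast
  next
   fix a b assume "a \<in> ?U" "b \<in> ?U"
   then obtain x y where xy: "x \<in> Y" "y \<in> Y" "a \<in> ext x" "b \<in> ext y" by blast
   have jc: "\<forall>a\<in>ext x. \<forall>b\<in>ext x. jn a b \<in> ext x" if "x \<in> Y" for x using Y(4)[OF that] by (simp add: idl_def)
   have "ext x \<subseteq> ext y \<or> ext y \<subseteq> ext x" using T(3) Y(2) xy unfolding chain_def by blast
   then show "jn a b \<in> ?U"
   proof
    assume "ext x \<subseteq> ext y"
    then have "jn a b \<in> ext y" using xy jc[OF xy(2)] by blast
    then show ?thesis using xy by blast
   next
    assume "ext y \<subseteq> ext x"
    then have "jn a b \<in> ext x" using xy jc[OF xy(1)] by blast
    then show ?thesis using xy by blast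
   qed
  qed
 qed
 from tower_top[OF Lc b Ds step] obtain m where m: "m \<in> ?T" "s m = m" by blast
 have mi: "idl m" using Tidl m by blast
 have mL: "ext m \<subseteq> Lc" "m \<in> pset Lc" using m unfolding tower_def by (auto simp: pset_iff)
 have mD: "m \<notin> D"
 proof
  assume h: "m \<in> D"
  have "ap ch m \<in> ext (s m)" unfolding es[OF h] using ch(2)[OF h] mi unfolding idl_def by blast
  then show False using m ch(3)[OF h] by auto
 qed
 \<comment> \<open>At the fixed point every element outside the ideal is completed to the top by a
   member of the ideal; this yields closure of the complement under meets.\<close>
 have max: "\<exists>j\<in>ext m. ext j \<union> ext a = Om" if "a \<in> Lc" "a \<notin> ext m" for a
  using mD mi mL that unfolding D_def by blast
 have uS: "Lc - ext m \<in> Sets" using Lc TU[OF m(1)] by auto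
 let ?u = "cd (Lc - ext m)"
 have eu: "ext ?u = Lc - ext m" using uS by simp
 have Ju: "J \<subseteq> ext m" using T(6)[OF m(1)] J by simp
 have "?u \<in> St" unfolding St_eq
 proof (rule CollectI, unfold eu, intro conjI ballI impI)
  show "?u \<in> pset Lc" using eu by (simp add: pset_iff)
  show "tp \<in> Lc - ext m" using mi unfolding idl_def by auto
  show "bt \<notin> Lc - ext m" using mi unfolding idl_def by auto
  show "y \<in> Lc - ext m" if "x \<in> Lc - ext m" "y \<in> Lc" "ext x \<subseteq> ext y" for x y using that mi unfolding idl_def by blast
  show "mt x y \<in> Lc - ext m" if xy: "x \<in> Lc - ext m" "y \<in> Lc - ext m" for x y
  proof -
   from xy max[of x] obtain j where j: "j \<in> ext m" "ext j \<union> ext x = Om" by blast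
   from xy max[of y] obtain k where k: "k \<in> ext m" "ext k \<union> ext y = Om" by blast
   have jk: "j \<in> Lc" "k \<in> Lc" using j k mL by auto
   have "mt x y \<notin> ext m"
   proof
    assume "mt x y \<in> ext m"
    then have "jn (jn j k) (mt x y) \<in> ext m" using mi j k unfolding idl_def by blast
    moreover have "ext (jn (jn j k) (mt x y)) = Om" using jk xy j k by auto
    then have "jn (jn j k) (mt x y) = tp" using jk xy by (intro L_eq) auto
    ultimately show False using mi unfolding idl_def by simp
   qed
   then show ?thesis using xy by blast
  qed
  show "x \<in> Lc - ext m \<or> cm x \<in> Lc - ext m" if x: "x \<in> Lc" for x
  proof (rule ccontr)
   assume "\<not> ?thesis"
   then have "x \<in> ext m" "cm x \<in> ext m" using x by auto
   then have "jn x (cm x) \<in> ext m" using mi unfolding idl_def by blast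
   moreover have "jn x (cm x) = tp" using x L_sub by (intro L_eq) auto
   ultimately show False using mi unfolding idl_def by simp
  qed
 qed
 then show ?thesis using eu Ju by blast
qed

corollary point_exists: assumes "b \<in> Lc" "b \<noteq> bt" shows "\<exists>u\<in>St. b \<in> ext u"
proof -
 let ?J = "{a \<in> Lc. ext a \<inter> ext b = {}}"
 have "ext b \<noteq> {}" using assms L_eq[of b bt] by auto
 moreover have "ext b \<subseteq> Om" using L_sub assms by blast
 ultimately have 1: "tp \<notin> ?J" by auto
 have "\<exists>u\<in>St. ext u \<inter> ?J = {}"
 proof (rule ultrafilter_exists)
  show "?J \<in> Sets" by (intro separation Lc df LU assms)
 qed (use 1 in auto)
 then obtain u where u: "u \<in> St" "ext u \<inter> ?J = {}" by blast
 have "cm b \<in> ?J" using assms by auto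
 then have "cm b \<notin> ext u" using u by blast
 then show ?thesis using u assms by (auto simp: St_cm)
qed

corollary St_ne: "\<exists>u. u \<in> St"
 using point_exists[of tp] Om_ne tp_ext bt_ext by (metis tp_L)

text \<open>If the top failed, the elements with \<open>P\<close> would form a proper ideal, and an
  ultrafilter avoiding it would contradict the local hypothesis. This is the form in which
  compactness of the Stone space is applied to continuous functions.\<close>

corollary compactness:
 assumes P: "Df (\<lambda>e. P (e 0))" and bot: "P bt" and loc: "\<And>u. u \<in> St \<Longrightarrow> \<exists>a\<in>ext u. P a"
  and dn: "\<And>a b. a \<in> Lc \<Longrightarrow> b \<in> Lc \<Longrightarrow> P a \<Longrightarrow> ext b \<subseteq> ext a \<Longrightarrow> P b"
  and jn: "\<And>a b. a \<in> Lc \<Longrightarrow> b \<in> Lc \<Longrightarrow> P a \<Longrightarrow> P b \<Longrightarrow> P (jn a b)"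
 shows "P tp"
proof (rule ccontr)
 assume "\<not> P tp"
 have "\<exists>u\<in>St. ext u \<inter> {a \<in> Lc. P a} = {}"
  by (rule ultrafilter_exists) (use \<open>\<not> P tp\<close> bot in \<open>auto intro: separation Lc P dn jn\<close>)
 then show False using loc St_sub by blast
qed

end

text \<open>A set algebra generated by a multiplicative family \<open>Gm\<close> that splits into countably many
 antichains, the antichain of an element being given by its code.\<close>

locale coded_algebra = set_algebra +
 fixes Gm :: "'a set" and cn :: 'a
 assumes Gm: "Gm \<in> Sets" and Gm_L: "Gm \<subseteq> Lc" and Gm_tp: "tp \<in> Gm"
  and Gm_mt: "\<And>a b. a \<in> Gm \<Longrightarrow> b \<in> Gm \<Longrightarrow> mt a b = bt \<or> mt a b \<in> Gm"
  and cnU: "cn \<in> U" and cn_omega: "\<And>a. a \<in> Gm \<Longrightarrow> ap cn a \<in> omega"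
  and cn_eq: "\<And>a b. a \<in> Gm \<Longrightarrow> b \<in> Gm \<Longrightarrow> a \<noteq> b \<Longrightarrow> ap cn a = ap cn b \<Longrightarrow> mt a b = bt"
  and Gm_gen: "\<And>S. S \<in> Sets \<Longrightarrow> Gm \<subseteq> S \<Longrightarrow> (\<And>a. a \<in> S \<Longrightarrow> a \<in> Lc \<Longrightarrow> cm a \<in> S) \<Longrightarrow>
   (\<And>a b. a \<in> S \<Longrightarrow> b \<in> S \<Longrightarrow> a \<in> Lc \<Longrightarrow> b \<in> Lc \<Longrightarrow> mt a b \<in> S) \<Longrightarrow> Lc \<subseteq> S"

subsection \<open>The algebra of a compatibility relation\<close>

locale compat_algebra = zfc +
 fixes I :: "'a set" and cw :: 'a and cpt :: "'a \<Rightarrow> 'a \<Rightarrow> bool"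
 assumes I: "I \<in> Sets" and cw: "cw \<in> U" and woI: "wo I (\<lambda>x y. x \<in> ext (ap cw y))"
  and seg: "\<And>x. x \<in> I \<Longrightarrow> ext (ap cw x) \<subseteq> I" "\<And>x. x \<in> I \<Longrightarrow> countable_in (ext (ap cw x))"
  and unc: "\<not> countable_in I" and cpt: "Df (\<lambda>e. cpt (e 0) (e (Suc 0)))"
  and cpt_sym: "\<And>a b. cpt a b \<Longrightarrow> cpt b a"
begin

lemmas Dcpt[df] = Df_2[OF cpt]

definition X0 :: "'a set" where "X0 = prd omega I"

definition ok :: "'a set \<Rightarrow> bool" where
 "ok s \<longleftrightarrow> (\<forall>z\<in>s. \<forall>w\<in>s. z \<noteq> w \<longrightarrow> p1 z \<noteq> p1 w \<and> cpt (p2 z) (p2 w))"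

definition Om :: "'a set" where "Om = {s \<in> Fin X0. ok (ext s)}"

text \<open>Membership in \<open>a\<close> depends only on the trace of \<open>f\<close> on
  \<open>s\<close>. The algebra \<open>Lc\<close> is defined as all sets of finite support, which
  makes the closure properties easy; \<open>gen_induct\<close> shows that the sets
  \<open>gn n a\<close> generate it.\<close>

definition supp :: "'a \<Rightarrow> 'a \<Rightarrow> bool" where
 "supp a s \<longleftrightarrow> (\<forall>f\<in>Om. \<forall>g\<in>Om. ext f \<inter> ext s = ext g \<inter> ext s \<longrightarrow> (f \<in> ext a \<longleftrightarrow> g \<in> ext a))"

definition Lc :: "'a set" where "Lc = {a \<in> pset Om. \<exists>s\<in>Fin X0. supp a s}"

lemma Df_ok[df]: assumes "DS S" shows "Df (\<lambda>e. ok (S e))"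
 unfolding ok_def by (intro df assms assms[THEN DS_weaken])

lemma X0[simp, intro]: "X0 \<in> Sets" unfolding X0_def using I by auto
lemma OmS[simp, intro]: "Om \<in> Sets" unfolding Om_def by (intro separation df) auto
lemma Df_supp[df]: assumes "DT t" "DT u" shows "Df (\<lambda>e. supp (t e) (u e))"
 unfolding supp_def by (intro df assms assms[THEN DT_weaken] OmS)
lemma LcS[simp, intro]: "Lc \<in> Sets" unfolding Lc_def by (rule separation) (auto intro!: df)

lemma Om_iff: "f \<in> Om \<longleftrightarrow> f \<in> U \<and> ext f \<subseteq> X0 \<and> finite_in (ext f) \<and> ok (ext f)"
 unfolding Om_def by (auto simp: Fin_iff)

lemma OmU: "f \<in> Om \<Longrightarrow> f \<in> U" by (simp add: Om_iff)

lemma Lc_I: assumes "S \<in> Sets" "S \<subseteq> Om" "s \<in> Fin X0"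
  "\<And>f g. f \<in> Om \<Longrightarrow> g \<in> Om \<Longrightarrow> ext f \<inter> ext s = ext g \<inter> ext s \<Longrightarrow> f \<in> S \<Longrightarrow> g \<in> S"
 shows "cd S \<in> Lc" "supp (cd S) s"
proof -
 show "supp (cd S) s" unfolding supp_def ext_cd[OF assms(1)] using assms(4) by metis
 then show "cd S \<in> Lc" unfolding Lc_def using assms(1-3) by (auto simp: pset_iff)
qed

lemma FinX_Un: assumes "s \<in> Fin X0" "t \<in> Fin X0" shows "cd (ext s \<union> ext t) \<in> Fin X0" "ext (cd (ext s \<union> ext t)) = ext s \<union> ext t"
 using assms by (auto simp: Fin_iff)

sublocale set_algebra U E Om Lc
proof unfold_locales
 show "Om \<in> Sets" "Lc \<in> Sets" by auto
 show "Lc \<subseteq> pset Om" by (auto simp: Lc_def)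
 have e: "cd {} \<in> Fin X0" by (simp add: Fin_iff)
 show "cd Om \<in> Lc" by (rule Lc_I[OF OmS order_refl e]) auto
 have "cd {} \<in> Om" by (simp add: Om_iff ok_def)
 then show "Om \<noteq> {}" by blast
 fix a assume a: "a \<in> Lc"
 then obtain s where s: "s \<in> Fin X0" "supp a s" and aU: "a \<in> U" unfolding Lc_def by (auto simp: pset_iff)
 show "cd (Om - ext a) \<in> Lc"
 proof (rule Lc_I(1)[OF _ _ s(1)])
  fix f g assume "f \<in> Om" "g \<in> Om" "ext f \<inter> ext s = ext g \<inter> ext s" "f \<in> Om - ext a"
  then show "g \<in> Om - ext a" using s(2) unfolding supp_def by blast
 qed (use aU in auto)
 fix b assume b: "b \<in> Lc"
 then obtain t where t: "t \<in> Fin X0" "supp b t" and bU: "b \<in> U" "ext b \<subseteq> Om" unfolding Lc_def by (auto simp: pset_iff)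
 show "cd (ext a \<inter> ext b) \<in> Lc"
 proof (rule Lc_I(1)[OF _ _ FinX_Un(1)[OF s(1) t(1)]])
  fix f g assume h: "f \<in> Om" "g \<in> Om" "ext f \<inter> ext (cd (ext s \<union> ext t)) = ext g \<inter> ext (cd (ext s \<union> ext t))" "f \<in> ext a \<inter> ext b"
  then have "ext f \<inter> ext s = ext g \<inter> ext s" "ext f \<inter> ext t = ext g \<inter> ext t" unfolding FinX_Un(2)[OF s(1) t(1)] by blast+
  then show "g \<in> ext a \<inter> ext b" using s(2) t(2) h unfolding supp_def by blast
 qed (use aU bU in auto)
qed

definition cell :: "'a \<Rightarrow> 'a" where "cell s = cd {f \<in> Om. ext s \<subseteq> ext f}"

lemma DT_cell[df]: "DT t \<Longrightarrow> DT (\<lambda>e. cell (t e))"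
 unfolding cell_def by (intro df OmS DT_weaken[of t Suc])

lemma cell_ext[simp]: assumes "s \<in> U" shows "ext (cell s) = {f \<in> Om. ext s \<subseteq> ext f}"
proof -
 have "{f \<in> Om. ext s \<subseteq> ext f} \<in> Sets" by (intro separation df assms) auto
 then show ?thesis unfolding cell_def by simp
qed

lemma cell_L[simp, intro]: assumes "s \<in> Fin X0" shows "cell s \<in> Lc"
 unfolding cell_def
proof (rule Lc_I(1)[OF _ _ assms])
 show "{f \<in> Om. ext s \<subseteq> ext f} \<in> Sets" by (intro separation df) (use assms in \<open>auto simp: Fin_iff\<close>)
qed auto

lemma Om_Fin: "s \<in> Om \<Longrightarrow> s \<in> Fin X0" by (simp add: Om_def)

lemma X0U: "z \<in> X0 \<Longrightarrow> z \<in> U" using Sets_U[OF X0] .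
lemma IU: "a \<in> I \<Longrightarrow> a \<in> U" using Sets_U[OF I] .

definition sg :: "'a \<Rightarrow> 'a" where "sg z = cd {z}"

lemma sg_ext[simp]: "z \<in> U \<Longrightarrow> ext (sg z) = {z}" using Sets_pair[of z z] by (simp add: sg_def)
lemma sg_U[simp, intro]: "sg z \<in> U" by (simp add: sg_def)
lemma DT_sg[df]: "DT t \<Longrightarrow> DT (\<lambda>e. sg (t e))" unfolding sg_def by (intro df)
lemma sg_Om[simp, intro]: "z \<in> X0 \<Longrightarrow> sg z \<in> Om"
 using X0U[of z] by (auto simp: Om_iff ok_def)

definition gn :: "'a \<Rightarrow> 'a \<Rightarrow> 'a" where "gn n a = cell (sg (pr n a))"

lemma DT_gn[df]: "DT t \<Longrightarrow> DT u \<Longrightarrow> DT (\<lambda>e. gn (t e) (u e))" unfolding gn_def by (intro df)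

lemma pr_X0: "n \<in> omega \<Longrightarrow> a \<in> I \<Longrightarrow> pr n a \<in> X0" unfolding X0_def by (auto simp: prd_iff)

lemma X0_cases: assumes "z \<in> X0" shows "p1 z \<in> omega" "p2 z \<in> I" "z = pr (p1 z) (p2 z)"
 using prdE[of z omega I] assms Sets_subset[OF I] Sets_subset[OF omega_Sets] unfolding X0_def by auto

lemma gn_L[simp, intro]: "n \<in> omega \<Longrightarrow> a \<in> I \<Longrightarrow> gn n a \<in> Lc"
 unfolding gn_def by (intro cell_L Om_Fin sg_Om pr_X0)

lemma gn_ext: "n \<in> omega \<Longrightarrow> a \<in> I \<Longrightarrow> ext (gn n a) = {f \<in> Om. pr n a \<in> ext f}"
 unfolding gn_def using X0U[OF pr_X0] by simp

lemma gn_inj: assumes "n \<in> omega" "a \<in> I" "m \<in> omega" "b \<in> I" "gn n a = gn m b" shows "n = m" "a = b"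
proof -
 have "sg (pr n a) \<in> ext (gn n a)" using assms(1,2) pr_X0 X0U by (simp add: gn_ext)
 then have "sg (pr n a) \<in> ext (gn m b)" using assms(5) by simp
 then have "pr m b \<in> ext (sg (pr n a))" unfolding gn_ext[OF assms(3,4)] by blast
 then have "pr m b = pr n a" using X0U[OF pr_X0[OF assms(1,2)]] by simp
 then show "n = m" "a = b" using pr_inj[of m b n a] assms IU omega_U by auto
qed

lemma ok_fun: "f \<in> Om \<Longrightarrow> n \<in> omega \<Longrightarrow> a \<in> I \<Longrightarrow> b \<in> I \<Longrightarrow> pr n a \<in> ext f \<Longrightarrow> pr n b \<in> ext f \<Longrightarrow> a = b"
 unfolding Om_iff ok_def by (metis IU omega_U p1 p2)

lemma gn_mt: assumes "n \<in> omega" "a \<in> I" "b \<in> I" "a \<noteq> b" shows "mt (gn n a) (gn n b) = bt"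
 using assms ok_fun by (intro L_eq) (auto simp: gn_ext)

lemma gn_ne: assumes "n \<in> omega" "a \<in> I" shows "gn n a \<noteq> bt"
proof
 assume "gn n a = bt"
 moreover have "sg (pr n a) \<in> ext (gn n a)" using assms pr_X0 X0U by (simp add: gn_ext)
 ultimately show False by simp
qed

text \<open>Induction over the support. A point \<open>z\<close> splits \<open>a\<close> into the
  part whose functions contain \<open>z\<close> and the part whose functions do not; each is cut out
  of a set supported by the remaining points.\<close>

lemma gen_induct:
 assumes S: "S \<in> Sets" and g: "\<And>n a. n \<in> omega \<Longrightarrow> a \<in> I \<Longrightarrow> gn n a \<in> S" and t: "tp \<in> S" and c: "\<And>a. a \<in> S \<Longrightarrow> a \<in> Lc \<Longrightarrow> cm a \<in> S"
  and m: "\<And>a b. a \<in> S \<Longrightarrow> b \<in> S \<Longrightarrow> a \<in> Lc \<Longrightarrow> b \<in> Lc \<Longrightarrow> mt a b \<in> S"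
 shows "Lc \<subseteq> S"
proof
 have jn: "jn a b \<in> S" if "a \<in> S" "b \<in> S" "a \<in> Lc" "b \<in> Lc" for a b
 proof -
  have "jn a b = cm (mt (cm a) (cm b))" using that L_in by (auto intro!: L_eq)
  then show ?thesis using that c m by auto
 qed
 have bS: "bt \<in> S"
 proof -
  have "bt = cm tp" by (auto intro!: L_eq)
  then show ?thesis using c t by auto
 qed
 fix a assume aL: "a \<in> Lc"
 then obtain s where s: "s \<in> Fin X0" "supp a s" unfolding Lc_def by blast
 have "finite_in (ext s)" using s by (simp add: Fin_iff)
 then have "\<forall>a\<in>Lc. (\<forall>f\<in>Om. \<forall>g\<in>Om. ext f \<inter> ext s = ext g \<inter> ext s \<longrightarrow> (f \<in> ext a \<longleftrightarrow> g \<in> ext a)) \<longrightarrow> a \<in> S"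
 proof (induction rule: finite_in_induct)
  case Df show ?case by (intro df S LcS OmS)
 next
  case empty
  show ?case
  proof (intro ballI impI)
   fix a assume a: "a \<in> Lc" "\<forall>f\<in>Om. \<forall>g\<in>Om. ext f \<inter> {} = ext g \<inter> {} \<longrightarrow> (f \<in> ext a \<longleftrightarrow> g \<in> ext a)"
   show "a \<in> S"
   proof (cases "ext a = {}")
    case True then have "a = bt" using a by (intro L_eq) auto
    then show ?thesis using bS by simp
   next
    case False
    then have "ext a = Om" using a L_sub[OF a(1)] by blast
    then have "a = tp" using a by (intro L_eq) auto
    then show ?thesis using t by simp
   qed
  qed
 next
  case (insert z F)
  have zX: "z \<in> X0" using insert(3) s by (auto simp: Fin_iff)
  have FX: "cd F \<in> Fin X0" "ext (cd F) = F" using insert s by (auto simp: Fin_iff)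
  note z = X0_cases[OF zX]
  let ?x = "gn (p1 z) (p2 z)"
  have ex: "ext ?x = {f \<in> Om. z \<in> ext f}" using gn_ext[OF z(1,2)] z(3) by simp
  have xL: "?x \<in> Lc" "?x \<in> S" using gn_L[OF z(1,2)] g[OF z(1,2)] by auto
  show ?case
  proof (intro ballI impI)
   fix a assume a: "a \<in> Lc" and h: "\<forall>f\<in>Om. \<forall>g\<in>Om. ext f \<inter> insert z F = ext g \<inter> insert z F \<longrightarrow> (f \<in> ext a \<longleftrightarrow> g \<in> ext a)"
   \<comment> \<open>Functions with the same trace on \<open>F\<close> as some member of
     \<open>a\<close> that contains \<open>z\<close>. This set is supported by \<open>F\<close> and
     coincides with \<open>a\<close> inside \<open>?x\<close>.\<close>
   let ?A1 = "{f \<in> Om. \<exists>g\<in>ext a. z \<in> ext g \<and> ext g \<inter> F = ext f \<inter> F}"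
   let ?A2 = "{f \<in> Om. \<exists>g\<in>ext a. z \<notin> ext g \<and> ext g \<inter> F = ext f \<inter> F}"
   have S12: "?A1 \<in> Sets" "?A2 \<in> Sets" by (intro separation df OmS LU[OF a] X0U[OF zX] insert(2))+
   have L1: "cd ?A1 \<in> Lc" "cd ?A2 \<in> Lc"
    by (rule Lc_I(1)[OF _ _ FX(1)], use S12 FX(2) in auto)+
   have "cd ?A1 \<in> S" "cd ?A2 \<in> S"
    using insert(6)[rule_format, OF L1(1)] insert(6)[rule_format, OF L1(2)] S12 by auto
   then have "jn (mt (cd ?A1) ?x) (mt (cd ?A2) (cm ?x)) \<in> S" using L1 xL by (intro jn m c) auto
   moreover have "a = jn (mt (cd ?A1) ?x) (mt (cd ?A2) (cm ?x))"
   proof (rule L_eq[OF a])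
    show "jn (mt (cd ?A1) ?x) (mt (cd ?A2) (cm ?x)) \<in> Lc" using L1 xL by auto
    have "ext (jn (mt (cd ?A1) ?x) (mt (cd ?A2) (cm ?x))) = (?A1 \<inter> ext ?x) \<union> (?A2 \<inter> (Om - ext ?x))"
     using L1 xL S12 by simp
    also have "\<dots> = ext a"
    proof (intro equalityI subsetI)
     fix f assume "f \<in> (?A1 \<inter> ext ?x) \<union> (?A2 \<inter> (Om - ext ?x))"
     then obtain g where g: "f \<in> Om" "g \<in> ext a" "z \<in> ext g \<longleftrightarrow> z \<in> ext f" "ext g \<inter> F = ext f \<inter> F" unfolding ex by blast
     then have "ext g \<inter> insert z F = ext f \<inter> insert z F" by blast
     then show "f \<in> ext a" using h g L_in[OF a] by blast
    next
     fix f assume "f \<in> ext a"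
     then show "f \<in> (?A1 \<inter> ext ?x) \<union> (?A2 \<inter> (Om - ext ?x))" unfolding ex using L_in[OF a] by blast
    qed
    finally show "ext a = ext (jn (mt (cd ?A1) ?x) (mt (cd ?A2) (cm ?x)))" by simp
   qed
   ultimately show "a \<in> S" by simp
  qed
 qed
 then show "a \<in> S" using aL s(2) unfolding supp_def by blast
qed

text \<open>For fixed \<open>n\<close> the sets \<open>gn n a\<close> are disjoint because a
  function has at most one value at \<open>n\<close>. The empty function lies in none of the
  generators, so no finite join of them is the top.\<close>

lemma c_algebra_L: "c_algebra L"
 unfolding c_algebra_def
proof (intro conjI boolean_L exI[of _ "\<lambda>n. cd (gn n ` I)"] ballI impI)
 have S: "gn n ` I \<in> Sets" if "n \<in> omega" for n by (intro Sets_imageT I df) (use that in auto)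
 show "fun_in omega (\<lambda>n. cd (gn n ` I))" by (intro fun_inT df I) auto
 show "antichain_of L (ext (cd (gn n ` I)))" if "n \<in> omega" for n
  unfolding antichain_of_def ext_cd[OF S[OF that]] L_simps bot_L
 proof (intro conjI ballI impI)
  show "gn n ` I \<subseteq> Lc - {bt}" using gn_L gn_ne that by auto
  fix x y assume "x \<in> gn n ` I" "y \<in> gn n ` I" "x \<noteq> y"
  then obtain a b where ab: "a \<in> I" "b \<in> I" "x = gn n a" "y = gn n b" "a \<noteq> b" by blast
  then show "x \<sqinter>\<^bsub>L\<^esub> y = bt" using gn_mt[OF that ab(1,2,5)] gn_L that by simp
 qed
 show "ext (cd (gn m ` I)) \<inter> ext (cd (gn n ` I)) = {}" if "m \<in> omega" "n \<in> omega" "m \<noteq> n" for m n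
  using S that gn_inj(1)[of m _ n] by auto
 have B: "(\<Union>n\<in>omega. ext (cd (gn n ` I))) = (\<Union>n\<in>omega. gn n ` I)" using S by simp
 show "nice L (\<Union>n\<in>omega. ext (cd (gn n ` I)))" unfolding nice_def B
 proof (intro conjI ballI impI)
  show "(\<Union>n\<in>omega. gn n ` I) \<subseteq> carrier L" using gn_L by auto
  fix F assume "F \<in> Sets" "F \<subseteq> (\<Union>n\<in>omega. gn n ` I) \<and> finite_in F"
  then have F: "F \<subseteq> (\<Union>n\<in>omega. gn n ` I)" "finite_in F" by auto
  have FL: "F \<subseteq> Lc" using F gn_L by auto
  have "\<exists>b\<in>Lc. ext b = (\<Union>a\<in>F. ext a) \<and> cd {} \<notin> ext b" using F(2)
  proof (induction rule: finite_in_induct)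
   case Df show ?case by (intro df LcS) auto
  next
   case empty show ?case by (rule bexI[of _ bt]) auto
  next
   case (insert x G)
   then obtain b where b: "b \<in> Lc" "ext b = (\<Union>a\<in>G. ext a)" "cd {} \<notin> ext b" by blast
   from insert(3) F obtain n a where n: "n \<in> omega" "a \<in> I" "x = gn n a" by blast
   then have "cd {} \<notin> ext x" by (simp add: gn_ext)
   then show ?case using b n by (intro bexI[of _ "jn x b"]) auto
  qed
  then obtain b where b: "b \<in> Lc" "ext b = (\<Union>a\<in>F. ext a)" "cd {} \<notin> ext b" by blast
  have "cd {} \<in> Om" by (simp add: Om_iff ok_def)
  then have "b \<noteq> tp" using b(3) by auto
  then show "\<Squnion>\<^bsub>L\<^esub> F \<noteq> \<top>\<^bsub>L\<^esub>" using lub_L[OF b(1) FL b(2)] by simp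
 qed
 show "generates L (\<Union>n\<in>omega. ext (cd (gn n ` I)))" unfolding generates_def B
 proof (intro ballI impI)
  fix S' assume S': "S' \<in> Sets" "subalgebra_of L S' \<and> (\<Union>n\<in>omega. gn n ` I) \<subseteq> S'"
  then have sub: "S' \<subseteq> Lc" "tp \<in> S'" "\<And>x y. x \<in> S' \<Longrightarrow> y \<in> S' \<Longrightarrow> x \<sqinter>\<^bsub>L\<^esub> y \<in> S'" "\<And>x y. x \<in> S' \<Longrightarrow> complement_of L x y \<Longrightarrow> y \<in> S'"
   unfolding subalgebra_of_def by auto
  have "Lc \<subseteq> S'"
  proof (rule gen_induct[OF S'(1)])
   show "gn n a \<in> S'" if "n \<in> omega" "a \<in> I" for n a using S' that by auto
   show "tp \<in> S'" by (rule sub)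
   show "cm a \<in> S'" if "a \<in> S'" "a \<in> Lc" for a using sub(4)[of a "cm a"] that complement_L by auto
   show "mt a b \<in> S'" if "a \<in> S'" "b \<in> S'" "a \<in> Lc" "b \<in> Lc" for a b using sub(3)[of a b] that by auto
  qed
  then show "S' = carrier L" using sub by auto
 qed
qed

text \<open>The stage at \<open>b\<close> of a filtration: elements supported by reals up to
  \<open>b\<close>. Stages are countable and increase along the well-order of \<open>I\<close>, and
  this bounds the size of the algebra.\<close>

definition Lev :: "'a \<Rightarrow> 'a set" where
 "Lev b = {a \<in> Lc. \<exists>s\<in>Fin (prd omega (insert b (ext (ap cw b)))). supp a s}"

lemma DS_Lev: "DT t \<Longrightarrow> DS (\<lambda>e. Lev (t e))"
 unfolding Lev_def by (intro df LcS omega_Sets cw DT_weaken[of t Suc])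

lemma Lev_Sets: "b \<in> I \<Longrightarrow> Lev b \<in> Sets"
 unfolding Lev_def by (intro separation df LcS omega_Sets cw IU)

text \<open>An element is determined by a finite support and by the set of traces of its members on
  that support; both range over iterated finite subsets of a countable set.\<close>

lemma Lev_countable: assumes b: "b \<in> I" shows "countable_in (Lev b)"
proof -
 let ?K = "insert b (ext (ap cw b))" let ?D = "prd omega ?K"
 have K: "?K \<in> Sets" using b IU by auto
 have "countable_in ?K"
 proof (rule countable_in_UN[of "two" _ "\<lambda>i. if i = cd {} then {b} else ext (ap cw b)"])
  show "countable_in two" using finite_countable[of two] unfolding two_def by auto
  show "DS (\<lambda>e. if e 0 = cd {} then {b} else ext (ap cw b))" by (intro df IU b cw) auto
  have "{b} \<in> Sets" using Sets_pair[of b b] IU[OF b] by simp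
  then show "(if p = cd {} then {b} else ext (ap cw b)) \<in> Sets" "countable_in (if p = cd {} then {b} else ext (ap cw b))" for p
   using seg b IU[OF b] by (auto intro: finite_countable finite_in_insert)
  show "?K \<subseteq> (\<Union>p\<in>two. if p = cd {} then {b} else ext (ap cw b))"
   by (auto simp: two_def)
 qed (use K in auto)
 then have D: "countable_in ?D" "?D \<in> Sets" using K by (auto intro: countable_in_prd)
 have DX: "?D \<subseteq> X0" unfolding X0_def prd_iff subset_iff using seg(1)[OF b] b by (metis insertE subsetD)
 have FD: "Fin ?D \<in> Sets" using D by auto
 have "\<exists>q\<in>U. \<forall>a\<in>Lev b. ap q a \<in> Fin ?D \<and> supp a (ap q a)"
  by (rule choice[OF Lev_Sets[OF b] FD]) (intro df, auto simp: Lev_def)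
 then obtain q where q: "q \<in> U" "\<And>a. a \<in> Lev b \<Longrightarrow> ap q a \<in> Fin ?D" "\<And>a. a \<in> Lev b \<Longrightarrow> supp a (ap q a)" by blast
 define tr where "tr a = (\<lambda>f. cd (ext f \<inter> ext (ap q a))) ` ext a" for a
 have Dtr: "DS (\<lambda>e. tr (e 0))" unfolding tr_def by (intro df q)
 have aU: "a \<in> U" "a \<in> Lc" if "a \<in> Lev b" for a using that LU unfolding Lev_def by auto
 have trS: "tr a \<in> Sets" if "a \<in> Lev b" for a unfolding tr_def by (intro Sets_imageT df q) (use aU[OF that] in auto)
 have trF: "cd (tr a) \<in> Fin (Fin ?D)" if a: "a \<in> Lev b" for a
 proof -
  have qa: "ext (ap q a) \<subseteq> ?D" "finite_in (ext (ap q a))" using q(2)[OF a] by (auto simp: Fin_iff)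
  have sub: "tr a \<subseteq> pset (ext (ap q a))" unfolding tr_def by (auto simp: pset_iff)
  then have "finite_in (tr a)" using finite_in_subset[OF finite_in_pset[OF qa(2)]] trS[OF a] by blast
  moreover have "tr a \<subseteq> Fin ?D"
  proof
   fix x assume x: "x \<in> tr a"
   then have "x \<in> U" "ext x \<subseteq> ext (ap q a)" using subsetD[OF sub] by (simp_all add: pset_iff)
   then show "x \<in> Fin ?D" using qa finite_in_subset[OF qa(2), of "ext x"] by (auto simp: Fin_iff)
  qed
  ultimately show ?thesis using trS[OF a] by (simp add: Fin_iff)
 qed
 show ?thesis
 proof (rule countable_inT[OF Lev_Sets[OF b], of "\<lambda>a. pr (ap q a) (cd (tr a))" "prd (Fin ?D) (Fin (Fin ?D))"])
  show "DT (\<lambda>e. pr (ap q (e 0)) (cd (tr (e 0))))" by (intro df q Dtr)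
  show "countable_in (prd (Fin ?D) (Fin (Fin ?D)))" by (rule countable_in_prd) (intro countable_in_Fin D FD Sets_Fin)+
  show "prd (Fin ?D) (Fin (Fin ?D)) \<in> Sets" using D by auto
  show "(\<lambda>a. pr (ap q a) (cd (tr a))) ` Lev b \<subseteq> prd (Fin ?D) (Fin (Fin ?D))"
   unfolding prd_iff subset_iff using q(2) trF by blast
  show "inj_on (\<lambda>a. pr (ap q a) (cd (tr a))) (Lev b)"
  proof (rule inj_onI)
   fix x y assume xy: "x \<in> Lev b" "y \<in> Lev b" "pr (ap q x) (cd (tr x)) = pr (ap q y) (cd (tr y))"
   then have e: "ap q x = ap q y" "cd (tr x) = cd (tr y)" by auto
   then have t: "tr x = tr y" using cd_inj trS xy by blast
   have sub: "ext x \<subseteq> ext y" if xy: "x \<in> Lev b" "y \<in> Lev b" "ap q x = ap q y" "tr x = tr y" for x y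
   proof
    fix f assume f: "f \<in> ext x"
    then have "cd (ext f \<inter> ext (ap q x)) \<in> tr y" using xy(4) unfolding tr_def by auto
    then obtain g where g: "g \<in> ext y" "cd (ext f \<inter> ext (ap q x)) = cd (ext g \<inter> ext (ap q y))" unfolding tr_def by blast
    have fg: "f \<in> Om" "g \<in> Om" using f g L_in aU xy by blast+
    then have "ext f \<inter> ext (ap q y) = ext g \<inter> ext (ap q y)" using g(2) xy(3) cd_inj OmU by auto
    then show "f \<in> ext y" using q(3)[OF xy(2)] fg g unfolding supp_def by blast
   qed
   show "x = y" using sub[OF xy(1,2) e(1) t] sub[OF xy(2,1) e(1)[symmetric] t[symmetric]] aU xy L_eq by blast
  qed
 qed
qed

lemma Lev_mono: assumes "b \<in> I" "c \<in> I" "c \<in> ext (ap cw b)" shows "Lev c \<subseteq> Lev b"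
proof -
 have "insert c (ext (ap cw c)) \<subseteq> insert b (ext (ap cw b))"
  using woD(3)[OF woI, of _ c b] assms seg(1) by blast
 then have "prd omega (insert c (ext (ap cw c))) \<subseteq> prd omega (insert b (ext (ap cw b)))" unfolding prd_def by blast
 then have "Fin (prd omega (insert c (ext (ap cw c)))) \<subseteq> Fin (prd omega (insert b (ext (ap cw b))))" unfolding Fin_iff subset_iff by blast
 then show ?thesis unfolding Lev_def by blast
qed

lemma I_ne: "\<exists>i. i \<in> I" using unc finite_countable[OF finite_in_empty] by (metis ex_in_conv)

lemma Lev_cover: assumes a: "a \<in> Lc" shows "\<exists>b\<in>I. a \<in> Lev b"
proof -
 from a obtain s where s: "s \<in> Fin X0" "supp a s" unfolding Lc_def by blast
 have "finite_in (ext s)" using s by (simp add: Fin_iff)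
 then have "\<exists>b\<in>I. \<forall>z\<in>ext s. p2 z = b \<or> p2 z \<in> ext (ap cw b)"
 proof (induction rule: finite_in_induct)
  case Df show ?case by (intro df I cw)
 next
  case empty show ?case using I_ne by auto
 next
  case (insert z F)
  then obtain b where b: "b \<in> I" "\<forall>z\<in>F. p2 z = b \<or> p2 z \<in> ext (ap cw b)" by blast
  have z: "p2 z \<in> I" using X0_cases[of z] insert s by (auto simp: Fin_iff)
  consider "p2 z = b \<or> p2 z \<in> ext (ap cw b)" | "b \<in> ext (ap cw (p2 z))" using woD(4)[OF woI z b(1)] by blast
  then show ?case
  proof cases
   case 1 then show ?thesis using b by auto
  next
   case 2
   have "p2 w \<in> ext (ap cw (p2 z))" if "w \<in> F" for w
    using b(2)[rule_format, OF that] 2 woD(3)[OF woI, of "p2 w" b "p2 z"] subsetD[OF seg(1)[OF b(1)]] b(1) z by auto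
   then show ?thesis using z by (intro bexI[of _ "p2 z"]) auto
  qed
 qed
 then obtain b where b: "b \<in> I" "\<forall>z\<in>ext s. p2 z = b \<or> p2 z \<in> ext (ap cw b)" by blast
 have "ext s \<subseteq> prd omega (insert b (ext (ap cw b)))"
 proof
  fix z assume z: "z \<in> ext s"
  then have "z \<in> X0" using s by (auto simp: Fin_iff)
  from X0_cases[OF this] z b show "z \<in> prd omega (insert b (ext (ap cw b)))" unfolding prd_iff by blast
 qed
 then have "s \<in> Fin (prd omega (insert b (ext (ap cw b))))" using s by (simp add: Fin_iff)
 then show ?thesis unfolding Lev_def using a b s by blast
qed

text \<open>Elements are ordered by a stage that contains them, then by an enumeration of that
  stage. The predecessors of \<open>x\<close> lie in the stage of \<open>x\<close>, so initial
  segments are countable, whereas \<open>gn (cd {})\<close> embeds \<open>I\<close> into the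
  algebra.\<close>

theorem size_L: "size_aleph1 Lc"
proof -
 have "\<exists>l\<in>U. \<forall>a\<in>Lc. ap l a \<in> I \<and> (a \<in> Lev (ap l a) \<and> (\<forall>c\<in>I. c \<in> ext (ap cw (ap l a)) \<longrightarrow> a \<notin> Lev c))"
 proof (rule choice[OF LcS I])
  show "Df (\<lambda>e. e 0 \<in> Lev (e (Suc 0)) \<and> (\<forall>c\<in>I. c \<in> ext (ap cw (e (Suc 0))) \<longrightarrow> e 0 \<notin> Lev c))"
   by (intro df DS_Lev I cw)
  fix a assume a: "a \<in> Lc"
  have "{b \<in> I. a \<in> Lev b} \<in> Sets" by (intro separation df DS_Lev I LU a)
  from woD(5)[OF woI this] Lev_cover[OF a] show "\<exists>b\<in>I. a \<in> Lev b \<and> (\<forall>c\<in>I. c \<in> ext (ap cw b) \<longrightarrow> a \<notin> Lev c)" by blast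
 qed
 then obtain l where l: "l \<in> U" "\<And>a. a \<in> Lc \<Longrightarrow> ap l a \<in> I" "\<And>a. a \<in> Lc \<Longrightarrow> a \<in> Lev (ap l a)" by blast
 from choose_enum[of I Lev, OF I DS_Lev[OF DT_var] Lev_Sets Lev_countable]
 obtain c where c: "c \<in> U" "\<forall>n\<in>I. inj_on (ap (ap c n)) (Lev n) \<and> ap (ap c n) ` Lev n \<subseteq> omega" by blast
 have "DT (\<lambda>e. ap (ap c (ap l (e 0))) (e 0))" by (intro df c l)
 from ap_existsT[OF LcS this] obtain en where en: "en \<in> U" "\<And>a. a \<in> Lc \<Longrightarrow> ap en a = ap (ap c (ap l a)) a" by blast
 let ?r = "\<lambda>x y. ap l x \<in> ext (ap cw (ap l y)) \<or> (ap l x = ap l y \<and> ap en x \<in> ext (ap en y))"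
 have w: "wo Lc ?r"
 proof (rule wo_lex[OF woI LcS l(1,2) en(1)])
  fix x assume x: "x \<in> Lc"
  show "ap en x \<in> omega" using en(2)[OF x] c l(2,3)[OF x] by auto
  fix y assume y: "y \<in> Lc" and e: "ap l x = ap l y" "ap en x = ap en y"
  have "inj_on (ap (ap c (ap l x))) (Lev (ap l x))" using c l(2)[OF x] by blast
  moreover have "ap (ap c (ap l x)) x = ap (ap c (ap l x)) y" using en(2)[OF x] en(2)[OF y] e by simp
  moreover have "x \<in> Lev (ap l x)" "y \<in> Lev (ap l x)" using l(3)[OF x] l(3)[OF y] e by simp_all
  ultimately show "x = y" by (rule inj_onD)
 qed
 show ?thesis
 proof (rule size_aleph1I[OF w])
  show "\<not> countable_in Lc"
  proof
   assume c: "countable_in Lc"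
   have "countable_in I"
    by (rule countable_inT[OF I _ c LcS, of "gn (cd {})"]) (auto intro!: df gn_L inj_onI dest: gn_inj(2)[OF omega_0 _ omega_0])
   then show False using unc by simp
  qed
  fix x assume x: "x \<in> Lc"
  show "countable_in {y \<in> Lc. ?r y x}"
  proof (rule countable_in_subset[OF Lev_countable Lev_Sets wo_below[OF w x]])
   show "ap l x \<in> I" "ap l x \<in> I" using l x by auto
   show "{y \<in> Lc. ?r y x} \<subseteq> Lev (ap l x)"
   proof
    fix y assume y: "y \<in> {y \<in> Lc. ?r y x}"
    then have "y \<in> Lc" by blast
    then have "y \<in> Lev (ap l y)" "ap l y \<in> I" using l by auto
    then show "y \<in> Lev (ap l x)" using y Lev_mono[of "ap l x" "ap l y"] l(2)[OF x] by auto
   qed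
  qed
 qed
qed

definition Cells :: "'a set" where "Cells = cell ` Om"

lemma cell_mem: "s \<in> Om \<Longrightarrow> s \<in> ext (cell s)" using OmU by simp

lemma cell_inj: assumes "s \<in> Om" "t \<in> Om" "cell s = cell t" shows "s = t"
proof -
 have "s \<in> ext (cell t)" "t \<in> ext (cell s)" using cell_mem[OF assms(1)] cell_mem[OF assms(2)] assms(3) by simp_all
 then have "ext t \<subseteq> ext s" "ext s \<subseteq> ext t" using OmU[OF assms(1)] OmU[OF assms(2)] by simp_all
 then show ?thesis using ext_inj OmU assms by blast
qed

text \<open>The code of a cell is the number of the finite domain of its function. Different
  functions with the same domain have no common extension, which is why equal codes will mean
  disjoint cells.\<close>

lemma ex_code: "\<exists>cn\<in>U. \<forall>s\<in>Om. ap cn (cell s) \<in> omega \<and>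
  (\<forall>t\<in>Om. ap cn (cell s) = ap cn (cell t) \<longrightarrow> p1 ` ext s = p1 ` ext t)"
proof -
 from countable_omega_Fin obtain k where k: "k \<in> U" "inj_on (ap k) (Fin omega)" "ap k ` Fin omega \<subseteq> omega"
  by (auto simp: countable_in_iff)
 have C: "Cells \<in> Sets" unfolding Cells_def by (intro Sets_imageT df) auto
 define g where "g a = ap k (cd (p1 ` ext (inv_into Om cell a)))" for a
 have inj: "inj_on cell Om" using cell_inj by (rule inj_onI)
 have g: "g (cell s) = ap k (cd (p1 ` ext s))" if "s \<in> Om" for s using that inj by (simp add: g_def)
 have "\<exists>cn\<in>U. \<forall>a\<in>Cells. ap cn a = g a"
 proof (rule ap_exists[OF C])
  show "Df (\<lambda>e. e 0 \<in> Cells \<and> e (Suc 0) = g (e 0))"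
  proof (rule Df_cong)
   show "Df (\<lambda>e. \<exists>s\<in>Om. e 0 = cell s \<and> e (Suc 0) = ap k (cd (p1 ` ext s)))" by (intro df OmS k)
  qed (use g in \<open>auto simp: Cells_def\<close>)
 qed (simp add: g_def)
 then obtain cn where cn: "cn \<in> U" "\<forall>a\<in>Cells. ap cn a = g a" by blast
 have v: "ap cn (cell s) = ap k (cd (p1 ` ext s))" if "s \<in> Om" for s using cn g that by (simp add: Cells_def)
 have F: "p1 ` ext s \<in> Sets" "cd (p1 ` ext s) \<in> Fin omega" if s: "s \<in> Om" for s
 proof -
  have "finite_in (p1 ` ext s)" by (intro finite_in_image df) (use s in \<open>simp add: Om_iff\<close>)
  moreover have "p1 ` ext s \<subseteq> omega" using s X0_cases(1) unfolding Om_iff by blast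
  ultimately show "p1 ` ext s \<in> Sets" "cd (p1 ` ext s) \<in> Fin omega" using finite_in_Sets by (auto simp: Fin_iff)
 qed
 show ?thesis
 proof (intro bexI[OF _ cn(1)] ballI conjI impI)
  fix s assume s: "s \<in> Om"
  show "ap cn (cell s) \<in> omega" using v[OF s] F[OF s] k by auto
  fix t assume t: "t \<in> Om" "ap cn (cell s) = ap cn (cell t)"
  then have "cd (p1 ` ext s) = cd (p1 ` ext t)" using inj_onD[OF k(2)] F s v by auto
  then show "p1 ` ext s = p1 ` ext t" using cd_inj F s t by blast
 qed
qed

lemma coded: "\<exists>cn. coded_algebra U E Om Lc Cells cn"
proof -
 from ex_code obtain cn where cnU: "cn \<in> U" and cn': "\<forall>s\<in>Om. ap cn (cell s) \<in> omega \<and>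
  (\<forall>t\<in>Om. ap cn (cell s) = ap cn (cell t) \<longrightarrow> p1 ` ext s = p1 ` ext t)" by (elim bexE)
 have cn: "cn \<in> U" "\<And>s. s \<in> Om \<Longrightarrow> ap cn (cell s) \<in> omega"
  "\<And>s t. s \<in> Om \<Longrightarrow> t \<in> Om \<Longrightarrow> ap cn (cell s) = ap cn (cell t) \<Longrightarrow> p1 ` ext s = p1 ` ext t"
  subgoal by (rule cnU)
  subgoal by (rule bspec[OF cn', THEN conjunct1])
  subgoal by (rule bspec[OF cn', THEN conjunct2, THEN bspec, THEN mp])
  done
 have "coded_algebra U E Om Lc Cells cn"
 proof unfold_locales
  show "Cells \<in> Sets" unfolding Cells_def by (intro Sets_imageT df) auto
  show "Cells \<subseteq> Lc" unfolding Cells_def using cell_L Om_Fin by auto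
  have e: "cd {} \<in> Om" by (simp add: Om_iff ok_def)
  have "tp = cell (cd {})" by (rule L_eq) (auto intro: cell_L Om_Fin e)
  then show "tp \<in> Cells" unfolding Cells_def using e by blast
  show "cn \<in> U" by (rule cn)
  show "ap cn a \<in> omega" if "a \<in> Cells" for a using that cn unfolding Cells_def by blast
  show "mt a b = bt \<or> mt a b \<in> Cells" if "a \<in> Cells" "b \<in> Cells" for a b
  proof -
   from that obtain s t where st: "s \<in> Om" "t \<in> Om" "a = cell s" "b = cell t" unfolding Cells_def by blast
   have ab: "a \<in> Lc" "b \<in> Lc" using st cell_L Om_Fin by auto
   let ?v = "cd (ext s \<union> ext t)"
   have v: "ext ?v = ext s \<union> ext t" using st OmU by simp
   have em: "ext (mt a b) = {f \<in> Om. ext ?v \<subseteq> ext f}" using ab st OmU unfolding v by auto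
   show ?thesis
   \<comment> \<open>The product of two cells is the cell of the union of their functions if this
     union is a point of \<open>Om\<close>; otherwise the product is zero.\<close>
   proof (cases "ok (ext ?v)")
    case True
    then have vO: "?v \<in> Om" using st v by (auto simp: Om_iff)
    have "mt a b = cell ?v" using em ab vO cell_L[OF Om_Fin] by (intro L_eq) auto
    then show ?thesis using vO unfolding Cells_def by blast
   next
    case False
    then have "ext (mt a b) = {}" unfolding em Om_iff ok_def by blast
    then show ?thesis using ab by (auto intro: L_eq)
   qed
  qed
  show "mt a b = bt" if ab: "a \<in> Cells" "b \<in> Cells" "a \<noteq> b" "ap cn a = ap cn b" for a b
  proof -
   from ab obtain s t where st: "s \<in> Om" "t \<in> Om" "a = cell s" "b = cell t" "s \<noteq> t" unfolding Cells_def by blast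
   have L: "a \<in> Lc" "b \<in> Lc" using st cell_L Om_Fin by auto
   have p: "p1 ` ext s = p1 ` ext t" using cn(3) st ab by blast
   have "ext (mt a b) = {}"
   proof (rule ccontr)
    assume "ext (mt a b) \<noteq> {}"
    then obtain f where f: "f \<in> Om" "ext s \<subseteq> ext f" "ext t \<subseteq> ext f" using L st OmU by auto
    have o: "z = w" if "z \<in> ext f" "w \<in> ext f" "p1 z = p1 w" for z w using f(1) that unfolding Om_iff ok_def by blast
    have "ext s \<subseteq> ext t"
    proof
     fix z assume z: "z \<in> ext s"
     then obtain w where "w \<in> ext t" "p1 z = p1 w" using p by (metis imageE imageI)
     then show "z \<in> ext t" using o[of z w] z f by blast
    qed
    moreover have "ext t \<subseteq> ext s"
    proof
     fix z assume z: "z \<in> ext t"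
     then obtain w where "w \<in> ext s" "p1 z = p1 w" using p by (metis imageE imageI)
     then show "z \<in> ext s" using o[of z w] z f by blast
    qed
    ultimately show False using st ext_inj OmU by blast
   qed
   then show ?thesis using L by (auto intro: L_eq)
  qed
  show "Lc \<subseteq> S" if S: "S \<in> Sets" "Cells \<subseteq> S" "\<And>a. a \<in> S \<Longrightarrow> a \<in> Lc \<Longrightarrow> cm a \<in> S"
   "\<And>a b. a \<in> S \<Longrightarrow> b \<in> S \<Longrightarrow> a \<in> Lc \<Longrightarrow> b \<in> Lc \<Longrightarrow> mt a b \<in> S" for S
  proof (rule gen_induct[OF S(1) _ _ S(3,4)])
   show "gn n a \<in> S" if "n \<in> omega" "a \<in> I" for n a
    using S(2) sg_Om[OF pr_X0[OF that]] unfolding Cells_def gn_def by blast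
   show "tp \<in> S" using S(2) \<open>tp \<in> Cells\<close> by blast
  qed
 qed
 then show ?thesis by blast
qed

end

subsection \<open>The generic compatibility relation\<close>

context zfc
begin

text \<open>Primitive recursion from course-of-values recursion: the union of a successor number is
  its predecessor, which gives the term \<open>pd\<close>.\<close>

lemma omega_rec:
 assumes a: "a \<in> U" and h: "DT (\<lambda>e. h (e 0) (e (Suc 0)))"
 shows "\<exists>c\<in>U. ap c (cd {}) = a \<and> (\<forall>n\<in>omega. ap c (sc n) = h n (ap c n))"
proof -
 have hU: "h x y \<in> U" if "x \<in> U" "y \<in> U" for x y
  using DT_U[OF h, of "case_nat x (\<lambda>_. y)"] that by (auto split: nat.splits simp: image_subset_iff)
 have Dh: "DT (\<lambda>e. h (t e) (u e))" if "DT t" "DT u" for t u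
 proof (rule DT_2[OF _ hU that])
  show "Df (\<lambda>e. e 0 = h (e (Suc 0)) (e (Suc (Suc 0))))" using h unfolding DT_def by auto
 qed
 define pd where "pd n = cd (\<Union>x\<in>ext n. ext x)" for n
 have pd: "pd (sc n) = n" if n: "n \<in> omega" for n
 proof -
  have "(\<Union>x\<in>ext (sc n). ext x) = ext n" using nat_trans[OF n] n by (auto simp: omega_U)
  then show ?thesis using n by (simp add: pd_def omega_U)
 qed
 have "\<exists>c\<in>U. \<forall>n\<in>omega. ap c n = (if n = cd {} then a else h (pd n) (ap (restr c {m \<in> omega. m \<in> ext n}) (pd n)))"
 proof (rule recursion[OF omega_Sets woD(2,3,5)[OF wo_omega]])
  show "DT (\<lambda>e. if e 0 = cd {} then a else h (pd (e 0)) (ap (e (Suc 0)) (pd (e 0))))"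
   unfolding pd_def by (intro df Dh a) auto
 qed
 then obtain c where c: "c \<in> U" "\<And>n. n \<in> omega \<Longrightarrow> ap c n = (if n = cd {} then a else h (pd n) (ap (restr c {m \<in> omega. m \<in> ext n}) (pd n)))" by blast
 have "ap c (sc n) = h n (ap c n)" if n: "n \<in> omega" for n
 proof -
  let ?B = "{m \<in> omega. m \<in> ext (sc n)}"
  have B: "?B \<in> Sets" by (intro separation df) auto
  have "n \<in> ?B" using n by (simp add: omega_U)
  then have "ap (restr c ?B) n = ap c n" using ap_restr[OF B c(1)] by blast
  then show ?thesis using c(2)[OF omega_sc[OF n]] pd[OF n] n by simp
 qed
 moreover have "ap c (cd {}) = a" using c(2)[OF omega_0] by simp
 ultimately show ?thesis using c(1) by blast
qed

text \<open>The splitting level of two reals, commonly written Delta.\<close>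

definition Dl :: "'a \<Rightarrow> 'a \<Rightarrow> 'a" where "Dl x y = lst (\<lambda>n. (n \<in> ext x) \<noteq> (n \<in> ext y))"

lemma Dl_U[simp, intro]: "Dl x y \<in> U" by (simp add: Dl_def)

lemma DT_Dl[df]: assumes "DT t" "DT u" shows "DT (\<lambda>e. Dl (t e) (u e))"
 unfolding Dl_def by (intro df assms[THEN DT_weaken])

lemma Dl: assumes "x \<in> pset omega" "y \<in> pset omega" "x \<noteq> y"
 shows "Dl x y \<in> omega" "(Dl x y \<in> ext x) \<noteq> (Dl x y \<in> ext y)"
proof -
 have U: "x \<in> U" "y \<in> U" "ext x \<subseteq> omega" "ext y \<subseteq> omega" using assms by (auto simp: pset_iff)
 have "ext x \<noteq> ext y" using ext_inj U assms by blast
 then obtain n where n: "(n \<in> ext x) \<noteq> (n \<in> ext y)" by blast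
 then have o: "n \<in> omega" using U by blast
 have D: "Df (\<lambda>e. (e 0 \<in> ext x) \<noteq> (e 0 \<in> ext y))" by (intro df U)
 show "Dl x y \<in> omega" "(Dl x y \<in> ext x) \<noteq> (Dl x y \<in> ext y)" unfolding Dl_def using lst(1,2)[of n "\<lambda>n. (n \<in> ext x) \<noteq> (n \<in> ext y)", OF o n D] .
qed

text \<open>The finite domain \<open>?d\<close> of \<open>p\<close> admits only finitely many
  traces, so uncountably many members of \<open>S\<close> share one. Reals with the same trace split
  outside \<open>?d\<close>, where \<open>p\<close> has made no decision.\<close>

lemma splitting:
 assumes S: "S \<in> Sets" "S \<subseteq> pset omega" "\<not> countable_in S" and p: "p \<in> cohen_conditions" and N: "N \<in> omega"
 shows "\<exists>a\<in>U. (\<forall>n\<in>ext N. ap a n \<in> S) \<and> (\<forall>n\<in>ext N. \<forall>m\<in>ext N. n \<noteq> m \<longrightarrow> ap a n \<noteq> ap a m) \<and>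
  (\<forall>i\<in>two. \<exists>q\<in>cohen_conditions. ext p \<subseteq> ext q \<and> (\<forall>n\<in>ext N. \<forall>m\<in>ext N. n \<noteq> m \<longrightarrow> pr (Dl (ap a n) (ap a m)) i \<in> ext q))"
proof -
 have p': "p \<in> U" "ext p \<subseteq> prd omega two" "finite_in (ext p)"
  "\<And>n i j. n \<in> omega \<Longrightarrow> i \<in> U \<Longrightarrow> j \<in> U \<Longrightarrow> pr n i \<in> ext p \<Longrightarrow> pr n j \<in> ext p \<Longrightarrow> i = j"
  using p unfolding cohen_conditions_eq by (auto simp: Fin_iff)
 let ?d = "p1 ` ext p"
 have fd: "finite_in ?d" by (intro finite_in_image p' df)
 then have d: "?d \<in> Sets" using finite_in_Sets by blast
 define St where "St t = {x \<in> S. ext x \<inter> ?d = ext t}" for t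
 have DSt: "DS (\<lambda>e. St (e 0))" unfolding St_def by (intro df S d)
 have StS: "St t \<in> Sets" if "t \<in> U" for t unfolding St_def by (intro separation df S d that)
 have "\<exists>t\<in>pset ?d. \<not> countable_in (St t)"
 proof (rule ccontr)
  assume "\<not> (\<exists>t\<in>pset ?d. \<not> countable_in (St t))"
  then have c: "countable_in (St t)" if "t \<in> pset ?d" for t using that by blast
  have "countable_in S"
  proof (rule countable_in_UN[OF _ _ S(1) DSt])
   show "pset ?d \<in> Sets" using d by auto
   show "countable_in (pset ?d)" by (intro finite_countable finite_in_pset fd)
   show "S \<subseteq> (\<Union>t\<in>pset ?d. St t)"
   proof
    fix x assume x: "x \<in> S"
    have xU: "x \<in> U" using x Sets_U[OF S(1)] by blast
    have i: "ext x \<inter> ?d \<in> Sets" using xU d by auto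
    have "cd (ext x \<inter> ?d) \<in> pset ?d" using i by (simp add: pset_iff)
    moreover have "x \<in> St (cd (ext x \<inter> ?d))" unfolding St_def using x i by simp
    ultimately show "x \<in> (\<Union>t\<in>pset ?d. St t)" by blast
   qed
  qed (use c StS in \<open>auto simp: pset_iff\<close>)
  then show False using S by blast
 qed
 then obtain t where tU: "t \<in> U" and t: "\<not> countable_in (St t)" by (auto simp: pset_iff)
 have "\<exists>a\<in>U. (\<forall>n\<in>ext N. ap a n \<in> St t) \<and> (\<forall>n\<in>ext N. \<forall>m\<in>ext N. n \<noteq> m \<longrightarrow> ap a n \<noteq> ap a m)"
  using N
 proof (induction rule: omega_induct)
  case Df show ?case by (intro df StS tU)
 next
  case 0 show ?case by auto
 next
  case (sc n)
  then obtain a where a: "a \<in> U" "\<forall>k\<in>ext n. ap a k \<in> St t" "\<forall>k\<in>ext n. \<forall>m\<in>ext n. k \<noteq> m \<longrightarrow> ap a k \<noteq> ap a m" by blast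
  have nU: "n \<in> U" using sc omega_U by blast
  have f: "finite_in (ap a ` ext n)" by (intro finite_in_image finite_in_nat sc df a)
  have "\<not> St t \<subseteq> ap a ` ext n" using t countable_in_subset[OF finite_countable[OF f] finite_in_Sets[OF f] StS[OF tU]] by blast
  then obtain x where x: "x \<in> St t" "x \<notin> ap a ` ext n" by blast
  have xU: "x \<in> U" using Sets_U[OF StS[OF tU]] x by blast
  from ap_upd[OF ext_Sets[OF nU] a(1) nU xU] obtain b where b: "b \<in> U" "ap b n = x" "\<forall>k\<in>ext n. k \<noteq> n \<longrightarrow> ap b k = ap a k" by blast
  have b3: "ap b k = ap a k" if "k \<in> ext n" for k using b(3) that no_self[OF nU] by metis
  show ?case
  proof (intro bexI[OF _ b(1)] conjI ballI impI)
   fix k assume "k \<in> ext (sc n)" then show "ap b k \<in> St t" using nU b(2) b3 a(2) x(1) by auto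
  next
   fix k m assume "k \<in> ext (sc n)" "m \<in> ext (sc n)" "k \<noteq> m"
   then consider "k = n" "m \<in> ext n" | "m = n" "k \<in> ext n" | "k \<in> ext n" "m \<in> ext n" "k \<noteq> m" using nU by auto
   then show "ap b k \<noteq> ap b m" using b(2) b3 a(3) x(2) by cases (metis imageI)+
  qed
 qed
 then obtain a where a: "a \<in> U" "\<And>n. n \<in> ext N \<Longrightarrow> ap a n \<in> St t" "\<And>n m. n \<in> ext N \<Longrightarrow> m \<in> ext N \<Longrightarrow> n \<noteq> m \<Longrightarrow> ap a n \<noteq> ap a m" by blast
 have aS: "ap a n \<in> S" "ap a n \<in> pset omega" "ext (ap a n) \<inter> ?d = ext t" if "n \<in> ext N" for n using a(2)[OF that] S(2) unfolding St_def by auto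
 have NS: "ext N \<in> Sets" "finite_in (ext N)" using N omega_U finite_in_nat by auto
 have q: "\<exists>q\<in>cohen_conditions. ext p \<subseteq> ext q \<and> (\<forall>n\<in>ext N. \<forall>m\<in>ext N. n \<noteq> m \<longrightarrow> pr (Dl (ap a n) (ap a m)) i \<in> ext q)" if i: "i \<in> two" for i
 proof -
  have iU: "i \<in> U" using i Sets_U[OF two_Sets] by blast
  let ?Z = "{z \<in> prd (ext N) (ext N). p1 z \<noteq> p2 z}"
  \<comment> \<open>Several pairs may split at the same place. As all of them get the same value
    \<open>i\<close>, the union with \<open>p\<close> is still a function.\<close>
  let ?R = "(\<lambda>z. pr (Dl (ap a (p1 z)) (ap a (p2 z))) i) ` ?Z"
  have Z: "?Z \<in> Sets" by (intro separation Sets_prd NS df)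
  have "finite_in ?Z" using finite_in_subset[OF finite_in_prd[OF NS(2) NS(2)] _ Z] by blast
  then have fR: "finite_in ?R" by (rule finite_in_image) (intro df a iU)
  have R: "\<exists>n\<in>ext N. \<exists>m\<in>ext N. n \<noteq> m \<and> z = pr (Dl (ap a n) (ap a m)) i" if "z \<in> ?R" for z
  proof -
   from that obtain x where x: "x \<in> prd (ext N) (ext N)" "p1 x \<noteq> p2 x" "z = pr (Dl (ap a (p1 x)) (ap a (p2 x))) i" by blast
   then obtain n m where nm: "n \<in> ext N" "m \<in> ext N" "x = pr n m" unfolding prd_iff by blast
   then have "p1 x = n" "p2 x = m" using p1 p2 in_ext_U by metis+
   then show ?thesis using x(2,3) nm by metis
  qed
  have R': "pr (Dl (ap a n) (ap a m)) i \<in> ?R" if "n \<in> ext N" "m \<in> ext N" "n \<noteq> m" for n m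
  proof (rule image_eqI)
   have "n \<in> U" "m \<in> U" using that by auto
   then show "pr (Dl (ap a n) (ap a m)) i = pr (Dl (ap a (p1 (pr n m))) (ap a (p2 (pr n m)))) i" "pr n m \<in> ?Z" using that by (auto simp: prd_iff)
  qed
  have fq: "finite_in (ext p \<union> ?R)" using fR p' by auto
  then have qS: "ext p \<union> ?R \<in> Sets" using finite_in_Sets by blast
  have nd: "Dl (ap a n) (ap a m) \<in> omega" "Dl (ap a n) (ap a m) \<notin> ?d" if "n \<in> ext N" "m \<in> ext N" "n \<noteq> m" for n m
  proof -
   note D = Dl[OF aS(2)[OF that(1)] aS(2)[OF that(2)] a(3)[OF that]]
   show "Dl (ap a n) (ap a m) \<in> omega" by (rule D)
   have "x \<in> ext (ap a n) \<longleftrightarrow> x \<in> ext (ap a m)" if "x \<in> ?d" for x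
    using aS(3)[OF \<open>n \<in> ext N\<close>] aS(3)[OF \<open>m \<in> ext N\<close>] that by (metis IntD1 IntI)
   then show "Dl (ap a n) (ap a m) \<notin> ?d" using D(2) by metis
  qed
  have pd: "n \<in> ?d" if "pr n j \<in> ext p" "n \<in> omega" "j \<in> U" for n j using that omega_U p1[of n j] by (metis imageI)
  have "cd (ext p \<union> ?R) \<in> cohen_conditions" unfolding cohen_conditions_eq mem_Collect_eq Fin_iff ext_cd[OF qS]
  proof (intro conjI fq ballI impI)
   have "?R \<subseteq> prd omega two"
   proof
    fix z assume "z \<in> ?R"
    from R[OF this] obtain x y where xy: "x \<in> ext N" "y \<in> ext N" "x \<noteq> y" "z = pr (Dl (ap a x) (ap a y)) i" by (elim bexE conjE)
    then show "z \<in> prd omega two" unfolding prd_iff using nd(1)[OF xy(1-3)] i by blast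
   qed
   then show "ext p \<union> ?R \<subseteq> prd omega two" using p'(2) by simp
   fix n j k assume h: "n \<in> omega" "j \<in> U" "k \<in> U" "pr n j \<in> ext p \<union> ?R \<and> pr n k \<in> ext p \<union> ?R"
   have r: "l = i \<and> n \<notin> ?d" if "pr n l \<in> ?R" "l \<in> U" for l
   proof -
    from R[OF that(1)] obtain x y where xy: "x \<in> ext N" "y \<in> ext N" "x \<noteq> y" "pr n l = pr (Dl (ap a x) (ap a y)) i" by blast
    then have "n = Dl (ap a x) (ap a y)" "l = i" using pr_inj[OF omega_U[OF h(1)] that(2) Dl_U iU, of "ap a x" "ap a y"] by simp_all
    then show ?thesis using nd(2)[OF xy(1-3)] by simp
   qed
   show "j = k"
   proof (cases "n \<in> ?d")
    case True
    have e: "pr n l \<in> ext p" if "pr n l \<in> ext p \<union> ?R" "l \<in> U" for l using that r[OF _ that(2)] True by (elim UnE) simp_all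
    show ?thesis by (rule p'(4)[OF h(1-3) e[OF conjunct1[OF h(4)] h(2)] e[OF conjunct2[OF h(4)] h(3)]])
   next
    case False
    have e: "l = i" if "pr n l \<in> ext p \<union> ?R" "l \<in> U" for l using that r[OF _ that(2)] pd[OF _ h(1) that(2)] False by (elim UnE) simp_all
    show ?thesis using e[OF conjunct1[OF h(4)] h(2)] e[OF conjunct2[OF h(4)] h(3)] by simp
   qed
  qed auto
  then show ?thesis using R' qS by (intro bexI[of _ "cd (ext p \<union> ?R)"]) auto
 qed
 show ?thesis using a aS q by (intro bexI[OF _ a(1)]) auto
qed

end

locale cohen_reals = cohen +
 fixes I :: "'a set" and cw :: 'a
 assumes IV: "I \<in> V.Sets" and cwV: "cw \<in> V" and Isub: "I \<subseteq> V.pset V.omega" and Iunc: "\<not> V.countable_in I"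
  and Iwo: "V.wo I (\<lambda>x y. x \<in> V.ext (V.ap cw y))"
  and Iseg: "\<And>x. x \<in> I \<Longrightarrow> V.ext (V.ap cw x) \<subseteq> I" "\<And>x. x \<in> I \<Longrightarrow> V.countable_in (V.ext (V.ap cw x))"
begin

definition Coh :: "'a set" where "Coh = {n \<in> W.omega. \<exists>p\<in>GG. W.pr n (W.sc (W.cd {})) \<in> W.ext p}"

definition cpt :: "'a \<Rightarrow> 'a \<Rightarrow> bool" where "cpt x y \<longleftrightarrow> x \<noteq> y \<and> W.Dl x y \<in> Coh"

lemma CohW: "Coh \<in> W.Sets" unfolding Coh_def by (intro W.separation df W.omega_Sets GW) auto

lemma IinV: "x \<in> I \<Longrightarrow> x \<in> V" using V.Sets_U[OF IV] .

lemma ord_eq: "x \<in> I \<Longrightarrow> V.ext (V.ap cw x) = W.ext (W.ap cw x)"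
 using ap_V[OF cwV IinV] V.ap_U[of cw x] by simp

text \<open>Minima have to be found again, because \<open>W\<close> may have more subsets of
  \<open>I\<close>. The collapse formed in the ground model turns the order into membership, and
  foundation in \<open>W\<close> supplies the minima.\<close>

lemma wo_W: "W.wo I (\<lambda>x y. x \<in> W.ext (W.ap cw y))"
proof -
 let ?r = "\<lambda>x y. x \<in> V.ext (V.ap cw y)" and ?s = "\<lambda>x y. x \<in> W.ext (W.ap cw y)"
 have e: "?r x y \<longleftrightarrow> ?s x y" if "y \<in> I" for x y using ord_eq[OF that] by simp
 from V.mostowski[OF Iwo] obtain c where c: "c \<in> V" "\<And>x. x \<in> I \<Longrightarrow> V.ext (V.ap c x) = V.ap c ` {y \<in> I. ?r y x}" by blast
 have c1: "V.ap c x = W.ap c x" if "x \<in> I" for x using c IinV that by simp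
 have c2: "W.ap c y \<in> W.ext (W.ap c x)" if "x \<in> I" "y \<in> I" "?s y x" for x y
 proof -
  have "V.ap c y \<in> V.ext (V.ap c x)" using c(2)[OF that(1)] that e by blast
  then show ?thesis using c1 that ext_V[OF V.ap_U[of c x]] by simp
 qed
 show ?thesis unfolding W.wo_def
 proof (intro conjI ballI impI)
  show "I \<in> W.Sets" using IV by simp
  show "W.Df (\<lambda>e. ?s (e 0) (e (Suc 0)))" using cwV by (intro df) auto
  show "?s x z" if "x \<in> I" "y \<in> I" "z \<in> I" "?s x y" "?s y z" for x y z using V.woD(3)[OF Iwo that(1-3)] e that by blast
  show "?s x y \<or> x = y \<or> ?s y x" if "x \<in> I" "y \<in> I" for x y using V.woD(4)[OF Iwo that] e that by blast
  fix B assume B: "B \<in> W.Sets" "B \<subseteq> I" "B \<noteq> {}"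
  have "W.ap c ` B \<in> W.Sets" using c by (intro W.Sets_imageT B df) auto
  from W.foundation[OF this] B obtain m where m: "m \<in> B" "W.ext (W.ap c m) \<inter> W.ap c ` B = {}" by blast
  have "\<not> ?s y m" if "y \<in> B" for y using c2[of m y] m that B by blast
  then show "\<exists>m\<in>B. \<forall>y\<in>B. \<not> ?s y m" using m by blast
 qed
qed

sublocale A: compat_algebra W E I cw cpt
proof unfold_locales
 show "I \<in> W.Sets" "cw \<in> W" using IV cwV by auto
 show "W.wo I (\<lambda>x y. x \<in> W.ext (W.ap cw y))" by (rule wo_W)
 show "\<not> W.countable_in I" by (rule uncountable_preserved[OF IV Iunc])
 show "W.ext (W.ap cw x) \<subseteq> I" if "x \<in> I" for x using Iseg(1)[OF that] ord_eq[OF that] by simp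
 show "W.countable_in (W.ext (W.ap cw x))" if "x \<in> I" for x
  using countable_V[OF Iseg(2)[OF that]] V.ext_Sets[OF V.ap_U[of cw x]] ord_eq[OF that] by simp
 show "W.Df (\<lambda>e. cpt (e 0) (e (Suc 0)))" unfolding cpt_def by (intro df CohW)
 show "cpt y x" if "cpt x y" for x y 
 proof -
  have "(\<lambda>n. (n \<in> W.ext y) \<noteq> (n \<in> W.ext x)) = (\<lambda>n. (n \<in> W.ext x) \<noteq> (n \<in> W.ext y))" by auto
  then show ?thesis using that unfolding cpt_def W.Dl_def by metis
 qed
qed

lemma Dl_V: assumes "x \<in> V" "y \<in> V" shows "V.Dl x y = W.Dl x y"
proof -
 let ?S = "{m \<in> V.omega. \<forall>k\<in>insert m (V.ext m). \<not> ((k \<in> V.ext x) \<noteq> (k \<in> V.ext y))}"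
 have S: "?S \<in> V.Sets" by (intro V.separation df assms V.omega_Sets)
 have "?S = {m \<in> W.omega. \<forall>k\<in>insert m (W.ext m). \<not> ((k \<in> W.ext x) \<noteq> (k \<in> W.ext y))}"
  unfolding omega_V ext_V[OF assms(1)] ext_V[OF assms(2)]
 proof (intro Collect_cong conj_cong refl)
  fix m assume "m \<in> W.omega"
  then have "m \<in> V" using V.omega_U[of m] by simp
  then show "(\<forall>k\<in>insert m (V.ext m). \<not> ((k \<in> W.ext x) \<noteq> (k \<in> W.ext y))) = (\<forall>k\<in>insert m (W.ext m). \<not> ((k \<in> W.ext x) \<noteq> (k \<in> W.ext y)))" using ext_V[of m] by simp
 qed
 then show ?thesis unfolding V.Dl_def W.Dl_def V.lst_def W.lst_def using cd_V[OF S] by simp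
qed

text \<open>The density argument in ground model terms: \<open>s\<close> holds the partial sums of
  the vectors assigned by \<open>g\<close>, formed with the addition table \<open>ad\<close> from
  the start value \<open>z\<close>. Whether the sum lies in \<open>R\<close> is settled in
  \<open>V\<close>, and the condition is extended accordingly.\<close>

lemma generic_sequence:
 assumes S: "S \<in> V.Sets" "S \<subseteq> I" "\<not> V.countable_in S" and N: "N \<in> W.omega"
  and ad: "ad \<in> V" "z \<in> V" "g \<in> V" and R: "R \<in> V.Sets"
 shows "\<exists>a\<in>V. \<exists>s\<in>V. (\<forall>n\<in>W.ext N. W.ap a n \<in> S) \<and> (\<forall>n\<in>W.ext N. \<forall>m\<in>W.ext N. n \<noteq> m \<longrightarrow> W.ap a n \<noteq> W.ap a m) \<and>
  W.ap s (W.cd {}) = z \<and> (\<forall>n\<in>W.ext N. W.ap s (W.sc n) = W.ap ad (W.pr (W.ap s n) (W.ap g (W.ap a n)))) \<and>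
  ((W.ap s N \<in> R \<and> (\<forall>n\<in>W.ext N. \<forall>m\<in>W.ext N. n \<noteq> m \<longrightarrow> cpt (W.ap a n) (W.ap a m))) \<or>
   (W.ap s N \<notin> R \<and> (\<forall>n\<in>W.ext N. \<forall>m\<in>W.ext N. n \<noteq> m \<longrightarrow> \<not> cpt (W.ap a n) (W.ap a m))))"
proof -
 let ?o = "V.cd {}" and ?i = "V.sc (V.cd {})"
 have NV: "N \<in> V.omega" "N \<in> V" using N V.omega_U by auto
 have two: "?o \<in> V.two" "?i \<in> V.two" "?o \<noteq> ?i" unfolding V.two_def using V.sc_ne_0[of ?o] by auto
 define ok where "ok a s \<longleftrightarrow> (\<forall>n\<in>V.ext N. V.ap a n \<in> S) \<and> (\<forall>n\<in>V.ext N. \<forall>m\<in>V.ext N. n \<noteq> m \<longrightarrow> V.ap a n \<noteq> V.ap a m) \<and>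
  V.ap s ?o = z \<and> (\<forall>n\<in>V.ext N. V.ap s (V.sc n) = V.ap ad (V.pr (V.ap s n) (V.ap g (V.ap a n))))" for a s
 define say where "say q a i \<longleftrightarrow> (\<forall>n\<in>V.ext N. \<forall>m\<in>V.ext N. n \<noteq> m \<longrightarrow> V.pr (V.Dl (V.ap a n) (V.ap a m)) i \<in> V.ext q)" for q a i
 \<comment> \<open>Value 1 at the splitting levels if the sum is in \<open>R\<close> and value 0
   otherwise; later \<open>R\<close> is a set of vectors of small norm, so either choice contradicts
   an embedding.\<close>
 let ?D = "{q \<in> PP. \<exists>a\<in>V. \<exists>s\<in>V. ok a s \<and> ((V.ap s N \<in> R \<and> say q a ?i) \<or> (V.ap s N \<notin> R \<and> say q a ?o))}"
 have "\<exists>q\<in>?D. q \<in> GG"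
 proof (rule GG_dense)
  show "?D \<in> V.Sets" unfolding ok_def say_def by (intro V.separation df V.cohen_Sets NV S ad R V.cd_U V.sc_U)
  show "?D \<subseteq> PP" by blast
  fix p assume p: "p \<in> PP"
  have "S \<subseteq> V.pset V.omega" using S Isub by blast
  from V.splitting[OF S(1) this S(3) p NV(1)] obtain a where a: "a \<in> V" "\<forall>n\<in>V.ext N. V.ap a n \<in> S"
   "\<forall>n\<in>V.ext N. \<forall>m\<in>V.ext N. n \<noteq> m \<longrightarrow> V.ap a n \<noteq> V.ap a m"
   "\<forall>i\<in>V.two. \<exists>q\<in>PP. p \<ll> q \<and> say q a i" unfolding say_def by (elim bexE conjE)
  have "V.DT (\<lambda>e. V.ap ad (V.pr (e (Suc 0)) (V.ap g (V.ap a (e 0)))))" by (intro df ad a)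
  from V.omega_rec[OF ad(2) this] obtain s where s: "s \<in> V" "V.ap s ?o = z" "\<forall>n\<in>V.omega. V.ap s (V.sc n) = V.ap ad (V.pr (V.ap s n) (V.ap g (V.ap a n)))" by blast
  have ok: "ok a s" unfolding ok_def using a s V.omega_trans[OF NV(1)] by blast
  show "\<exists>q\<in>?D. p \<ll> q"
  proof (cases "V.ap s N \<in> R")
   case True
   with a(4)[rule_format, OF two(2)] a(1) s(1) ok show ?thesis by blast
  next
   case False
   with a(4)[rule_format, OF two(1)] a(1) s(1) ok show ?thesis by blast
  qed
 qed
 then obtain q a s where q: "q \<in> GG" "a \<in> V" "s \<in> V" "ok a s" "(V.ap s N \<in> R \<and> say q a ?i) \<or> (V.ap s N \<notin> R \<and> say q a ?o)" by blast
 have qV: "q \<in> PP" "q \<in> V" using q(1) GG_sub PV by auto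
 have eN: "V.ext N = W.ext N" using NV by simp
 have nV: "n \<in> V" if "n \<in> W.ext N" for n using in_ext_V[OF NV(2) that] .
 have apa: "V.ap a n = W.ap a n" "W.ap a n \<in> V" if "n \<in> W.ext N" for n
 proof -
  show "V.ap a n = W.ap a n" using q nV[OF that] by simp
  then show "W.ap a n \<in> V" using V.ap_U[of a n] by simp
 qed
 have aps: "V.ap s n = W.ap s n" "W.ap s n \<in> V" if "n \<in> V" for n
 proof -
  show "V.ap s n = W.ap s n" using q that by simp
  then show "W.ap s n \<in> V" using V.ap_U[of s n] by simp
 qed
 have aI: "W.ap a n \<in> I" if "n \<in> W.ext N" for n using q(4) that S(2) apa[OF that] unfolding ok_def eN by auto
 have D: "V.Dl (V.ap a n) (V.ap a m) = W.Dl (W.ap a n) (W.ap a m)" "V.Dl (V.ap a n) (V.ap a m) \<in> V.omega" "W.ap a n \<noteq> W.ap a m"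
  if "n \<in> W.ext N" "m \<in> W.ext N" "n \<noteq> m" for n m
 proof -
  show "V.Dl (V.ap a n) (V.ap a m) = W.Dl (W.ap a n) (W.ap a m)" using Dl_V apa that by simp
  show ne: "W.ap a n \<noteq> W.ap a m" using q(4) that apa unfolding ok_def eN by metis
  show "V.Dl (V.ap a n) (V.ap a m) \<in> V.omega" by (rule V.Dl(1)) (use aI Isub apa that ne in auto)
 qed
 have one: "cpt (W.ap a n) (W.ap a m)" if nm: "n \<in> W.ext N" "m \<in> W.ext N" "n \<noteq> m" and s: "say q a ?i" for n m
 proof -
  have "V.pr (V.Dl (V.ap a n) (V.ap a m)) ?i \<in> V.ext q" using s nm unfolding say_def eN by blast
  then have "W.pr (W.Dl (W.ap a n) (W.ap a m)) (W.sc (W.cd {})) \<in> W.ext q" using D(1)[OF nm] qV V.Dl_U[of "V.ap a n" "V.ap a m"] by simp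
  then show ?thesis unfolding cpt_def Coh_def using q(1) D[OF nm] by auto
 qed
 \<comment> \<open>A condition of the filter that says 1 at a place where \<open>q\<close> says 0
   would have no common extension with \<open>q\<close>.\<close>
 have zero: "\<not> cpt (W.ap a n) (W.ap a m)" if nm: "n \<in> W.ext N" "m \<in> W.ext N" "n \<noteq> m" and s: "say q a ?o" for n m
 proof
  let ?d = "V.Dl (V.ap a n) (V.ap a m)"
  assume "cpt (W.ap a n) (W.ap a m)"
  then obtain p where p: "p \<in> GG" "W.pr (W.Dl (W.ap a n) (W.ap a m)) (W.sc (W.cd {})) \<in> W.ext p" unfolding cpt_def Coh_def by blast
  have "p \<in> V" using p GG_sub PV by auto
  then have p2: "V.pr ?d ?i \<in> V.ext p" using p(2) D(1)[OF nm] V.Dl_U[of "V.ap a n" "V.ap a m"] by simp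
  have q2: "V.pr ?d ?o \<in> V.ext q" using s nm unfolding say_def eN by blast
  from GG_dir[OF p(1) q(1)] obtain r where r: "r \<in> GG" "p \<ll> r" "q \<ll> r" by blast
  have "r \<in> PP" using GG_sub r by blast
  then have "?i = ?o" unfolding V.cohen_conditions_eq using p2 q2 r D(2)[OF nm] V.cd_U V.sc_U by blast
  then show False using two by simp
 qed
 have "\<forall>n\<in>W.ext N. W.ap s (W.sc n) = W.ap ad (W.pr (W.ap s n) (W.ap g (W.ap a n)))"
 proof
  fix n assume n: "n \<in> W.ext N"
  have "V.ap s (V.sc n) = V.ap ad (V.pr (V.ap s n) (V.ap g (V.ap a n)))" using q(4) n unfolding ok_def eN by blast
  moreover have "V.ap g (W.ap a n) = W.ap g (W.ap a n)" "W.ap g (W.ap a n) \<in> V" using ad apa[OF n] V.ap_U[of g "W.ap a n"] by auto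
  moreover have "V.pr (W.ap s n) (W.ap g (W.ap a n)) = W.pr (W.ap s n) (W.ap g (W.ap a n))" "W.pr (W.ap s n) (W.ap g (W.ap a n)) \<in> V"
   using aps nV[OF n] calculation(3) V.pr_U[of "W.ap s n" "W.ap g (W.ap a n)"] by auto
  ultimately show "W.ap s (W.sc n) = W.ap ad (W.pr (W.ap s n) (W.ap g (W.ap a n)))"
   using apa[OF n] aps nV[OF n] aps[OF sc_in_V[OF nV[OF n]]] ad by simp
 qed
 moreover have "W.ap s (W.cd {}) = z" using q(4) aps[of "W.cd {}"] unfolding ok_def by simp
 moreover have "\<forall>n\<in>W.ext N. W.ap a n \<in> S" using q(4) apa unfolding ok_def eN by auto
 ultimately show ?thesis using q(2,3,5) D(3) one zero aps[OF NV(2)] by (intro bexI[of _ a] bexI[of _ s]) auto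
qed

text \<open>Collects the failure of any part of the conclusion for a real field \<open>R\<close>.
  Since \<open>critical\<close> then quantifies over the models, a field can be selected that
  depends on the underlying type alone.\<close>

definition refutes :: "'a ordered_ring \<Rightarrow> bool" where
 "refutes R \<longleftrightarrow> W.real_field R \<and> (\<not> W.UG R (W.C_Stone R A.L) \<or>
   (\<exists>K Z Y. V.banach_space_in K Z \<and> W.completion_of K Z R Y \<and> W.iso_embeds R (W.C_Stone R A.L) Y))"

end

section \<open>An ordered field turned into a type\<close>

definition critical :: "'a ordered_ring \<Rightarrow> bool" where
 "critical R \<longleftrightarrow> (\<exists>V W E G I cw. cohen_reals V W E G I cw \<and> cohen_reals.refutes V W E G I R)"

text \<open>No type can depend on a given field \<open>R\<close>, but the carrier of one fixed field whose choice
 depends on nothing can be made a type, on which the arithmetic of ordered fields is available.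
 Hilbert's choice operator selects a field that refutes the theorem, if there is one. The
 rationals serve as a default when no ordered field lives on the type at hand.\<close>

definition R0 :: "'a ordered_ring" where
 "R0 = (SOME R. critical R)"

typedef 'a fld = "if ordered_field (R0 :: 'a ordered_ring) then Inl ` carrier (R0 :: 'a ordered_ring) else (Inr ` UNIV :: ('a + rat) set)"
proof (cases "ordered_field (R0 :: 'a ordered_ring)")
 case True
 then interpret field "R0 :: 'a ordered_ring" by (simp add: ordered_field_def)
 show ?thesis using True zero_closed by auto
qed auto

definition rp :: "'a fld \<Rightarrow> 'a" where "rp x = projl (Rep_fld x)"
definition rq :: "'a fld \<Rightarrow> rat" where "rq x = projr (Rep_fld x)"
definition ar :: "'a \<Rightarrow> 'a fld" where "ar a = Abs_fld (Inl a)"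
definition aq :: "rat \<Rightarrow> 'a fld" where "aq a = Abs_fld (Inr a)"

abbreviation "okR (x :: 'a fld itself) \<equiv> ordered_field (R0 :: 'a ordered_ring)"

lemma rp_carrier: "ordered_field (R0 :: 'a ordered_ring) \<Longrightarrow> rp (x :: 'a fld) \<in> carrier R0"
 using Rep_fld[of x] by (auto simp: rp_def)

lemma rp_ar: "ordered_field (R0 :: 'a ordered_ring) \<Longrightarrow> a \<in> carrier R0 \<Longrightarrow> rp (ar a :: 'a fld) = a"
 by (simp add: rp_def ar_def Abs_fld_inverse)

lemma ar_rp: "ordered_field (R0 :: 'a ordered_ring) \<Longrightarrow> ar (rp x) = (x :: 'a fld)"
 using Rep_fld[of x] Rep_fld_inverse[of x] by (auto simp: rp_def ar_def)

lemma rq_aq: "\<not> ordered_field (R0 :: 'a ordered_ring) \<Longrightarrow> rq (aq a :: 'a fld) = a"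
 by (simp add: rq_def aq_def Abs_fld_inverse)

lemma aq_rq: "\<not> ordered_field (R0 :: 'a ordered_ring) \<Longrightarrow> aq (rq x) = (x :: 'a fld)"
 using Rep_fld[of x] Rep_fld_inverse[of x] by (auto simp: rq_def aq_def)

lemma rp_eq: "ordered_field (R0 :: 'a ordered_ring) \<Longrightarrow> x = y \<longleftrightarrow> rp x = rp (y :: 'a fld)"
 by (metis ar_rp)

lemma rq_eq: "\<not> ordered_field (R0 :: 'a ordered_ring) \<Longrightarrow> x = y \<longleftrightarrow> rq x = rq (y :: 'a fld)"
 by (metis aq_rq)

instantiation fld :: (type) linordered_field
begin

definition zero_fld :: "'a fld" where "0 = (if okR TYPE('a fld) then ar \<zero>\<^bsub>R0\<^esub> else aq 0)"
definition one_fld :: "'a fld" where "1 = (if okR TYPE('a fld) then ar \<one>\<^bsub>R0\<^esub> else aq 1)"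
definition plus_fld :: "'a fld \<Rightarrow> 'a fld \<Rightarrow> 'a fld" where
 "x + y = (if okR TYPE('a fld) then ar (rp x \<oplus>\<^bsub>R0\<^esub> rp y) else aq (rq x + rq y))"
definition times_fld :: "'a fld \<Rightarrow> 'a fld \<Rightarrow> 'a fld" where
 "x * y = (if okR TYPE('a fld) then ar (rp x \<otimes>\<^bsub>R0\<^esub> rp y) else aq (rq x * rq y))"
definition uminus_fld :: "'a fld \<Rightarrow> 'a fld" where
 "- x = (if okR TYPE('a fld) then ar (\<ominus>\<^bsub>R0\<^esub> rp x) else aq (- rq x))"
definition minus_fld :: "'a fld \<Rightarrow> 'a fld \<Rightarrow> 'a fld" where "x - y = x + (- y)" for x y :: "'a fld"
definition inverse_fld :: "'a fld \<Rightarrow> 'a fld" where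
 "inverse x = (if x = 0 then 0 else if okR TYPE('a fld) then ar (inv\<^bsub>R0\<^esub> rp x) else aq (inverse (rq x)))"
definition divide_fld :: "'a fld \<Rightarrow> 'a fld \<Rightarrow> 'a fld" where "x div y = x * inverse y" for x y :: "'a fld"
definition less_eq_fld :: "'a fld \<Rightarrow> 'a fld \<Rightarrow> bool" where
 "x \<le> y \<longleftrightarrow> (if okR TYPE('a fld) then rp x \<preceq>\<^bsub>R0\<^esub> rp y else rq x \<le> rq y)"
definition less_fld :: "'a fld \<Rightarrow> 'a fld \<Rightarrow> bool" where "x < y \<longleftrightarrow> x \<le> y \<and> \<not> y \<le> x" for x y :: "'a fld"
definition abs_fld :: "'a fld \<Rightarrow> 'a fld" where "\<bar>x\<bar> = (if x < 0 then - x else x)" for x :: "'a fld"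
definition sgn_fld :: "'a fld \<Rightarrow> 'a fld" where "sgn x = (if x = 0 then 0 else if 0 < x then 1 else - 1)" for x :: "'a fld"

text \<open>All laws are put into one statement so that the two interpretations of the type are
  separated only once. The last four conjuncts are demanded by the type classes of cancellation and
  of zero.\<close>

lemma fld_axioms:
 fixes a b c :: "'a fld"
 shows "a + b + c = a + (b + c) \<and> a + b = b + a \<and> 0 + a = a \<and> - a + a = 0 \<and> a * b * c = a * (b * c) \<and> a * b = b * a \<and>
  1 * a = a \<and> (a + b) * c = a * c + b * c \<and> (0 :: 'a fld) \<noteq> 1 \<and> (a \<noteq> 0 \<longrightarrow> inverse a * a = 1) \<and> a \<le> a \<and>
  (a \<le> b \<longrightarrow> b \<le> c \<longrightarrow> a \<le> c) \<and> (a \<le> b \<longrightarrow> b \<le> a \<longrightarrow> a = b) \<and> (a \<le> b \<or> b \<le> a) \<and>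
  (a \<le> b \<longrightarrow> c + a \<le> c + b) \<and> (a < b \<longrightarrow> 0 < c \<longrightarrow> c * a < c * b) \<and>
  a + b - a = b \<and> a - b - c = a - (b + c) \<and> 0 * a = 0 \<and> a * 0 = 0"
proof (cases "okR TYPE('a fld)")
 case True
 note T = True
 interpret R: field "R0 :: 'a ordered_ring" using T by (simp add: ordered_field_def)
 interpret O: total_order "order_of (R0 :: 'a ordered_ring)" using T by (simp add: ordered_field_def)
 note c = rp_carrier[OF T]
 have O: "carrier (order_of R0) = carrier R0" "le (order_of R0) = rle R0" by (simp_all add: order_of_def)
 note [simp] = c rp_ar[OF T]
 have s: "rp (0 :: 'a fld) = \<zero>\<^bsub>R0\<^esub>" "rp (1 :: 'a fld) = \<one>\<^bsub>R0\<^esub>" "\<And>x y :: 'a fld. rp (x + y) = rp x \<oplus>\<^bsub>R0\<^esub> rp y"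
  "\<And>x y :: 'a fld. rp (x * y) = rp x \<otimes>\<^bsub>R0\<^esub> rp y" "\<And>x :: 'a fld. rp (- x) = \<ominus>\<^bsub>R0\<^esub> rp x"
  "\<And>x y :: 'a fld. x \<le> y \<longleftrightarrow> rp x \<preceq>\<^bsub>R0\<^esub> rp y"
  using T by (simp_all add: zero_fld_def one_fld_def plus_fld_def times_fld_def uminus_fld_def less_eq_fld_def)
 have am: "x \<oplus>\<^bsub>R0\<^esub> z \<preceq>\<^bsub>R0\<^esub> y \<oplus>\<^bsub>R0\<^esub> z" if "x \<in> carrier R0" "y \<in> carrier R0" "z \<in> carrier R0" "x \<preceq>\<^bsub>R0\<^esub> y" for x y z :: 'a
  using T that unfolding ordered_field_def by blast
 have mm: "\<zero>\<^bsub>R0\<^esub> \<preceq>\<^bsub>R0\<^esub> x \<otimes>\<^bsub>R0\<^esub> y" if "x \<in> carrier R0" "y \<in> carrier R0" "\<zero>\<^bsub>R0\<^esub> \<preceq>\<^bsub>R0\<^esub> x" "\<zero>\<^bsub>R0\<^esub> \<preceq>\<^bsub>R0\<^esub> y" for x y :: 'a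
  using T that unfolding ordered_field_def by blast
 note e = rp_eq[OF T]
 show ?thesis
 proof (intro conjI impI)
  show "a + b + c = a + (b + c)" by (simp add: e s R.a_assoc)
  show "a + b = b + a" by (simp add: e s R.a_comm)
  show "0 + a = a" by (simp add: e s)
  show "- a + a = 0" by (simp add: e s R.l_neg)
  show "a * b * c = a * (b * c)" by (simp add: e s R.m_assoc)
  show "a * b = b * a" by (simp add: e s R.m_comm)
  show "1 * a = a" by (simp add: e s)
  show "(a + b) * c = a * c + b * c" by (simp add: e s R.l_distr)
  show "(0 :: 'a fld) \<noteq> 1" by (simp add: e s)
  show "a + b - a = b" by (simp add: e s minus_fld_def R.a_comm[of "rp a" "rp b"] R.a_assoc R.r_neg)
  show "a - b - c = a - (b + c)" by (simp add: e s minus_fld_def R.minus_add R.a_assoc)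
  show "0 * a = 0" "a * 0 = 0" by (simp_all add: e s)
  show "inverse a * a = 1" if "a \<noteq> 0"
  proof -
   have "rp a \<noteq> \<zero>\<^bsub>R0\<^esub>" using that by (simp add: e s)
   then have u: "rp a \<in> Units R0" using R.field_Units by simp
   then have "inv\<^bsub>R0\<^esub> rp a \<in> carrier R0" "inv\<^bsub>R0\<^esub> rp a \<otimes>\<^bsub>R0\<^esub> rp a = \<one>\<^bsub>R0\<^esub>" by simp_all
   then show ?thesis using that T by (simp add: e s inverse_fld_def)
  qed
  show "a \<le> a" using O.le_refl[of "rp a"] by (simp add: s O)
  show "a \<le> c" if "a \<le> b" "b \<le> c" using that O.le_trans[of "rp a" "rp b" "rp c"] by (simp add: s O)
  show "a = b" if "a \<le> b" "b \<le> a" using that O.le_antisym[of "rp a" "rp b"] by (simp add: s e O)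
  show "a \<le> b \<or> b \<le> a" using O.total_order_total[of "rp a" "rp b"] by (simp add: s O)
  show "c + a \<le> c + b" if "a \<le> b" using that am[of "rp a" "rp b" "rp c"] by (simp add: s R.a_comm)
  show "c * a < c * b" if h: "a < b" "0 < c"
  proof -
   have ab: "a \<le> b" "a \<noteq> b" and c: "0 \<le> c" "c \<noteq> 0" using h by (auto simp: less_fld_def)
   have zb: "0 \<le> b + - a" using am[of "rp a" "rp b" "rp (- a)"] ab by (simp add: s R.r_neg)
   have "0 \<le> c * (b + - a)" using mm[of "rp c" "rp (b + - a)"] c zb by (simp add: s)
   moreover have "c * (b + - a) = c * b + - (c * a)" by (simp add: e s R.r_distr R.r_minus)
   ultimately have "0 \<le> c * b + - (c * a)" by simp
   then have "rp (0 + c * a) \<preceq>\<^bsub>R0\<^esub> rp (c * b + - (c * a) + c * a)"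
    using am[of "rp 0" "rp (c * b + - (c * a))" "rp (c * a)"] by (simp add: s)
   moreover have "rp (c * b + - (c * a) + c * a) = rp (c * b)" by (simp add: s R.a_assoc R.l_neg)
   moreover have "rp (0 + c * a) = rp (c * a)" by (simp add: s)
   ultimately have le: "c * a \<le> c * b" by (simp add: s)
   have "c * a \<noteq> c * b"
   proof
    assume "c * a = c * b"
    then have "rp c \<otimes>\<^bsub>R0\<^esub> rp a = rp c \<otimes>\<^bsub>R0\<^esub> rp b" by (simp add: e s)
    moreover have "rp c \<noteq> \<zero>\<^bsub>R0\<^esub>" using c by (simp add: e s)
    ultimately have "rp a = rp b" using R.m_lcancel by simp
    then show False using ab by (simp add: e)
   qed
   moreover have "\<not> c * b \<le> c * a" using le \<open>c * a \<noteq> c * b\<close> O.le_antisym[of "rp (c * a)" "rp (c * b)"] by (auto simp: s e O)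
   ultimately show ?thesis using le by (simp add: less_fld_def)
  qed
 qed
next
 case False
 note F = False
 note [simp] = rq_aq[OF F]
 note e = rq_eq[OF F]
 have s: "rq (0 :: 'a fld) = 0" "rq (1 :: 'a fld) = 1" "\<And>x y :: 'a fld. rq (x + y) = rq x + rq y"
  "\<And>x y :: 'a fld. rq (x * y) = rq x * rq y" "\<And>x :: 'a fld. rq (- x) = - rq x"
  "\<And>x y :: 'a fld. x \<le> y \<longleftrightarrow> rq x \<le> rq y" "\<And>x y :: 'a fld. x < y \<longleftrightarrow> rq x < rq y"
  using F by (auto simp: zero_fld_def one_fld_def plus_fld_def times_fld_def uminus_fld_def less_eq_fld_def less_fld_def)
 show ?thesis
 proof (intro conjI impI)
  show "a + b + c = a + (b + c)" "a + b = b + a" "0 + a = a" "- a + a = 0" "a * b * c = a * (b * c)" "a * b = b * a"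
   "1 * a = a" "(a + b) * c = a * c + b * c" "(0 :: 'a fld) \<noteq> 1" by (simp_all add: e s algebra_simps)
  show "inverse a * a = 1" if "a \<noteq> 0" using that F by (simp add: e s inverse_fld_def)
  show "a + b - a = b" "a - b - c = a - (b + c)" "0 * a = 0" "a * 0 = 0" by (simp_all add: e s minus_fld_def)
  show "a \<le> a" "a \<le> b \<or> b \<le> a" by (auto simp: s)
  show "a \<le> c" if "a \<le> b" "b \<le> c" using that by (simp add: s)
  show "a = b" if "a \<le> b" "b \<le> a" using that by (simp add: s e)
  show "c + a \<le> c + b" if "a \<le> b" using that by (simp add: s)
  show "c * a < c * b" if "a < b" "0 < c" using that by (simp add: s)
 qed
qed

instance
proof
 fix a b c :: "'a fld"
 note x = fld_axioms[of a b c]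
 show "a + b + c = a + (b + c)" "a + b = b + a" "0 + a = a" "- a + a = 0" "a * b * c = a * (b * c)" "a * b = b * a"
  "1 * a = a" "(a + b) * c = a * c + b * c" "(0 :: 'a fld) \<noteq> 1" "a \<noteq> 0 \<Longrightarrow> inverse a * a = 1" "a \<le> a" "a \<le> b \<or> b \<le> a"
  "a \<le> b \<Longrightarrow> b \<le> c \<Longrightarrow> a \<le> c" "a \<le> b \<Longrightarrow> b \<le> a \<Longrightarrow> a = b" "a \<le> b \<Longrightarrow> c + a \<le> c + b" "a < b \<Longrightarrow> 0 < c \<Longrightarrow> c * a < c * b"
  "a + b - a = b" "a - b - c = a - (b + c)" "0 * a = 0" "a * 0 = 0"
  using x by metis+
 show "a - b = a + - b" "inverse (0 :: 'a fld) = 0" "a div b = a * inverse b" "a < b \<longleftrightarrow> a \<le> b \<and> \<not> b \<le> a"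
  "\<bar>a\<bar> = (if a < 0 then - a else a)" "sgn a = (if a = 0 then 0 else if 0 < a then 1 else - 1)"
  by (simp_all add: minus_fld_def inverse_fld_def divide_fld_def less_fld_def abs_fld_def sgn_fld_def)
qed

end

context
 assumes okR: "ordered_field (R0 :: 'a ordered_ring)"
begin

lemma rp_simps:
 shows "rp (0 :: 'a fld) = \<zero>\<^bsub>R0\<^esub>" "rp (1 :: 'a fld) = \<one>\<^bsub>R0\<^esub>"
  "rp (x + y :: 'a fld) = rp x \<oplus>\<^bsub>R0\<^esub> rp y" "rp (x * y :: 'a fld) = rp x \<otimes>\<^bsub>R0\<^esub> rp y"
  "rp (- x :: 'a fld) = \<ominus>\<^bsub>R0\<^esub> rp x" "rp (x - y :: 'a fld) = rp x \<ominus>\<^bsub>R0\<^esub> rp y"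
  "x \<noteq> 0 \<Longrightarrow> rp (inverse x :: 'a fld) = inv\<^bsub>R0\<^esub> rp x"
  "(rp x \<preceq>\<^bsub>R0\<^esub> rp y) \<longleftrightarrow> (x :: 'a fld) \<le> y" "(rp x \<prec>\<^bsub>R0\<^esub> rp y) \<longleftrightarrow> (x :: 'a fld) < y"
  "rabs R0 (rp x) = rp (\<bar>x\<bar> :: 'a fld)" "rp x = rp y \<longleftrightarrow> x = y"
proof -
 interpret R: field "R0 :: 'a ordered_ring" using okR by (simp add: ordered_field_def)
 note c = rp_carrier[OF okR] rp_ar[OF okR]
 show s: "rp (0 :: 'a fld) = \<zero>\<^bsub>R0\<^esub>" "rp (1 :: 'a fld) = \<one>\<^bsub>R0\<^esub>"
  "rp (x + y :: 'a fld) = rp x \<oplus>\<^bsub>R0\<^esub> rp y" "rp (x * y :: 'a fld) = rp x \<otimes>\<^bsub>R0\<^esub> rp y"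
  "rp (- x :: 'a fld) = \<ominus>\<^bsub>R0\<^esub> rp x" for x y
  by (simp_all only: zero_fld_def one_fld_def plus_fld_def times_fld_def uminus_fld_def okR if_True c
   R.zero_closed R.one_closed R.a_closed R.m_closed R.a_inv_closed)
 show "rp (x - y :: 'a fld) = rp x \<ominus>\<^bsub>R0\<^esub> rp y"
  by (simp only: minus_fld_def s a_minus_def)
 show "x \<noteq> 0 \<Longrightarrow> rp (inverse x :: 'a fld) = inv\<^bsub>R0\<^esub> rp x"
 proof -
  assume x: "x \<noteq> 0"
  then have "rp x \<noteq> \<zero>\<^bsub>R0\<^esub>" by (simp only: rp_eq[OF okR] s not_False_eq_True)
  then have "rp x \<in> Units R0" using R.field_Units c(1) by blast
  then show ?thesis using x by (simp only: inverse_fld_def okR if_True if_False c R.Units_inv_closed)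
 qed
 show le: "(rp x \<preceq>\<^bsub>R0\<^esub> rp y) \<longleftrightarrow> (x :: 'a fld) \<le> y" for x y by (simp only: less_eq_fld_def okR if_True)
 show "(rp x \<prec>\<^bsub>R0\<^esub> rp y) \<longleftrightarrow> (x :: 'a fld) < y" unfolding rlt_def le rp_eq[OF okR, symmetric] by (simp only: less_le)
 show "rp x = rp y \<longleftrightarrow> x = y" by (rule rp_eq[OF okR, symmetric])
 show "rabs R0 (rp x) = rp (\<bar>x\<bar> :: 'a fld)"
  unfolding rabs_def abs_fld_def s(1)[symmetric] le by (cases "x < 0") (simp_all add: s(5) not_le)
qed

end

context zfc
begin

lemma fun2_code: assumes "fun2_in S T f" "S \<in> Sets" "T \<in> Sets"
 shows "\<exists>c\<in>U. \<forall>x\<in>S. \<forall>y\<in>T. ap c (pr x y) = f x y"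
proof -
 let ?G = "{pr (pr x y) (f x y) | x y. x \<in> S \<and> y \<in> T}"
 have G: "?G \<in> Sets" and fU: "\<And>x y. x \<in> S \<Longrightarrow> y \<in> T \<Longrightarrow> f x y \<in> U" using assms by (auto simp: fun2_in_def)
 have SU: "\<And>x. x \<in> S \<Longrightarrow> x \<in> U" "\<And>x. x \<in> T \<Longrightarrow> x \<in> U" using assms Sets_U by auto
 show ?thesis
 proof (intro bexI[of _ "cd ?G"] ballI ap_unique)
  fix x y assume xy: "x \<in> S" "y \<in> T"
  show "f x y \<in> U" using fU xy .
  show "pr (pr x y) (f x y) \<in> ext (cd ?G)" using G xy by auto
  fix z assume z: "z \<in> U" "pr (pr x y) z \<in> ext (cd ?G)"
  then obtain x' y' where *: "x' \<in> S" "y' \<in> T" "pr (pr x y) z = pr (pr x' y') (f x' y')" using G by auto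
  then have "pr x y = pr x' y'" "z = f x' y'" using pr_inj[of "pr x y" z "pr x' y'" "f x' y'"] SU xy z fU by auto
  moreover from this have "x = x'" "y = y'" using pr_inj[of x y x' y'] SU xy * by auto
  ultimately show "z = f x y" by simp
 qed auto
qed

end

subsection \<open>The real field as a type\<close>

locale realf = zfc U E for U :: "'a set" and E +
 assumes rf: "real_field (R0 :: 'a ordered_ring)"
begin

abbreviation CR :: "'a set" where "CR \<equiv> carrier R0"

lemma ordR: "ordered_field (R0 :: 'a ordered_ring)" using rf by (simp add: real_field_def)

lemmas rps = rp_simps[OF ordR]
lemma rpC[simp, intro]: "rp x \<in> CR" using rp_carrier[OF ordR] .
lemma CR: "CR \<in> Sets" using rf by (simp add: real_field_def)
lemma CRU: "x \<in> CR \<Longrightarrow> x \<in> U" using Sets_U[OF CR] .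
lemma rpU[simp, intro]: "rp x \<in> U" using CRU by blast

text \<open>A retraction of \<open>U\<close> onto the field with default 0, inverse to
  \<open>rp\<close> on the carrier. It reads variables of the field type off valuations in
  \<open>U\<close>.\<close>

definition pi :: "'a \<Rightarrow> 'a fld" where "pi x = (if x \<in> CR then ar x else 0)"

lemma pi_rp[simp]: "pi (rp x) = x" by (simp add: pi_def ar_rp[OF ordR])
lemma rp_pi[simp]: "x \<in> CR \<Longrightarrow> rp (pi x) = x" by (simp add: pi_def rp_ar[OF ordR])

text \<open>Quantifiers over the type become quantifiers over \<open>U\<close>, so that properties
  written with the arithmetic of the type are expressible by formulas.\<close>

lemma allR: "(\<forall>r. Q r) \<longleftrightarrow> (\<forall>x\<in>U. Q (pi x))" by (metis pi_rp rpU)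
lemma exR: "(\<exists>r. Q r) \<longleftrightarrow> (\<exists>x\<in>U. Q (pi x))" by (metis pi_rp rpU)

definition DR :: "((nat \<Rightarrow> 'a) \<Rightarrow> 'a fld) \<Rightarrow> bool" where "DR t \<longleftrightarrow> DT (\<lambda>e. rp (t e))"

lemma DT_rp[df]: "DR t \<Longrightarrow> DT (\<lambda>e. rp (t e))" by (simp add: DR_def)

lemma DR_weaken: "DR t \<Longrightarrow> DR (\<lambda>e. t (\<lambda>n. e (f n)))"
 unfolding DR_def using DT_weaken[of "\<lambda>e. rp (t e)"] .

lemma DR_const[df]: "DR (\<lambda>e. r)" unfolding DR_def by (intro df) auto

lemma DR_pi[df]: assumes "DT t" shows "DR (\<lambda>e. pi (t e))"
proof -
 have "rp (pi x) = (if x \<in> CR then x else rp 0)" for x by (simp add: pi_def rp_ar[OF ordR])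
 then show ?thesis unfolding DR_def by (simp, intro df assms CR) auto
qed

lemma Df_Req[df]: assumes "DR t" "DR u" shows "Df (\<lambda>e. t e = u e)"
proof -
 have "Df (\<lambda>e. rp (t e) = rp (u e))" by (intro df assms)
 then show ?thesis by (simp add: rps)
qed

lemma DR_I: assumes "Df (\<lambda>e. pi (e 0) = t (sh e))" shows "DR t"
 unfolding DR_def DT_def
proof (intro conjI allI impI)
 show "Df (\<lambda>e. e 0 = rp (t (sh e)))"
 proof (rule Df_cong)
  show "Df (\<lambda>e. e 0 \<in> CR \<and> pi (e 0) = t (sh e))" by (intro df assms CR)
 qed (metis pi_rp rp_pi rpC)
qed auto

lemma Df_allR[df]: assumes "Df (\<lambda>e. Q (sh e) (pi (e 0)))" shows "Df (\<lambda>e. \<forall>r. Q e r)"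
 unfolding allR by (intro df assms)

lemma Df_exR[df]: assumes "Df (\<lambda>e. Q (sh e) (pi (e 0)))" shows "Df (\<lambda>e. \<exists>r. Q e r)"
 unfolding exR by (intro df assms)

lemma DR_op2: assumes "fun2_in CR CR f" "\<And>x y. rp (g x y) = f (rp x) (rp y)" "DR t" "DR u" shows "DR (\<lambda>e. g (t e) (u e))"
proof -
 from fun2_code[OF assms(1) CR CR] obtain c where c: "c \<in> U" "\<forall>x\<in>CR. \<forall>y\<in>CR. ap c (pr x y) = f x y" by blast
 have "rp (g x y) = ap c (pr (rp x) (rp y))" for x y using c assms(2) by simp
 then show ?thesis unfolding DR_def by (simp, intro df assms c)
qed

lemma rf_ops: "fun2_in CR CR (add R0)" "fun2_in CR CR (mult R0)" "rel_in CR (rle R0)"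
 using rf unfolding real_field_def by blast+

lemma DR_add[df]: "DR t \<Longrightarrow> DR u \<Longrightarrow> DR (\<lambda>e. t e + u e)"
 by (rule DR_op2[OF rf_ops(1) rps(3)])

lemma DR_mult[df]: "DR t \<Longrightarrow> DR u \<Longrightarrow> DR (\<lambda>e. t e * u e)"
 by (rule DR_op2[OF rf_ops(2) rps(4)])

lemma Df_le[df]: assumes "DR t" "DR u" shows "Df (\<lambda>e. t e \<le> u e)"
proof -
 have S: "{pr x y | x y. x \<in> CR \<and> y \<in> CR \<and> x \<preceq>\<^bsub>R0\<^esub> y} \<in> Sets" (is "?S \<in> _") using rf_ops(3) unfolding rel_in_def .
 have eq: "x \<le> y \<longleftrightarrow> pr (rp x) (rp y) \<in> ?S" for x y
 proof
  assume "x \<le> y"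
  then have "rp x \<preceq>\<^bsub>R0\<^esub> rp y" by (simp add: rps)
  then show "pr (rp x) (rp y) \<in> ?S" using rpC by blast
 next
  assume "pr (rp x) (rp y) \<in> ?S"
  then obtain a b where ab: "a \<in> CR" "b \<in> CR" "a \<preceq>\<^bsub>R0\<^esub> b" "pr (rp x) (rp y) = pr a b" by blast
  then have "rp x = a" "rp y = b" using pr_inj[of "rp x" "rp y" a b] CRU by auto
  then show "x \<le> y" using ab rps(8) by metis
 qed
 have "Df (\<lambda>e. pr (rp (t e)) (rp (u e)) \<in> ?S)" by (intro df S assms)
 then show ?thesis by (rule Df_cong) (rule eq)
qed

lemma Df_less[df]: assumes "DR t" "DR u" shows "Df (\<lambda>e. t e < u e)"
 unfolding less_le by (intro df assms)

lemma DR_minus[df]: assumes "DR t" shows "DR (\<lambda>e. - t e)"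
proof (rule DR_I, rule Df_cong)
 show "Df (\<lambda>e. pi (e 0) + t (sh e) = 0)" by (intro df assms[THEN DR_weaken])
qed (simp add: eq_neg_iff_add_eq_0)

lemma DR_diff[df]: assumes "DR t" "DR u" shows "DR (\<lambda>e. t e - u e)"
proof -
 have "DR (\<lambda>e. t e + (- u e))" by (intro df assms)
 then show ?thesis by simp
qed

lemma DR_inverse[df]: assumes "DR t" shows "DR (\<lambda>e. inverse (t e))"
proof (rule DR_I, rule Df_cong)
 show "Df (\<lambda>e. (t (sh e) = 0 \<and> pi (e 0) = 0) \<or> pi (e 0) * t (sh e) = 1)" by (intro df assms[THEN DR_weaken])
 fix e :: "nat \<Rightarrow> 'a"
 show "(pi (e 0) = inverse (t (sh e))) = ((t (sh e) = 0 \<and> pi (e 0) = 0) \<or> pi (e 0) * t (sh e) = 1)"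
  by (cases "t (sh e) = 0") (auto simp: field_simps)
qed

lemma DR_divide[df]: assumes "DR t" "DR u" shows "DR (\<lambda>e. t e / u e)"
 unfolding divide_inverse by (intro df assms)

lemma DR_if[df]: assumes "Df P" "DR t" "DR u" shows "DR (\<lambda>e. if P e then t e else u e)"
proof -
 have "rp (if P e then t e else u e) = (if P e then rp (t e) else rp (u e))" for e by simp
 then show ?thesis unfolding DR_def by (simp, intro df assms)
qed

lemma DR_abs[df]: assumes "DR t" shows "DR (\<lambda>e. \<bar>t e\<bar>)"
 unfolding abs_if by (intro df assms)

lemma DR_power2[df]: assumes "DR t" shows "DR (\<lambda>e. (t e)\<^sup>2)"
 unfolding power2_eq_square by (intro df assms)

definition rap :: "'a \<Rightarrow> 'a \<Rightarrow> 'a fld" where "rap c x = pi (ap c x)"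

lemma DR_rap[df]: "DT t \<Longrightarrow> DT u \<Longrightarrow> DR (\<lambda>e. rap (t e) (u e))" unfolding rap_def by (intro df)

definition mkf :: "'a set \<Rightarrow> ('a \<Rightarrow> 'a fld) \<Rightarrow> 'a" where "mkf S g = cd ((\<lambda>x. pr x (rp (g x))) ` S)"

lemma mkf_U[simp, intro]: "mkf S g \<in> U" by (simp add: mkf_def)

lemma DT_mkf[df]: assumes "DS S" "DR (\<lambda>e. g (sh e) (e 0))" shows "DT (\<lambda>e. mkf (S e) (\<lambda>x. g e x))"
 unfolding mkf_def by (intro df assms)

lemma mkf_ext: assumes "S \<in> Sets" "DR (\<lambda>e. g (e 0))" shows "ext (mkf S g) = (\<lambda>x. pr x (rp (g x))) ` S"
proof -
 have "(\<lambda>x. pr x (rp (g x))) ` S \<in> Sets" by (intro Sets_imageT df assms)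
 then show ?thesis by (simp add: mkf_def)
qed

lemma ap_mkf: assumes "S \<in> Sets" "DR (\<lambda>e. g (e 0))" "x \<in> S" shows "ap (mkf S g) x = rp (g x)"
proof (rule ap_unique)
 show "pr x (rp (g x)) \<in> ext (mkf S g)" using mkf_ext[OF assms(1,2)] assms by auto
 fix z assume z: "z \<in> U" "pr x z \<in> ext (mkf S g)"
 then obtain x' where x': "x' \<in> S" "pr x z = pr x' (rp (g x'))" using mkf_ext[OF assms(1,2)] by auto
 then show "z = rp (g x)" using pr_inj[of x z x' "rp (g x')"] z Sets_U[OF assms(1)] assms(3) by auto
qed auto

lemma rap_mkf: assumes "S \<in> Sets" "DR (\<lambda>e. g (e 0))" "x \<in> S" shows "rap (mkf S g) x = g x"
 using ap_mkf[OF assms] by (simp add: rap_def)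

lemma mkf_cong: "(\<And>x. x \<in> S \<Longrightarrow> g x = h x) \<Longrightarrow> mkf S g = mkf S h"
 unfolding mkf_def by (metis (mono_tags, lifting) image_cong)

definition lub :: "('a fld \<Rightarrow> bool) \<Rightarrow> 'a fld \<Rightarrow> bool" where
 "lub P s \<longleftrightarrow> (\<forall>r. P r \<longrightarrow> r \<le> s) \<and> (\<forall>t. (\<forall>r. P r \<longrightarrow> r \<le> t) \<longrightarrow> s \<le> t)"

lemma lub_unique: "lub P s \<Longrightarrow> lub P t \<Longrightarrow> s = t"
 unfolding lub_def by (meson antisym)

text \<open>Dedekind completeness is assumed for sets of the structure, hence it is available for
  definable \<open>P\<close> only.\<close>

lemma lub_ex: assumes P: "Df (\<lambda>e. P (pi (e 0)))" and r: "P r" and b: "\<And>r. P r \<Longrightarrow> r \<le> b"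
 shows "\<exists>s. lub P s"
proof -
 let ?S = "{x \<in> CR. P (pi x)}"
 have S: "?S \<in> Sets" by (intro separation CR P)
 have O: "carrier (order_of R0) = CR" "le (order_of R0) = rle R0" by (simp_all add: order_of_def)
 have up: "u \<in> Upper (order_of R0) ?S \<longleftrightarrow> u \<in> CR \<and> (\<forall>r. P r \<longrightarrow> r \<le> pi u)" for u
 proof
  assume u: "u \<in> Upper (order_of R0) ?S"
  then have uC: "u \<in> CR" "\<And>x. x \<in> CR \<Longrightarrow> P (pi x) \<Longrightarrow> x \<preceq>\<^bsub>R0\<^esub> u" by (auto simp: Upper_def O)
  have "r \<le> pi u" if "P r" for r using uC(2)[of "rp r"] that uC(1) rps(8)[of r "pi u"] by simp
  then show "u \<in> CR \<and> (\<forall>r. P r \<longrightarrow> r \<le> pi u)" using uC by blast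
 next
  assume u: "u \<in> CR \<and> (\<forall>r. P r \<longrightarrow> r \<le> pi u)"
  have "x \<preceq>\<^bsub>R0\<^esub> u" if "x \<in> CR" "P (pi x)" for x using u that rps(8)[of "pi x" "pi u"] by simp
  then show "u \<in> Upper (order_of R0) ?S" using u by (auto simp: Upper_def O)
 qed
 have "rp r \<in> ?S" using r by simp
 moreover have "rp b \<in> Upper (order_of R0) ?S" using b by (simp add: up)
 moreover have "\<forall>S\<in>Sets. S \<subseteq> CR \<and> S \<noteq> {} \<and> Upper (order_of R0) S \<noteq> {} \<longrightarrow> (\<exists>s. least (order_of R0) s (Upper (order_of R0) S))"
  using rf unfolding real_field_def by (elim conjE)
 ultimately have "\<exists>s. least (order_of R0) s (Upper (order_of R0) ?S)"
  using S by (metis (no_types, lifting) empty_iff mem_Collect_eq subsetI)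
 then obtain s where s: "s \<in> Upper (order_of R0) ?S" "\<And>t. t \<in> Upper (order_of R0) ?S \<Longrightarrow> s \<preceq>\<^bsub>R0\<^esub> t"
  by (auto simp: least_def O)
 have sC: "s \<in> CR" "\<forall>r. P r \<longrightarrow> r \<le> pi s" using s(1) up by auto
 have "pi s \<le> t" if "\<forall>r. P r \<longrightarrow> r \<le> t" for t
  using s(2)[of "rp t"] that sC rps(8)[of "pi s" t] by (simp add: up)
 then show ?thesis unfolding lub_def using sC by blast
qed

lemma rrec: assumes "DR (\<lambda>e. h (e 0) (pi (e (Suc 0))))"
 shows "\<exists>c\<in>U. rap c (cd {}) = r \<and> (\<forall>n\<in>omega. rap c (sc n) = h n (rap c n))"
proof -
 have "DT (\<lambda>e. rp (h (e 0) (pi (e (Suc 0)))))" by (intro df assms)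
 from omega_rec[OF rpU this, of r] obtain c where c: "c \<in> U" "ap c (cd {}) = rp r" "\<forall>n\<in>omega. ap c (sc n) = rp (h n (pi (ap c n)))" by blast
 then show ?thesis by (intro bexI[OF _ c(1)]) (simp add: rap_def)
qed

lemma iota_ex: "\<exists>c. c \<in> U \<and> rap c (cd {}) = 0 \<and> (\<forall>n\<in>omega. rap c (sc n) = rap c n + 1)"
proof -
 have "DR (\<lambda>e. pi (e (Suc 0)) + 1)" by (intro df)
 from rrec[of "\<lambda>n x. x + 1", OF this] show ?thesis by blast
qed

definition iota :: 'a where "iota = (SOME c. c \<in> U \<and> rap c (cd {}) = 0 \<and> (\<forall>n\<in>omega. rap c (sc n) = rap c n + 1))"
text \<open>The numbers of the structure as field elements. These numbers may be nonstandard, so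
  \<open>of_nat\<close> need not reach all of them.\<close>

definition nt :: "'a \<Rightarrow> 'a fld" where "nt n = rap iota n"

lemma iota: "iota \<in> U" "nt (cd {}) = 0" "n \<in> omega \<Longrightarrow> nt (sc n) = nt n + 1"
 using someI_ex[OF iota_ex] unfolding iota_def nt_def by auto

lemma DR_nt[df]: "DT t \<Longrightarrow> DR (\<lambda>e. nt (t e))" unfolding nt_def by (intro df iota)

lemma nt_nonneg: "n \<in> omega \<Longrightarrow> 0 \<le> nt n"
proof (induction rule: omega_induct)
 case Df show ?case by (intro df)
qed (auto simp: iota)

text \<open>A least upper bound \<open>s\<close> of all \<open>nt n\<close> would satisfy
  \<open>s \<le> s - 1\<close>, since the numbers are closed under successor.\<close>

lemma archimedean: "\<exists>n\<in>omega. r < nt n"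
proof (rule ccontr)
 assume c: "\<not> ?thesis"
 have "\<exists>s. lub (\<lambda>x. \<exists>n\<in>omega. x = nt n) s"
 proof (rule lub_ex)
  show "Df (\<lambda>e. \<exists>n\<in>omega. pi (e 0) = nt n)" by (intro df) auto
  show "\<exists>n\<in>omega. nt (cd {}) = nt n" by auto
  show "x \<le> r" if "\<exists>n\<in>omega. x = nt n" for x using c that by (auto simp: not_less)
 qed
 then obtain s where l: "lub (\<lambda>x. \<exists>n\<in>omega. x = nt n) s" ..
 have s: "\<And>n. n \<in> omega \<Longrightarrow> nt n \<le> s" "\<And>t. (\<And>n. n \<in> omega \<Longrightarrow> nt n \<le> t) \<Longrightarrow> s \<le> t"
  using l unfolding lub_def by auto
 have "s \<le> s - 1"
 proof (rule s(2))
  fix n assume "n \<in> omega" then show "nt n \<le> s - 1" using s(1)[of "sc n"] iota(3)[of n] by simp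
 qed
 then show False by simp
qed

text \<open>Sums over internally finite sets cannot be taken in HOL, as their extensions may be
  infinite. \<open>S\<close> is a table of the sums of \<open>k\<close> over all subsets of
  \<open>F\<close>; adding any missing element adds its term, so no order of summation has to be
  fixed.\<close>

definition good :: "'a \<Rightarrow> 'a \<Rightarrow> 'a \<Rightarrow> bool" where
 "good S k F \<longleftrightarrow> rap S (cd {}) = 0 \<and>
   (\<forall>H\<in>pset (ext F). \<forall>a\<in>ext F. a \<notin> ext H \<longrightarrow> rap S (cd (insert a (ext H))) = rap S H + rap k a)"

lemma Df_good[df]: assumes "DT t" "DT u" "DT v" shows "Df (\<lambda>e. good (t e) (u e) (v e))"
 unfolding good_def by (intro df assms assms[THEN DT_weaken]) auto

definition rs :: "'a \<Rightarrow> 'a \<Rightarrow> 'a fld" where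
 "rs k F = (if \<exists>S\<in>U. good S k F then rap (SOME S. S \<in> U \<and> good S k F) F else 0)"

lemma good_unique: assumes "finite_in H" "good S k F" "good S' k F" "H \<subseteq> ext F" "S \<in> U" "S' \<in> U"
 shows "rap S (cd H) = rap S' (cd H)"
 using assms(1)
proof (induction rule: finite_in_induct)
 case Df
 show ?case by (intro df assms)
next
 case empty then show ?case using assms by (simp add: good_def)
next
 case (insert x G)
 have "cd G \<in> pset (ext F)" "x \<in> ext F" "x \<notin> ext (cd G)" using insert assms(4) by (auto simp: pset_iff)
 then have "rap S (cd (insert x (ext (cd G)))) = rap S (cd G) + rap k x" "rap S' (cd (insert x (ext (cd G)))) = rap S' (cd G) + rap k x"
  using assms unfolding good_def by blast+
 then show ?case using insert by simp
qed

text \<open>The table for \<open>insert z F\<close> looks up the subset without \<open>z\<close> in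
  the old table and adds the term of \<open>z\<close> if \<open>z\<close> was present.\<close>

lemma good_ex: assumes "finite_in F" "k \<in> U" shows "\<exists>S\<in>U. good S k (cd F)"
 using assms(1)
proof (induction rule: finite_in_induct)
 case Df show ?case by (intro df assms)
next
 case empty
 from ap_existsT[of "{cd {}}" "\<lambda>_. rp 0"] obtain S where "S \<in> U" "ap S (cd {}) = rp 0" by (auto intro: df)
 then show ?case by (intro bexI[of _ S]) (auto simp: good_def rap_def)
next
 case (insert z F)
 then obtain S where S: "S \<in> U" "good S k (cd F)" by blast
 have zU: "z \<in> U" using insert assms finite_in_Sets Sets_U by blast
 have z: "{z} \<in> Sets" using zU Sets_pair[of z z] by simp
 define g where "g H = rap S (cd (ext H - {z})) + (if z \<in> ext H then rap k z else 0)" for H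
 have zF: "insert z F \<in> Sets" using zU insert by auto
 have Dg: "DR (\<lambda>e. g (e 0))" unfolding g_def by (intro df S zU assms z)
 let ?S = "mkf (pset (insert z F)) g"
 have r: "rap ?S H = g H" if "H \<in> pset (insert z F)" for H using rap_mkf[OF Sets_pset[OF zF] Dg that] .
 have gS: "rap S (cd {}) = 0" "\<And>H a. H \<in> pset F \<Longrightarrow> a \<in> F \<Longrightarrow> a \<notin> ext H \<Longrightarrow> rap S (cd (insert a (ext H))) = rap S H + rap k a"
  using S(2) insert(2) unfolding good_def by auto
 have "good ?S k (cd (insert z F))" unfolding good_def ext_cd[OF zF]
 proof (intro conjI ballI impI)
  have "rap ?S (cd {}) = g (cd {})" by (rule r) (simp add: pset_iff)
  then show "rap ?S (cd {}) = 0" using gS by (simp add: g_def)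
  fix H a assume H: "H \<in> pset (insert z F)" "a \<in> insert z F" "a \<notin> ext H"
  have HU: "H \<in> U" "ext H \<subseteq> insert z F" using H by (auto simp: pset_iff)
  have aU: "a \<in> U" using H zF Sets_U by blast
  have i: "insert a (ext H) \<in> Sets" using aU HU by auto
  have "cd (insert a (ext H)) \<in> pset (insert z F)" using i HU H by (simp add: pset_iff)
  then have "rap ?S (cd (insert a (ext H))) = g (cd (insert a (ext H)))" by (rule r)
  also have "\<dots> = g H + rap k a"
  proof (cases "a = z")
   case True
   have "insert a (ext H) - {z} = ext H" "ext H - {z} = ext H" using True H by auto
   then show ?thesis using True H i unfolding g_def by simp
  next
   case False
   have m: "ext H - {z} \<in> Sets" using HU z by auto
   have "insert a (ext H) - {z} = insert a (ext H - {z})" using False by auto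
   moreover have "rap S (cd (insert a (ext (cd (ext H - {z}))))) = rap S (cd (ext H - {z})) + rap k a"
    using gS(2)[of "cd (ext H - {z})" a] m HU H False by (auto simp: pset_iff)
   ultimately show ?thesis using i m False unfolding g_def by (simp add: algebra_simps)
  qed
  finally show "rap ?S (cd (insert a (ext H))) = rap ?S H + rap k a" using r[OF H(1)] by simp
 qed
 then show ?case by blast
qed

lemma rs_eq: assumes "F \<in> U" "finite_in (ext F)" "S \<in> U" "good S k F" shows "rs k F = rap S F"
proof -
 have ex: "\<exists>S. S \<in> U \<and> good S k F" using assms by blast
 have g: "(SOME S. S \<in> U \<and> good S k F) \<in> U \<and> good (SOME S. S \<in> U \<and> good S k F) k F" by (rule someI_ex[OF ex])
 then show ?thesis unfolding rs_def using good_unique[OF assms(2), of "SOME S. S \<in> U \<and> good S k F" k F S] assms ex by auto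
qed

text \<open>For finite sets the value does not depend on the table that \<open>rs\<close> picks, and
  the existence of a table with a given value is expressible. The guard gives the remaining sets the
  value 0.\<close>

lemma DR_rs: assumes "DT t" "DT u" shows "DR (\<lambda>e. if finite_in (ext (u e)) then rs (t e) (u e) else 0)"
proof (rule DR_I, rule Df_cong)
 let ?t = "\<lambda>e. t (sh e)" and ?u = "\<lambda>e. u (sh e)"
 show "Df (\<lambda>e. (finite_in (ext (?u e)) \<and> (\<exists>S\<in>U. good S (?t e) (?u e) \<and> pi (e 0) = rap S (?u e))) \<or>
   (\<not> finite_in (ext (?u e)) \<and> pi (e 0) = 0))"
  by (intro df assms[THEN DT_weaken])
 fix e :: "nat \<Rightarrow> 'a" assume e: "range e \<subseteq> U"
 have U: "?t e \<in> U" "?u e \<in> U" using DT_U[OF assms(1) range_Suc[OF e, of Suc]] DT_U[OF assms(2) range_Suc[OF e, of Suc]] by simp_all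
 show "(pi (e 0) = (if finite_in (ext (?u e)) then rs (?t e) (?u e) else 0)) =
  ((finite_in (ext (?u e)) \<and> (\<exists>S\<in>U. good S (?t e) (?u e) \<and> pi (e 0) = rap S (?u e))) \<or> (\<not> finite_in (ext (?u e)) \<and> pi (e 0) = 0))"
 proof (cases "finite_in (ext (?u e))")
  case True
  from good_ex[OF True U(1)] U obtain S where S: "S \<in> U" "good S (?t e) (?u e)" by auto
  have "rs (?t e) (?u e) = rap S' (?u e)" if "S' \<in> U" "good S' (?t e) (?u e)" for S' using rs_eq[OF U(2) True that] .
  with True S show ?thesis by metis
 qed simp
qed

definition rsum :: "('a \<Rightarrow> 'a fld) \<Rightarrow> 'a set \<Rightarrow> 'a fld" where
 "rsum g F = (if finite_in (ext (cd F)) then rs (mkf F g) (cd F) else 0)"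

lemma DR_rsum[df]: assumes "DS F" "DR (\<lambda>e. g (sh e) (e 0))" shows "DR (\<lambda>e. rsum (\<lambda>a. g e a) (F e))"
 unfolding rsum_def by (rule DR_rs) (intro df assms)+

context
 fixes g assumes g: "DR (\<lambda>e. g (e 0))"
begin

lemma rsum_empty[simp]: "rsum g {} = 0"
proof -
 from good_ex[OF finite_in_empty mkf_U] obtain S where S: "S \<in> U" "good S (mkf {} g) (cd {})" by blast
 then have "rs (mkf {} g) (cd {}) = rap S (cd {})" by (intro rs_eq) auto
 then show ?thesis using S unfolding rsum_def good_def by simp
qed

lemma rsum_insert: assumes "finite_in F" "a \<in> U" "a \<notin> F" shows "rsum g (insert a F) = rsum g F + g a"
proof -
 have FS: "F \<in> Sets" using assms finite_in_Sets by blast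
 have iF: "finite_in (insert a F)" using assms by auto
 have iS: "insert a F \<in> Sets" using FS assms by auto
 from good_ex[OF iF mkf_U] obtain S where S: "S \<in> U" "good S (mkf (insert a F) g) (cd (insert a F))" by blast
 have v: "rap (mkf (insert a F) g) x = g x" if "x \<in> insert a F" for x using rap_mkf[OF iS g that] .
 have v': "rap (mkf F g) x = g x" if "x \<in> F" for x using rap_mkf[OF FS g that] .
 have gS: "rap S (cd {}) = 0" "\<And>H x. H \<in> pset (insert a F) \<Longrightarrow> x \<in> insert a F \<Longrightarrow> x \<notin> ext H \<Longrightarrow> rap S (cd (insert x (ext H))) = rap S H + g x"
  using S(2) v iS unfolding good_def by auto
 have "good S (mkf F g) (cd F)" unfolding good_def ext_cd[OF FS]
 proof (intro conjI ballI impI gS(1))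
  fix H x assume "H \<in> pset F" "x \<in> F" "x \<notin> ext H"
  moreover from this have "H \<in> pset (insert a F)" unfolding pset_iff by blast
  ultimately show "rap S (cd (insert x (ext H))) = rap S H + rap (mkf F g) x" using gS(2)[of H x] v' by simp
 qed
 then have 1: "rsum g F = rap S (cd F)" unfolding rsum_def using rs_eq[of "cd F" S "mkf F g"] S assms FS by simp
 have 2: "rsum g (insert a F) = rap S (cd (insert a F))" unfolding rsum_def using rs_eq[of "cd (insert a F)" S] S iF iS by simp
 have "rap S (cd (insert a (ext (cd F)))) = rap S (cd F) + g a"
  by (rule gS(2)) (use FS assms in \<open>auto simp: pset_iff\<close>)
 then show ?thesis using 1 2 FS by simp
qed

end

lemma rsum_cong: assumes "\<And>x. x \<in> F \<Longrightarrow> g x = h x" shows "rsum g F = rsum h F"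
 unfolding rsum_def using mkf_cong[of F g h] assms by auto

lemma finU: "finite_in F \<Longrightarrow> x \<in> F \<Longrightarrow> x \<in> U" using finite_in_Sets Sets_U by blast

lemma rsum_add: assumes F: "finite_in F" and g: "DR (\<lambda>e. g (e 0))" and h: "DR (\<lambda>e. h (e 0))"
 shows "rsum (\<lambda>a. g a + h a) F = rsum g F + rsum h F"
proof -
 have gh: "DR (\<lambda>e. g (e 0) + h (e 0))" by (intro df g h)
 show ?thesis using F
 proof (induction rule: finite_in_induct)
  case Df show ?case by (intro df g h)
 next
  case empty show ?case using g h gh by simp
 next
  case (insert x G)
  have "x \<in> U" using finU F insert by blast
  then show ?case using insert rsum_insert[OF gh, of G x] rsum_insert[OF g, of G x] rsum_insert[OF h, of G x] by simp
 qed
qed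

lemma rsum_scale: assumes F: "finite_in F" and g: "DR (\<lambda>e. g (e 0))"
 shows "rsum (\<lambda>a. r * g a) F = r * rsum g F"
proof -
 have gh: "DR (\<lambda>e. r * g (e 0))" by (intro df g)
 show ?thesis using F
 proof (induction rule: finite_in_induct)
  case Df show ?case by (intro df g)
 next
  case empty show ?case using g gh by simp
 next
  case (insert x G)
  have "x \<in> U" using finU F insert by blast
  then show ?case using insert rsum_insert[OF gh, of G x] rsum_insert[OF g, of G x] by (simp add: algebra_simps)
 qed
qed

lemma rsum_mono: assumes F: "finite_in F" and g: "DR (\<lambda>e. g (e 0))" and h: "DR (\<lambda>e. h (e 0))" and le: "\<And>a. a \<in> F \<Longrightarrow> g a \<le> h a"
 shows "rsum g F \<le> rsum h F"
 using F
proof (induction rule: finite_in_induct)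
 case Df show ?case by (intro df g h)
next
 case empty show ?case using g h by simp
next
 case (insert x G)
 have "x \<in> U" using finU F insert by blast
 then show ?case using insert rsum_insert[OF g, of G x] rsum_insert[OF h, of G x] le[of x] by simp
qed

lemma rsum_neutral: assumes F: "finite_in F" "finite_in G" and g: "DR (\<lambda>e. g (e 0))" and z: "\<And>a. a \<in> G \<Longrightarrow> a \<notin> F \<Longrightarrow> g a = 0"
 shows "rsum g (F \<union> G) = rsum g F"
 using F(2)
proof (induction rule: finite_in_induct)
 case Df show ?case by (intro df g finite_in_Sets F)
next
 case empty show ?case by simp
next
 case (insert x H)
 have xU: "x \<in> U" using finU F insert by blast
 show ?case
 proof (cases "x \<in> F")
  case True then show ?thesis using insert by (simp add: insert_absorb)
 next
  case False
  then have "rsum g (insert x (F \<union> H)) = rsum g (F \<union> H) + g x" using insert F xU by (intro rsum_insert g) auto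
  then show ?thesis using insert z[of x] False by simp
 qed
qed

lemma rsum_remove: assumes F: "finite_in F" "a \<in> F" and g: "DR (\<lambda>e. g (e 0))"
 shows "rsum g F = rsum g (F - {a}) + g a" "finite_in (F - {a})"
proof -
 have aU: "a \<in> U" using finU F by blast
 have "F - {a} \<in> Sets" using finite_in_Sets[OF F(1)] Sets_pair[OF aU aU] by auto
 then show f: "finite_in (F - {a})" using finite_in_subset[OF F(1)] by blast
 have "insert a (F - {a}) = F" using F by blast
 then show "rsum g F = rsum g (F - {a}) + g a" using rsum_insert[OF g f aU] by simp
qed

end

context zfc
begin

lemma nat_upper: assumes "m \<in> omega" "n \<in> omega" shows "\<exists>k\<in>omega. m \<in> ext k \<and> n \<in> ext k"
proof -
 consider "m \<in> ext n" | "m = n" | "n \<in> ext m" using nat_linear assms by blast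
 then show ?thesis
 proof cases
  case 1 then show ?thesis using assms by (intro bexI[of _ "sc n"]) (auto simp: omega_U)
 next
  case 2 then show ?thesis using assms by (intro bexI[of _ "sc n"]) (auto simp: omega_U)
 next
  case 3 then show ?thesis using assms by (intro bexI[of _ "sc m"]) (auto simp: omega_U)
 qed
qed

lemma E_ext: "x \<in> U \<Longrightarrow> E x y \<longleftrightarrow> x \<in> ext y" by (simp add: ext_def)

lemma fun2_inT: assumes S: "S \<in> Sets" and T: "T \<in> Sets" and g: "DT (\<lambda>e. g (e 0) (e (Suc 0)))" and eq: "\<And>x y. x \<in> S \<Longrightarrow> y \<in> T \<Longrightarrow> f x y = g x y"
 shows "fun2_in S T f"
proof -
 have gU: "g x y \<in> U" if "x \<in> U" "y \<in> U" for x y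
  using DT_U[OF g, of "case_nat x (\<lambda>_. y)"] that by (auto split: nat.splits simp: image_subset_iff)
 have Dg: "DT (\<lambda>e. g (t e) (u e))" if "DT t" "DT u" for t u
 proof (rule DT_2[OF _ gU that])
  show "Df (\<lambda>e. e 0 = g (e (Suc 0)) (e (Suc (Suc 0))))" using g unfolding DT_def by auto
 qed
 have SU: "x \<in> U" if "x \<in> S" for x using that S Sets_U by blast
 have TU: "x \<in> U" if "x \<in> T" for x using that T Sets_U by blast
 have "(\<lambda>z. pr z (g (p1 z) (p2 z))) ` prd S T \<in> Sets" by (intro Sets_imageT Sets_prd S T df Dg)
 moreover have "(\<lambda>z. pr z (g (p1 z) (p2 z))) ` prd S T = {pr (pr x y) (f x y) | x y. x \<in> S \<and> y \<in> T}"
 proof (intro equalityI subsetI)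
  fix w assume "w \<in> (\<lambda>z. pr z (g (p1 z) (p2 z))) ` prd S T"
  then obtain x y where "x \<in> S" "y \<in> T" "w = pr (pr x y) (g (p1 (pr x y)) (p2 (pr x y)))" unfolding image_iff Bex_def prd_iff by blast
  then have "x \<in> S" "y \<in> T" "w = pr (pr x y) (f x y)" using SU TU eq by simp_all
  then show "w \<in> {pr (pr x y) (f x y) | x y. x \<in> S \<and> y \<in> T}" by blast
 next
  fix w assume "w \<in> {pr (pr x y) (f x y) | x y. x \<in> S \<and> y \<in> T}"
  then obtain x y where xy: "x \<in> S" "y \<in> T" "w = pr (pr x y) (f x y)" by blast
  then have "w = (\<lambda>z. pr z (g (p1 z) (p2 z))) (pr x y)" using SU TU eq by simp
  moreover have "pr x y \<in> prd S T" unfolding prd_iff using xy by blast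
  ultimately show "w \<in> (\<lambda>z. pr z (g (p1 z) (p2 z))) ` prd S T" by blast
 qed
 ultimately show ?thesis unfolding fun2_in_def using eq gU SU TU by auto
qed

end

context realf
begin

definition lubf :: "('a fld \<Rightarrow> bool) \<Rightarrow> 'a fld" where
 "lubf P = (if \<exists>s. lub P s then THE s. lub P s else 0)"

lemma lubf: "lub P s \<Longrightarrow> lubf P = s"
 unfolding lubf_def using lub_unique[of P] by (metis the_equality)

lemma DR_lubf[df]: assumes "Df (\<lambda>e. Q (sh e) (pi (e 0)))" shows "DR (\<lambda>e. lubf (\<lambda>r. Q e r))"
proof (rule DR_I, rule Df_cong)
 have 1: "Df (\<lambda>e. Q (\<lambda>n. e (Suc (Suc n))) (pi (e 0)))"
  using Df_rename[OF assms, of "case_nat 0 (\<lambda>n. Suc (Suc n))"] by simp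
 have 2: "Df (\<lambda>e. Q (\<lambda>n. e (Suc (Suc (Suc n)))) (pi (e 0)))"
  using Df_rename[OF assms, of "case_nat 0 (\<lambda>n. Suc (Suc (Suc n)))"] by simp
 have 3: "Df (\<lambda>e. Q (\<lambda>n. e (Suc (Suc (Suc (Suc n))))) (pi (e 0)))"
  using Df_rename[OF assms, of "case_nat 0 (\<lambda>n. Suc (Suc (Suc (Suc n))))"] by simp
 show "Df (\<lambda>e. lub (Q (sh e)) (pi (e 0)) \<or> (\<not> (\<exists>s. lub (Q (sh e)) s) \<and> pi (e 0) = 0))"
  unfolding lub_def by (intro df 1 2 3)
 fix e :: "nat \<Rightarrow> 'a"
 show "(pi (e 0) = lubf (Q (sh e))) = (lub (Q (sh e)) (pi (e 0)) \<or> (\<not> (\<exists>s. lub (Q (sh e)) s) \<and> pi (e 0) = 0))"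
 proof (cases "\<exists>s. lub (Q (sh e)) s")
  case True
  then obtain s where s: "lub (Q (sh e)) s" ..
  have "lub (Q (sh e)) x \<longleftrightarrow> x = s" for x using s lub_unique by metis
  then show ?thesis using True lubf[OF s] by simp
 qed (simp add: lubf_def)
qed

end

subsection \<open>Continuous functions on the Stone space\<close>

locale cstone = set_algebra U E Om Lc + realf U E
 for U :: "'a set" and E Om Lc
begin

abbreviation X :: "'a normed_module" where "X \<equiv> C_Stone R0 L"

definition cont :: "('a \<Rightarrow> 'a fld) \<Rightarrow> bool" where
 "cont F \<longleftrightarrow> (\<forall>u\<in>St. \<forall>\<epsilon>. 0 < \<epsilon> \<longrightarrow> (\<exists>a\<in>ext u. \<forall>v\<in>St. a \<in> ext v \<longrightarrow> \<bar>F v - F u\<bar> < \<epsilon>))"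

definition mk :: "('a \<Rightarrow> 'a fld) \<Rightarrow> 'a" where "mk F = mkf St F"

lemma mk_U[simp, intro]: "mk F \<in> U" by (simp add: mk_def)
lemma DT_mk[df]: assumes "DR (\<lambda>e. g (sh e) (e 0))" shows "DT (\<lambda>e. mk (\<lambda>x. g e x))"
 unfolding mk_def by (intro df assms) auto
lemma mk_ap[simp]: "DR (\<lambda>e. F (e 0)) \<Longrightarrow> u \<in> St \<Longrightarrow> rap (mk F) u = F u" unfolding mk_def by (rule rap_mkf) auto
lemma mk_cong: "(\<And>u. u \<in> St \<Longrightarrow> F u = G u) \<Longrightarrow> mk F = mk G" unfolding mk_def by (rule mkf_cong)

lemma cont_cong: "(\<And>u. u \<in> St \<Longrightarrow> F u = G u) \<Longrightarrow> cont F \<Longrightarrow> cont G"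
 unfolding cont_def by (metis (no_types, lifting))

lemma Df_cont_rap[df]: assumes "DT t" shows "Df (\<lambda>e. cont (rap (t e)))"
 unfolding cont_def by (intro df assms[THEN DT_weaken]) auto

text \<open>The equation \<open>c = mk (rap c)\<close> says that \<open>c\<close> is exactly the
  graph of a real function on the Stone space, so equality of elements is pointwise
  equality.\<close>

definition Cc :: "'a set" where "Cc = {c \<in> pset (prd St CR). c = mk (rap c) \<and> cont (rap c)}"

lemma Cc_Sets[simp, intro]: "Cc \<in> Sets" unfolding Cc_def by (intro separation df) (auto intro: CR)
lemma CcU: "c \<in> Cc \<Longrightarrow> c \<in> U" using Sets_U[OF Cc_Sets] .
lemma Cc_mk: "c \<in> Cc \<Longrightarrow> mk (rap c) = c" unfolding Cc_def by simp
lemma Cc_cont: "c \<in> Cc \<Longrightarrow> cont (rap c)" unfolding Cc_def by simp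
lemma DR_rapc: "c \<in> U \<Longrightarrow> DR (\<lambda>e. rap c (e 0))" by (intro df)

lemma mk_C: assumes F: "DR (\<lambda>e. F (e 0))" and c: "cont F" shows "mk F \<in> Cc"
proof -
 have e: "ext (mk F) = (\<lambda>x. pr x (rp (F x))) ` St" unfolding mk_def by (rule mkf_ext[OF St_Sets F])
 then have "ext (mk F) \<subseteq> prd St CR" using prd_iff rpC by blast
 then have 1: "mk F \<in> pset (prd St CR)" by (simp add: pset_iff)
 have 2: "rap (mk F) u = F u" if "u \<in> St" for u using F that by simp
 have "mk (rap (mk F)) = mk F" by (rule mk_cong) (rule 2)
 moreover have "cont (rap (mk F))" by (rule cont_cong[OF _ c]) (simp add: 2)
 ultimately show ?thesis unfolding Cc_def using 1 by simp
qed

lemma C_eq: "c \<in> Cc \<Longrightarrow> d \<in> Cc \<Longrightarrow> (\<And>u. u \<in> St \<Longrightarrow> rap c u = rap d u) \<Longrightarrow> c = d"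
 using Cc_mk mk_cong by metis

lemma Cc_ext: assumes "c \<in> Cc" shows "ext c = (\<lambda>u. pr u (rp (rap c u))) ` St"
 using mkf_ext[OF St_Sets DR_rapc[OF CcU[OF assms]]] Cc_mk[OF assms] unfolding mk_def by simp

lemma app_C: assumes "c \<in> Cc" "u \<in> St" shows "app c u = rp (rap c u)"
 unfolding app_def
proof (rule the_equality)
 show "rp (rap c u) \<in> U \<and> pr u (rp (rap c u)) \<in> ext c" using Cc_ext[OF assms(1)] assms by auto
 fix y assume y: "y \<in> U \<and> pr u y \<in> ext c"
 then obtain v where v: "v \<in> St" "pr u y = pr v (rp (rap c v))" using Cc_ext[OF assms(1)] by auto
 then show "y = rp (rap c u)" using pr_inj[of u y v "rp (rap c v)"] y StU assms by auto
qed

lemma code_mk: assumes "\<And>u. u \<in> St \<Longrightarrow> f u = rp (F u)" "DR (\<lambda>e. F (e 0))" shows "code St f = mk F" "fun_in St f"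
proof -
 have e: "{pr x (f x) | x. x \<in> St} = (\<lambda>x. pr x (rp (F x))) ` St" unfolding image_def using assms(1) by (intro Collect_cong) metis
 have S: "(\<lambda>x. pr x (rp (F x))) ` St \<in> Sets" by (intro Sets_imageT df assms) auto
 then show "code St f = mk F" using code_eq[of f St] unfolding e mk_def mkf_def by simp
 show "fun_in St f" unfolding fun_in_def e using S assms(1) by auto
qed

lemma carrier_X: "carrier X = Cc"
proof -
 have "carrier X = {code St f | f. fun_in St f \<and> continuous_Stone R0 L f}" by (simp add: C_Stone_def St_def)
 also have "\<dots> = Cc"
 proof (intro equalityI subsetI)
  fix c assume "c \<in> {code St f | f. fun_in St f \<and> continuous_Stone R0 L f}"
  then obtain f where f: "c = code St f" "fun_in St f" "continuous_Stone R0 L f" by blast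
  from fn_of_fun_in[OF f(2) St_Sets] obtain d where d: "d \<in> U" "\<And>x. x \<in> St \<Longrightarrow> f x = ap d x" by blast
  have fC: "f u \<in> CR" if "u \<in> St" for u using f(3) that unfolding continuous_Stone_def St_def by blast
  have v: "f u = rp (rap d u)" if "u \<in> St" for u using d(2)[OF that] fC[OF that] by (simp add: rap_def)
  have "c = mk (rap d)" using code_mk(1)[OF v DR_rapc[OF d(1)]] f by simp
  moreover have "cont (rap d)" unfolding cont_def
  proof (intro ballI allI impI)
   fix u and \<epsilon> :: "'a fld" assume u: "u \<in> St" "0 < \<epsilon>"
   then have "\<zero>\<^bsub>R0\<^esub> \<prec>\<^bsub>R0\<^esub> rp \<epsilon>" using rps(9)[of 0 \<epsilon>] by (simp add: rps(1))
   then obtain a where a: "a \<in> ext u" "\<forall>w\<in>St. a \<in> ext w \<longrightarrow> rabs R0 (f w \<ominus>\<^bsub>R0\<^esub> f u) \<prec>\<^bsub>R0\<^esub> rp \<epsilon>"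
    using f(3) u(1) rpC[of \<epsilon>] unfolding continuous_Stone_def St_def by blast
   have "\<bar>rap d w - rap d u\<bar> < \<epsilon>" if "w \<in> St" "a \<in> ext w" for w
    using a(2)[rule_format, OF that] unfolding v[OF u(1)] v[OF that(1)] by (simp add: rps(6)[symmetric] rps(10) rps(9))
   then show "\<exists>a\<in>ext u. \<forall>v\<in>St. a \<in> ext v \<longrightarrow> \<bar>rap d v - rap d u\<bar> < \<epsilon>" using a(1) by blast
  qed
  ultimately show "c \<in> Cc" using mk_C[OF DR_rapc[OF d(1)]] by simp
 next
  fix c assume c: "c \<in> Cc"
  let ?f = "\<lambda>u. rp (rap c u)"
  have "code St ?f = c" "fun_in St ?f" using code_mk[of ?f "rap c", OF refl DR_rapc[OF CcU[OF c]]] Cc_mk[OF c] by auto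
  moreover have "continuous_Stone R0 L ?f" unfolding continuous_Stone_def St_def[symmetric]
  proof (intro conjI ballI impI)
   show "?f ` St \<subseteq> CR" by auto
   fix u e assume u: "u \<in> St" "e \<in> CR" "\<zero>\<^bsub>R0\<^esub> \<prec>\<^bsub>R0\<^esub> e"
   have "0 < pi e" using u rps(9)[of 0 "pi e"] by (simp add: rps(1))
   then obtain a where a: "a \<in> ext u" "\<forall>v\<in>St. a \<in> ext v \<longrightarrow> \<bar>rap c v - rap c u\<bar> < pi e" using Cc_cont[OF c] u(1) unfolding cont_def by blast
   have "rabs R0 (?f v \<ominus>\<^bsub>R0\<^esub> ?f u) \<prec>\<^bsub>R0\<^esub> e" if "v \<in> St" "a \<in> ext v" for v
    using a(2) that rps(9)[of "\<bar>rap c v - rap c u\<bar>" "pi e"] u(2) by (simp add: rps(6)[symmetric] rps(10))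
   then show "\<exists>a\<in>ext u. \<forall>v\<in>St. a \<in> ext v \<longrightarrow> rabs R0 (?f v \<ominus>\<^bsub>R0\<^esub> ?f u) \<prec>\<^bsub>R0\<^esub> e" using a(1) by blast
  qed
  ultimately show "c \<in> {code St f | f. fun_in St f \<and> continuous_Stone R0 L f}" by (intro CollectI exI[of _ ?f]) simp
 qed
 finally show ?thesis .
qed

lemma cont_const: "cont (\<lambda>u. r)"
 unfolding cont_def by (intro ballI allI impI bexI[of _ tp]) auto

lemma cont_lin: assumes F: "cont F" and G: "cont G" shows "cont (\<lambda>u. r * F u + G u)"
 unfolding cont_def
proof (intro ballI allI impI)
 fix u and \<epsilon> :: "'a fld" assume u: "u \<in> St" "0 < \<epsilon>"
 \<comment> \<open>With this choice \<open>(\<bar>r\<bar> + 1) * d\<close> is half of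
   \<open>\<epsilon>\<close>; adding 1 keeps the denominator positive when
   \<open>r = 0\<close>.\<close>
 define d where "d = \<epsilon> / (2 * (\<bar>r\<bar> + 1))"
 have p: "0 < 2 * (\<bar>r\<bar> + 1)" by (meson abs_ge_zero add_nonneg_pos mult_pos_pos zero_less_numeral zero_less_one)
 then have d: "0 < d" "2 * (\<bar>r\<bar> + 1) * d = \<epsilon>" unfolding d_def using u by auto
 from F u d obtain a where a: "a \<in> ext u" "\<forall>v\<in>St. a \<in> ext v \<longrightarrow> \<bar>F v - F u\<bar> < d" unfolding cont_def by blast
 from G u d obtain b where b: "b \<in> ext u" "\<forall>v\<in>St. b \<in> ext v \<longrightarrow> \<bar>G v - G u\<bar> < d" unfolding cont_def by blast
 have ab: "a \<in> Lc" "b \<in> Lc" using a b u St_sub by blast+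
 show "\<exists>a\<in>ext u. \<forall>v\<in>St. a \<in> ext v \<longrightarrow> \<bar>r * F v + G v - (r * F u + G u)\<bar> < \<epsilon>"
 proof (intro bexI[of _ "mt a b"] ballI impI)
  show "mt a b \<in> ext u" using a b u ab St_mt by blast
  fix v assume v: "v \<in> St" "mt a b \<in> ext v"
  then have "\<bar>F v - F u\<bar> < d" "\<bar>G v - G u\<bar> < d" using a b ab St_mt by blast+
  moreover have "\<bar>r * F v + G v - (r * F u + G u)\<bar> \<le> \<bar>r\<bar> * \<bar>F v - F u\<bar> + \<bar>G v - G u\<bar>"
  proof -
   have "r * F v + G v - (r * F u + G u) = r * (F v - F u) + (G v - G u)" by (simp add: algebra_simps)
   then show ?thesis using abs_triangle_ineq[of "r * (F v - F u)" "G v - G u"] by (simp add: abs_mult)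
  qed
  moreover have "\<bar>r\<bar> * \<bar>F v - F u\<bar> \<le> \<bar>r\<bar> * d" using calculation(1) by (intro mult_left_mono) auto
  moreover have "\<bar>r\<bar> * d + d \<le> \<epsilon>"
  proof -
   have "\<epsilon> = \<bar>r\<bar> * d + d + (\<bar>r\<bar> * d + d)" using d(2) by (simp add: algebra_simps)
   moreover have "0 \<le> \<bar>r\<bar> * d" using d(1) by simp
   ultimately show ?thesis using d(1) by linarith
  qed
  ultimately show "\<bar>r * F v + G v - (r * F u + G u)\<bar> < \<epsilon>" by linarith
 qed
qed

lemma cont_add: "cont F \<Longrightarrow> cont G \<Longrightarrow> cont (\<lambda>u. F u + G u)" using cont_lin[of F G 1] by simp
lemma cont_scale: "cont F \<Longrightarrow> cont (\<lambda>u. r * F u)" using cont_lin[of F "\<lambda>u. 0" r] cont_const by simp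

definition va :: "'a \<Rightarrow> 'a \<Rightarrow> 'a" where "va c d = mk (\<lambda>u. rap c u + rap d u)"
definition vs :: "'a fld \<Rightarrow> 'a \<Rightarrow> 'a" where "vs r c = mk (\<lambda>u. r * rap c u)"
definition vz :: 'a where "vz = mk (\<lambda>u. 0)"

lemma DT_va[df]: assumes "DT t" "DT u" shows "DT (\<lambda>e. va (t e) (u e))" unfolding va_def by (intro df assms[THEN DT_weaken])
lemma DT_vs[df]: assumes "DR t" "DT u" shows "DT (\<lambda>e. vs (t e) (u e))" unfolding vs_def by (intro df assms(1)[THEN DR_weaken] assms(2)[THEN DT_weaken])

lemma va_C[simp, intro]: "c \<in> Cc \<Longrightarrow> d \<in> Cc \<Longrightarrow> va c d \<in> Cc"
 unfolding va_def by (intro mk_C cont_add Cc_cont df CcU)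
lemma vs_C[simp, intro]: "c \<in> Cc \<Longrightarrow> vs r c \<in> Cc"
 unfolding vs_def by (intro mk_C cont_scale Cc_cont df CcU)
lemma vz_C[simp, intro]: "vz \<in> Cc"
 unfolding vz_def by (intro mk_C cont_const df)
lemma va_ap[simp]: "c \<in> Cc \<Longrightarrow> d \<in> Cc \<Longrightarrow> u \<in> St \<Longrightarrow> rap (va c d) u = rap c u + rap d u"
 unfolding va_def by (intro mk_ap df CcU)
lemma vs_ap[simp]: "c \<in> Cc \<Longrightarrow> u \<in> St \<Longrightarrow> rap (vs r c) u = r * rap c u"
 unfolding vs_def by (intro mk_ap df CcU)
lemma vz_ap[simp]: "u \<in> St \<Longrightarrow> rap vz u = 0"
 unfolding vz_def by (intro mk_ap df)

lemma add_X: assumes "c \<in> Cc" "d \<in> Cc" shows "c \<oplus>\<^bsub>X\<^esub> d = va c d"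
proof -
 have "c \<oplus>\<^bsub>X\<^esub> d = code St (\<lambda>u. app c u \<oplus>\<^bsub>R0\<^esub> app d u)" by (simp add: C_Stone_def St_def)
 also have "\<dots> = mk (\<lambda>u. rap c u + rap d u)"
  by (rule code_mk(1)) (auto simp: app_C assms rps intro!: df CcU)
 finally show ?thesis by (simp add: va_def)
qed

lemma smult_X: assumes "r \<in> CR" "c \<in> Cc" shows "r \<odot>\<^bsub>X\<^esub> c = vs (pi r) c"
proof -
 have "r \<odot>\<^bsub>X\<^esub> c = code St (\<lambda>u. r \<otimes>\<^bsub>R0\<^esub> app c u)" by (simp add: C_Stone_def St_def)
 also have "\<dots> = mk (\<lambda>u. pi r * rap c u)"
  by (rule code_mk(1)) (auto simp: app_C assms rps intro!: df CcU)
 finally show ?thesis by (simp add: vs_def)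
qed

lemma zero_X: "\<zero>\<^bsub>X\<^esub> = vz"
proof -
 have "\<zero>\<^bsub>X\<^esub> = code St (\<lambda>u. \<zero>\<^bsub>R0\<^esub>)" by (simp add: C_Stone_def St_def)
 also have "\<dots> = mk (\<lambda>u. 0)" by (rule code_mk(1)) (auto simp: rps intro!: df)
 finally show ?thesis by (simp add: vz_def)
qed

lemma smult_rp: "c \<in> Cc \<Longrightarrow> rp r \<odot>\<^bsub>X\<^esub> c = vs r c" by (simp add: smult_X)

text \<open>Compactness, applied to the property of \<open>a\<close> that \<open>c\<close> is
  bounded on the clopen set given by \<open>a\<close>. Locally the bound comes from continuity with
  error 1.\<close>

lemma bounded: assumes c: "c \<in> Cc" shows "\<exists>b. \<forall>u\<in>St. \<bar>rap c u\<bar> \<le> b"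
proof -
 have "\<exists>b. \<forall>u\<in>St. tp \<in> ext u \<longrightarrow> \<bar>rap c u\<bar> \<le> b"
 proof (rule compactness[of "\<lambda>a. \<exists>b. \<forall>u\<in>St. a \<in> ext u \<longrightarrow> \<bar>rap c u\<bar> \<le> b"])
  show "Df (\<lambda>e. \<exists>b. \<forall>u\<in>St. e 0 \<in> ext u \<longrightarrow> \<bar>rap c u\<bar> \<le> b)" by (intro df CcU c St_Sets)
  show "\<exists>b. \<forall>u\<in>St. bt \<in> ext u \<longrightarrow> \<bar>rap c u\<bar> \<le> b" by simp
  fix u assume u: "u \<in> St"
  obtain a where a: "a \<in> ext u" "\<forall>v\<in>St. a \<in> ext v \<longrightarrow> \<bar>rap c v - rap c u\<bar> < 1"
   using Cc_cont[OF c] u zero_less_one unfolding cont_def by blast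
  have "\<bar>rap c v\<bar> \<le> \<bar>rap c u\<bar> + 1" if "v \<in> St" "a \<in> ext v" for v using a(2)[rule_format, OF that] by linarith
  then show "\<exists>a\<in>ext u. \<exists>b. \<forall>u\<in>St. a \<in> ext u \<longrightarrow> \<bar>rap c u\<bar> \<le> b" using a(1) by blast
 next
  fix a b assume "a \<in> Lc" "b \<in> Lc" "\<exists>r. \<forall>u\<in>St. a \<in> ext u \<longrightarrow> \<bar>rap c u\<bar> \<le> r" "ext b \<subseteq> ext a"
  then show "\<exists>r. \<forall>u\<in>St. b \<in> ext u \<longrightarrow> \<bar>rap c u\<bar> \<le> r" using St_up by meson
 next
  fix a b assume ab: "a \<in> Lc" "b \<in> Lc" "\<exists>r. \<forall>u\<in>St. a \<in> ext u \<longrightarrow> \<bar>rap c u\<bar> \<le> r" "\<exists>r. \<forall>u\<in>St. b \<in> ext u \<longrightarrow> \<bar>rap c u\<bar> \<le> r"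
  then obtain r s where rs: "\<forall>u\<in>St. a \<in> ext u \<longrightarrow> \<bar>rap c u\<bar> \<le> r" "\<forall>u\<in>St. b \<in> ext u \<longrightarrow> \<bar>rap c u\<bar> \<le> s" by blast
  have "\<bar>rap c u\<bar> \<le> max r s" if "u \<in> St" "jn a b \<in> ext u" for u
   using rs that ab(1,2) St_jn[of u a b] by (meson le_max_iff_disj)
  then show "\<exists>r. \<forall>u\<in>St. jn a b \<in> ext u \<longrightarrow> \<bar>rap c u\<bar> \<le> r" by blast
 qed
 then show ?thesis by simp
qed

definition nm :: "'a \<Rightarrow> 'a fld" where "nm c = lubf (\<lambda>r. \<exists>u\<in>St. r = \<bar>rap c u\<bar>)"

lemma DR_nm[df]: assumes "DT t" shows "DR (\<lambda>e. nm (t e))"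
 unfolding nm_def by (intro df St_Sets assms[THEN DT_weaken])

lemma nm_lub: assumes "c \<in> Cc" shows "lub (\<lambda>r. \<exists>u\<in>St. r = \<bar>rap c u\<bar>) (nm c)"
proof -
 from St_ne obtain u where u: "u \<in> St" ..
 from bounded[OF assms] obtain b where b: "\<forall>u\<in>St. \<bar>rap c u\<bar> \<le> b" ..
 have "\<exists>s. lub (\<lambda>r. \<exists>u\<in>St. r = \<bar>rap c u\<bar>) s"
 proof (rule lub_ex)
  show "Df (\<lambda>e. \<exists>u\<in>St. pi (e 0) = \<bar>rap c u\<bar>)" by (intro df St_Sets CcU assms)
  show "\<exists>v\<in>St. \<bar>rap c u\<bar> = \<bar>rap c v\<bar>" using u by blast
  show "r \<le> b" if "\<exists>u\<in>St. r = \<bar>rap c u\<bar>" for r using that b by auto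
 qed
 then obtain s where s: "lub (\<lambda>r. \<exists>u\<in>St. r = \<bar>rap c u\<bar>) s" ..
 then show ?thesis unfolding nm_def using lubf[OF s] by simp
qed

lemma nm_ge: "c \<in> Cc \<Longrightarrow> u \<in> St \<Longrightarrow> \<bar>rap c u\<bar> \<le> nm c"
 using nm_lub[of c] unfolding lub_def by blast

lemma nm_le: assumes "c \<in> Cc" "\<And>u. u \<in> St \<Longrightarrow> \<bar>rap c u\<bar> \<le> b" shows "nm c \<le> b"
 using nm_lub[OF assms(1)] assms(2) unfolding lub_def by blast

lemma nm_nonneg: "c \<in> Cc \<Longrightarrow> 0 \<le> nm c"
 using nm_ge St_ne by (meson abs_ge_zero order_trans)

lemma nrm_X: assumes c: "c \<in> Cc" shows "nrm X c = rp (nm c)"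
proof -
 let ?A = "{rabs R0 (app c u) | u. u \<in> St}"
 have A: "?A = {rp \<bar>rap c u\<bar> | u. u \<in> St}" using app_C[OF c] rps(10) by metis
 have O: "carrier (order_of R0) = CR" "le (order_of R0) = rle R0" by (simp_all add: order_of_def)
 interpret O: total_order "order_of (R0 :: 'a ordered_ring)" using ordR by (simp add: ordered_field_def)
 have "least (order_of R0) (rp (nm c)) (Upper (order_of R0) ?A)"
  unfolding least_def
 proof (intro conjI ballI)
  show "Upper (order_of R0) ?A \<subseteq> carrier (order_of R0)" by (simp add: Upper_def)
  show "rp (nm c) \<in> Upper (order_of R0) ?A" unfolding Upper_def O A using nm_ge[OF c] by (auto simp: rps)
  fix x assume "x \<in> Upper (order_of R0) ?A"
  then have x: "x \<in> CR" "\<And>u. u \<in> St \<Longrightarrow> rp \<bar>rap c u\<bar> \<preceq>\<^bsub>R0\<^esub> x" unfolding Upper_def O A by auto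
  have "\<bar>rap c u\<bar> \<le> pi x" if "u \<in> St" for u using x(2)[OF that] rps(8)[of "\<bar>rap c u\<bar>" "pi x"] x(1) by simp
  then have "nm c \<le> pi x" using nm_le[OF c] by blast
  then show "rp (nm c) \<sqsubseteq>\<^bsub>order_of R0\<^esub> x" unfolding O using rps(8)[of "nm c" "pi x"] x(1) by simp
 qed
 moreover have "nrm X c = \<Squnion>\<^bsub>order_of R0\<^esub> ?A" by (simp add: C_Stone_def St_def)
 ultimately show ?thesis unfolding Lattice.sup_def using O.least_unique by (metis (no_types, lifting) someI)
qed

lemma nm_zero: "c \<in> Cc \<Longrightarrow> nm c = 0 \<longleftrightarrow> c = vz"
proof
 assume c: "c \<in> Cc" "nm c = 0"
 show "c = vz"
 proof (rule C_eq[OF c(1) vz_C])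
  fix u assume "u \<in> St" then show "rap c u = rap vz u" using nm_ge[OF c(1)] c(2) by fastforce
 qed
next
 assume c: "c \<in> Cc" "c = vz"
 have "nm c \<le> 0" by (rule nm_le[OF c(1)]) (simp add: c(2))
 then show "nm c = 0" using nm_nonneg[OF c(1)] by simp
qed

lemma nm_scale: assumes c: "c \<in> Cc" shows "nm (vs r c) = \<bar>r\<bar> * nm c"
proof (rule antisym)
 show "nm (vs r c) \<le> \<bar>r\<bar> * nm c"
  by (rule nm_le) (use c nm_ge[OF c] in \<open>auto simp: abs_mult intro!: mult_left_mono\<close>)
 show "\<bar>r\<bar> * nm c \<le> nm (vs r c)"
 proof (cases "r = 0")
  case False
  have "nm c \<le> nm (vs r c) / \<bar>r\<bar>"
  proof (rule nm_le[OF c])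
   fix u assume u: "u \<in> St"
   have "\<bar>r\<bar> * \<bar>rap c u\<bar> \<le> nm (vs r c)" using nm_ge[OF vs_C[OF c, of r] u] c u by (simp add: abs_mult)
   then show "\<bar>rap c u\<bar> \<le> nm (vs r c) / \<bar>r\<bar>" using False by (simp add: pos_le_divide_eq mult.commute)
  qed
  then show ?thesis using False by (simp add: pos_le_divide_eq mult.commute)
 qed (use nm_nonneg c in simp)
qed

lemma nm_triangle: assumes c: "c \<in> Cc" "d \<in> Cc" shows "nm (va c d) \<le> nm c + nm d"
proof (rule nm_le)
 fix u assume u: "u \<in> St"
 show "\<bar>rap (va c d) u\<bar> \<le> nm c + nm d" unfolding va_ap[OF c u] using nm_ge[OF c(1) u] nm_ge[OF c(2) u] by linarith
qed (use c in auto)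

text \<open>The norm component is left arbitrary because the same vector space carries both the
  supremum norm and the smooth norm.\<close>

lemma module_X: "module R0 (X\<lparr>nrm := n\<rparr>)"
proof -
 interpret R: field "R0 :: 'a ordered_ring" using ordR by (simp add: ordered_field_def)
 let ?Y = "X\<lparr>nrm := n\<rparr>"
 have y: "carrier ?Y = Cc" "\<zero>\<^bsub>?Y\<^esub> = vz" "\<And>c d. c \<in> Cc \<Longrightarrow> d \<in> Cc \<Longrightarrow> c \<oplus>\<^bsub>?Y\<^esub> d = va c d"
  "\<And>r c. r \<in> CR \<Longrightarrow> c \<in> Cc \<Longrightarrow> r \<odot>\<^bsub>?Y\<^esub> c = vs (pi r) c"
  using carrier_X zero_X add_X smult_X by simp_all
 have pis: "pi (r \<oplus>\<^bsub>R0\<^esub> s) = pi r + pi s" "pi (r \<otimes>\<^bsub>R0\<^esub> s) = pi r * pi s" if "r \<in> CR" "s \<in> CR" for r s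
 proof -
  have "r \<oplus>\<^bsub>R0\<^esub> s = rp (pi r + pi s)" "r \<otimes>\<^bsub>R0\<^esub> s = rp (pi r * pi s)" using that by (simp_all add: rps)
  then show "pi (r \<oplus>\<^bsub>R0\<^esub> s) = pi r + pi s" "pi (r \<otimes>\<^bsub>R0\<^esub> s) = pi r * pi s" by simp_all
 qed
 have pi1: "pi \<one>\<^bsub>R0\<^esub> = 1" using pi_rp[of 1] by (simp add: rps)
 show ?thesis
 proof (rule moduleI)
  show "cring (R0 :: 'a ordered_ring)" by (rule R.cring_axioms)
  show "abelian_group ?Y"
  proof (rule abelian_groupI)
   fix c d b assume "c \<in> carrier ?Y" "d \<in> carrier ?Y" "b \<in> carrier ?Y"
   then have cdb: "c \<in> Cc" "d \<in> Cc" "b \<in> Cc" using y by auto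
   show "c \<oplus>\<^bsub>?Y\<^esub> d \<in> carrier ?Y" using y cdb by simp
   show "c \<oplus>\<^bsub>?Y\<^esub> d \<oplus>\<^bsub>?Y\<^esub> b = c \<oplus>\<^bsub>?Y\<^esub> (d \<oplus>\<^bsub>?Y\<^esub> b)" using y cdb by (auto intro!: C_eq)
   show "c \<oplus>\<^bsub>?Y\<^esub> d = d \<oplus>\<^bsub>?Y\<^esub> c" using y cdb by (auto intro!: C_eq)
   show "\<zero>\<^bsub>?Y\<^esub> \<oplus>\<^bsub>?Y\<^esub> c = c" using y cdb by (auto intro!: C_eq)
   show "\<exists>z\<in>carrier ?Y. z \<oplus>\<^bsub>?Y\<^esub> c = \<zero>\<^bsub>?Y\<^esub>"
    by (rule bexI[of _ "vs (- 1) c"]) (use y cdb in \<open>auto intro!: C_eq\<close>)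
  qed (use y in simp)
  fix r s c d assume "r \<in> CR" "s \<in> CR" "c \<in> carrier ?Y" "d \<in> carrier ?Y"
  then have rc: "r \<in> CR" "s \<in> CR" "c \<in> Cc" "d \<in> Cc" using y by auto
  show "(r \<oplus>\<^bsub>R0\<^esub> s) \<odot>\<^bsub>?Y\<^esub> c = r \<odot>\<^bsub>?Y\<^esub> c \<oplus>\<^bsub>?Y\<^esub> s \<odot>\<^bsub>?Y\<^esub> c"
   using y rc pis by (auto intro!: C_eq simp: algebra_simps)
  show "r \<odot>\<^bsub>?Y\<^esub> (c \<oplus>\<^bsub>?Y\<^esub> d) = r \<odot>\<^bsub>?Y\<^esub> c \<oplus>\<^bsub>?Y\<^esub> r \<odot>\<^bsub>?Y\<^esub> d"
   using y rc by (auto intro!: C_eq simp: algebra_simps)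
  show "(r \<otimes>\<^bsub>R0\<^esub> s) \<odot>\<^bsub>?Y\<^esub> c = r \<odot>\<^bsub>?Y\<^esub> (s \<odot>\<^bsub>?Y\<^esub> c)"
   using y rc pis by (auto intro!: C_eq simp: algebra_simps)
 next
  fix r c assume "r \<in> CR" "c \<in> carrier ?Y"
  then show "r \<odot>\<^bsub>?Y\<^esub> c \<in> carrier ?Y" using y by simp
 next
  fix c assume "c \<in> carrier ?Y"
  then show "\<one>\<^bsub>R0\<^esub> \<odot>\<^bsub>?Y\<^esub> c = c" using y pi1 by (auto intro!: C_eq)
 qed
qed

lemma normed_X:
 assumes n: "\<And>c. c \<in> Cc \<Longrightarrow> n c = rp (\<nu> c)" and D: "DR (\<lambda>e. \<nu> (e 0))"
  and nn: "\<And>c. c \<in> Cc \<Longrightarrow> 0 \<le> \<nu> c" and z: "\<And>c. c \<in> Cc \<Longrightarrow> \<nu> c = 0 \<longleftrightarrow> c = vz"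
  and sc: "\<And>r c. c \<in> Cc \<Longrightarrow> \<nu> (vs r c) = \<bar>r\<bar> * \<nu> c" and tr: "\<And>c d. c \<in> Cc \<Longrightarrow> d \<in> Cc \<Longrightarrow> \<nu> (va c d) \<le> \<nu> c + \<nu> d"
 shows "normed_space_in R0 (X\<lparr>nrm := n\<rparr>)"
 unfolding normed_space_in_def
proof (intro conjI rf module_X)
 have y: "carrier (X\<lparr>nrm := n\<rparr>) = Cc" "\<zero>\<^bsub>X\<lparr>nrm := n\<rparr>\<^esub> = vz" "\<And>c d. c \<in> Cc \<Longrightarrow> d \<in> Cc \<Longrightarrow> c \<oplus>\<^bsub>X\<lparr>nrm := n\<rparr>\<^esub> d = va c d"
  "\<And>r c. r \<in> CR \<Longrightarrow> c \<in> Cc \<Longrightarrow> r \<odot>\<^bsub>X\<lparr>nrm := n\<rparr>\<^esub> c = vs (pi r) c" "nrm (X\<lparr>nrm := n\<rparr>) = n"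
  using carrier_X zero_X add_X smult_X by simp_all
 show "norm_on R0 (X\<lparr>nrm := n\<rparr>)" unfolding norm_on_def y
 proof (intro conjI ballI)
  fix c assume c: "c \<in> Cc"
  show "n c \<in> CR" using n c by simp
  show "\<zero>\<^bsub>R0\<^esub> \<preceq>\<^bsub>R0\<^esub> n c" using n[OF c] nn[OF c] rps(8)[of 0 "\<nu> c"] by (simp add: rps(1))
  show "n c = \<zero>\<^bsub>R0\<^esub> \<longleftrightarrow> c = vz" using n[OF c] z[OF c] rps(11)[of "\<nu> c" 0] by (simp add: rps(1))
 next
  fix r c assume rc: "r \<in> CR" "c \<in> Cc"
  have "n (r \<odot>\<^bsub>X\<lparr>nrm := n\<rparr>\<^esub> c) = rp (\<bar>pi r\<bar> * \<nu> c)" using y(4)[OF rc] n[OF vs_C[OF rc(2)]] sc[OF rc(2)] by simp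
  then show "n (r \<odot>\<^bsub>X\<lparr>nrm := n\<rparr>\<^esub> c) = rabs R0 r \<otimes>\<^bsub>R0\<^esub> n c" using rps(10)[of "pi r"] rc n by (simp add: rps)
 next
  fix c d assume cd: "c \<in> Cc" "d \<in> Cc"
  show "n (c \<oplus>\<^bsub>X\<lparr>nrm := n\<rparr>\<^esub> d) \<preceq>\<^bsub>R0\<^esub> n c \<oplus>\<^bsub>R0\<^esub> n d"
   using y(3)[OF cd] n[OF va_C[OF cd]] n[OF cd(1)] n[OF cd(2)] tr[OF cd] rps(8)[of "\<nu> (va c d)" "\<nu> c + \<nu> d"] by (simp add: rps(3))
 qed
 show "carrier (X\<lparr>nrm := n\<rparr>) \<in> Sets" unfolding y by auto
 show "fun2_in (carrier (X\<lparr>nrm := n\<rparr>)) (carrier (X\<lparr>nrm := n\<rparr>)) (add (X\<lparr>nrm := n\<rparr>))" unfolding y(1)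
  by (rule fun2_inT[OF Cc_Sets Cc_Sets _ y(3)]) (intro df, auto)
 show "fun2_in CR (carrier (X\<lparr>nrm := n\<rparr>)) (smult (X\<lparr>nrm := n\<rparr>))" unfolding y(1)
  by (rule fun2_inT[OF CR Cc_Sets _ y(4)]) (intro df, auto)
 show "fun_in (carrier (X\<lparr>nrm := n\<rparr>)) (nrm (X\<lparr>nrm := n\<rparr>))" unfolding y(1,5)
  by (rule fun_in_cong[of _ "\<lambda>c. rp (\<nu> c)"]) (auto intro!: fun_inT df D simp: n)
qed

lemma normed_space_X: "normed_space_in R0 X"
proof -
 have "normed_space_in R0 (X\<lparr>nrm := nrm X\<rparr>)"
  by (rule normed_X[of "nrm X" nm]) (auto simp: nrm_X nm_nonneg nm_zero nm_scale nm_triangle intro!: df)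
 then show ?thesis by simp
qed

lemma minus_X: assumes c: "c \<in> Cc" "d \<in> Cc" shows "c \<ominus>\<^bsub>X\<^esub> d = va c (vs (- 1) d)"
proof -
 have "X = X\<lparr>nrm := nrm X\<rparr>" by simp
 then have "module R0 X" using module_X[of "nrm X"] by metis
 then interpret M: module "R0 :: 'a ordered_ring" X .
 have "\<ominus>\<^bsub>X\<^esub> d = vs (- 1) d"
 proof (rule M.minus_equality)
  show "vs (- 1) d \<oplus>\<^bsub>X\<^esub> d = \<zero>\<^bsub>X\<^esub>" using c by (auto simp: add_X zero_X intro!: C_eq)
 qed (use c in \<open>auto simp: carrier_X\<close>)
 then show ?thesis unfolding a_minus_def using c by (simp add: add_X)
qed

text \<open>The limit \<open>l u\<close> is the supremum of the eventual lower bounds of the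
  sequence at \<open>u\<close>. The Cauchy condition makes the convergence uniform in
  \<open>u\<close>, and this gives both continuity of \<open>l\<close> and convergence in
  norm.\<close>

lemma banach_X: "banach_space_in R0 X"
 unfolding banach_space_in_def
proof (intro conjI normed_space_X allI impI)
 fix s assume s: "fun_in omega s \<and> s ` omega \<subseteq> carrier X \<and>
    (\<forall>e\<in>CR. \<zero>\<^bsub>R0\<^esub> \<prec>\<^bsub>R0\<^esub> e \<longrightarrow> (\<exists>k\<in>omega. \<forall>m\<in>omega. \<forall>n\<in>omega. E k m \<and> E k n \<longrightarrow> nrm X (s m \<ominus>\<^bsub>X\<^esub> s n) \<prec>\<^bsub>R0\<^esub> e))"
 have sC: "s n \<in> Cc" if "n \<in> omega" for n using s that carrier_X by auto
 from s have "fun_in omega s" by blast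
 from fn_of_fun_in[OF this omega_Sets] obtain q where q: "q \<in> U" "\<And>n. n \<in> omega \<Longrightarrow> s n = ap q n" by blast
 have Eo: "E k m \<longleftrightarrow> k \<in> ext m" if "k \<in> omega" for k m using E_ext that by blast
 let ?ca = "\<lambda>k \<epsilon>. \<forall>m\<in>omega. \<forall>n\<in>omega. k \<in> ext m \<longrightarrow> k \<in> ext n \<longrightarrow> (\<forall>u\<in>St. \<bar>rap (s m) u - rap (s n) u\<bar> < \<epsilon>)"
 have cauchy: "\<exists>k\<in>omega. ?ca k (\<epsilon>)" if \<epsilon>: "0 < \<epsilon>" for \<epsilon>
 proof -
  have "\<zero>\<^bsub>R0\<^esub> \<prec>\<^bsub>R0\<^esub> rp \<epsilon>" using rps(9)[of 0 \<epsilon>] \<epsilon> by (simp add: rps(1))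
  then obtain k where k: "k \<in> omega" "\<forall>m\<in>omega. \<forall>n\<in>omega. E k m \<and> E k n \<longrightarrow> nrm X (s m \<ominus>\<^bsub>X\<^esub> s n) \<prec>\<^bsub>R0\<^esub> rp \<epsilon>"
   using s rpC[of \<epsilon>] by blast
  show ?thesis
  proof (intro bexI[OF _ k(1)] ballI impI)
   fix m n u assume mn: "m \<in> omega" "n \<in> omega" "k \<in> ext m" "k \<in> ext n" and u: "u \<in> St"
   have "nrm X (s m \<ominus>\<^bsub>X\<^esub> s n) \<prec>\<^bsub>R0\<^esub> rp \<epsilon>" using k mn Eo by blast
   then have "nm (va (s m) (vs (- 1) (s n))) < \<epsilon>" using minus_X[OF sC[OF mn(1)] sC[OF mn(2)]] nrm_X sC mn rps(9) by simp
   moreover have "\<bar>rap (va (s m) (vs (- 1) (s n))) u\<bar> \<le> nm (va (s m) (vs (- 1) (s n)))" by (intro nm_ge va_C vs_C sC mn u)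
   ultimately show "\<bar>rap (s m) u - rap (s n) u\<bar> < \<epsilon>" using sC mn u by simp
  qed
 qed
 define P where "P u r \<longleftrightarrow> (\<exists>k\<in>omega. \<forall>n\<in>omega. k \<in> ext n \<longrightarrow> r \<le> rap (ap q n) u)" for u r
 have DP: "Df (\<lambda>e. P (t e) (r e))" if "DT t" "DR r" for t r
  unfolding P_def by (intro df q that(1)[THEN DT_weaken] that(2)[THEN DR_weaken] omega_Sets)
 define l where "l u = lubf (P u)" for u
 have Dl: "DR (\<lambda>e. l (e 0))" unfolding l_def by (intro df DP)
 have lim: "\<bar>rap (s n) u - l u\<bar> \<le> \<epsilon>"
  if k: "k \<in> omega" "?ca k (\<epsilon>)"
   and n: "n \<in> omega" "k \<in> ext n" and u: "u \<in> St" for k n u \<epsilon>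
 proof -
  have lo: "P u (rap (s n) u - \<epsilon>)" unfolding P_def
  proof (intro bexI[OF _ k(1)] ballI impI)
   fix m assume m: "m \<in> omega" "k \<in> ext m"
   then show "rap (s n) u - \<epsilon> \<le> rap (ap q m) u" using k(2)[rule_format, OF n(1) m(1) n(2) m(2) u] unfolding q(2)[OF m(1), symmetric] by linarith
  qed
  have hi: "r \<le> rap (s n) u + \<epsilon>" if "P u r" for r
  proof -
   from that obtain j where j: "j \<in> omega" "\<forall>n\<in>omega. j \<in> ext n \<longrightarrow> r \<le> rap (ap q n) u" unfolding P_def by blast
   from nat_upper[OF j(1) k(1)] obtain m where m: "m \<in> omega" "j \<in> ext m" "k \<in> ext m" by blast
   then have "r \<le> rap (s m) u" using j q by simp
   then show ?thesis using k(2)[rule_format, OF n(1) m(1) n(2) m(3) u] by linarith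
  qed
  have "\<exists>x. lub (P u) x" by (rule lub_ex[of "P u", OF _ lo hi]) (intro DP df StU u)
  then obtain x where x: "lub (P u) x" ..
  then have "l u = x" unfolding l_def by (rule lubf)
  then have "rap (s n) u - \<epsilon> \<le> l u" "l u \<le> rap (s n) u + \<epsilon>" using x lo hi unfolding lub_def by blast+
  then show ?thesis by linarith
 qed
 have "cont l" unfolding cont_def
 proof (intro ballI allI impI)
  fix u and \<epsilon> :: "'a fld" assume u: "u \<in> St" "0 < \<epsilon>"
  then have e3: "0 < \<epsilon> / 4" by simp
  from cauchy[OF e3] obtain k where k: "k \<in> omega" "?ca k (\<epsilon> / 4)" by blast
  let ?n = "sc k"
  have n: "?n \<in> omega" "k \<in> ext ?n" using k by (auto simp: omega_U)
  from Cc_cont[OF sC[OF n(1)]] u(1) e3 obtain a where a: "a \<in> ext u" "\<forall>v\<in>St. a \<in> ext v \<longrightarrow> \<bar>rap (s ?n) v - rap (s ?n) u\<bar> < \<epsilon> / 4"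
   unfolding cont_def by blast
  have "\<bar>l v - l u\<bar> < \<epsilon>" if v: "v \<in> St" "a \<in> ext v" for v
  proof -
   have "\<bar>rap (s ?n) v - rap (s ?n) u\<bar> < \<epsilon> / 4" using a v by blast
   moreover have "\<bar>rap (s ?n) v - l v\<bar> \<le> \<epsilon> / 4" "\<bar>rap (s ?n) u - l u\<bar> \<le> \<epsilon> / 4" using lim[OF k n v(1)] lim[OF k n u(1)] by auto
   ultimately have "\<bar>l v - l u\<bar> < 3 * (\<epsilon> / 4)" by linarith
   then show ?thesis using u(2) by simp
  qed
  then show "\<exists>a\<in>ext u. \<forall>v\<in>St. a \<in> ext v \<longrightarrow> \<bar>l v - l u\<bar> < \<epsilon>" using a(1) by blast
 qed
 then have xC: "mk l \<in> Cc" using mk_C[OF Dl] by blast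
 have xl: "rap (mk l) u = l u" if "u \<in> St" for u using Dl that by simp
 show "\<exists>x\<in>carrier X. \<forall>e\<in>CR. \<zero>\<^bsub>R0\<^esub> \<prec>\<^bsub>R0\<^esub> e \<longrightarrow> (\<exists>k\<in>omega. \<forall>n\<in>omega. E k n \<longrightarrow> nrm X (s n \<ominus>\<^bsub>X\<^esub> x) \<prec>\<^bsub>R0\<^esub> e)"
  unfolding carrier_X
 proof (intro bexI[OF _ xC] ballI impI)
  fix e assume e: "e \<in> CR" "\<zero>\<^bsub>R0\<^esub> \<prec>\<^bsub>R0\<^esub> e"
  then have p: "0 < pi e" using rps(9)[of 0 "pi e"] by (simp add: rps(1))
  then have "0 < pi e / 2" by simp
  from cauchy[OF this] obtain k where k: "k \<in> omega" "?ca k (pi e / 2)" by blast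
  show "\<exists>k\<in>omega. \<forall>n\<in>omega. E k n \<longrightarrow> nrm X (s n \<ominus>\<^bsub>X\<^esub> mk l) \<prec>\<^bsub>R0\<^esub> e"
  proof (intro bexI[OF _ k(1)] ballI impI)
   fix n assume n: "n \<in> omega" "E k n"
   then have kn: "k \<in> ext n" using Eo k by blast
   have "nm (va (s n) (vs (- 1) (mk l))) \<le> pi e / 2"
   proof (rule nm_le)
    fix u assume u: "u \<in> St"
    show "\<bar>rap (va (s n) (vs (- 1) (mk l))) u\<bar> \<le> pi e / 2" using lim[OF k n(1) kn u] sC[OF n(1)] xC u xl by simp
   qed (use sC n xC in auto)
   also have "\<dots> < pi e" using p by simp
   finally have "rp (nm (va (s n) (vs (- 1) (mk l)))) \<prec>\<^bsub>R0\<^esub> rp (pi e)" by (simp add: rps(9))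
   then show "nrm X (s n \<ominus>\<^bsub>X\<^esub> mk l) \<prec>\<^bsub>R0\<^esub> e" using minus_X[OF sC[OF n(1)] xC] nrm_X sC n xC e by simp
  qed
 qed
qed

definition ch :: "'a \<Rightarrow> 'a \<Rightarrow> 'a fld" where "ch a u = (if a \<in> ext u then 1 else 0)"

lemma DR_ch[df]: "DT t \<Longrightarrow> DT u \<Longrightarrow> DR (\<lambda>e. ch (t e) (u e))" unfolding ch_def by (intro df)

text \<open>The product of a function with the characteristic function of a clopen set;
  \<open>cut a one\<close> is this characteristic function itself.\<close>

definition cut :: "'a \<Rightarrow> 'a \<Rightarrow> 'a" where "cut a c = mk (\<lambda>u. ch a u * rap c u)"

lemma DT_cut[df]: assumes "DT t" "DT u" shows "DT (\<lambda>e. cut (t e) (u e))"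
 unfolding cut_def by (intro df assms[THEN DT_weaken])

lemma cut_C: assumes a: "a \<in> Lc" and c: "c \<in> Cc" shows "cut a c \<in> Cc"
 unfolding cut_def
proof (rule mk_C)
 show "DR (\<lambda>e. ch a (e 0) * rap c (e 0))" by (intro df CcU c LU a)
 show "cont (\<lambda>u. ch a u * rap c u)" unfolding cont_def
 proof (intro ballI allI impI)
  fix u and \<epsilon> :: "'a fld" assume u: "u \<in> St" "0 < \<epsilon>"
  \<comment> \<open>A clopen neighbourhood of \<open>u\<close> on which the factor
    \<open>ch a\<close> is constant.\<close>
  let ?a = "if a \<in> ext u then a else cm a"
  have A: "?a \<in> Lc" "?a \<in> ext u" using a St_cm[OF u(1) a] by auto
  have eq: "ch a v = ch a u" if "v \<in> St" "?a \<in> ext v" for v using that St_cm[OF that(1) a] by (auto simp: ch_def split: if_splits)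
  from Cc_cont[OF c] u obtain b where b: "b \<in> ext u" "\<forall>v\<in>St. b \<in> ext v \<longrightarrow> \<bar>rap c v - rap c u\<bar> < \<epsilon>" unfolding cont_def by blast
  have bL: "b \<in> Lc" using b u St_sub by blast
  show "\<exists>d\<in>ext u. \<forall>v\<in>St. d \<in> ext v \<longrightarrow> \<bar>ch a v * rap c v - ch a u * rap c u\<bar> < \<epsilon>"
  proof (intro bexI[of _ "mt ?a b"] ballI impI)
   show "mt ?a b \<in> ext u" using St_mt[OF u(1) A(1) bL] A b by simp
   fix v assume v: "v \<in> St" "mt ?a b \<in> ext v"
   then have "?a \<in> ext v" "b \<in> ext v" using St_mt[OF v(1) A(1) bL] by auto
   then have "ch a v = ch a u" "\<bar>rap c v - rap c u\<bar> < \<epsilon>" using eq[OF v(1)] b v by auto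
   then show "\<bar>ch a v * rap c v - ch a u * rap c u\<bar> < \<epsilon>" using u(2) by (simp add: ch_def)
  qed
 qed
qed

lemma cut_ap: "a \<in> U \<Longrightarrow> c \<in> Cc \<Longrightarrow> u \<in> St \<Longrightarrow> rap (cut a c) u = ch a u * rap c u"
 unfolding cut_def using CcU[of c] by (intro mk_ap df)

definition one :: 'a where "one = mk (\<lambda>u. 1)"

lemma one_C: "one \<in> Cc" unfolding one_def by (intro mk_C cont_const df)
lemma one_ap: "u \<in> St \<Longrightarrow> rap one u = 1" unfolding one_def by (intro mk_ap df)
lemma oneU: "one \<in> U" using CcU one_C by blast

end

subsection \<open>A uniformly Gateaux smooth renorming\<close>

locale coded_cstone = cstone U E Om Lc + coded_algebra U E Om Lc Gm cn
 for U :: "'a set" and E Om Lc Gm cn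
begin

lemma halves_ex: "\<exists>c. c \<in> U \<and> rap c (cd {}) = 1 \<and> (\<forall>n\<in>omega. rap c (sc n) = rap c n / 2)"
proof -
 have "DR (\<lambda>e. pi (e (Suc 0)) / 2)" by (intro df)
 from rrec[of "\<lambda>n x. x / 2", OF this] show ?thesis by blast
qed

definition hv :: 'a where "hv = (SOME c. c \<in> U \<and> rap c (cd {}) = 1 \<and> (\<forall>n\<in>omega. rap c (sc n) = rap c n / 2))"

lemma hv: "hv \<in> U" "rap hv (cd {}) = 1" "n \<in> omega \<Longrightarrow> rap hv (sc n) = rap hv n / 2"
 using someI_ex[OF halves_ex] unfolding hv_def by auto

lemma hv_pos: "n \<in> omega \<Longrightarrow> 0 < rap hv n"
proof (induction rule: omega_induct)
 case Df show ?case by (intro df hv)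
qed (auto simp: hv)

text \<open>The weight is \<open>1 / 2 ^ (k + 1)\<close> for an element with code \<open>k\<close>;
  the shift by one makes the sum over all codes at most 1.\<close>

definition w :: "'a \<Rightarrow> 'a fld" where "w a = rap hv (sc (ap cn a))"

lemma DR_w[df]: "DT t \<Longrightarrow> DR (\<lambda>e. w (t e))" unfolding w_def by (intro df hv cnU)

lemma w_pos: "a \<in> Gm \<Longrightarrow> 0 < w a" unfolding w_def using cn_omega hv_pos omega_sc by blast

lemma GmU: "a \<in> Gm \<Longrightarrow> a \<in> U" using Gm_L LU by blast

lemma FinU: "F \<in> Fin Gm \<Longrightarrow> F \<in> U" "F \<in> Fin Gm \<Longrightarrow> finite_in (ext F)" "F \<in> Fin Gm \<Longrightarrow> a \<in> ext F \<Longrightarrow> a \<in> Gm"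
 unfolding Fin_iff by blast+

text \<open>Elements with the same code are disjoint, so at the point \<open>u\<close> each code
  contributes at most one term. Passing from \<open>m\<close> to its successor costs at most half of
  \<open>rap hv m\<close>.\<close>

lemma weights_below: assumes u: "u \<in> St" and "m \<in> omega"
 shows "\<forall>F\<in>Fin Gm. (\<forall>a\<in>ext F. ap cn a \<in> ext m) \<longrightarrow> rsum (\<lambda>a. w a * ch a u) (ext F) \<le> 1 - rap hv m"
 using assms(2)
proof (induction rule: omega_induct)
 case Df show ?case by (intro df Gm StU u hv cnU Sets_Fin)
next
 have D: "DR (\<lambda>e. w (e 0) * ch (e 0) u)" by (intro df StU u)
 case 0
 show ?case
 proof (intro ballI impI)
  fix F assume "F \<in> Fin Gm" "\<forall>a\<in>ext F. ap cn a \<in> ext (cd {})"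
  then have "ext F = {}" by auto
  then show "rsum (\<lambda>a. w a * ch a u) (ext F) \<le> 1 - rap hv (cd {})" using rsum_empty[OF D] hv by simp
 qed
next
 have D: "DR (\<lambda>e. w (e 0) * ch (e 0) u)" by (intro df StU u)
 case (sc m)
 show ?case
 proof (intro ballI impI)
  fix F assume F: "F \<in> Fin Gm" "\<forall>a\<in>ext F. ap cn a \<in> ext (sc m)"
  let ?B = "{a \<in> ext F. ap cn a \<in> ext m}"
  have B: "?B \<in> Sets" by (intro separation df cnU omega_U sc) (use FinU[OF F(1)] in auto)
  have fB: "finite_in ?B" using finite_in_subset[OF FinU(2)[OF F(1)] _ B] by blast
  have "cd ?B \<in> Fin Gm" using B fB FinU(3)[OF F(1)] by (auto simp: Fin_iff)
  then have le: "rsum (\<lambda>a. w a * ch a u) ?B \<le> 1 - rap hv m" using sc(2) B by auto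
  have m: "ap cn a = m" if "a \<in> ext F" "a \<notin> ?B" for a using F(2) that sc(1) by (auto simp: omega_U)
  have h: "0 < rap hv m" "rap hv (sc m) = rap hv m / 2" using hv_pos hv sc by auto
  show "rsum (\<lambda>a. w a * ch a u) (ext F) \<le> 1 - rap hv (sc m)"
  proof (cases "\<exists>a\<in>ext F. a \<notin> ?B \<and> a \<in> ext u")
   case True
   then obtain a where a: "a \<in> ext F" "a \<notin> ?B" "a \<in> ext u" by blast
   note R = rsum_remove[OF FinU(2)[OF F(1)] a(1) D]
   have z: "w b * ch b u = 0" if b: "b \<in> ext F - {a}" "b \<notin> ?B" for b
   proof -
    have "ap cn b = ap cn a" using m[of b] m[of a] a b by auto
    moreover have g: "a \<in> Gm" "b \<in> Gm" "a \<noteq> b" using FinU(3)[OF F(1)] a b by auto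
    ultimately have "mt a b = bt" using cn_eq by metis
    then have "b \<notin> ext u" using St_mt[OF u, of a b] g Gm_L a St_bt[OF u] by auto
    then show ?thesis by (simp add: ch_def)
   qed
   have "?B \<union> (ext F - {a}) = ext F - {a}" using a by blast
   then have "rsum (\<lambda>a. w a * ch a u) (ext F - {a}) = rsum (\<lambda>a. w a * ch a u) ?B"
    using rsum_neutral[OF fB R(2) D z] by simp
   moreover have "w a = rap hv m / 2" unfolding w_def using m[OF a(1,2)] h by simp
   ultimately show ?thesis using R(1) le h a(3) by (simp add: ch_def)
  next
   case False
   have z: "w b * ch b u = 0" if "b \<in> ext F" "b \<notin> ?B" for b using False that by (auto simp: ch_def)
   have "?B \<union> ext F = ext F" by blast
   then have "rsum (\<lambda>a. w a * ch a u) (ext F) = rsum (\<lambda>a. w a * ch a u) ?B"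
    using rsum_neutral[OF fB FinU(2)[OF F(1)] D z] by simp
   then show ?thesis using le h by simp
  qed
 qed
qed

lemma weights: assumes u: "u \<in> St" and F: "F \<in> Fin Gm" shows "rsum (\<lambda>a. w a * ch a u) (ext F) \<le> 1"
proof -
 have f: "finite_in (ap cn ` ext F)" by (rule finite_in_image[OF FinU(2)[OF F]]) (intro df cnU)
 have o: "ap cn ` ext F \<subseteq> omega" using FinU(3)[OF F] cn_omega by blast
 have "\<exists>m\<in>omega. \<forall>a\<in>ext F. ap cn a \<in> ext m"
 proof (cases "ext F = {}")
  case False
  then obtain m where m: "m \<in> ap cn ` ext F" "\<forall>n\<in>ap cn ` ext F. n = m \<or> n \<in> ext m" using finite_max[OF f o] by blast
  then show ?thesis using o by (intro bexI[of _ "sc m"]) (auto simp: omega_U)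
 qed auto
 then obtain m where m: "m \<in> omega" "\<forall>a\<in>ext F. ap cn a \<in> ext m" by blast
 then have "rsum (\<lambda>a. w a * ch a u) (ext F) \<le> 1 - rap hv m" using weights_below[OF u m(1)] F by blast
 then show ?thesis using hv_pos[OF m(1)] by simp
qed

text \<open>\<open>Rp c q\<close>: the function \<open>c\<close> is a finite combination \<open>\<Sum> k\<^sub>a \<chi>\<^sub>a\<close> of generators with
 \<open>q = \<Sum> k\<^sub>a\<^sup>2 / w\<^sub>a\<close>. Up to bounded factors, the new norm is the infimum of
 \<open>(\<parallel>x - c\<parallel>\<^sup>2 + q)\<^sup>1\<^sup>/\<^sup>2\<close>; translating \<open>x\<close> and \<open>c\<close> in the same direction changes only the
 Hilbertian part \<open>q\<close>.\<close>

definition Rp :: "'a \<Rightarrow> 'a fld \<Rightarrow> bool" where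
 "Rp c q \<longleftrightarrow> c \<in> Cc \<and> (\<exists>F\<in>Fin Gm. \<exists>k\<in>U. (\<forall>u\<in>St. rap c u = rsum (\<lambda>a. rap k a * ch a u) (ext F)) \<and>
   q = rsum (\<lambda>a. (rap k a)\<^sup>2 / w a) (ext F))"

lemma Df_Rp[df]: assumes "DT t" "DR r" shows "Df (\<lambda>e. Rp (t e) (r e))"
 unfolding Rp_def by (intro df Cc_Sets Sets_Fin Gm St_Sets assms assms(1)[THEN DT_weaken] assms(2)[THEN DR_weaken])

lemma Rp_C: "Rp c q \<Longrightarrow> c \<in> Cc" unfolding Rp_def by blast

text \<open>The Cauchy-Schwarz inequality for weights with sum at most 1. It is obtained without
  square roots: with \<open>y = rap c u\<close>, the nonnegative terms
  \<open>(rap k a - y * w a)\<^sup>2 / w a\<close> are expanded for those \<open>a\<close> that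
  contain \<open>u\<close>, and the resulting bounds are summed.\<close>

lemma Rp_bound: assumes R: "Rp c q" and u: "u \<in> St" shows "(rap c u)\<^sup>2 \<le> q"
proof -
 from R obtain F k where F: "F \<in> Fin Gm" "k \<in> U" "rap c u = rsum (\<lambda>a. rap k a * ch a u) (ext F)"
  "q = rsum (\<lambda>a. (rap k a)\<^sup>2 / w a) (ext F)" unfolding Rp_def using u by blast
 let ?y = "rap c u"
 note uU = StU[OF u]
 have D: "DR (\<lambda>e. rap k (e 0) * ch (e 0) u)" "DR (\<lambda>e. w (e 0) * ch (e 0) u)" "DR (\<lambda>e. (rap k (e 0))\<^sup>2 / w (e 0))" "DR (\<lambda>e. (2 * ?y) * (rap k (e 0) * ch (e 0) u))" "DR (\<lambda>e. (- ?y\<^sup>2) * (w (e 0) * ch (e 0) u))"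
  "DR (\<lambda>e. (2 * ?y) * (rap k (e 0) * ch (e 0) u) + (- ?y\<^sup>2) * (w (e 0) * ch (e 0) u))"
  by (intro df F uU)+
 note fF = FinU(2)[OF F(1)]
 have "rsum (\<lambda>a. (2 * ?y) * (rap k a * ch a u) + (- ?y\<^sup>2) * (w a * ch a u)) (ext F) \<le> rsum (\<lambda>a. (rap k a)\<^sup>2 / w a) (ext F)"
 proof (rule rsum_mono[OF fF D(6,3)])
  fix a assume "a \<in> ext F"
  then have wp: "0 < w a" using w_pos FinU(3)[OF F(1)] by blast
  have "0 \<le> (rap k a - ?y * w a)\<^sup>2 / w a" using wp by simp
  also have "\<dots> = (rap k a)\<^sup>2 / w a - (2 * ?y * rap k a - ?y\<^sup>2 * w a)" using wp by (simp add: field_simps power2_eq_square)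
  finally show "(2 * ?y) * (rap k a * ch a u) + (- ?y\<^sup>2) * (w a * ch a u) \<le> (rap k a)\<^sup>2 / w a"
   using wp by (simp add: ch_def)
 qed
 then have "2 * ?y * ?y - ?y\<^sup>2 * rsum (\<lambda>a. w a * ch a u) (ext F) \<le> q"
  unfolding rsum_add[OF fF D(4,5)] rsum_scale[OF fF D(1)] rsum_scale[OF fF D(2)] using F by simp
 moreover have "?y\<^sup>2 * rsum (\<lambda>a. w a * ch a u) (ext F) \<le> ?y\<^sup>2 * 1" by (intro mult_left_mono weights u F) auto
 ultimately show ?thesis by (simp add: power2_eq_square)
qed

lemma Rp_nonneg: "Rp c q \<Longrightarrow> 0 \<le> q" using Rp_bound St_ne by (meson ex_in_conv order_trans zero_le_power2)

lemma Rp_zero: "Rp vz 0"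
proof -
 have "DR (\<lambda>e. rap (cd {}) (e 0) * ch (e 0) u)" if "u \<in> St" for u by (intro df StU that) auto
 moreover have "DR (\<lambda>e. (rap (cd {}) (e 0))\<^sup>2 / w (e 0))" by (intro df) auto
 ultimately show ?thesis unfolding Rp_def
  by (intro conjI vz_C bexI[of _ "cd {}"] ballI) (auto simp: Fin_iff)
qed

lemma rsum_ext0: assumes F: "finite_in F" and G: "finite_in G" and g: "\<And>a. a \<in> F \<Longrightarrow> g a = h a" "\<And>a. a \<in> G \<Longrightarrow> a \<notin> F \<Longrightarrow> h a = 0"
 and D: "DR (\<lambda>e. h (e 0))" shows "rsum g F = rsum h (F \<union> G)"
 using rsum_neutral[OF F G D g(2)] rsum_cong[of F g h, OF g(1)] by simp

text \<open>Both representations are extended by zero to the union of their index sets, and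
  \<open>b\<close> is the weighted inner product of the coefficients. The point is that one
  \<open>b\<close> serves all \<open>r\<close>: the Hilbertian part is a quadratic polynomial along
  a line.\<close>

lemma Rp_line: assumes h: "Rp h q" and g: "Rp g p"
 shows "\<exists>b. \<forall>r. Rp (va h (vs r g)) (q + 2 * r * b + r\<^sup>2 * p)"
proof -
 from h obtain F k where F: "F \<in> Fin Gm" "k \<in> U" "\<And>u. u \<in> St \<Longrightarrow> rap h u = rsum (\<lambda>a. rap k a * ch a u) (ext F)"
  "q = rsum (\<lambda>a. (rap k a)\<^sup>2 / w a) (ext F)" unfolding Rp_def by blast
 from g obtain H l where H: "H \<in> Fin Gm" "l \<in> U" "\<And>u. u \<in> St \<Longrightarrow> rap g u = rsum (\<lambda>a. rap l a * ch a u) (ext H)"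
  "p = rsum (\<lambda>a. (rap l a)\<^sup>2 / w a) (ext H)" unfolding Rp_def by blast
 have hC: "h \<in> Cc" "g \<in> Cc" using h g Rp_C by auto
 note f = FinU(2)[OF F(1)] FinU(2)[OF H(1)] and FU = FinU(1)[OF F(1)] FinU(1)[OF H(1)]
 let ?S = "ext F \<union> ext H"
 have fS: "finite_in ?S" using f by auto
 have SS: "?S \<in> Sets" using fS finite_in_Sets by blast
 define kk where "kk a = (if a \<in> ext F then rap k a else 0)" for a
 define ll where "ll a = (if a \<in> ext H then rap l a else 0)" for a
 have Dk: "DR (\<lambda>e. kk (t e))" "DR (\<lambda>e. ll (t e))" if "DT t" for t unfolding kk_def ll_def by (intro df F H FU that)+
 have hk: "rap h u = rsum (\<lambda>a. kk a * ch a u) ?S" if "u \<in> St" for u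
  unfolding F(3)[OF that] by (rule rsum_ext0[OF f]) (auto simp: kk_def[symmetric] intro!: df Dk StU that, auto simp: kk_def)
 have gl: "rap g u = rsum (\<lambda>a. ll a * ch a u) ?S" if "u \<in> St" for u
  unfolding H(3)[OF that] Un_commute[of "ext F"] by (rule rsum_ext0[OF f(2,1)]) (auto simp: ll_def[symmetric] intro!: df Dk StU that, auto simp: ll_def)
 have qk: "q = rsum (\<lambda>a. (kk a)\<^sup>2 / w a) ?S"
  unfolding F(4) by (rule rsum_ext0[OF f]) (auto simp: kk_def[symmetric] intro!: df Dk, auto simp: kk_def)
 have pl: "p = rsum (\<lambda>a. (ll a)\<^sup>2 / w a) ?S"
  unfolding H(4) Un_commute[of "ext F"] by (rule rsum_ext0[OF f(2,1)]) (auto simp: ll_def[symmetric] intro!: df Dk, auto simp: ll_def)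
 define b where "b = rsum (\<lambda>a. kk a * ll a / w a) ?S"
 show ?thesis
 proof (intro exI[of _ b] allI)
  fix r
  let ?m = "mkf ?S (\<lambda>a. kk a + r * ll a)"
  have m: "rap ?m a = kk a + r * ll a" if "a \<in> ?S" for a by (rule rap_mkf[OF SS _ that]) (intro df Dk)
  show "Rp (va h (vs r g)) (q + 2 * r * b + r\<^sup>2 * p)" unfolding Rp_def
  proof (rule conjI, intro va_C vs_C hC, rule bexI[of _ "cd ?S"], rule bexI[of _ ?m], intro conjI ballI)
   show "cd ?S \<in> Fin Gm" using F H SS fS by (auto simp: Fin_iff)
   fix u assume u: "u \<in> St"
   have "rap (va h (vs r g)) u = rsum (\<lambda>a. kk a * ch a u) ?S + r * rsum (\<lambda>a. ll a * ch a u) ?S" using hk gl u hC by simp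
   also have "\<dots> = rsum (\<lambda>a. kk a * ch a u) ?S + rsum (\<lambda>a. r * (ll a * ch a u)) ?S"
    by (subst rsum_scale[OF fS]) (intro df Dk StU u refl)+
   also have "\<dots> = rsum (\<lambda>a. kk a * ch a u + r * (ll a * ch a u)) ?S"
    by (subst rsum_add[OF fS]) (intro df Dk StU u refl)+
   also have "\<dots> = rsum (\<lambda>a. rap ?m a * ch a u) ?S" by (rule rsum_cong) (simp add: m algebra_simps)
   finally show "rap (va h (vs r g)) u = rsum (\<lambda>a. rap ?m a * ch a u) (ext (cd ?S))" using SS by simp
  next
   have "q + 2 * r * b + r\<^sup>2 * p = rsum (\<lambda>a. (kk a)\<^sup>2 / w a) ?S + rsum (\<lambda>a. (2 * r) * (kk a * ll a / w a)) ?S + rsum (\<lambda>a. r\<^sup>2 * ((ll a)\<^sup>2 / w a)) ?S"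
    unfolding qk pl b_def
    by (subst rsum_scale[OF fS], intro df Dk, subst rsum_scale[OF fS], intro df Dk, rule refl)
   also have "\<dots> = rsum (\<lambda>a. (kk a)\<^sup>2 / w a + (2 * r) * (kk a * ll a / w a) + r\<^sup>2 * ((ll a)\<^sup>2 / w a)) ?S"
    by (subst rsum_add[OF fS], intro df Dk, intro df Dk, subst rsum_add[OF fS], intro df Dk, intro df Dk, rule refl)
   also have "\<dots> = rsum (\<lambda>a. (rap ?m a)\<^sup>2 / w a) ?S"
   proof (rule rsum_cong)
    fix a assume a: "a \<in> ?S"
    have "(kk a)\<^sup>2 / w a + (2 * r) * (kk a * ll a / w a) + r\<^sup>2 * ((ll a)\<^sup>2 / w a) = ((kk a)\<^sup>2 + 2 * r * (kk a * ll a) + r\<^sup>2 * (ll a)\<^sup>2) / w a"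
     by (simp add: add_divide_distrib)
    then show "(kk a)\<^sup>2 / w a + (2 * r) * (kk a * ll a / w a) + r\<^sup>2 * ((ll a)\<^sup>2 / w a) = (rap ?m a)\<^sup>2 / w a"
     unfolding m[OF a] by (simp add: power2_eq_square algebra_simps)
   qed
   finally show "q + 2 * r * b + r\<^sup>2 * p = rsum (\<lambda>a. (rap ?m a)\<^sup>2 / w a) (ext (cd ?S))" using SS by simp
  qed auto
 qed
qed

text \<open>Along a line through zero the quadratic polynomial has no constant term and is
  nonnegative, which forces its linear coefficient to vanish; \<open>- b / q\<close> is its
  minimiser for \<open>q > 0\<close>.\<close>

lemma Rp_scale: assumes "Rp c q" shows "Rp (vs r c) (r\<^sup>2 * q)"
proof -
 have c: "c \<in> Cc" using assms Rp_C by blast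
 from Rp_line[OF Rp_zero assms] obtain b where b: "\<And>r. Rp (va vz (vs r c)) (2 * r * b + r\<^sup>2 * q)" by auto
 have nn: "0 \<le> 2 * r * b + r\<^sup>2 * q" for r using Rp_nonneg[OF b] .
 have "b = 0"
 proof (cases "q = 0")
  case True then show ?thesis using nn[of 1] nn[of "- 1"] by simp
 next
  case False
  then have q: "0 < q" using Rp_nonneg[OF assms] by simp
  have "0 \<le> 2 * (- b / q) * b + (- b / q)\<^sup>2 * q" by (rule nn)
  also have "\<dots> = - (b\<^sup>2 / q)" using q by (simp add: field_simps power2_eq_square)
  finally have "b\<^sup>2 \<le> 0" using q by (simp add: divide_le_0_iff)
  then show ?thesis by simp
 qed
 moreover have "va vz (vs r c) = vs r c" using c by (intro C_eq) auto
 ultimately show ?thesis using b[of r] by simp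
qed

text \<open>Joint convexity of the quotient \<open>q / l\<close> in the vector and the parameter.
  The mixed term is controlled by evaluating the nonnegative polynomial of \<open>Rp_line\<close> at
  \<open>r = - l / m\<close>.\<close>

lemma Rp_convex: assumes h: "Rp h q" and g: "Rp g p" and l: "0 < l" "0 < m"
 shows "\<exists>r. Rp (va h g) r \<and> r / (l + m) \<le> q / l + p / m"
proof -
 have C: "h \<in> Cc" "g \<in> Cc" using h g Rp_C by auto
 from Rp_line[OF h g] obtain b where b: "\<And>r. Rp (va h (vs r g)) (q + 2 * r * b + r\<^sup>2 * p)" by blast
 have "va h (vs 1 g) = va h g" using C by (intro C_eq) auto
 then have R: "Rp (va h g) (q + 2 * b + p)" using b[of 1] by simp
 have "0 \<le> q + 2 * (- l / m) * b + (- l / m)\<^sup>2 * p" using Rp_nonneg[OF b] .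
 then have "0 \<le> (q + 2 * (- l / m) * b + (- l / m)\<^sup>2 * p) * m\<^sup>2" by simp
 also have "\<dots> = q * m\<^sup>2 - 2 * l * m * b + l\<^sup>2 * p" using l by (simp add: field_simps power2_eq_square)
 finally have "(q + 2 * b + p) * (l * m) \<le> (q * m + p * l) * (l + m)" by (simp add: algebra_simps power2_eq_square)
 then have "(q + 2 * b + p) / (l + m) \<le> (q * m + p * l) / (l * m)" using l by (simp add: divide_le_eq le_divide_eq pos_less_divide_eq mult.commute add_pos_pos)
 also have "\<dots> = q / l + p / m" using l by (simp add: field_simps)
 finally show ?thesis using R by blast
qed

end

section \<open>Density of the span of the generators and the new norm\<close>

context coded_cstone
begin

definition Sp :: "'a \<Rightarrow> bool" where "Sp c \<longleftrightarrow> (\<exists>q. Rp c q)"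

lemma Df_Sp[df]: assumes "DT t" shows "Df (\<lambda>e. Sp (t e))"
 unfolding Sp_def by (intro df assms[THEN DT_weaken])

lemma Sp_C: "Sp c \<Longrightarrow> c \<in> Cc" unfolding Sp_def using Rp_C by blast
lemma Sp_zero: "Sp vz" unfolding Sp_def using Rp_zero by blast
lemma Sp_lin: "Sp c \<Longrightarrow> Sp d \<Longrightarrow> Sp (va c (vs r d))" unfolding Sp_def using Rp_line by blast

lemma Sp_gen: assumes a: "a \<in> Gm" shows "Sp (cut a one)"
proof -
 have aU: "a \<in> U" using a GmU by blast
 have s: "{a} \<in> Sets" using Sets_pair[OF aU aU] by simp
 let ?k = "mkf {a} (\<lambda>_. 1)"
 have k: "rap ?k a = 1" by (rule rap_mkf[OF s]) (auto intro!: df)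
 have D: "DR (\<lambda>e. rap ?k (e 0) * ch (e 0) u)" if "u \<in> St" for u by (intro df mkf_U StU[OF that])
 have "rsum (\<lambda>b. rap ?k b * ch b u) {a} = ch a u" if "u \<in> St" for u
  using rsum_insert[OF D[OF that], of "{}" a] rsum_empty[OF D[OF that]] aU k by simp
 then have "Rp (cut a one) (rsum (\<lambda>b. (rap ?k b)\<^sup>2 / w b) {a})" unfolding Rp_def
  using a aU s by (intro conjI cut_C one_C bexI[of _ "cd {a}"] bexI[of _ ?k] ballI)
   (auto simp: cut_ap one_C one_ap Fin_iff subsetD[OF Gm_L])
 then show ?thesis unfolding Sp_def by blast
qed

text \<open>Multiplying a combination of generators by a generator turns each term into a multiple
  of a generator or into zero, because \<open>Gm\<close> is multiplicative.\<close>

lemma Sp_cut_gen: assumes a: "a \<in> Gm" and c: "Sp c" shows "Sp (cut a c)"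
proof -
 from c obtain F k where F: "F \<in> Fin Gm" "k \<in> U" "\<And>u. u \<in> St \<Longrightarrow> rap c u = rsum (\<lambda>a. rap k a * ch a u) (ext F)"
  unfolding Sp_def Rp_def by blast
 have aL: "a \<in> Lc" "a \<in> U" using a Gm_L GmU by auto
 have D: "DR (\<lambda>e. rap k (e 0) * ch (e 0) u)" if "u \<in> St" for u by (intro df StU that F)
 have "ext F \<subseteq> Gm \<longrightarrow> (\<exists>d\<in>U. Sp d \<and> (\<forall>u\<in>St. rap d u = ch a u * rsum (\<lambda>b. rap k b * ch b u) (ext F)))"
  using FinU(2)[OF F(1)]
 proof (induction rule: finite_in_induct)
  case Df show ?case by (intro df Gm St_Sets aL F)
 next
  case empty
  show ?case using Sp_zero CcU[OF vz_C] rsum_empty[OF D] by (intro impI bexI[of _ vz]) auto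
 next
  case (insert x H)
  show ?case
  proof
   assume sub: "insert x H \<subseteq> Gm"
   then obtain d where d: "d \<in> U" "Sp d" "\<And>u. u \<in> St \<Longrightarrow> rap d u = ch a u * rsum (\<lambda>b. rap k b * ch b u) H" using insert by auto
   have x: "x \<in> Gm" "x \<in> Lc" "x \<in> U" using sub Gm_L GmU by auto
   have cx: "Sp (cut (mt a x) one)"
   proof (cases "mt a x = bt")
    case True
    have "cut (mt a x) one = vz" using True
     by (intro C_eq) (auto simp: cut_ap one_C one_ap ch_def intro!: cut_C)
    then show ?thesis using Sp_zero by simp
   qed (use Gm_mt[OF a x(1)] Sp_gen in auto)
   let ?d = "va d (vs (rap k x) (cut (mt a x) one))"
   have "rap ?d u = ch a u * rsum (\<lambda>b. rap k b * ch b u) (insert x H)" if u: "u \<in> St" for u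
   proof -
    have "rap ?d u = ch a u * rsum (\<lambda>b. rap k b * ch b u) H + rap k x * ch (mt a x) u"
     using d u Sp_C[OF d(2)] Sp_C[OF cx] by (simp add: cut_ap one_C one_ap)
    also have "ch (mt a x) u = ch a u * ch x u" using St_mt[OF u aL(1) x(2)] by (auto simp: ch_def)
    finally show ?thesis using rsum_insert[OF D[OF u], of H x] insert x by (simp add: algebra_simps)
   qed
   moreover have "Sp ?d" using Sp_lin[OF d(2) cx] .
   ultimately show "\<exists>d\<in>U. Sp d \<and> (\<forall>u\<in>St. rap d u = ch a u * rsum (\<lambda>b. rap k b * ch b u) (insert x H))"
    using CcU[OF Sp_C] by blast
  qed
 qed
 then obtain d where d: "Sp d" "\<And>u. u \<in> St \<Longrightarrow> rap d u = ch a u * rap c u" using F FinU(3) by auto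
 have "cut a c = d" using Sp_C[OF d(1)] Sp_C[OF c] d(2) aL by (intro C_eq) (auto simp: cut_ap cut_C)
 then show ?thesis using d by simp
qed

text \<open>The elements whose characteristic functions multiply the span into itself contain
  \<open>Gm\<close> and are closed under complements and meets.\<close>

lemma Sp_cut: assumes "a \<in> Lc" "Sp c" shows "Sp (cut a c)"
proof -
 let ?S = "{a \<in> Lc. \<forall>c\<in>Cc. Sp c \<longrightarrow> Sp (cut a c)}"
 have "Lc \<subseteq> ?S"
 proof (rule Gm_gen)
  show "?S \<in> Sets" by (intro separation df Lc Cc_Sets)
  show "Gm \<subseteq> ?S" using Gm_L Sp_cut_gen by blast
 next
  fix a assume a: "a \<in> ?S" "a \<in> Lc"
  have "Sp (cut (cm a) c)" if c: "c \<in> Cc" "Sp c" for c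
  proof -
   have "cut (cm a) c = va c (vs (- 1) (cut a c))"
    by (intro C_eq) (use a c in \<open>auto simp: cut_C cut_ap LU ch_def St_cm\<close>)
   then show ?thesis using Sp_lin a c by auto
  qed
  then show "cm a \<in> ?S" using a by auto
 next
  fix a b assume ab: "a \<in> ?S" "b \<in> ?S" "a \<in> Lc" "b \<in> Lc"
  have "Sp (cut (mt a b) c)" if c: "c \<in> Cc" "Sp c" for c
  proof -
   have "cut (mt a b) c = cut a (cut b c)"
    by (intro C_eq) (use ab c in \<open>auto simp: cut_C cut_ap LU ch_def St_mt\<close>)
   then show ?thesis using ab c cut_C by auto
  qed
  then show "mt a b \<in> ?S" using ab by auto
 qed
 then show ?thesis using assms Sp_C by blast
qed

text \<open>An approximation argument by compactness. Near a point, \<open>g\<close> is close to a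
  constant; approximations on \<open>a\<close> and on \<open>b\<close> are patched by cutting one to
  \<open>a\<close> and the other to the complement of \<open>a\<close>.\<close>

lemma Sp_dense: assumes g: "g \<in> Cc" and \<epsilon>: "0 < \<epsilon>" shows "\<exists>c. Sp c \<and> nm (va g (vs (- 1) c)) \<le> \<epsilon>"
proof -
 define P where "P a \<longleftrightarrow> (\<exists>c\<in>Cc. Sp c \<and> (\<forall>u\<in>St. a \<in> ext u \<longrightarrow> \<bar>rap g u - rap c u\<bar> \<le> \<epsilon>))" for a
 have "P tp"
 proof (rule compactness)
  show "Df (\<lambda>e. P (e 0))" unfolding P_def by (intro df CcU g St_Sets Cc_Sets)
  show "P bt" unfolding P_def using Sp_zero by (intro bexI[of _ vz]) auto
 next
  fix u assume u: "u \<in> St"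
  obtain a where a: "a \<in> ext u" "\<forall>v\<in>St. a \<in> ext v \<longrightarrow> \<bar>rap g v - rap g u\<bar> < \<epsilon>"
   using Cc_cont[OF g] u \<epsilon> unfolding cont_def by blast
  have o: "cut tp one \<in> Cc" by (intro cut_C one_C tp_L)
  let ?c = "va vz (vs (rap g u) (cut tp one))"
  have "Sp ?c" by (intro Sp_lin Sp_zero Sp_gen Gm_tp)
  moreover have "\<bar>rap g v - rap ?c v\<bar> \<le> \<epsilon>" if "v \<in> St" "a \<in> ext v" for v
   using a(2)[rule_format, OF that] that o by (simp add: cut_ap one_C one_ap ch_def)
  ultimately show "\<exists>a\<in>ext u. P a" unfolding P_def using Sp_C a(1) by blast
 next
  fix a b assume "a \<in> Lc" "b \<in> Lc" "P a" "ext b \<subseteq> ext a"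
  then show "P b" unfolding P_def using St_up by meson
 next
  fix a b assume ab: "a \<in> Lc" "b \<in> Lc" "P a" "P b"
  from ab obtain c d where cd: "Sp c" "Sp d" "\<forall>u\<in>St. a \<in> ext u \<longrightarrow> \<bar>rap g u - rap c u\<bar> \<le> \<epsilon>" "\<forall>u\<in>St. b \<in> ext u \<longrightarrow> \<bar>rap g u - rap d u\<bar> \<le> \<epsilon>"
   unfolding P_def by blast
  let ?c = "va (cut a c) (vs 1 (cut (cm a) d))"
  have s: "Sp (cut a c)" "Sp (cut (cm a) d)" using Sp_cut ab cd by auto
  have "Sp ?c" using Sp_lin s by blast
  moreover have "\<bar>rap g u - rap ?c u\<bar> \<le> \<epsilon>" if u: "u \<in> St" "jn a b \<in> ext u" for u
  proof -
   have v: "rap ?c u = ch a u * rap c u + ch (cm a) u * rap d u" using u s Sp_C cd ab by (simp add: cut_ap LU)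
   show ?thesis
   proof (cases "a \<in> ext u")
    case True then show ?thesis using v u ab cd St_cm by (simp add: ch_def)
   next
    case False
    then have "b \<in> ext u" using u ab St_jn by blast
    then show ?thesis using False v u ab cd St_cm by (simp add: ch_def)
   qed
  qed
  ultimately show "P (jn a b)" unfolding P_def using Sp_C by blast
 qed
 then obtain c where c: "Sp c" "\<forall>u\<in>St. \<bar>rap g u - rap c u\<bar> \<le> \<epsilon>" unfolding P_def by auto
 have "nm (va g (vs (- 1) c)) \<le> \<epsilon>" by (rule nm_le) (use g c Sp_C in auto)
 then show ?thesis using c by blast
qed

text \<open>Let \<open>A\<close> be the squared distance of \<open>x\<close> from \<open>h\<close>
  plus \<open>q\<close>. The infimum of \<open>(l + A / l) / 2\<close> over \<open>l > 0\<close> is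
  the square root of \<open>A\<close>; the auxiliary variable \<open>l\<close> avoids roots and
  makes the expression jointly convex.\<close>

definition Val :: "'a \<Rightarrow> 'a fld \<Rightarrow> bool" where
 "Val x r \<longleftrightarrow> (\<exists>l. 0 < l \<and> (\<exists>h\<in>Cc. \<exists>q. Rp h q \<and> r = (l + ((nm (va x (vs (- 1) h)))\<^sup>2 + q) / l) / 2))"

lemma Df_Val[df]: assumes "DT t" "DR r" shows "Df (\<lambda>e. Val (t e) (r e))"
 unfolding Val_def by (intro df Cc_Sets assms(1)[THEN DT_weaken] assms(2)[THEN DR_weaken])

text \<open>The infimum of all values, written as the negative of a supremum because completeness is
  available for suprema.\<close>

definition nu :: "'a \<Rightarrow> 'a fld" where "nu x = - lubf (\<lambda>s. Val x (- s))"

lemma DR_nu[df]: assumes "DT t" shows "DR (\<lambda>e. nu (t e))"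
 unfolding nu_def by (intro df assms[THEN DT_weaken])

lemma ValI: assumes "0 < l" "Rp h q" shows "Val x ((l + ((nm (va x (vs (- 1) h)))\<^sup>2 + q) / l) / 2)"
 unfolding Val_def using assms Rp_C by blast

lemma diff0: "x \<in> Cc \<Longrightarrow> va x (vs (- 1) vz) = x" by (intro C_eq) auto

lemma Val_triv: "x \<in> Cc \<Longrightarrow> 0 < l \<Longrightarrow> Val x ((l + (nm x)\<^sup>2 / l) / 2)" using ValI[OF _ Rp_zero, of l x] diff0 by simp

text \<open>With \<open>M\<close> the distance of \<open>x\<close> from \<open>h\<close> and
  \<open>y = \<bar>rap h u\<bar>\<close>, the function \<open>x\<close> is bounded at
  \<open>u\<close> by \<open>M + y\<close>. A sum of squares gives
  \<open>l * (M + y) \<le> l\<^sup>2 + M\<^sup>2 + y\<^sup>2\<close>, and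
  \<open>y\<^sup>2 \<le> q\<close> by \<open>Rp_bound\<close>.\<close>

lemma Val_lower: assumes x: "x \<in> Cc" and v: "Val x r" shows "nm x / 2 \<le> r"
proof -
 from v obtain l h q where l: "0 < l" "Rp h q" "r = (l + ((nm (va x (vs (- 1) h)))\<^sup>2 + q) / l) / 2" unfolding Val_def by blast
 have h: "h \<in> Cc" using l Rp_C by blast
 let ?M = "nm (va x (vs (- 1) h))"
 have "nm x \<le> 2 * r"
 proof (rule nm_le[OF x])
  fix u assume u: "u \<in> St"
  let ?y = "\<bar>rap h u\<bar>"
  have "\<bar>rap (va x (vs (- 1) h)) u\<bar> \<le> ?M" by (intro nm_ge va_C vs_C x h u)
  then have "\<bar>rap x u\<bar> \<le> ?M + ?y" using x h u by simp
  moreover have "l * (?M + ?y) \<le> l\<^sup>2 + (?M\<^sup>2 + q)"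
  proof -
   have "?y\<^sup>2 \<le> q" using Rp_bound[OF l(2) u] by simp
   moreover have "0 \<le> (l - (?M + ?y) / 2)\<^sup>2 + (?M - ?y)\<^sup>2 / 4 + (?M\<^sup>2 + ?y\<^sup>2) / 2" by simp
   moreover have "(l - (?M + ?y) / 2)\<^sup>2 + (?M - ?y)\<^sup>2 / 4 + (?M\<^sup>2 + ?y\<^sup>2) / 2 = l\<^sup>2 - l * (?M + ?y) + (?M\<^sup>2 + ?y\<^sup>2)"
    by (simp add: power2_eq_square field_simps)
   ultimately show ?thesis by linarith
  qed
  moreover have "2 * r = (l\<^sup>2 + (?M\<^sup>2 + q)) / l" using l by (simp add: field_simps power2_eq_square)
  ultimately show "\<bar>rap x u\<bar> \<le> 2 * r" using l(1) by (simp add: pos_le_divide_eq mult.commute) (meson mult_left_mono order_trans less_imp_le)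
 qed
 then show ?thesis by simp
qed

lemma nu_inf: assumes x: "x \<in> Cc" shows "Val x r \<Longrightarrow> nu x \<le> r" "(\<And>r. Val x r \<Longrightarrow> b \<le> r) \<Longrightarrow> b \<le> nu x"
proof -
 have 1: "Val x (- (- ((1 + (nm x)\<^sup>2 / 1) / 2)))" using Val_triv[OF x, of 1] by simp
 have "\<exists>s. lub (\<lambda>s. Val x (- s)) s"
 proof (rule lub_ex[of "\<lambda>s. Val x (- s)", OF _ 1])
  show "Df (\<lambda>e. Val x (- pi (e 0)))" by (intro df CcU x)
  show "r \<le> - (nm x / 2)" if "Val x (- r)" for r using Val_lower[OF x that] by simp
 qed
 then obtain s where s: "lub (\<lambda>s. Val x (- s)) s" ..
 then have n: "nu x = - s" unfolding nu_def using lubf by simp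
 show "nu x \<le> r" if "Val x r"
 proof -
  have "- r \<le> s" using s that unfolding lub_def by simp
  then show ?thesis using n by simp
 qed
 show "b \<le> nu x" if b: "\<And>r. Val x r \<Longrightarrow> b \<le> r"
 proof -
  have "r \<le> - b" if "Val x (- r)" for r using b[OF that] by simp
  then have "s \<le> - b" using s unfolding lub_def by blast
  then show ?thesis using n by simp
 qed
qed

lemma nu_lower: "x \<in> Cc \<Longrightarrow> nm x / 2 \<le> nu x" using nu_inf(2) Val_lower by blast

lemma nu_upper: assumes x: "x \<in> Cc" shows "nu x \<le> nm x"
proof (cases "nm x = 0")
 case True
 show ?thesis
 proof (rule ccontr)
  assume "\<not> nu x \<le> nm x"
  then have p: "0 < nu x" using True by simp
  \<comment> \<open>The parameter is \<open>l = nu x\<close> itself; the other term drops out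
    because the supremum norm vanishes here.\<close>
  then have "nu x \<le> nu x / 2" using nu_inf(1)[OF x Val_triv[OF x p]] True by simp
  then show False using p by simp
 qed
next
 case False
 then have p: "0 < nm x" using nm_nonneg[OF x] by simp
 then have "(nm x + (nm x)\<^sup>2 / nm x) / 2 = nm x" by (simp add: power2_eq_square)
 then show ?thesis using nu_inf(1)[OF x Val_triv[OF x p]] by simp
qed

lemma nu_nonneg: "x \<in> Cc \<Longrightarrow> 0 \<le> nu x" using nu_lower nm_nonneg by fastforce

lemma nu_zero: "x \<in> Cc \<Longrightarrow> nu x = 0 \<longleftrightarrow> x = vz" using nu_lower nu_upper nm_nonneg nm_zero by fastforce

text \<open>Scaling \<open>h\<close> by \<open>s\<close>, \<open>l\<close> by
  \<open>\<bar>s\<bar>\<close> and \<open>q\<close> by \<open>s\<^sup>2\<close> multiplies a value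
  by \<open>\<bar>s\<bar>\<close>.\<close>

lemma nu_scale_le: assumes x: "x \<in> Cc" and s: "s \<noteq> 0" shows "nu (vs s x) \<le> \<bar>s\<bar> * nu x"
proof -
 have "nu (vs s x) / \<bar>s\<bar> \<le> nu x"
 proof (rule nu_inf(2)[OF x])
  fix r assume "Val x r"
  then obtain l h q where l: "0 < l" "Rp h q" "r = (l + ((nm (va x (vs (- 1) h)))\<^sup>2 + q) / l) / 2" unfolding Val_def by blast
  have h: "h \<in> Cc" using l Rp_C by blast
  have sl: "0 < \<bar>s\<bar> * l" using s l by simp
  have "va (vs s x) (vs (- 1) (vs s h)) = vs s (va x (vs (- 1) h))" using x h by (intro C_eq) (auto simp: algebra_simps)
  then have "nm (va (vs s x) (vs (- 1) (vs s h))) = \<bar>s\<bar> * nm (va x (vs (- 1) h))" using x h nm_scale by simp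
  then have "nu (vs s x) \<le> (\<bar>s\<bar> * l + ((\<bar>s\<bar> * nm (va x (vs (- 1) h)))\<^sup>2 + s\<^sup>2 * q) / (\<bar>s\<bar> * l)) / 2"
   using nu_inf(1)[OF vs_C[OF x] ValI[OF sl Rp_scale[OF l(2), of s]], of s] by simp
  also have "\<dots> = \<bar>s\<bar> * r"
  proof -
   have "(\<bar>s\<bar> * nm (va x (vs (- 1) h)))\<^sup>2 + s\<^sup>2 * q = \<bar>s\<bar> * (\<bar>s\<bar> * ((nm (va x (vs (- 1) h)))\<^sup>2 + q))"
    by (simp add: power2_eq_square algebra_simps flip: abs_mult)
   moreover have "\<bar>s\<bar> * (\<bar>s\<bar> * A) / (\<bar>s\<bar> * l) = \<bar>s\<bar> * (A / l)" for A using s by simp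
   ultimately show ?thesis unfolding l(3) by (simp only:) (simp add: algebra_simps)
  qed
  finally show "nu (vs s x) / \<bar>s\<bar> \<le> r" using s by (simp add: pos_divide_le_eq mult.commute)
 qed
 then show ?thesis using s by (simp add: pos_divide_le_eq mult.commute)
qed

lemma nu_scale: assumes x: "x \<in> Cc" shows "nu (vs s x) = \<bar>s\<bar> * nu x"
proof (cases "s = 0")
 case True
 have "vs s x = vz" using True x by (intro C_eq) auto
 then show ?thesis using True nu_zero by simp
next
 case False
 have "vs (inverse s) (vs s x) = x" using False x by (intro C_eq) auto
 then have "nu x \<le> \<bar>inverse s\<bar> * nu (vs s x)" using nu_scale_le[OF vs_C[OF x], of "inverse s" s] False by simp
 then have "\<bar>s\<bar> * nu x \<le> nu (vs s x)" using False by (simp add: field_simps)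
 then show ?thesis using nu_scale_le[OF x False] by simp
qed

text \<open>The difference of the two sides is
  \<open>(a * m - b * l)\<^sup>2 / (l * m * (l + m))\<close>. This is the convexity of the
  perspective of the square function.\<close>

lemma sq_convex: assumes "0 < l" "0 < (m :: 'a fld)" shows "(a + b)\<^sup>2 / (l + m) \<le> a\<^sup>2 / l + b\<^sup>2 / m"
proof -
 have "a\<^sup>2 / l + b\<^sup>2 / m - (a + b)\<^sup>2 / (l + m) = (a * m - b * l)\<^sup>2 / (l * m * (l + m))"
  using assms by (simp add: divide_simps add_pos_pos[THEN less_imp_neq, THEN not_sym] power2_eq_square) (simp add: algebra_simps)
 moreover have "0 \<le> (a * m - b * l)\<^sup>2 / (l * m * (l + m))" using assms by (simp add: add_pos_pos less_imp_le)
 ultimately show ?thesis by linarith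
qed

text \<open>A value for \<open>x\<close> with parameter \<open>l\<close> and vector \<open>h\<close>
  and one for \<open>y\<close> with \<open>m\<close> and \<open>g\<close> bound a value for the sum
  with \<open>l + m\<close> and the sum of the vectors, by convexity of both quotients.
  Subadditivity thus needs no square roots.\<close>

lemma nu_triangle: assumes x: "x \<in> Cc" and y: "y \<in> Cc" shows "nu (va x y) \<le> nu x + nu y"
proof -
 have "nu (va x y) \<le> r + s" if "Val x r" "Val y s" for r s
 proof -
  from that(1) obtain l h q where l: "0 < l" "Rp h q" "r = (l + ((nm (va x (vs (- 1) h)))\<^sup>2 + q) / l) / 2" unfolding Val_def by blast
  from that(2) obtain m g p where m: "0 < m" "Rp g p" "s = (m + ((nm (va y (vs (- 1) g)))\<^sup>2 + p) / m) / 2" unfolding Val_def by blast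
  have C: "h \<in> Cc" "g \<in> Cc" using l m Rp_C by auto
  from Rp_convex[OF l(2) m(2) l(1) m(1)] obtain t where t: "Rp (va h g) t" "t / (l + m) \<le> q / l + p / m" by blast
  let ?M = "nm (va x (vs (- 1) h))" and ?N = "nm (va y (vs (- 1) g))" and ?K = "nm (va (va x y) (vs (- 1) (va h g)))"
  have "va (va x y) (vs (- 1) (va h g)) = va (va x (vs (- 1) h)) (va y (vs (- 1) g))" using x y C by (intro C_eq) auto
  then have "?K \<le> ?M + ?N" using nm_triangle x y C by simp
  moreover have "0 \<le> ?K" using nm_nonneg x y C by simp
  ultimately have "?K\<^sup>2 \<le> (?M + ?N)\<^sup>2" by (intro power_mono)
  then have "?K\<^sup>2 / (l + m) \<le> (?M + ?N)\<^sup>2 / (l + m)" using l m by (intro divide_right_mono) auto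
  also have "\<dots> \<le> ?M\<^sup>2 / l + ?N\<^sup>2 / m" by (rule sq_convex[OF l(1) m(1)])
  finally have K: "?K\<^sup>2 / (l + m) \<le> ?M\<^sup>2 / l + ?N\<^sup>2 / m" .
  have "0 < l + m" using l m by simp
  then have "nu (va x y) \<le> ((l + m) + (?K\<^sup>2 + t) / (l + m)) / 2" using nu_inf(1)[OF va_C[OF x y] ValI[OF _ t(1)]] by blast
  also have "\<dots> = (l + m + (?K\<^sup>2 / (l + m) + t / (l + m))) / 2" by (simp add: add_divide_distrib)
  also have "\<dots> \<le> (l + m + ((?M\<^sup>2 / l + ?N\<^sup>2 / m) + (q / l + p / m))) / 2" using K t(2) by (intro divide_right_mono add_mono order_refl) auto
  also have "\<dots> = r + s" unfolding l(3) m(3) by (simp add: add_divide_distrib)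
  finally show ?thesis .
 qed
 then have "nu (va x y) - s \<le> nu x" if "Val y s" for s using nu_inf(2)[OF x, of "nu (va x y) - s"] that by (simp add: diff_le_eq)
 then have "nu (va x y) - nu x \<le> nu y" using nu_inf(2)[OF y, of "nu (va x y) - nu x"] by (simp add: diff_le_eq add.commute)
 then show ?thesis by simp
qed

text \<open>A minimiser with parameter \<open>l < 1/4\<close> would have value above 2, because \<open>A = \<parallel>x - h\<parallel>\<^sup>2 + q \<ge> 1\<close>
 on the unit sphere.\<close>

lemma nu_second_difference: assumes x: "x \<in> Cc" "nu x = 1" and g: "Rp g p"
 shows "nu (va x (vs t g)) + nu (va x (vs (- t) g)) \<le> 2 + 4 * t\<^sup>2 * p"
proof -
 have gC: "g \<in> Cc" and p: "0 \<le> p" using g Rp_C Rp_nonneg by auto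
 let ?s = "nu (va x (vs t g)) + nu (va x (vs (- t) g))"
 have main: "?s \<le> 2 * r + 4 * t\<^sup>2 * p" if v: "Val x r" and r: "r \<le> 2" for r
 proof -
  from v obtain l h q where l: "0 < l" "Rp h q" "r = (l + ((nm (va x (vs (- 1) h)))\<^sup>2 + q) / l) / 2" unfolding Val_def by blast
  have h: "h \<in> Cc" using l Rp_C by blast
  define A where "A = (nm (va x (vs (- 1) h)))\<^sup>2 + q"
  have "nu x \<le> (1 + A / 1) / 2" unfolding A_def by (rule nu_inf(1)[OF x(1) ValI[OF zero_less_one l(2)]])
  then have A: "1 \<le> A" using x(2) by simp
  have rA: "2 * r * l = l\<^sup>2 + A" unfolding l(3) A_def using l(1) by (simp add: field_simps power2_eq_square)
  have l4: "1 \<le> 4 * l"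
  proof -
   have "2 * r * l \<le> 2 * 2 * l" using r l(1) by (intro mult_right_mono mult_left_mono) auto
   moreover have "0 \<le> l\<^sup>2" by simp
   ultimately show ?thesis using rA A by linarith
  qed
  from Rp_line[OF l(2) g] obtain b where b: "\<And>r. Rp (va h (vs r g)) (q + 2 * r * b + r\<^sup>2 * p)" by blast
  have "nu (va x (vs s g)) \<le> (l + (A + 2 * s * b + s\<^sup>2 * p) / l) / 2" for s
  proof -
   have "va (va x (vs s g)) (vs (- 1) (va h (vs s g))) = va x (vs (- 1) h)" using x h gC by (intro C_eq) auto
   then show ?thesis using nu_inf(1)[OF va_C[OF x(1) vs_C[OF gC]] ValI[OF l(1) b[of s]], of s] unfolding A_def by (simp add: add.assoc)
  qed
  from this[of t] this[of "- t"]
  \<comment> \<open>The terms linear in the step cancel between \<open>t\<close> and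
    \<open>- t\<close>. What remains besides \<open>2 * r\<close> is
    \<open>t\<^sup>2 * p / l\<close>, where \<open>1 / l \<le> 4\<close>.\<close>
  have "?s \<le> (l + (A + 2 * t * b + t\<^sup>2 * p) / l) / 2 + (l + (A + 2 * (- t) * b + (- t)\<^sup>2 * p) / l) / 2" by linarith
  also have "\<dots> = 2 * r + t\<^sup>2 * p / l" unfolding l(3) A_def using l(1) by (simp add: field_simps)
  also have "t\<^sup>2 * p / l \<le> 4 * t\<^sup>2 * p"
  proof -
   have "t\<^sup>2 * p * 1 \<le> t\<^sup>2 * p * (4 * l)" using p l4 by (intro mult_left_mono) auto
   then show ?thesis using l(1) by (simp add: divide_le_eq algebra_simps)
  qed
  finally show ?thesis by simp
 qed
 \<comment> \<open>\<open>main\<close> covers values up to 2, and larger ones exceed the constant 2.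
   Since \<open>nu x = 1\<close>, the minimum has to be its second argument.\<close>
 have "min 2 ((?s - 4 * t\<^sup>2 * p) / 2) \<le> nu x"
 proof (rule nu_inf(2)[OF x(1)])
  fix r assume r: "Val x r"
  show "min 2 ((?s - 4 * t\<^sup>2 * p) / 2) \<le> r"
  proof (cases "r \<le> 2")
   case True then show ?thesis using main[OF r] by (simp add: min_def)
  qed simp
 qed
 then have "(?s - 4 * t\<^sup>2 * p) / 2 \<le> 1" using x(2) by (simp add: min_def split: if_splits)
 then show ?thesis by simp
qed

text \<open>The direction \<open>g\<close> is replaced by a nearby \<open>c\<close> of the span, for
  which the second difference is quadratic in \<open>t\<close>. The replacement costs
  \<open>t * (e / 4)\<close> on either side.\<close>

lemma nu_smooth: assumes g: "g \<in> Cc" and e: "0 < e"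
 shows "\<exists>d>0. \<forall>x\<in>Cc. nu x = 1 \<longrightarrow> (\<forall>t. 0 < t \<longrightarrow> t < d \<longrightarrow> nu (va x (vs t g)) + nu (va x (vs (- t) g)) \<le> 2 + e * t)"
proof -
 have "0 < e / 4" using e by simp
 from Sp_dense[OF g this] obtain c p where c: "Rp c p" "nm (va g (vs (- 1) c)) \<le> e / 4" unfolding Sp_def by blast
 have C: "c \<in> Cc" and p: "0 \<le> p" using c Rp_C Rp_nonneg by auto
 let ?z = "va g (vs (- 1) c)"
 have z: "?z \<in> Cc" "nu ?z \<le> e / 4" using g C nu_upper[of ?z] c by auto
 \<comment> \<open>Chosen so that \<open>4 * t\<^sup>2 * p \<le> t * (e / 2)\<close> for
   \<open>t < d\<close>; \<open>p + 1\<close> avoids division by zero.\<close>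
 define d where "d = e / (8 * (p + 1))"
 have d: "0 < d" "8 * (p + 1) * d = e" unfolding d_def using e p by (auto simp: add_nonneg_pos)
 show ?thesis
 proof (intro exI[of _ d] conjI ballI impI allI d)
  fix x t assume x: "x \<in> Cc" "nu x = 1" and t: "0 < t" "t < d"
  have le: "nu (va x (vs s g)) \<le> nu (va x (vs s c)) + \<bar>s\<bar> * (e / 4)" for s
  proof -
   have "va x (vs s g) = va (va x (vs s c)) (vs s ?z)" using x g C by (intro C_eq) (auto simp: algebra_simps)
   then have "nu (va x (vs s g)) \<le> nu (va x (vs s c)) + nu (vs s ?z)" using nu_triangle[of "va x (vs s c)" "vs s ?z"] x g C by simp
   also have "nu (vs s ?z) \<le> \<bar>s\<bar> * (e / 4)" unfolding nu_scale[OF z(1)] using z(2) by (intro mult_left_mono) auto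
   finally show ?thesis by simp
  qed
  have "nu (va x (vs t g)) + nu (va x (vs (- t) g)) \<le> 2 + 4 * t\<^sup>2 * p + 2 * (t * (e / 4))"
   using le[of t, unfolded abs_of_pos[OF t(1)]] le[of "- t", unfolded abs_minus_cancel abs_of_pos[OF t(1)]] nu_second_difference[OF x c(1), of t] by linarith
  also have "4 * t\<^sup>2 * p \<le> t * (e / 2)"
  proof -
   have "8 * p * t \<le> 8 * (p + 1) * d" using p t by (intro mult_mono) auto
   then have "t * (8 * p * t) \<le> t * e" using d t by (intro mult_left_mono) auto
   then show ?thesis by (simp add: power2_eq_square algebra_simps)
  qed
  finally show "nu (va x (vs t g)) + nu (va x (vs (- t) g)) \<le> 2 + e * t" by (simp add: algebra_simps)
 qed
qed

end

section \<open>Directional derivatives of the new norm\<close>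

context coded_cstone
begin

text \<open>Convexity of the norm on a line: \<open>x\<close> is the mean of the points at distance
  \<open>t\<close> forward and \<open>s\<close> backward, with weights proportional to
  \<open>s\<close> and \<open>t\<close>.\<close>

lemma nu_quotients: assumes x: "x \<in> Cc" and g: "g \<in> Cc" and s: "0 < s" and t: "0 < t"
 shows "(nu x - nu (va x (vs (- s) g))) / s \<le> (nu (va x (vs t g)) - nu x) / t"
proof -
 have "vs (s + t) x = va (vs s (va x (vs t g))) (vs t (va x (vs (- s) g)))" using x g by (intro C_eq) (auto simp: algebra_simps)
 then have "nu (vs (s + t) x) \<le> nu (vs s (va x (vs t g))) + nu (vs t (va x (vs (- s) g)))" using nu_triangle x g by simp
 then have "(s + t) * nu x \<le> s * nu (va x (vs t g)) + t * nu (va x (vs (- s) g))" using x g s t nu_scale by simp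
 then have "t * (nu x - nu (va x (vs (- s) g))) \<le> s * (nu (va x (vs t g)) - nu x)" by (simp add: algebra_simps)
 then show ?thesis using s t by (simp add: divide_le_eq le_divide_eq mult.commute)
qed

text \<open>The left derivative at \<open>x\<close> in direction \<open>g\<close>: by convexity it
  is the supremum of the left difference quotients. It is the candidate for the uniform
  limit.\<close>

definition slope :: "'a \<Rightarrow> 'a \<Rightarrow> 'a fld" where
 "slope g x = lubf (\<lambda>r. \<exists>s. 0 < s \<and> r = (nu x - nu (va x (vs (- s) g))) / s)"

lemma DR_slope[df]: assumes "DT t" "DT u" shows "DR (\<lambda>e. slope (t e) (u e))"
 unfolding slope_def by (intro df assms[THEN DT_weaken])

lemma slope: assumes x: "x \<in> Cc" and g: "g \<in> Cc" and t: "0 < t"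
 shows "(nu x - nu (va x (vs (- t) g))) / t \<le> slope g x" "slope g x \<le> (nu (va x (vs t g)) - nu x) / t"
proof -
 let ?P = "\<lambda>r. \<exists>s. 0 < s \<and> r = (nu x - nu (va x (vs (- s) g))) / s"
 have P: "?P ((nu x - nu (va x (vs (- t) g))) / t)" using t by blast
 have b: "r \<le> (nu (va x (vs t g)) - nu x) / t" if "?P r" for r using that nu_quotients[OF x g _ t] by blast
 have "\<exists>s. lub ?P s"
 proof (rule lub_ex[of ?P, OF _ P b])
  show "Df (\<lambda>e. ?P (pi (e 0)))" by (intro df CcU x g)
 qed
 then obtain s where s: "lub ?P s" ..
 then have "slope g x = s" unfolding slope_def by (rule lubf)
 then show "(nu x - nu (va x (vs (- t) g))) / t \<le> slope g x" "slope g x \<le> (nu (va x (vs t g)) - nu x) / t"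
  using s P b unfolding lub_def by blast+
qed

lemma pos_rp: "\<zero>\<^bsub>R0\<^esub> \<prec>\<^bsub>R0\<^esub> rp x \<longleftrightarrow> 0 < (x :: 'a fld)" using rps(9)[of 0 x] by (simp add: rps(1))

lemma UG_X: "UG R0 X"
 unfolding UG_def
proof (intro conjI banach_X exI)
 let ?n = "\<lambda>c. rp (nu c)"
 let ?Y = "X\<lparr>nrm := ?n\<rparr>"
 show "normed_space_in R0 ?Y"
  by (rule normed_X[of ?n nu]) (auto simp: nu_nonneg nu_zero nu_scale nu_triangle intro!: df)
 show "equivalent_norms R0 X ?n" unfolding equivalent_norms_def carrier_X
 proof (intro bexI[of _ "rp 2"] conjI ballI)
  show "\<zero>\<^bsub>R0\<^esub> \<prec>\<^bsub>R0\<^esub> rp (2 :: 'a fld)" by (simp add: pos_rp)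
  fix x assume x: "x \<in> Cc"
  have "rp (inverse 2 * nm x) \<preceq>\<^bsub>R0\<^esub> rp (nu x)" using nu_lower[OF x] rps(8)[of "inverse 2 * nm x" "nu x"] by (simp add: field_simps)
  then show "inv\<^bsub>R0\<^esub> rp 2 \<otimes>\<^bsub>R0\<^esub> nrm X x \<preceq>\<^bsub>R0\<^esub> rp (nu x)" using nrm_X[OF x] rps(7)[of "2 :: 'a fld"] rps(4)[of "inverse 2" "nm x"] by simp
  have "rp (nu x) \<preceq>\<^bsub>R0\<^esub> rp (2 * nm x)" using nu_upper[OF x] nm_nonneg[OF x] rps(8)[of "nu x" "2 * nm x"] by simp
  then show "rp (nu x) \<preceq>\<^bsub>R0\<^esub> rp 2 \<otimes>\<^bsub>R0\<^esub> nrm X x" using nrm_X[OF x] rps(4)[of 2 "nm x"] by simp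
 qed auto
 have y: "carrier ?Y = Cc" "\<And>c d. c \<in> Cc \<Longrightarrow> d \<in> Cc \<Longrightarrow> c \<oplus>\<^bsub>?Y\<^esub> d = va c d"
  "\<And>r c. c \<in> Cc \<Longrightarrow> rp r \<odot>\<^bsub>?Y\<^esub> c = vs r c" "nrm ?Y = ?n"
  using carrier_X add_X smult_rp by simp_all
 let ?S = "{x \<in> Cc. rp (nu x) = \<one>\<^bsub>R0\<^esub>}"
 have S: "x \<in> Cc" "nu x = 1" if "x \<in> ?S" for x using that rps(11)[of "nu x" 1] by (auto simp: rps(2))
 have SS: "?S \<in> Sets" by (intro separation df Cc_Sets) (simp add: rps(2)[symmetric])
 show "unif_gateaux_norm R0 ?Y" unfolding unif_gateaux_norm_def Let_def y(1,4)
 proof (intro ballI exI conjI impI)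
  fix g assume g: "g \<in> Cc"
  let ?D = "\<lambda>x. rp (slope g x)"
  show "fun_in ?S ?D" by (rule fun_inT[OF SS]) (intro df CcU g)
  show "?D ` ?S \<subseteq> CR" by auto
  fix e0 assume e0: "e0 \<in> CR" "\<zero>\<^bsub>R0\<^esub> \<prec>\<^bsub>R0\<^esub> e0"
  define e where "e = pi e0"
  have ee: "e0 = rp e" "0 < e" using e0 pos_rp[of e] by (simp_all add: e_def)
  then have "0 < e / 2" by simp
  from nu_smooth[OF g this] obtain d where d: "0 < d" "\<And>x t. x \<in> Cc \<Longrightarrow> nu x = 1 \<Longrightarrow> 0 < t \<Longrightarrow> t < d \<Longrightarrow> nu (va x (vs t g)) + nu (va x (vs (- t) g)) \<le> 2 + e / 2 * t" by blast
  show "\<exists>d\<in>CR. \<zero>\<^bsub>R0\<^esub> \<prec>\<^bsub>R0\<^esub> d \<and> (\<forall>x\<in>?S. \<forall>t\<in>CR. t \<noteq> \<zero>\<^bsub>R0\<^esub> \<and> rabs R0 t \<prec>\<^bsub>R0\<^esub> d \<longrightarrow>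
    rabs R0 (inv\<^bsub>R0\<^esub> t \<otimes>\<^bsub>R0\<^esub> (rp (nu (x \<oplus>\<^bsub>?Y\<^esub> t \<odot>\<^bsub>?Y\<^esub> g)) \<ominus>\<^bsub>R0\<^esub> rp (nu x)) \<ominus>\<^bsub>R0\<^esub> rp (slope g x)) \<prec>\<^bsub>R0\<^esub> e0)"
  proof (intro bexI[of _ "rp d"] conjI ballI impI rpC)
   show "\<zero>\<^bsub>R0\<^esub> \<prec>\<^bsub>R0\<^esub> rp d" using d by (simp add: pos_rp)
   fix x t0 assume x: "x \<in> ?S" and t0: "t0 \<in> CR" "t0 \<noteq> \<zero>\<^bsub>R0\<^esub> \<and> rabs R0 t0 \<prec>\<^bsub>R0\<^esub> rp d"
   define t where "t = pi t0"
   have tt: "t0 = rp t" using t0 by (simp add: t_def)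
   have t: "t \<noteq> 0" "\<bar>t\<bar> < d" using t0 rps(11)[of t 0] unfolding tt rps(10) rps(9) by (auto simp: rps(1))
   note x = S[OF x]
   \<comment> \<open>Both the quotient for \<open>t\<close> and the slope lie between the left and
     the right quotient for \<open>\<bar>t\<bar>\<close>, and these two differ by at most
     \<open>e / 2\<close>.\<close>
   have b: "\<bar>inverse t * (nu (va x (vs t g)) - nu x) - slope g x\<bar> < e"
   proof -
    let ?s = "\<bar>t\<bar>" and ?A = "nu (va x (vs \<bar>t\<bar> g))" and ?B = "nu (va x (vs (- \<bar>t\<bar>) g))"
    have s: "0 < ?s" using t by simp
    have "?A + ?B \<le> 2 + e / 2 * ?s" by (rule d(2)[OF x s t(2)])
    then have "(?A - 1) - (1 - ?B) \<le> e / 2 * ?s" by simp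
    then have "((?A - 1) - (1 - ?B)) / ?s \<le> e / 2" using s by (simp only: pos_divide_le_eq)
    then have 1: "(?A - 1) / ?s - (1 - ?B) / ?s \<le> e / 2" by (simp only: diff_divide_distrib)
    have 2: "(1 - ?B) / ?s \<le> slope g x" "slope g x \<le> (?A - 1) / ?s" using slope[OF x(1) g s] x(2) by auto
    have e2: "e / 2 < e" using ee(2) by simp
    show ?thesis
    proof (cases "0 < t")
     case True
     then have "inverse t * (nu (va x (vs t g)) - nu x) = (?A - 1) / ?s" using x(2) by (simp add: divide_inverse mult.commute)
     then show ?thesis using 1 2 e2 by linarith
    next
     case False
     then have "inverse t * (nu (va x (vs t g)) - nu x) = (1 - ?B) / ?s" using x(2) t(1) by (simp add: divide_inverse algebra_simps abs_if)
     then show ?thesis using 1 2 e2 by linarith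
    qed
   qed
   have "rabs R0 (inv\<^bsub>R0\<^esub> t0 \<otimes>\<^bsub>R0\<^esub> (rp (nu (x \<oplus>\<^bsub>?Y\<^esub> t0 \<odot>\<^bsub>?Y\<^esub> g)) \<ominus>\<^bsub>R0\<^esub> rp (nu x)) \<ominus>\<^bsub>R0\<^esub> rp (slope g x))
    = rp \<bar>inverse t * (nu (va x (vs t g)) - nu x) - slope g x\<bar>"
    unfolding tt y(3)[OF g] y(2)[OF x(1) vs_C[OF g]] unfolding rps(7)[OF t(1), symmetric] rps(6)[symmetric] rps(4)[symmetric] rps(10) ..
   then show "rabs R0 (inv\<^bsub>R0\<^esub> t0 \<otimes>\<^bsub>R0\<^esub> (rp (nu (x \<oplus>\<^bsub>?Y\<^esub> t0 \<odot>\<^bsub>?Y\<^esub> g)) \<ominus>\<^bsub>R0\<^esub> rp (nu x)) \<ominus>\<^bsub>R0\<^esub> rp (slope g x)) \<prec>\<^bsub>R0\<^esub> e0"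
    using b unfolding ee(1) by (simp add: rps(9))
  qed
 qed
qed

end

section \<open>Norms of sums and the failure of embeddings\<close>

context zfc
begin

lemma upto_induct:
 assumes N: "N \<in> omega" and D: "Df (\<lambda>e. P (e 0))" and z: "P (cd {})" and s: "\<And>n. n \<in> omega \<Longrightarrow> n \<in> ext N \<Longrightarrow> P n \<Longrightarrow> P (sc n)"
 shows "P N"
proof -
 have "n = N \<or> n \<in> ext N \<longrightarrow> P n" if "n \<in> omega" for n
  using that
 proof (induction rule: omega_induct)
  case Df show ?case by (intro df D omega_U N)
 next
  case 0 show ?case using z by simp
 next
  case (sc n)
  have "n \<in> ext N" if "sc n = N \<or> sc n \<in> ext N"
  proof -
   have "n \<in> ext (sc n)" using sc by (simp add: omega_U)
   then show ?thesis using that nat_trans[OF N] by blast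
  qed
  then show ?case using sc s by blast
 qed
 then show ?thesis using N by blast
qed

end

context realf
begin

text \<open>Besides translating the norm axioms to the field type, this provides the metric as an
  element of the structure, so that distances may occur in definable properties.\<close>

lemma normed_dist: assumes Y: "normed_space_in R0 Y"
 shows "\<exists>c\<in>U. \<forall>y\<in>carrier Y. \<forall>z\<in>carrier Y. rap c (pr y z) = pi (nrm Y (y \<ominus>\<^bsub>Y\<^esub> z))"
  "\<And>y. y \<in> carrier Y \<Longrightarrow> nrm Y y = rp (pi (nrm Y y))" "pi (nrm Y \<zero>\<^bsub>Y\<^esub>) = 0"
  "\<And>y z y' z'. y \<in> carrier Y \<Longrightarrow> z \<in> carrier Y \<Longrightarrow> y' \<in> carrier Y \<Longrightarrow> z' \<in> carrier Y \<Longrightarrow>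
   pi (nrm Y ((y \<oplus>\<^bsub>Y\<^esub> y') \<ominus>\<^bsub>Y\<^esub> (z \<oplus>\<^bsub>Y\<^esub> z'))) \<le> pi (nrm Y (y \<ominus>\<^bsub>Y\<^esub> z)) + pi (nrm Y (y' \<ominus>\<^bsub>Y\<^esub> z'))"
  "\<And>y z. y \<in> carrier Y \<Longrightarrow> z \<in> carrier Y \<Longrightarrow> pi (nrm Y y) \<le> pi (nrm Y z) + pi (nrm Y (y \<ominus>\<^bsub>Y\<^esub> z))"
  "\<And>y z. y \<in> carrier Y \<Longrightarrow> z \<in> carrier Y \<Longrightarrow> pi (nrm Y z) \<le> pi (nrm Y y) + pi (nrm Y (y \<ominus>\<^bsub>Y\<^esub> z))"
proof -
 have M: "module R0 Y" and no: "norm_on R0 Y" and CY: "carrier Y \<in> Sets" and f: "fun2_in (carrier Y) (carrier Y) (add Y)"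
   "fun2_in CR (carrier Y) (smult Y)" "fun_in (carrier Y) (nrm Y)"
  using Y unfolding normed_space_in_def by blast+
 interpret Y: module "R0 :: 'a ordered_ring" Y by (rule M)
 let ?n = "\<lambda>y. pi (nrm Y y)"
 have nC: "nrm Y y \<in> CR" if "y \<in> carrier Y" for y using no that unfolding norm_on_def by blast
 show nr: "nrm Y y = rp (?n y)" if "y \<in> carrier Y" for y using nC[OF that] by simp
 have neg: "\<ominus>\<^bsub>Y\<^esub> y = rp (- 1) \<odot>\<^bsub>Y\<^esub> y" if "y \<in> carrier Y" for y
  using Y.smult_l_minus[of "\<one>\<^bsub>R0\<^esub>" y] that rps(5)[of 1] by (simp add: rps(2))
 show n0: "?n \<zero>\<^bsub>Y\<^esub> = 0"
 proof -
  have "nrm Y \<zero>\<^bsub>Y\<^esub> = \<zero>\<^bsub>R0\<^esub>" using no Y.zero_closed unfolding norm_on_def by blast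
  then show ?thesis using pi_rp[of 0] by (simp add: rps(1))
 qed
 have tri: "?n (y \<oplus>\<^bsub>Y\<^esub> z) \<le> ?n y + ?n z" if yz: "y \<in> carrier Y" "z \<in> carrier Y" for y z
 proof -
  have "nrm Y (y \<oplus>\<^bsub>Y\<^esub> z) \<preceq>\<^bsub>R0\<^esub> nrm Y y \<oplus>\<^bsub>R0\<^esub> nrm Y z" using no yz unfolding norm_on_def by blast
  then have "rp (?n (y \<oplus>\<^bsub>Y\<^esub> z)) \<preceq>\<^bsub>R0\<^esub> rp (?n y + ?n z)" using nr[OF Y.a_closed[OF yz]] nr[OF yz(1)] nr[OF yz(2)] by (simp only: rps(3))
  then show ?thesis by (simp only: rps(8))
 qed
 have nneg: "?n (\<ominus>\<^bsub>Y\<^esub> y) = ?n y" if y: "y \<in> carrier Y" for y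
 proof -
  have "nrm Y (rp (- 1) \<odot>\<^bsub>Y\<^esub> y) = rabs R0 (rp (- 1)) \<otimes>\<^bsub>R0\<^esub> nrm Y y" using no y unfolding norm_on_def by blast
  also have "\<dots> = rp (\<bar>- 1\<bar> * ?n y)" using nr[OF y] by (simp only: rps(10) rps(4))
  finally show ?thesis using neg[OF y] by simp
 qed
 show "?n ((y \<oplus>\<^bsub>Y\<^esub> y') \<ominus>\<^bsub>Y\<^esub> (z \<oplus>\<^bsub>Y\<^esub> z')) \<le> ?n (y \<ominus>\<^bsub>Y\<^esub> z) + ?n (y' \<ominus>\<^bsub>Y\<^esub> z')"
  if yz: "y \<in> carrier Y" "z \<in> carrier Y" "y' \<in> carrier Y" "z' \<in> carrier Y" for y z y' z'
 proof -
  have "(y \<oplus>\<^bsub>Y\<^esub> y') \<ominus>\<^bsub>Y\<^esub> (z \<oplus>\<^bsub>Y\<^esub> z') = (y \<ominus>\<^bsub>Y\<^esub> z) \<oplus>\<^bsub>Y\<^esub> (y' \<ominus>\<^bsub>Y\<^esub> z')"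
   using yz by (simp add: a_minus_def Y.minus_add Y.a_ac)
  then show ?thesis using tri[OF Y.minus_closed[OF yz(1,2)] Y.minus_closed[OF yz(3,4)]] by simp
 qed
 show "?n y \<le> ?n z + ?n (y \<ominus>\<^bsub>Y\<^esub> z)" if yz: "y \<in> carrier Y" "z \<in> carrier Y" for y z
 proof -
  have "z \<oplus>\<^bsub>Y\<^esub> (y \<ominus>\<^bsub>Y\<^esub> z) = y" using yz by (simp add: a_minus_def Y.a_lcomm Y.r_neg)
  then show ?thesis using tri[OF yz(2) Y.minus_closed[OF yz]] by simp
 qed
 show "?n z \<le> ?n y + ?n (y \<ominus>\<^bsub>Y\<^esub> z)" if yz: "y \<in> carrier Y" "z \<in> carrier Y" for y z
 proof -
  have "y \<oplus>\<^bsub>Y\<^esub> \<ominus>\<^bsub>Y\<^esub> (y \<ominus>\<^bsub>Y\<^esub> z) = z" using yz by (simp add: a_minus_def Y.minus_add Y.r_neg1 flip: Y.a_assoc) (simp add: Y.r_neg)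
  then show ?thesis using tri[OF yz(1) Y.a_inv_closed[OF Y.minus_closed[OF yz]]] nneg[OF Y.minus_closed[OF yz]] by simp
 qed
 from fun2_code[OF f(1) CY CY] obtain ad where ad: "ad \<in> U" "\<forall>y\<in>carrier Y. \<forall>z\<in>carrier Y. ap ad (pr y z) = y \<oplus>\<^bsub>Y\<^esub> z" by blast
 from fun2_code[OF f(2) CR CY] obtain sm where sm: "sm \<in> U" "\<forall>r\<in>CR. \<forall>z\<in>carrier Y. ap sm (pr r z) = r \<odot>\<^bsub>Y\<^esub> z" by blast
 from fn_of_fun_in[OF f(3) CY] obtain na where na: "na \<in> U" "\<And>y. y \<in> carrier Y \<Longrightarrow> nrm Y y = ap na y" by blast
 have "\<exists>c\<in>U. \<forall>x\<in>prd (carrier Y) (carrier Y). ap c x = ap na (ap ad (pr (p1 x) (ap sm (pr (rp (- 1)) (p2 x)))))"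
  by (rule ap_existsT) (intro Sets_prd CY df ad sm na rpU)+
 then obtain c where c: "c \<in> U" "\<And>x. x \<in> prd (carrier Y) (carrier Y) \<Longrightarrow> ap c x = ap na (ap ad (pr (p1 x) (ap sm (pr (rp (- 1)) (p2 x)))))" by blast
 show "\<exists>c\<in>U. \<forall>y\<in>carrier Y. \<forall>z\<in>carrier Y. rap c (pr y z) = ?n (y \<ominus>\<^bsub>Y\<^esub> z)"
 proof (intro bexI[OF _ c(1)] ballI)
  fix y z assume yz: "y \<in> carrier Y" "z \<in> carrier Y"
  have "pr y z \<in> prd (carrier Y) (carrier Y)" unfolding prd_iff using yz by blast
  then have "ap c (pr y z) = ap na (ap ad (pr y (ap sm (pr (rp (- 1)) z))))" using c(2) Sets_U[OF CY] yz by simp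
  also have "ap sm (pr (rp (- 1)) z) = \<ominus>\<^bsub>Y\<^esub> z" using sm(2) yz neg by simp
  also have "ap ad (pr y (\<ominus>\<^bsub>Y\<^esub> z)) = y \<ominus>\<^bsub>Y\<^esub> z" using ad(2) yz by (simp add: a_minus_def)
  finally show "rap c (pr y z) = ?n (y \<ominus>\<^bsub>Y\<^esub> z)" using na(2)[OF Y.minus_closed[OF yz]] by (simp add: rap_def)
 qed
qed

end

context compat_algebra
begin

definition uu :: "'a \<Rightarrow> 'a \<Rightarrow> 'a" where "uu N a = cd {f \<in> Om. \<exists>n\<in>ext N. pr n a \<in> ext f}"

lemma DT_uu[df]: assumes "DT t" "DT u" shows "DT (\<lambda>e. uu (t e) (u e))"
 unfolding uu_def by (intro df OmS assms[THEN DT_weaken])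

lemma uu: assumes N: "N \<in> omega" and a: "a \<in> I" shows "uu N a \<in> Lc" "ext (uu N a) = {f \<in> Om. \<exists>n\<in>ext N. pr n a \<in> ext f}"
proof -
 have U: "N \<in> U" "a \<in> U" using N a omega_U IU by auto
 have S: "{f \<in> Om. \<exists>n\<in>ext N. pr n a \<in> ext f} \<in> Sets" by (intro separation df U) auto
 then show "ext (uu N a) = {f \<in> Om. \<exists>n\<in>ext N. pr n a \<in> ext f}" by (simp add: uu_def)
 let ?s = "(\<lambda>n. pr n a) ` ext N"
 have f: "finite_in ?s" by (intro finite_in_image finite_in_nat N df U)
 then have s: "?s \<in> Sets" using finite_in_Sets by blast
 have "?s \<subseteq> X0" using pr_X0 a omega_trans[OF N] by blast
 then have F: "cd ?s \<in> Fin X0" using f s by (simp add: Fin_iff)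
 show "uu N a \<in> Lc" unfolding uu_def
 proof (rule Lc_I(1)[OF S _ F])
  fix f g assume "f \<in> Om" "g \<in> Om" and e: "ext f \<inter> ext (cd ?s) = ext g \<inter> ext (cd ?s)" and "f \<in> {f \<in> Om. \<exists>n\<in>ext N. pr n a \<in> ext f}"
  then obtain n where "n \<in> ext N" "pr n a \<in> ext f" "g \<in> Om" by blast
  moreover from this have "pr n a \<in> ext g" using e s by auto
  ultimately show "g \<in> {f \<in> Om. \<exists>n\<in>ext N. pr n a \<in> ext f}" by blast
 qed auto
qed

lemma uu_disjoint: assumes N: "N \<in> omega" and a: "a \<in> I" "b \<in> I" "a \<noteq> b" "\<not> cpt a b" shows "mt (uu N a) (uu N b) = bt"
proof (rule L_eq)
 have "False" if f: "f \<in> ext (uu N a)" "f \<in> ext (uu N b)" for f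
 proof -
  from f obtain n m where n: "f \<in> Om" "n \<in> ext N" "pr n a \<in> ext f" "m \<in> ext N" "pr m b \<in> ext f" unfolding uu(2)[OF N a(1)] uu(2)[OF N a(2)] by blast
  have U: "n \<in> U" "m \<in> U" "a \<in> U" "b \<in> U" using n a IU by auto
  then have ne: "pr n a \<noteq> pr m b" using pr_inj[of n a m b] a by auto
  have "ok (ext f)" using n(1) by (simp add: Om_iff)
  then have "cpt (p2 (pr n a)) (p2 (pr m b))" unfolding ok_def using n ne by blast
  then show False using a U by simp
 qed
 then show "ext (mt (uu N a) (uu N b)) = ext bt" using uu(1)[OF N] a by auto
qed (use uu(1)[OF N] a in auto)

text \<open>For pairwise compatible reals the finite function \<open>n \<mapsto> ap c n\<close> is
  itself a point of \<open>Om\<close>. Its cell lies below every \<open>uu N (ap c n)\<close>, so an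
  ultrafilter containing the cell contains them all.\<close>

lemma uu_point: assumes N: "N \<in> omega" and c: "c \<in> U" "\<And>n. n \<in> ext N \<Longrightarrow> ap c n \<in> I"
  "\<And>n m. n \<in> ext N \<Longrightarrow> m \<in> ext N \<Longrightarrow> n \<noteq> m \<Longrightarrow> cpt (ap c n) (ap c m)"
 shows "\<exists>u\<in>St. \<forall>n\<in>ext N. uu N (ap c n) \<in> ext u"
proof -
 let ?F = "(\<lambda>n. pr n (ap c n)) ` ext N"
 have f: "finite_in ?F" by (intro finite_in_image finite_in_nat N df c)
 then have s: "?F \<in> Sets" using finite_in_Sets by blast
 have o: "n \<in> omega" if "n \<in> ext N" for n using omega_trans[OF N] that by blast
 have "?F \<subseteq> X0" using pr_X0 c o by blast
 moreover have "ok ?F" unfolding ok_def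
 proof (intro ballI impI)
  fix z w assume "z \<in> ?F" "w \<in> ?F" "z \<noteq> w"
  then obtain n m where n: "n \<in> ext N" "z = pr n (ap c n)" "m \<in> ext N" "w = pr m (ap c m)" "n \<noteq> m" by blast
  have "n \<in> U" "m \<in> U" using n o omega_U by blast+
  then show "p1 z \<noteq> p1 w \<and> cpt (p2 z) (p2 w)" using n c(3) by simp
 qed
 ultimately have O: "cd ?F \<in> Om" using f s by (simp add: Om_iff)
 have L: "cell (cd ?F) \<in> Lc" using O Om_Fin by blast
 have "cell (cd ?F) \<noteq> bt" using cell_mem[OF O] bt_ext by force
 from point_exists[OF L this] obtain u where u: "u \<in> St" "cell (cd ?F) \<in> ext u" by blast
 have "uu N (ap c n) \<in> ext u" if n: "n \<in> ext N" for n
 proof (rule St_up[OF u uu(1)[OF N c(2)[OF n]]])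
  show "ext (cell (cd ?F)) \<subseteq> ext (uu N (ap c n))" unfolding uu(2)[OF N c(2)[OF n]] using s n by auto
 qed
 then show ?thesis using u by blast
qed

end

locale compat_cstone = compat_algebra U E I cw cpt + realf U E
 for U :: "'a set" and E I cw cpt
begin

sublocale cstone U E Om Lc by unfold_locales

definition chi :: "'a \<Rightarrow> 'a \<Rightarrow> 'a" where "chi N a = cut (uu N a) one"

lemma DT_chi[df]: "DT t \<Longrightarrow> DT u \<Longrightarrow> DT (\<lambda>e. chi (t e) (u e))" unfolding chi_def by (intro df oneU)

lemma chi_C: "N \<in> omega \<Longrightarrow> a \<in> I \<Longrightarrow> chi N a \<in> Cc" unfolding chi_def by (intro cut_C one_C uu)
lemma chi_ap: "N \<in> omega \<Longrightarrow> a \<in> I \<Longrightarrow> u \<in> St \<Longrightarrow> rap (chi N a) u = ch (uu N a) u"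
 unfolding chi_def using LU[OF uu(1)] by (simp add: cut_ap one_C one_ap)

context
 fixes N a b
 assumes N: "N \<in> omega" and a: "a \<in> U" "\<And>n. n \<in> ext N \<Longrightarrow> ap a n \<in> I" and b: "b \<in> U" "ap b (cd {}) = vz"
  "\<And>n. n \<in> omega \<Longrightarrow> ap b (sc n) = va (ap b n) (chi N (ap a n))"
begin

lemma sum_C: "ap b N \<in> Cc"
proof (rule upto_induct[OF N])
 show "Df (\<lambda>e. ap b (e 0) \<in> Cc)" by (intro df b Cc_Sets)
qed (use b a N in \<open>auto intro!: va_C chi_C\<close>)

lemma sum_compatible: assumes cp: "\<And>n m. n \<in> ext N \<Longrightarrow> m \<in> ext N \<Longrightarrow> n \<noteq> m \<Longrightarrow> cpt (ap a n) (ap a m)" shows "nt N \<le> nm (ap b N)"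
proof -
 from uu_point[OF N a cp] obtain u where u: "u \<in> St" "\<forall>n\<in>ext N. uu N (ap a n) \<in> ext u" by blast
 have "ap b N \<in> Cc \<and> rap (ap b N) u = nt N"
 proof (rule upto_induct[OF N])
  show "Df (\<lambda>e. ap b (e 0) \<in> Cc \<and> rap (ap b (e 0)) u = nt (e 0))" by (intro df b StU u Cc_Sets)
  show "ap b (cd {}) \<in> Cc \<and> rap (ap b (cd {})) u = nt (cd {})" using b u iota by simp
  fix n assume n: "n \<in> omega" "n \<in> ext N" "ap b n \<in> Cc \<and> rap (ap b n) u = nt n"
  then show "ap b (sc n) \<in> Cc \<and> rap (ap b (sc n)) u = nt (sc n)"
   using b(3)[OF n(1)] chi_C[OF N a(2)[OF n(2)]] chi_ap[OF N a(2)[OF n(2)] u(1)] u iota by (simp add: ch_def)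
 qed
 then show ?thesis using nm_ge[OF sum_C u(1)] by simp
qed

lemma sum_incompatible: assumes cp: "\<And>n m. n \<in> ext N \<Longrightarrow> m \<in> ext N \<Longrightarrow> n \<noteq> m \<Longrightarrow> ap a n \<noteq> ap a m \<and> \<not> cpt (ap a n) (ap a m)" shows "nm (ap b N) \<le> 1"
proof (rule nm_le[OF sum_C])
 fix u assume u: "u \<in> St"
 have dis: "\<not> (uu N (ap a n) \<in> ext u \<and> uu N (ap a m) \<in> ext u)" if "n \<in> ext N" "m \<in> ext N" "n \<noteq> m" for n m
  using uu_disjoint[OF N a(2)[OF that(1)] a(2)[OF that(2)]] cp[OF that] St_mt[OF u uu(1)[OF N a(2)[OF that(1)]] uu(1)[OF N a(2)[OF that(2)]]] St_bt[OF u] by auto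
 \<comment> \<open>At the point \<open>u\<close> the partial sums are 0 until the only index whose
   set contains \<open>u\<close> has been passed, if there is one, and 1 afterwards.\<close>
 let ?P = "\<lambda>n. ap b n \<in> Cc \<and> ((rap (ap b n) u = 0 \<and> \<not> (\<exists>m\<in>ext n. uu N (ap a m) \<in> ext u)) \<or>
  (rap (ap b n) u = 1 \<and> (\<exists>m\<in>ext n. m \<in> ext N \<and> uu N (ap a m) \<in> ext u)))"
 have "?P N"
 proof (rule upto_induct[of N ?P, OF N])
  show "Df (\<lambda>e. ?P (e 0))" by (intro df a b StU u Cc_Sets omega_U N)
  show "?P (cd {})" using b u by simp
  fix n assume n: "n \<in> omega" "n \<in> ext N" and IH: "?P n"
  have C: "chi N (ap a n) \<in> Cc" by (intro chi_C N a n)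
  have v: "rap (ap b (sc n)) u = rap (ap b n) u + ch (uu N (ap a n)) u" using b(3)[OF n(1)] IH C u chi_ap[OF N a(2)[OF n(2)] u] by simp
  have s: "ext (sc n) = insert n (ext n)" using n by (simp add: omega_U)
  have bC: "ap b (sc n) \<in> Cc" using b(3)[OF n(1)] IH C by simp
  show "?P (sc n)"
  proof (cases "uu N (ap a n) \<in> ext u")
   case True
   have "\<not> (\<exists>m\<in>ext n. m \<in> ext N \<and> uu N (ap a m) \<in> ext u)" using dis[OF n(2)] True no_self[of n] by blast
   then have "rap (ap b n) u = 0" using IH by blast
   then show ?thesis using True v n s bC by (simp add: ch_def)
  next
   case False
   then show ?thesis using v IH s bC by (auto simp: ch_def)
  qed
 qed
 then show "\<bar>rap (ap b N) u\<bar> \<le> 1" by auto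
qed

end

end

locale cohen_field = cohen_reals +
 assumes rfW: "W.real_field R0"
begin

sublocale C: compat_cstone W E I cw cpt
 by unfold_locales (rule rfW)

text \<open>The approximating vectors are taken from the ground space itself, so
  \<open>uncountable_ground_restriction\<close> applies to their choice function;
  \<open>generic_sequence\<close> then plays the norm of their sum against compatibility.\<close>

lemma no_embedding:
 assumes Z: "V.banach_space_in K Z" and cmp: "W.completion_of K Z R0 Y"
 shows "\<not> W.iso_embeds R0 C.X Y"
proof
 assume "W.iso_embeds R0 C.X Y"
 then obtain T c0 where T0: "W.fun_in (carrier C.X) T" "T ` carrier C.X \<subseteq> carrier Y"
   "\<forall>x\<in>carrier C.X. \<forall>y\<in>carrier C.X. T (x \<oplus>\<^bsub>C.X\<^esub> y) = T x \<oplus>\<^bsub>Y\<^esub> T y"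
   "\<forall>r\<in>C.CR. \<forall>x\<in>carrier C.X. T (r \<odot>\<^bsub>C.X\<^esub> x) = r \<odot>\<^bsub>Y\<^esub> T x"
  and c0: "c0 \<in> C.CR" "\<zero>\<^bsub>R0\<^esub> \<prec>\<^bsub>R0\<^esub> c0"
   "\<forall>x\<in>carrier C.X. inv\<^bsub>R0\<^esub> c0 \<otimes>\<^bsub>R0\<^esub> nrm C.X x \<preceq>\<^bsub>R0\<^esub> nrm Y (T x) \<and> nrm Y (T x) \<preceq>\<^bsub>R0\<^esub> c0 \<otimes>\<^bsub>R0\<^esub> nrm C.X x"
  unfolding W.iso_embeds_def by (elim exE bexE conjE)
 note T = T0(1,2)[unfolded C.carrier_X] T0(3)[unfolded C.carrier_X, rule_format]
 note c0 = c0(1,2) bspec[OF c0(3)[unfolded C.carrier_X]]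
 have nZ: "V.normed_space_in K Z" using Z unfolding V.banach_space_in_def by blast
 have KZ: "V.real_field K" "module K Z" "carrier Z \<in> V.Sets" "V.fun2_in (carrier Z) (carrier Z) (add Z)" "V.fun_in (carrier Z) (nrm Z)" and nrZ: "norm_on K Z"
  using nZ unfolding V.normed_space_in_def by blast+
 have Kf: "ordered_field K" "carrier K \<in> V.Sets" "V.rel_in (carrier K) (rle K)" using KZ(1) unfolding V.real_field_def by blast+
 interpret K: field K using Kf(1) by (simp add: ordered_field_def)
 interpret R: field "R0 :: 'a ordered_ring" using C.ordR by (simp add: ordered_field_def)
 interpret Z: module K Z by (rule KZ(2))
 have nZC: "nrm Z x \<in> carrier K" if "x \<in> carrier Z" for x using nrZ that unfolding norm_on_def by blast
 have nY: "W.normed_space_in R0 Y" using cmp unfolding W.completion_of_def W.banach_space_in_def by blast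
 note dist = C.normed_dist[OF nY]
 have "module R0 Y" using nY unfolding W.normed_space_in_def by blast
 then interpret Y: module "R0 :: 'a ordered_ring" Y .
 from cmp obtain j i where jj: "W.fun_in (carrier K) j" "j \<in> ring_hom K R0"
   "\<forall>r\<in>carrier K. \<forall>s\<in>carrier K. r \<preceq>\<^bsub>K\<^esub> s \<longleftrightarrow> j r \<preceq>\<^bsub>R0\<^esub> j s"
  and ii: "W.fun_in (carrier Z) i" "i ` carrier Z \<subseteq> carrier Y"
   "\<forall>x\<in>carrier Z. \<forall>y\<in>carrier Z. i (x \<oplus>\<^bsub>Z\<^esub> y) = i x \<oplus>\<^bsub>Y\<^esub> i y"
   "\<forall>r\<in>carrier K. \<forall>x\<in>carrier Z. i (r \<odot>\<^bsub>Z\<^esub> x) = j r \<odot>\<^bsub>Y\<^esub> i x"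
   "\<forall>x\<in>carrier Z. nrm Y (i x) = j (nrm Z x)" "dense_in R0 Y (i ` carrier Z)"
  unfolding W.completion_of_def by (elim exE conjE)
 note j = jj(1,2) jj(3)[rule_format] and i = ii(1,2) ii(3)[rule_format] ii(5)[rule_format] ii(6)
 define n where "n y = C.pi (nrm Y y)" for y
 note dist = dist[folded n_def]
 define c where "c = C.pi c0"
 have c: "c0 = rp c" "0 < c" using c0 C.rps(9)[of 0 c] by (simp_all add: c_def C.rps(1))
 have TY: "T x \<in> carrier Y" if "x \<in> C.Cc" for x using T(2) that by blast
 have T1: "C.nm x \<le> c * n (T x)" "n (T x) \<le> c * C.nm x" if x: "x \<in> C.Cc" for x
 proof -
  have "rp (inverse c * C.nm x) \<preceq>\<^bsub>R0\<^esub> rp (n (T x))" "rp (n (T x)) \<preceq>\<^bsub>R0\<^esub> rp (c * C.nm x)"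
   using c0(3)[OF x] dist(2)[OF TY[OF x]] C.nrm_X[OF x] c C.rps(7)[of c] by (simp_all add: C.rps(4))
  then have "inverse c * C.nm x \<le> n (T x)" "n (T x) \<le> c * C.nm x" by (simp_all only: C.rps(8))
  then show "C.nm x \<le> c * n (T x)" "n (T x) \<le> c * C.nm x" using c(2) by (simp_all add: field_simps)
 qed
 from C.archimedean[of "c + 1"] obtain k where k: "k \<in> W.omega" "c + 1 < C.nt k" by blast
 from C.archimedean[of "c * (C.nt k + 1)"] obtain N where N: "N \<in> W.omega" "c * (C.nt k + 1) < C.nt N" by blast
 have Np: "0 < C.nt N"
 proof -
  have "0 \<le> c * (C.nt k + 1)" using c k C.nt_nonneg by simp
  then show ?thesis using N by linarith
 qed
 define \<epsilon> where "\<epsilon> = 1 / C.nt N"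
 have \<epsilon>: "0 < \<epsilon>" "C.nt N * \<epsilon> = 1" using Np by (simp_all add: \<epsilon>_def)
 \<comment> \<open>The threshold must come from a real of the ground model, because the set
   \<open>?R\<close> of vectors of norm at most \<open>k\<close> is to be formed there.\<close>
 have "\<exists>t\<in>carrier K. j t = rp (C.nt k)"
 proof -
  from W.fn_of_fun_in[OF j(1) Sets_V[OF Kf(2)]] obtain jc where jc: "jc \<in> W" "\<And>x. x \<in> carrier K \<Longrightarrow> j x = W.ap jc x" by blast
  have "\<exists>t\<in>carrier K. W.ap jc t = rp (C.nt k)" using k(1)
  proof (induction rule: W.omega_induct)
   case Df show ?case by (intro df jc Sets_V Kf)
  next
   case 0
   show ?case using ring_hom_zero[OF j(2) K.ring_axioms R.ring_axioms] jc(2)[of "\<zero>\<^bsub>K\<^esub>"] C.iota(2) by (intro bexI[of _ "\<zero>\<^bsub>K\<^esub>"]) (auto simp: C.rps(1))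
  next
   case (sc m)
   then obtain t where t: "t \<in> carrier K" "W.ap jc t = rp (C.nt m)" by blast
   have "j (t \<oplus>\<^bsub>K\<^esub> \<one>\<^bsub>K\<^esub>) = j t \<oplus>\<^bsub>R0\<^esub> \<one>\<^bsub>R0\<^esub>" using ring_hom_add[OF j(2) t(1) K.one_closed] ring_hom_one[OF j(2)] by simp
   then have "W.ap jc (t \<oplus>\<^bsub>K\<^esub> \<one>\<^bsub>K\<^esub>) = rp (C.nt (W.sc m))" using t jc(2)[of t] jc(2)[of "t \<oplus>\<^bsub>K\<^esub> \<one>\<^bsub>K\<^esub>"] C.iota(3)[OF sc(1)] by (simp add: C.rps(2,3))
   then show ?case using t(1) by (intro bexI[of _ "t \<oplus>\<^bsub>K\<^esub> \<one>\<^bsub>K\<^esub>"]) auto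
  qed
  then show ?thesis using jc by auto
 qed
 then obtain t where t: "t \<in> carrier K" "j t = rp (C.nt k)" by blast
 from dist(1) obtain dc where dc: "dc \<in> W" "\<And>y z. y \<in> carrier Y \<Longrightarrow> z \<in> carrier Y \<Longrightarrow> C.rap dc (W.pr y z) = n (y \<ominus>\<^bsub>Y\<^esub> z)" by blast
 from W.fn_of_fun_in[OF T(1) C.Cc_Sets] obtain tc where tc: "tc \<in> W" "\<And>x. x \<in> C.Cc \<Longrightarrow> T x = W.ap tc x" by blast
 have ZW: "carrier Z \<in> W.Sets" by (rule Sets_V[OF KZ(3)])
 from W.fn_of_fun_in[OF i(1) ZW] obtain ic where ic: "ic \<in> W" "\<And>x. x \<in> carrier Z \<Longrightarrow> i x = W.ap ic x" by blast
 have iY: "i x \<in> carrier Y" if "x \<in> carrier Z" for x using i(2) that by blast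
 have "\<exists>h\<in>W. \<forall>\<alpha>\<in>I. W.ap h \<alpha> \<in> carrier Z \<and> C.rap dc (W.pr (W.ap tc (C.chi N \<alpha>)) (W.ap ic (W.ap h \<alpha>))) < \<epsilon>"
 proof (rule W.choice[OF Sets_V[OF IV] ZW])
  show "W.Df (\<lambda>e. C.rap dc (W.pr (W.ap tc (C.chi N (e 0))) (W.ap ic (e (Suc 0)))) < \<epsilon>)" by (intro df dc tc ic W.omega_U N)
  fix \<alpha> assume a: "\<alpha> \<in> I"
  have x: "C.chi N \<alpha> \<in> C.Cc" by (rule C.chi_C[OF N(1) a])
  have "\<zero>\<^bsub>R0\<^esub> \<prec>\<^bsub>R0\<^esub> rp \<epsilon>" using C.rps(9)[of 0 \<epsilon>] \<epsilon> by (simp add: C.rps(1))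
  then obtain d where d: "d \<in> carrier Z" "nrm Y (T (C.chi N \<alpha>) \<ominus>\<^bsub>Y\<^esub> i d) \<prec>\<^bsub>R0\<^esub> rp \<epsilon>" using i(5) TY[OF x] C.rpC[of \<epsilon>] unfolding dense_in_def by blast
  have "n (T (C.chi N \<alpha>) \<ominus>\<^bsub>Y\<^esub> i d) < \<epsilon>" using d(2) dist(2)[OF Y.minus_closed[OF TY[OF x] iY[OF d(1)]]] C.rps(9) by metis
  then show "\<exists>d\<in>carrier Z. C.rap dc (W.pr (W.ap tc (C.chi N \<alpha>)) (W.ap ic d)) < \<epsilon>"
   using d(1) dc(2)[OF TY[OF x] iY[OF d(1)]] tc(2)[OF x] ic(2)[OF d(1)] by (intro bexI[of _ d]) simp_all
 qed
 then obtain h where h: "h \<in> W" "\<And>\<alpha>. \<alpha> \<in> I \<Longrightarrow> W.ap h \<alpha> \<in> carrier Z" "\<And>\<alpha>. \<alpha> \<in> I \<Longrightarrow> C.rap dc (W.pr (W.ap tc (C.chi N \<alpha>)) (W.ap ic (W.ap h \<alpha>))) < \<epsilon>" by blast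
 have "W.fun_in I (W.ap h)" using h Sets_V[OF IV] by simp
 from uncountable_ground_restriction[OF IV Iunc KZ(3) this] h(2)
 obtain S g where S: "S \<in> V.Sets" "S \<subseteq> I" "\<not> V.countable_in S" and g: "g \<in> V" "\<And>x. x \<in> S \<Longrightarrow> V.ap g x = W.ap h x" by blast
 from V.fun2_code[OF KZ(4) KZ(3) KZ(3)] obtain ad where ad: "ad \<in> V" "\<And>x y. x \<in> carrier Z \<Longrightarrow> y \<in> carrier Z \<Longrightarrow> V.ap ad (V.pr x y) = x \<oplus>\<^bsub>Z\<^esub> y" by blast
 from V.fn_of_fun_in[OF KZ(5,3)] obtain na where na: "na \<in> V" "\<And>x. x \<in> carrier Z \<Longrightarrow> nrm Z x = V.ap na x" by blast
 have CV: "x \<in> V" if "x \<in> carrier Z" for x using V.Sets_U[OF KZ(3) that] .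
 have KV: "x \<in> V" if "x \<in> carrier K" for x using V.Sets_U[OF Kf(2) that] .
 let ?L = "{V.pr x y | x y. x \<in> carrier K \<and> y \<in> carrier K \<and> x \<preceq>\<^bsub>K\<^esub> y}"
 have L: "V.pr x y \<in> ?L \<longleftrightarrow> x \<preceq>\<^bsub>K\<^esub> y" if "x \<in> carrier K" "y \<in> carrier K" for x y
  using that V.pr_inj[OF KV KV KV KV] by blast
 let ?R = "{x \<in> carrier Z. V.pr (V.ap na x) t \<in> ?L}"
 have LS: "?L \<in> V.Sets" using Kf(3) unfolding V.rel_in_def .
 have R: "?R \<in> V.Sets" by (intro V.separation KZ df na KV t LS)
 have Rn: "x \<in> ?R \<longleftrightarrow> n (i x) \<le> C.nt k" if x: "x \<in> carrier Z" for x
 proof -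
  have "x \<in> ?R \<longleftrightarrow> nrm Z x \<preceq>\<^bsub>K\<^esub> t" using L[OF nZC[OF x] t(1)] na(2)[OF x] x by simp
  also have "\<dots> \<longleftrightarrow> nrm Y (i x) \<preceq>\<^bsub>R0\<^esub> rp (C.nt k)" using j(3)[OF nZC[OF x] t(1)] t(2) i(4)[OF x] by simp
  also have "\<dots> \<longleftrightarrow> n (i x) \<le> C.nt k" using dist(2)[OF iY[OF x]] C.rps(8)[of "n (i x)" "C.nt k"] by simp
  finally show ?thesis .
 qed
 have zV: "\<zero>\<^bsub>Z\<^esub> \<in> V" using CV[OF Z.zero_closed] .
 from generic_sequence[OF S N(1) ad(1) zV g(1) R]
 obtain a s where a: "a \<in> V" "s \<in> V" "\<forall>n\<in>W.ext N. W.ap a n \<in> S" "\<forall>n\<in>W.ext N. \<forall>m\<in>W.ext N. n \<noteq> m \<longrightarrow> W.ap a n \<noteq> W.ap a m"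
  and s: "W.ap s (W.cd {}) = \<zero>\<^bsub>Z\<^esub>" "\<forall>n\<in>W.ext N. W.ap s (W.sc n) = W.ap ad (W.pr (W.ap s n) (W.ap g (W.ap a n)))"
  and cs: "(W.ap s N \<in> ?R \<and> (\<forall>n\<in>W.ext N. \<forall>m\<in>W.ext N. n \<noteq> m \<longrightarrow> cpt (W.ap a n) (W.ap a m))) \<or>
   (W.ap s N \<notin> ?R \<and> (\<forall>n\<in>W.ext N. \<forall>m\<in>W.ext N. n \<noteq> m \<longrightarrow> \<not> cpt (W.ap a n) (W.ap a m)))" by (elim bexE conjE)
 have aI: "W.ap a m \<in> I" if "m \<in> W.ext N" for m using a(3) that S(2) by blast
 have aW: "a \<in> W" "s \<in> W" using a by auto
 have "W.DT (\<lambda>e. C.va (e (Suc 0)) (C.chi N (W.ap a (e 0))))" by (intro df aW W.omega_U N)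
 from W.omega_rec[OF C.CcU[OF C.vz_C] this] obtain b where b: "b \<in> W" "W.ap b (W.cd {}) = C.vz" "\<And>m. m \<in> W.omega \<Longrightarrow> W.ap b (W.sc m) = C.va (W.ap b m) (C.chi N (W.ap a m))" by blast
 have Tz: "T C.vz = \<zero>\<^bsub>Y\<^esub>"
 proof -
  have "C.va C.vz C.vz = C.vz" by (intro C.C_eq) auto
  then have "T C.vz = T C.vz \<oplus>\<^bsub>Y\<^esub> T C.vz" using T(3)[of C.vz C.vz] C.add_X[of C.vz C.vz] by simp
  then show ?thesis using TY[OF C.vz_C] Y.add.l_cancel_one' by metis
 qed
 have i0: "i \<zero>\<^bsub>Z\<^esub> = \<zero>\<^bsub>Y\<^esub>"
 proof -
  have "i \<zero>\<^bsub>Z\<^esub> = i \<zero>\<^bsub>Z\<^esub> \<oplus>\<^bsub>Y\<^esub> i \<zero>\<^bsub>Z\<^esub>" using i(3)[of "\<zero>\<^bsub>Z\<^esub>" "\<zero>\<^bsub>Z\<^esub>"] by simp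
  then show ?thesis using iY[OF Z.zero_closed] Y.add.l_cancel_one' by metis
 qed
 \<comment> \<open>After \<open>m\<close> summands the image of the sum in the function space and
   the sum of the approximating vectors differ by at most \<open>m * \<epsilon>\<close>, which is 1
   for \<open>m = N\<close>.\<close>
 let ?P = "\<lambda>m. W.ap b m \<in> C.Cc \<and> W.ap s m \<in> carrier Z \<and> C.rap dc (W.pr (W.ap tc (W.ap b m)) (W.ap ic (W.ap s m))) \<le> C.nt m * \<epsilon>"
 have main: "?P N"
 proof (rule W.upto_induct[of N ?P, OF N(1)])
  show "W.Df (\<lambda>e. ?P (e 0))" by (intro df b aW dc tc ic ZW C.Cc_Sets)
  have "\<zero>\<^bsub>Y\<^esub> \<ominus>\<^bsub>Y\<^esub> \<zero>\<^bsub>Y\<^esub> = \<zero>\<^bsub>Y\<^esub>" unfolding a_minus_def by (rule Y.r_neg[OF Y.zero_closed])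
  then have "C.rap dc (W.pr (W.ap tc C.vz) (W.ap ic \<zero>\<^bsub>Z\<^esub>)) = 0"
   using dc(2)[OF Y.zero_closed Y.zero_closed] dist(3) Tz i0 tc(2)[OF C.vz_C] ic(2)[OF Z.zero_closed] by simp
  then show "?P (W.cd {})"
   using b(2) s(1) C.iota(2) by simp
  fix m assume m: "m \<in> W.omega" "m \<in> W.ext N" and IH: "?P m"
  let ?x = "W.ap b m" and ?y = "C.chi N (W.ap a m)" and ?z = "W.ap s m" and ?w = "W.ap h (W.ap a m)"
  have C: "?x \<in> C.Cc" "?y \<in> C.Cc" "?z \<in> carrier Z" "?w \<in> carrier Z" using IH C.chi_C[OF N(1) aI[OF m(2)]] h(2)[OF aI[OF m(2)]] by auto
  have aS: "W.ap a m \<in> S" using a(3) m by blast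
  have "W.ap g (W.ap a m) = ?w" using g(2)[OF aS] ap_V[OF g(1) IinV[OF aI[OF m(2)]]] by simp
  moreover have "W.ap ad (W.pr ?z ?w) = ?z \<oplus>\<^bsub>Z\<^esub> ?w"
   using ad(2)[OF C(3,4)] pr_V[OF CV[OF C(3)] CV[OF C(4)]] ap_V[OF ad(1) V.pr_U[OF CV[OF C(3)] CV[OF C(4)]]] by simp
  ultimately have sm: "W.ap s (W.sc m) = ?z \<oplus>\<^bsub>Z\<^esub> ?w" using s(2) m by simp
  have bm: "W.ap b (W.sc m) = C.va ?x ?y" using b(3) m by simp
  have "C.rap dc (W.pr (W.ap tc (C.va ?x ?y)) (W.ap ic (?z \<oplus>\<^bsub>Z\<^esub> ?w))) = n (T (C.va ?x ?y) \<ominus>\<^bsub>Y\<^esub> i (?z \<oplus>\<^bsub>Z\<^esub> ?w))"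
   using dc(2)[OF TY iY] tc(2) ic(2) C by simp
  also have "\<dots> = n ((T ?x \<oplus>\<^bsub>Y\<^esub> T ?y) \<ominus>\<^bsub>Y\<^esub> (i ?z \<oplus>\<^bsub>Y\<^esub> i ?w))" using T(3)[OF C(1,2)] C.add_X[OF C(1,2)] i(3)[OF C(3,4)] by simp
  also have "\<dots> \<le> n (T ?x \<ominus>\<^bsub>Y\<^esub> i ?z) + n (T ?y \<ominus>\<^bsub>Y\<^esub> i ?w)" by (intro dist(4) TY iY C)
  also have "n (T ?x \<ominus>\<^bsub>Y\<^esub> i ?z) \<le> C.nt m * \<epsilon>" using IH dc(2)[OF TY iY] tc(2) ic(2) C by simp
  also have "n (T ?y \<ominus>\<^bsub>Y\<^esub> i ?w) \<le> \<epsilon>" using h(3)[OF aI[OF m(2)]] dc(2)[OF TY[OF C(2)] iY[OF C(4)]] tc(2)[OF C(2)] ic(2)[OF C(4)] by simp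
  finally have "C.rap dc (W.pr (W.ap tc (C.va ?x ?y)) (W.ap ic (?z \<oplus>\<^bsub>Z\<^esub> ?w))) \<le> C.nt (W.sc m) * \<epsilon>" using C.iota(3)[OF m(1)] by (simp add: algebra_simps)
  then show "?P (W.sc m)"
   unfolding sm bm using C by simp
 qed
 let ?x = "W.ap b N" and ?z = "W.ap s N"
 have xz: "?x \<in> C.Cc" "?z \<in> carrier Z" using main by auto
 have d1: "n (T ?x \<ominus>\<^bsub>Y\<^esub> i ?z) \<le> 1" using main dc(2)[OF TY[OF xz(1)] iY[OF xz(2)]] tc(2)[OF xz(1)] ic(2)[OF xz(2)] \<epsilon>(2) by simp
 note d2 = dist(5)[OF TY[OF xz(1)] iY[OF xz(2)]] dist(6)[OF TY[OF xz(1)] iY[OF xz(2)]]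
 from cs show False
 proof
  assume h: "?z \<in> ?R \<and> (\<forall>n\<in>W.ext N. \<forall>m\<in>W.ext N. n \<noteq> m \<longrightarrow> cpt (W.ap a n) (W.ap a m))"
  have "C.nt N \<le> C.nm ?x" by (rule C.sum_compatible[OF N(1) aW(1) aI b conjunct2[OF h, rule_format]])
  also have "\<dots> \<le> c * n (T ?x)" by (rule T1(1)[OF xz(1)])
  also have "\<dots> \<le> c * (C.nt k + 1)" using Rn[OF xz(2)] h d1 d2(1) c(2) by (intro mult_left_mono) auto
  finally show False using N(2) by simp
 next
  assume h: "?z \<notin> ?R \<and> (\<forall>n\<in>W.ext N. \<forall>m\<in>W.ext N. n \<noteq> m \<longrightarrow> \<not> cpt (W.ap a n) (W.ap a m))"
  have "C.nm ?x \<le> 1" by (rule C.sum_incompatible[OF N(1) aW(1) aI b conjI[OF a(4)[rule_format] conjunct2[OF h, rule_format]]])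
  then have "c * C.nm ?x \<le> c * 1" using c(2) by (intro mult_left_mono) auto
  then have "n (i ?z) \<le> c + 1" using T1(2)[OF xz(1)] d1 d2(2) by simp
  then show False using Rn[OF xz(2)] h k(2) by auto
 qed
qed

end

context cohen_field
begin

lemma UG_L: "W.UG R0 (W.C_Stone R0 A.L)"
proof -
 from A.coded obtain cn where "coded_algebra W E A.Om A.Lc A.Cells cn" ..
 then interpret B: coded_algebra W E A.Om A.Lc A.Cells cn .
 interpret B: coded_cstone W E A.Om A.Lc A.Cells cn ..
 show ?thesis by (rule B.UG_X)
qed

lemma not_refutes: "\<not> refutes R0"
 unfolding refutes_def using UG_L no_embedding by blast

end

text \<open>A refuting field makes the selected \<open>R0\<close> critical as well, but possibly for
  other models over the same type. The results obtained for \<open>R0\<close> are therefore applied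
  to those models, where they give the contradiction.\<close>

lemma (in cohen_reals) no_refutation: "\<not> refutes R"
proof
 assume "refutes R"
 then have "critical R" unfolding critical_def using cohen_reals_axioms by blast
 then have "critical (R0 :: 'a ordered_ring)" unfolding R0_def by (rule someI)
 then obtain V' W' :: "'a set" and E' G' I' cw' where r: "cohen_reals V' W' E' G' I' cw'" "cohen_reals.refutes V' W' E' G' I' (R0 :: 'a ordered_ring)"
  unfolding critical_def by blast
 interpret B: cohen_reals V' W' E' G' I' cw' by (rule r(1))
 have "B.W.real_field (R0 :: 'a ordered_ring)" using r(2) unfolding B.refutes_def by blast
 then interpret B: cohen_field V' W' E' G' I' cw' by unfold_locales
 show False using r(2) B.not_refutes by blast
qed

theorem theorem2p6:
  fixes V W :: "'a set" and E :: "'a \<Rightarrow> 'a \<Rightarrow> bool" and G :: 'a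
  assumes "set_structure.ZFC V E"
    and "cohen_extension V W E G"
  shows "\<exists>L. set_structure.c_algebra W E L \<and> set_structure.size_aleph1 W E (carrier L) \<and>
    (\<forall>R. set_structure.real_field W E R \<longrightarrow>
      set_structure.UG W E R (set_structure.C_Stone W E R L) \<and>
      (\<forall>K X Y. set_structure.banach_space_in V E K X \<and> set_structure.density_aleph1 V E K X \<and>
         set_structure.completion_of W E K X R Y \<longrightarrow>
         \<not> set_structure.iso_embeds W E R (set_structure.C_Stone W E R L) Y))"
proof -
 interpret cohen V W E G using assms by unfold_locales
 from V.aleph1_reals obtain I cw where "I \<in> V.Sets" "cw \<in> V" "I \<subseteq> V.pset V.omega" "\<not> V.countable_in I"
  "V.wo I (\<lambda>x y. x \<in> V.ext (V.ap cw y))" "\<forall>x\<in>I. V.ext (V.ap cw x) \<subseteq> I \<and> V.countable_in (V.ext (V.ap cw x))"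
  by (elim bexE conjE)
 then interpret cohen_reals V W E G I cw by unfold_locales blast+
 show ?thesis
 proof (intro exI[of _ A.L] conjI allI impI)
  show "W.c_algebra A.L" by (rule A.c_algebra_L)
  show "W.size_aleph1 (carrier A.L)" using A.size_L by simp
  fix R assume R: "W.real_field R"
  then show "W.UG R (W.C_Stone R A.L)" using no_refutation[of R] unfolding refutes_def by blast
  fix K X Y assume "V.banach_space_in K X \<and> V.density_aleph1 K X \<and> W.completion_of K X R Y"
  then show "\<not> W.iso_embeds R (W.C_Stone R A.L) Y" using R no_refutation[of R] unfolding refutes_def by blast
 qed
qed

end
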